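(* Let $C=\operatorname{Spec}A_0$ be a smooth affine curve over $\mathbb{C}$, $D_\pm$ $\mathbb{Q}$-divisors on $C$ with $D_++D_-\le0$, and $A=\bigoplus_{i\in\mathbb{Z}}A_i=A_0[D_+,D_-]\subseteq\operatorname{Frac}(A_0)[u,u^{-1}]$. Let $d_\pm$ be the minimal positive integer such that the divisor $d_\pm D_\pm$ is integral. Assume that $A_{\pm1}=u_\pm\cdot A_0$ and $A_{\pm d_\pm}=v_\pm\cdot A_0$ for some elements $u_\pm, v_\pm$, and that $u_+u_-=Q$, $u_\pm^{d_\pm}=P_\pm v_\pm$ for some elements $Q,P_\pm\in A_0$. Then the following hold. (a) $A$ is the normalization of the $A_0$-algebra $$B:=A_0[u_-,v_+,v_-]/\left(u_-^{d_-}-v_-P_-,\ v_+^{d_-'}v_-^{d_+'}-P,\ v_+u_-^{d_+}-Q_+\right)$$ graded via $\deg u_-=-1$, $\deg v_\pm=\pm d_\pm$, where $k:=\gcd(d_+,d_-)$, $d_\pm':=d_\pm/k$ and $$P:=\frac{Q^{kd_+'d_-'}}{P_+^{d_-'}P_-^{d_+'}}\in A_0,\qquad Q_+:=\frac{Q^{d_+}}{P_+}\in A_0.$$ (b) $V=\operatorname{Spec}A$ is a cyclic branched covering of degree $k$ of the normalization of the hypersurface $\{v_+^{d_-'}v_-^{d_+'}-P=0\}$ in $C\times\mathbb{A}^2_{\mathbb{C}}$. (c) If $k=1$, i.e. if $d_+$ and $d_-$ are coprime, and if $v_+$ is not invertible, then $V=\operatorname{Spec}A$ can be represented as the normalization of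 a hypersurface $X$ in $\mathbb{A}^3_{\mathbb{C}}=\operatorname{Spec}\mathbb{C}[s,v_+,v_-]$ with equation $$q(s,v_+^{d_-}\cdot v_-^{d_+})=0,$$ where $q\in\mathbb{C}[s,t]$ is a suitable irreducible polynomial.
   Context: For a $\mathbb{Q}$-divisor $D=\sum D(a)\,a$ on $C$, $\lfloor D\rfloor=\sum\lfloor D(a)\rfloor a$. For $\mathbb{Q}$-divisors with $D_++D_-\le0$, the normal graded $A_0$-algebra $A_0[D_+,D_-]=\bigoplus_{n\in\mathbb{Z}}A_n\subseteq\operatorname{Frac}(A_0)[u,u^{-1}]$ ($u$ an indeterminate of degree $1$) is defined by $A_n=H^0(C,\mathcal{O}_C(\lfloor nD_+\rfloor))\cdot u^n$ and $A_{-n}=H^0(C,\mathcal{O}_C(\lfloor nD_-\rfloor))\cdot u^{-n}$ for $n\ge0$. In the presentation of $B$ the symbols $u_-,v_+,v_-$ are used as polynomial variables, mapped to the elements of $A$ with the same name. The normalization of a ring with irreducible spectrum is understood as the integral closure of its reduction in the fraction field of that reduction. *)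

theory Defs
  imports
    Complex_Main
    "HOL-Algebra.Generated_Rings"
    "HOL-Algebra.Ideal_Product"
    "HOL-Library.Poly_Mapping"
    "HOL-Computational_Algebra.Polynomial"
    "HOL-Computational_Algebra.Fraction_Field"
begin

text \<open>
  The coordinate ring of the curve, polynomial rings over it and the Laurent polynomial ring
  over its fraction field are types of class \<open>idom\<close>; their subrings and quotients are
  HOL-Algebra records over these types.
\<close>

definition ring_on :: "'a::comm_ring_1 set \<Rightarrow> 'a ring" where
  "ring_on S = \<lparr>carrier = S, monoid.mult = (*), one = 1, zero = 0, add = (+)\<rparr>"

abbreviation full_ring :: "'a::comm_ring_1 itself \<Rightarrow> 'a ring" where
  "full_ring _ \<equiv> ring_on UNIV"

section \<open>Normalization\<close>

definition nilradical :: "('r, 'm) ring_scheme \<Rightarrow> 'r set" where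
  "nilradical R = {a \<in> carrier R. \<exists>n::nat. a [^]\<^bsub>R\<^esub> n = \<zero>\<^bsub>R\<^esub>}"

definition reduction :: "('r, 'm) ring_scheme \<Rightarrow> 'r set ring" where
  "reduction R = R Quot nilradical R"

text \<open>Fractions of a domain \<open>R\<close> are classes of pairs (numerator, denominator).\<close>

definition frac_rel :: "('r, 'm) ring_scheme \<Rightarrow> (('r \<times> 'r) \<times> ('r \<times> 'r)) set" where
  "frac_rel R = {((a, b), (c, d)) | a b c d.
     a \<in> carrier R \<and> b \<in> carrier R - {\<zero>\<^bsub>R\<^esub>} \<and> c \<in> carrier R \<and> d \<in> carrier R - {\<zero>\<^bsub>R\<^esub>} \<and>
     a \<otimes>\<^bsub>R\<^esub> d = c \<otimes>\<^bsub>R\<^esub> b}"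

definition frac_class :: "('r, 'm) ring_scheme \<Rightarrow> 'r \<Rightarrow> 'r \<Rightarrow> ('r \<times> 'r) set" where
  "frac_class R a b = frac_rel R `` {(a, b)}"

definition frac_field :: "('r, 'm) ring_scheme \<Rightarrow> ('r \<times> 'r) set ring" where
  "frac_field R = \<lparr>
     carrier = (carrier R \<times> (carrier R - {\<zero>\<^bsub>R\<^esub>})) // frac_rel R,
     monoid.mult = (\<lambda>X Y. \<Union>(a, b)\<in>X. \<Union>(c, d)\<in>Y. frac_class R (a \<otimes>\<^bsub>R\<^esub> c) (b \<otimes>\<^bsub>R\<^esub> d)),
     one = frac_class R \<one>\<^bsub>R\<^esub> \<one>\<^bsub>R\<^esub>,
     zero = frac_class R \<zero>\<^bsub>R\<^esub> \<one>\<^bsub>R\<^esub>,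
     add = (\<lambda>X Y. \<Union>(a, b)\<in>X. \<Union>(c, d)\<in>Y.
       frac_class R ((a \<otimes>\<^bsub>R\<^esub> d) \<oplus>\<^bsub>R\<^esub> (c \<otimes>\<^bsub>R\<^esub> b)) (b \<otimes>\<^bsub>R\<^esub> d))\<rparr>"

definition frac_embed :: "('r, 'm) ring_scheme \<Rightarrow> 'r \<Rightarrow> ('r \<times> 'r) set" where
  "frac_embed R a = frac_class R a \<one>\<^bsub>R\<^esub>"

text \<open>\<open>x\<close> is a root of a monic polynomial of degree \<open>n\<close> with coefficients in \<open>S\<close>.\<close>

definition integral_over :: "('r, 'm) ring_scheme \<Rightarrow> 'r set \<Rightarrow> 'r \<Rightarrow> bool" where
  "integral_over K S x \<longleftrightarrow> (\<exists>(n::nat) c. 0 < n \<and> (\<forall>i<n. c i \<in> S) \<and>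
     (x [^]\<^bsub>K\<^esub> n) \<oplus>\<^bsub>K\<^esub> (\<Oplus>\<^bsub>K\<^esub>i\<in>{..<n}. c i \<otimes>\<^bsub>K\<^esub> (x [^]\<^bsub>K\<^esub> i)) = \<zero>\<^bsub>K\<^esub>)"

definition integral_closure :: "('r, 'm) ring_scheme \<Rightarrow> 'r set \<Rightarrow> 'r set" where
  "integral_closure K S = {x \<in> carrier K. integral_over K S x}"

definition normalization :: "('r, 'm) ring_scheme \<Rightarrow> ('r set \<times> 'r set) set ring" where
  "normalization R = (let Rr = reduction R; K = frac_field Rr in
     K\<lparr>carrier := integral_closure K (frac_embed Rr ` carrier Rr)\<rparr>)"

definition normalization_map :: "('r, 'm) ring_scheme \<Rightarrow> 'r \<Rightarrow> ('r set \<times> 'r set) set" where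
  "normalization_map R b = frac_embed (reduction R) (nilradical R +>\<^bsub>R\<^esub> b)"

text \<open>
  The homomorphism \<open>\<phi>\<close> from \<open>R\<close> to \<open>A\<close> exhibits \<open>A\<close> as the normalization of \<open>R\<close>. The spectrum
  of \<open>R\<close> is irreducible iff the nilradical is prime; otherwise \<^const>\<open>normalization\<close> is meaningless.
\<close>

definition is_normalization ::
  "('r, 'm) ring_scheme \<Rightarrow> ('s, 'n) ring_scheme \<Rightarrow> ('r \<Rightarrow> 's) \<Rightarrow> bool" where
  "is_normalization R A \<phi> \<longleftrightarrow> \<phi> \<in> ring_hom R A \<and> primeideal (nilradical R) R \<and>
     (\<exists>h \<in> ring_iso (normalization R) A. \<forall>b\<in>carrier R. h (normalization_map R b) = \<phi> b)"

section \<open>Gradings and cyclic coverings\<close>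

definition is_grading :: "('r, 'm) ring_scheme \<Rightarrow> (int \<Rightarrow> 'r set) \<Rightarrow> bool" where
  "is_grading R G \<longleftrightarrow>
     (\<forall>n. additive_subgroup (G n) R) \<and>
     (\<forall>m n. \<forall>x\<in>G m. \<forall>y\<in>G n. x \<otimes>\<^bsub>R\<^esub> y \<in> G (m + n)) \<and>
     (\<forall>x\<in>carrier R. \<exists>!f. (\<forall>n. f n \<in> G n) \<and> finite {n. f n \<noteq> \<zero>\<^bsub>R\<^esub>} \<and>
        x = (\<Oplus>\<^bsub>R\<^esub>n\<in>{n. f n \<noteq> \<zero>\<^bsub>R\<^esub>}. f n))"

text \<open>
  The morphism from \<open>Spec A\<close> to \<open>Spec N\<close> given by \<open>\<psi>\<close> is finite and is the quotient of
  \<open>Spec A\<close> by an effective action of a cyclic group of order \<open>k\<close>, generated by \<open>\<sigma>\<close>.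
\<close>

definition cyclic_branched_covering ::
  "('r, 'm) ring_scheme \<Rightarrow> ('s, 'n) ring_scheme \<Rightarrow> ('r \<Rightarrow> 's) \<Rightarrow> nat \<Rightarrow> bool" where
  "cyclic_branched_covering N A \<psi> k \<longleftrightarrow>
     \<psi> \<in> ring_hom N A \<and> inj_on \<psi> (carrier N) \<and>
     (\<exists>F. finite F \<and> F \<subseteq> carrier A \<and>
        (\<forall>a\<in>carrier A. \<exists>c. c ` F \<subseteq> carrier N \<and> a = (\<Oplus>\<^bsub>A\<^esub>f\<in>F. \<psi> (c f) \<otimes>\<^bsub>A\<^esub> f))) \<and>
     (\<exists>\<sigma> \<in> ring_iso A A.
        0 < k \<and> (\<forall>a\<in>carrier A. (\<sigma> ^^ k) a = a) \<and>
        (\<forall>j. 0 < j \<and> j < k \<longrightarrow> (\<exists>a\<in>carrier A. (\<sigma> ^^ j) a \<noteq> a)) \<and>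
        \<psi> ` carrier N = {a \<in> carrier A. \<sigma> a = a})"

section \<open>Smooth affine curves\<close>

definition closed_points :: "'a::comm_ring_1 set set" where
  "closed_points = {m. maximalideal m (full_ring TYPE('a))}"

definition krull_dim_one :: "'a::comm_ring_1 itself \<Rightarrow> bool" where
  "krull_dim_one _ \<longleftrightarrow>
     (\<exists>p q. primeideal p (full_ring TYPE('a)) \<and> primeideal q (full_ring TYPE('a)) \<and> p \<subset> q) \<and>
     \<not> (\<exists>p q r. primeideal p (full_ring TYPE('a)) \<and> primeideal q (full_ring TYPE('a)) \<and>
          primeideal r (full_ring TYPE('a)) \<and> p \<subset> q \<and> q \<subset> r)"

text \<open>The class of \<open>t\<close> is a basis of the cotangent space \<open>m/m\<^sup>2\<close>.\<close>

definition one_dim_cotangent :: "'a::comm_ring_1 set \<Rightarrow> bool" where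
  "one_dim_cotangent m \<longleftrightarrow>
     (let m2 = ideal_prod (full_ring TYPE('a)) m m in
      \<exists>t\<in>m. t \<notin> m2 \<and> (\<forall>f\<in>m. \<exists>a. f - a * t \<in> m2))"

text \<open>
  The type \<open>'a\<close> with structure map \<open>emb\<close> is the coordinate ring of a smooth (irreducible)
  affine curve over \<open>\<complex>\<close>.
\<close>

definition smooth_affine_curve :: "(complex \<Rightarrow> 'a::idom) \<Rightarrow> bool" where
  "smooth_affine_curve emb \<longleftrightarrow>
     emb \<in> ring_hom (full_ring TYPE(complex)) (full_ring TYPE('a)) \<and>
     (\<exists>F. finite F \<and> generate_ring (full_ring TYPE('a)) (range emb \<union> F) = UNIV) \<and>
     krull_dim_one TYPE('a) \<and>
     (\<forall>m \<in> (closed_points :: 'a set set). one_dim_cotangent m)"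

section \<open>Divisors and the algebra attached to a pair of divisors\<close>

definition is_qdivisor :: "('a::comm_ring_1 set \<Rightarrow> rat) \<Rightarrow> bool" where
  "is_qdivisor D \<longleftrightarrow> finite {m. D m \<noteq> 0} \<and> {m. D m \<noteq> 0} \<subseteq> closed_points"

definition min_denom :: "('a::comm_ring_1 set \<Rightarrow> rat) \<Rightarrow> nat" where
  "min_denom D = (LEAST d. 0 < d \<and> (\<forall>m. of_nat d * D m \<in> \<int>))"

text \<open>
  The condition on \<open>s\<close> says that \<open>f\<close> lies in the \<open>n\<close>-th power of the maximal ideal of the
  local ring at \<open>m\<close>.
\<close>

definition ord_elem :: "'a::idom set \<Rightarrow> 'a \<Rightarrow> nat" where
  "ord_elem m f =
     (GREATEST n. \<exists>s. s \<notin> m \<and> s * f \<in> m [^]\<^bsub>ideals_set (full_ring TYPE('a))\<^esub> n)"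

definition ord_at :: "'a::idom set \<Rightarrow> 'a fract \<Rightarrow> int" where
  "ord_at m x = (THE z. \<exists>f g. f \<noteq> 0 \<and> g \<noteq> 0 \<and> x = Fract f g \<and>
     z = int (ord_elem m f) - int (ord_elem m g))"

definition global_sections :: "('a::idom set \<Rightarrow> int) \<Rightarrow> 'a fract set" where
  "global_sections E = {x. x = 0 \<or> (\<forall>m\<in>closed_points. ord_at m x + E m \<ge> 0)}"

text \<open>Laurent polynomials over the fraction field; \<^term>\<open>Poly_Mapping.single n f\<close> is \<open>f u\<^sup>n\<close>.\<close>

type_synonym 'a laurent = "int \<Rightarrow>\<^sub>0 'a fract"

definition base :: "'a::idom \<Rightarrow> 'a laurent" where
  "base a = Poly_Mapping.single 0 (Fract a 1)"

definition graded_piece ::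
  "('a::idom set \<Rightarrow> rat) \<Rightarrow> ('a set \<Rightarrow> rat) \<Rightarrow> int \<Rightarrow> 'a laurent set" where
  "graded_piece Dp Dm n = Poly_Mapping.single n `
     global_sections (\<lambda>m. \<lfloor>if n \<ge> 0 then of_int n * Dp m else of_int (- n) * Dm m\<rfloor>)"

definition DPD_algebra ::
  "('a::idom set \<Rightarrow> rat) \<Rightarrow> ('a set \<Rightarrow> rat) \<Rightarrow> 'a laurent ring" where
  "DPD_algebra Dp Dm = ring_on
     {F. \<forall>n. Poly_Mapping.single n (Poly_Mapping.lookup F n) \<in> graded_piece Dp Dm n}"

section \<open>Polynomials in two and three variables\<close>

text \<open>
  \<open>R[x,y]\<close> is \<open>R[x][y]\<close>, and \<open>R[x,y,z]\<close> is \<open>R[x][y][z]\<close>: the first variable is the innermost.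
  Coefficients are sent through \<open>c\<close>, which has to be a ring homomorphism.
\<close>

definition eval2 ::
  "('r::comm_ring_1 \<Rightarrow> 's::comm_ring_1) \<Rightarrow> 's \<Rightarrow> 's \<Rightarrow> 'r poly poly \<Rightarrow> 's" where
  "eval2 c x y p = poly (map_poly (\<lambda>q. poly (map_poly c q) x) p) y"

definition eval3 ::
  "('r::comm_ring_1 \<Rightarrow> 's::comm_ring_1) \<Rightarrow> 's \<Rightarrow> 's \<Rightarrow> 's \<Rightarrow> 'r poly poly poly \<Rightarrow> 's" where
  "eval3 c x y z p = poly (map_poly (eval2 c x y) p) z"

definition const2 :: "'r::comm_ring_1 \<Rightarrow> 'r poly poly" where "const2 a = [:[:a:]:]"
definition X2 :: "'r::comm_ring_1 poly poly" where "X2 = [:[:0, 1:]:]"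
definition Y2 :: "'r::comm_ring_1 poly poly" where "Y2 = [:0, 1:]"

definition const3 :: "'r::comm_ring_1 \<Rightarrow> 'r poly poly poly" where "const3 a = [:[:[:a:]:]:]"
definition X3 :: "'r::comm_ring_1 poly poly poly" where "X3 = [:[:[:0, 1:]:]:]"
definition Y3 :: "'r::comm_ring_1 poly poly poly" where "Y3 = [:[:0, 1:]:]"
definition Z3 :: "'r::comm_ring_1 poly poly poly" where "Z3 = [:0, 1:]"

text \<open>Residue class of \<open>p\<close> modulo the ideal generated by \<open>S\<close>, and the quotient ring.\<close>

definition rel_class :: "'r::comm_ring_1 set \<Rightarrow> 'r \<Rightarrow> 'r set" where
  "rel_class S p = Idl\<^bsub>ring_on UNIV\<^esub> S +>\<^bsub>ring_on UNIV\<^esub> p"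

definition rel_quotient :: "'r::comm_ring_1 set \<Rightarrow> 'r set ring" where
  "rel_quotient S = ring_on UNIV Quot (Idl\<^bsub>ring_on UNIV\<^esub> S)"

section \<open>The rings of the proposition\<close>

text \<open>The variables are \<open>u\<^sub>-, v\<^sub>+, v\<^sub>-\<close> in this order.\<close>

definition B_relations ::
  "nat \<Rightarrow> nat \<Rightarrow> nat \<Rightarrow> nat \<Rightarrow> 'a \<Rightarrow> 'a \<Rightarrow> 'a \<Rightarrow> 'a::comm_ring_1 poly poly poly set" where
  "B_relations dp dm dp' dm' Pm P Qp =
     {X3 ^ dm - Z3 * const3 Pm, Y3 ^ dm' * Z3 ^ dp' - const3 P, Y3 * X3 ^ dp - const3 Qp}"

text \<open>Image in the quotient of the polynomials of weighted degree \<open>n\<close>, for the weights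
  \<open>-1\<close>, \<open>dp\<close>, \<open>-dm\<close> of the variables.\<close>

definition weighted_part ::
  "'r poly poly poly set \<Rightarrow> nat \<Rightarrow> nat \<Rightarrow> int \<Rightarrow> 'r::comm_ring_1 poly poly poly set set" where
  "weighted_part S dp dm n = rel_class S ` {p. \<forall>i j l.
     Polynomial.coeff (Polynomial.coeff (Polynomial.coeff p l) j) i \<noteq> 0 \<longrightarrow>
       - int i + int dp * int j - int dm * int l = n}"

text \<open>The variables are \<open>v\<^sub>+, v\<^sub>-\<close> in this order.\<close>

definition hypersurface_relation ::
  "nat \<Rightarrow> nat \<Rightarrow> 'a \<Rightarrow> 'a::comm_ring_1 poly poly set" where
  "hypersurface_relation dp' dm' P = {X2 ^ dm' * Y2 ^ dp' - const2 P}"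

text \<open>The equation \<open>q(s, v\<^sub>+\<^sup>d\<^sup>m v\<^sub>-\<^sup>d\<^sup>p) = 0\<close> in the variables \<open>s, v\<^sub>+, v\<^sub>-\<close>.\<close>

definition space_relation ::
  "nat \<Rightarrow> nat \<Rightarrow> complex poly poly \<Rightarrow> complex poly poly poly set" where
  "space_relation dp dm q = {eval2 const3 X3 (Y3 ^ dm * Z3 ^ dp) q}"

end

theory Submission
  imports Defs "Jordan_Normal_Form.Char_Poly" "HOL-Analysis.Continuum_Not_Denumerable"
    "HOL-Computational_Algebra.Field_as_Ring"
begin

text \<open>
  The graded pieces of \<open>A\<close> are spaces of sections of divisors, described by orders of vanishing at
  the closed points (the local rings are discrete valuation rings by Nakayama's lemma). Comparing
  orders shows that \<open>v\<^sub>\<plusminus>\<close> has divisor exactly \<open>- d\<^sub>\<plusminus> D\<^sub>\<plusminus>\<close>; hence division by \<open>v\<^sub>+\<close> maps \<open>A\<^sub>n\<^sub>+\<^sub>d\<close>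
  to \<open>A\<^sub>n\<close> for \<open>d = d\<^sub>+\<close>, \<open>n \<ge> 0\<close>, and likewise for \<open>v\<^sub>-\<close>. The conditions on orders are stable under taking
  roots of monic equations, so \<open>A\<close> is integrally closed, and every homogeneous element of \<open>A\<close> has
  a power in the subalgebra generated by \<open>A\<^sub>0, v\<^sub>+, v\<^sub>-\<close>. So \<open>A\<close> is the normalization of each subalgebra that
  contains \<open>v\<^sub>+, v\<^sub>-\<close>, over which \<open>A\<^sub>0\<close> is integral, and that has the same fraction field.

  (a) A homogeneous relation among \<open>u\<^sub>-, v\<^sub>+, v\<^sub>-\<close> is killed by a power of \<open>Q\<^sub>+\<close> modulo the given relations;
  modulo the radical of \<open>Q\<^sub>+\<close> a monomial of degree divisible by \<open>d\<^sub>+ d\<^sub>-\<close> is a multiple of a power of \<open>v\<^sub>+\<close>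
  or \<open>v\<^sub>-\<close>, so some power of the relation is divisible by \<open>Q\<^sub>+\<close>; together the relation is nilpotent.
  (b) The elements of degree divisible by \<open>k\<close> are the invariants of the automorphism that multiplies
  degree \<open>n\<close> by the \<open>n\<close>-th power of a primitive \<open>k\<close>-th root of unity, and they form the normalization
  of the hypersurface.
  (c) If \<open>v\<^sub>+\<close> is not invertible, then \<open>P\<close> is not constant. A general linear combination \<open>s\<close> of generators of
  \<open>A\<^sub>0\<close> then makes \<open>A\<^sub>0\<close> integral over \<open>\<complex>[s, P]\<close> with the same fraction field, and \<open>q\<close> is the irreducible
  relation between \<open>s\<close> and \<open>P\<close>.
\<close>

section \<open>Subrings and normalization of a domain\<close>

text \<open>The abstract side, with nilradicals and fractions as classes of pairs, is met only once:
  each ring in question comes with generators, relations and an evaluation \<open>e\<close> into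
  Laurent polynomials over the fraction field, and it suffices to control the kernel and the image
  of \<open>e\<close>. In (a) the ideal of relations may fail to be radical, so its elements are
  compared with the kernel only up to powers. The exponent \<open>dp * dm\<close> brings a
  homogeneous relation into a degree where a single power of \<open>v_+\<close> or
  \<open>v_-\<close> generates. In (b) and (c) the relation ideal is the full kernel: two variables
  of opposite degrees leave only powers of one product \<open>t\<close> free in each degree, so
  everything reduces to the kernel of \<open>t \<mapsto> P\<close> on polynomials in one variable.
  The countable dimension of the coordinate ring against the uncountable field enters twice: for the
  Nullstellensatz, and to show that every function on the curve is algebraic over a nonconstant
  one.\<close>

lemma ring_on_simps [simp]:
  "carrier (ring_on S) = S" "x \<otimes>\<^bsub>ring_on S\<^esub> y = x * y" "x \<oplus>\<^bsub>ring_on S\<^esub> y = x + y"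
  "\<one>\<^bsub>ring_on S\<^esub> = 1" "\<zero>\<^bsub>ring_on S\<^esub> = 0"
  by (simp_all add: ring_on_def)

definition is_subring :: "'a::comm_ring_1 set \<Rightarrow> bool" where
  "is_subring S \<longleftrightarrow> 1 \<in> S \<and> (\<forall>x\<in>S. \<forall>y\<in>S. x - y \<in> S \<and> x * y \<in> S)"

lemma is_subringI:
  assumes "1 \<in> S" "\<And>x y. x \<in> S \<Longrightarrow> y \<in> S \<Longrightarrow> x + y \<in> S"
    "\<And>x y. x \<in> S \<Longrightarrow> y \<in> S \<Longrightarrow> x * y \<in> S" "\<And>x. x \<in> S \<Longrightarrow> - x \<in> S"
  shows "is_subring S"
proof -
  have "x - y \<in> S" if "x \<in> S" "y \<in> S" for x y
    using assms(2)[OF that(1) assms(4)[OF that(2)]] by simp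
  then show ?thesis using assms(1,3) by (simp add: is_subring_def)
qed

lemma subring_closed:
  assumes "is_subring S"
  shows subring_one: "1 \<in> S" and subring_zero: "0 \<in> S"
    and subring_uminus: "x \<in> S \<Longrightarrow> - x \<in> S"
    and subring_add: "x \<in> S \<Longrightarrow> y \<in> S \<Longrightarrow> x + y \<in> S"
    and subring_diff: "x \<in> S \<Longrightarrow> y \<in> S \<Longrightarrow> x - y \<in> S"
    and subring_mult: "x \<in> S \<Longrightarrow> y \<in> S \<Longrightarrow> x * y \<in> S"
proof -
  show 1: "1 \<in> S" and d: "x \<in> S \<Longrightarrow> y \<in> S \<Longrightarrow> x - y \<in> S"
    and "x \<in> S \<Longrightarrow> y \<in> S \<Longrightarrow> x * y \<in> S" for x y
    using assms unfolding is_subring_def by auto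
  show 0: "0 \<in> S" using d[OF 1 1] by simp
  show u: "x \<in> S \<Longrightarrow> - x \<in> S" for x using d[OF 0] by force
  show "x \<in> S \<Longrightarrow> y \<in> S \<Longrightarrow> x + y \<in> S" for x y using d[OF _ u] by force
qed

lemma subring_power: "is_subring S \<Longrightarrow> x \<in> S \<Longrightarrow> x ^ n \<in> S"
  by (induction n) (auto intro: subring_closed)

lemma subring_sum: "is_subring S \<Longrightarrow> (\<And>i. i \<in> A \<Longrightarrow> f i \<in> S) \<Longrightarrow> sum f A \<in> S"
  by (induction A rule: infinite_finite_induct) (auto intro: subring_closed)

lemma subring_prod: "is_subring S \<Longrightarrow> (\<And>i. i \<in> A \<Longrightarrow> f i \<in> S) \<Longrightarrow> prod f A \<in> S"
  by (induction A rule: infinite_finite_induct) (auto intro: subring_closed)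

lemma cring_ring_on: "is_subring S \<Longrightarrow> cring (ring_on S)"
proof (rule cringI)
  assume S: "is_subring S"
  show "abelian_group (ring_on S)"
    by (rule abelian_groupI) (auto simp: algebra_simps intro: subring_closed[OF S]
        intro!: bexI[of _ "- x" for x])
  show "Group.comm_monoid (ring_on S)"
    by unfold_locales (auto simp: algebra_simps intro: subring_closed[OF S])
qed (auto simp: algebra_simps)

lemma is_subring_UNIV [simp]: "is_subring UNIV"
  by (auto simp: is_subring_def)

lemma finsum_ring_on:
  assumes "is_subring S" "\<And>i. i \<in> A \<Longrightarrow> f i \<in> S"
  shows "finsum (ring_on S) f A = sum f A"
proof -
  interpret cring "ring_on S" by (rule cring_ring_on[OF assms(1)])
  show ?thesis using assms(2)
    by (induction A rule: infinite_finite_induct) (auto simp: Pi_def finsum_infinite)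
qed

section \<open>Fraction fields and integral closures seen through an evaluation map\<close>

definition integral_elem :: "'a::comm_ring_1 set \<Rightarrow> 'a \<Rightarrow> bool" where
  "integral_elem S x \<longleftrightarrow>
     (\<exists>(n::nat) c. 0 < n \<and> (\<forall>i<n. c i \<in> S) \<and> x ^ n + (\<Sum>i<n. c i * x ^ i) = 0)"

text \<open>\<open>Rr\<close> is a quotient of the type \<open>'t\<close> by the fibres of a ring
  homomorphism \<open>e\<close> into a domain. Since \<open>pr\<close> and \<open>e\<close> identify
  the same elements, every statement about classes and fractions in \<open>Rr\<close> becomes an
  identity between values of \<open>e\<close>.\<close>

locale frac_model =
  fixes Rr :: "'c ring" and pr :: "'t::comm_ring_1 \<Rightarrow> 'c" and e :: "'t \<Rightarrow> 's::idom"
  assumes e_add: "e (p + q) = e p + e q" and e_mult: "e (p * q) = e p * e q" and e_one: "e 1 = 1"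
    and carr: "carrier Rr = range pr"
    and pr_mult: "pr p \<otimes>\<^bsub>Rr\<^esub> pr q = pr (p * q)" and pr_add: "pr p \<oplus>\<^bsub>Rr\<^esub> pr q = pr (p + q)"
    and pr_one: "\<one>\<^bsub>Rr\<^esub> = pr 1" and pr_zero: "\<zero>\<^bsub>Rr\<^esub> = pr 0"
    and pr_eq: "pr p = pr q \<longleftrightarrow> e p = e q"
begin

abbreviation "K \<equiv> frac_field Rr"
abbreviation "cl a b \<equiv> frac_class Rr (pr a) (pr b)"

lemma e_zero: "e 0 = 0" using e_add[of 0 0] by (simp only: add_0 add_cancel_right_right)

lemma e_uminus: "e (- p) = - e p"
  using e_add[of p "- p"] by (simp add: e_zero eq_neg_iff_add_eq_0 add.commute)

lemma frac_rel_iff: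
  "((pr a, pr b), (pr c, pr d)) \<in> frac_rel Rr \<longleftrightarrow> e b \<noteq> 0 \<and> e d \<noteq> 0 \<and> e a * e d = e c * e b"
  unfolding frac_rel_def by (auto simp: carr pr_zero pr_eq pr_mult e_mult e_zero)

lemma cl_eq: "e b \<noteq> 0 \<Longrightarrow> cl a b = {(pr c, pr d) |c d. e d \<noteq> 0 \<and> e a * e d = e c * e b}"
proof (intro equalityI subsetI)
  fix x assume b: "e b \<noteq> 0" and "x \<in> cl a b"
  then have r: "((pr a, pr b), x) \<in> frac_rel Rr" by (auto simp: frac_class_def)
  then obtain c d where "x = (pr c, pr d)" unfolding frac_rel_def carr by auto
  with r show "x \<in> {(pr c, pr d) |c d. e d \<noteq> 0 \<and> e a * e d = e c * e b}"
    by (auto simp: frac_rel_iff)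
qed (auto simp: frac_class_def frac_rel_iff)

lemma mem_cl_iff: "e b \<noteq> 0 \<Longrightarrow> (pr c, pr d) \<in> cl a b \<longleftrightarrow> e d \<noteq> 0 \<and> e a * e d = e c * e b"
  by (auto simp: frac_class_def frac_rel_iff)

lemma cl_eq_iff:
  assumes "e b \<noteq> 0" "e d \<noteq> 0" shows "cl a b = cl c d \<longleftrightarrow> e a * e d = e c * e b"
proof
  assume "cl a b = cl c d"
  moreover have "(pr c, pr d) \<in> cl c d" using assms by (simp add: mem_cl_iff)
  ultimately have "(pr c, pr d) \<in> cl a b" by simp
  then show "e a * e d = e c * e b" using assms by (simp add: mem_cl_iff)
next
  assume h: "e a * e d = e c * e b"
  have "e a * e y = e x * e b \<longleftrightarrow> e c * e y = e x * e d" if "e y \<noteq> 0" for x y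
  proof -
    have "e a * e y = e x * e b \<longleftrightarrow> (e a * e y) * e d = (e x * e b) * e d" using assms by simp
    also have "(e a * e y) * e d = (e c * e y) * e b" using h by (metis mult.assoc mult.commute)
    also have "(e x * e b) * e d = (e x * e d) * e b" by (simp add: ac_simps)
    finally show ?thesis using assms by simp
  qed
  then show "cl a b = cl c d" unfolding cl_eq[OF assms(1)] cl_eq[OF assms(2)] by blast
qed

lemma carrier_K: "carrier K = {cl a b |a b. e b \<noteq> 0}"
proof (intro equalityI subsetI)
  fix x assume "x \<in> carrier K"
  then obtain a b where "b \<noteq> pr 0" "b \<in> range pr" "a \<in> range pr" "x = frac_class Rr a b"
    unfolding frac_field_def quotient_def frac_class_def carr pr_zero by auto
  then obtain a' b' where "x = cl a' b'" "e b' \<noteq> 0" by (auto simp: pr_eq e_zero)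
  then show "x \<in> {cl a b |a b. e b \<noteq> 0}" by blast
next
  fix x assume "x \<in> {cl a b |a b. e b \<noteq> 0}"
  then obtain a b where "pr b \<noteq> pr 0" "x = cl a b" by (auto simp: pr_eq e_zero)
  then show "x \<in> carrier K"
    unfolding frac_field_def quotient_def frac_class_def carr pr_zero by auto
qed

lemma carrier_KE: "x \<in> carrier K \<Longrightarrow> (\<And>a b. e b \<noteq> 0 \<Longrightarrow> x = cl a b \<Longrightarrow> thesis) \<Longrightarrow> thesis"
  unfolding carrier_K by blast

lemma cl_in_K: "e b \<noteq> 0 \<Longrightarrow> cl a b \<in> carrier K" by (auto simp: carrier_K)

text \<open>The operations of \<open>frac_field\<close> are unions over all pairs of
  representatives; independence of the representatives collapses such a union to one class.\<close>

lemma UN_const: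
  assumes "x0 \<in> X" "y0 \<in> Y" "\<And>a b c d. (a, b) \<in> X \<Longrightarrow> (c, d) \<in> Y \<Longrightarrow> f a b c d = Z"
  shows "(\<Union>(a, b)\<in>X. \<Union>(c, d)\<in>Y. f a b c d) = Z"
  using assms(1,2) by (force simp: assms(3))

lemma K_mult:
  assumes b: "e b \<noteq> 0" and d: "e d \<noteq> 0"
  shows "cl a b \<otimes>\<^bsub>K\<^esub> cl c d = cl (a * c) (b * d)"
proof -
  have "frac_class Rr (x \<otimes>\<^bsub>Rr\<^esub> z) (y \<otimes>\<^bsub>Rr\<^esub> w) = cl (a * c) (b * d)"
    if 1: "(x, y) \<in> cl a b" and 2: "(z, w) \<in> cl c d" for x y z w
  proof -
    obtain x' y' where x: "x = pr x'" "y = pr y'" "e y' \<noteq> 0" "e a * e y' = e x' * e b"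
      using 1 unfolding cl_eq[OF b] by auto
    obtain z' w' where z: "z = pr z'" "w = pr w'" "e w' \<noteq> 0" "e c * e w' = e z' * e d"
      using 2 unfolding cl_eq[OF d] by auto
    have "(e x' * e b) * (e z' * e d) = (e a * e y') * (e c * e w')" using x z by simp
    then have "(e x' * e z') * (e b * e d) = (e a * e c) * (e y' * e w')" by (simp only: ac_simps)
    then have "cl (x' * z') (y' * w') = cl (a * c) (b * d)"
      using x z b d by (subst cl_eq_iff) (simp_all add: e_mult)
    then show ?thesis using x z by (simp add: pr_mult)
  qed
  moreover have "(pr a, pr b) \<in> cl a b" "(pr c, pr d) \<in> cl c d" using b d by (simp_all add: mem_cl_iff)
  ultimately show ?thesis unfolding frac_field_def by (simp add: UN_const)
qed

lemma K_add:
  assumes b: "e b \<noteq> 0" and d: "e d \<noteq> 0"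
  shows "cl a b \<oplus>\<^bsub>K\<^esub> cl c d = cl (a * d + c * b) (b * d)"
proof -
  have "frac_class Rr (x \<otimes>\<^bsub>Rr\<^esub> w \<oplus>\<^bsub>Rr\<^esub> z \<otimes>\<^bsub>Rr\<^esub> y) (y \<otimes>\<^bsub>Rr\<^esub> w) = cl (a * d + c * b) (b * d)"
    if 1: "(x, y) \<in> cl a b" and 2: "(z, w) \<in> cl c d" for x y z w
  proof -
    obtain x' y' where x: "x = pr x'" "y = pr y'" "e y' \<noteq> 0" "e a * e y' = e x' * e b"
      using 1 unfolding cl_eq[OF b] by auto
    obtain z' w' where z: "z = pr z'" "w = pr w'" "e w' \<noteq> 0" "e c * e w' = e z' * e d"
      using 2 unfolding cl_eq[OF d] by auto
    have "(e x' * e w' + e z' * e y') * (e b * e d)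
        = (e x' * e b) * e w' * e d + (e z' * e d) * e y' * e b" by (simp add: algebra_simps)
    also have "\<dots> = (e a * e y') * e w' * e d + (e c * e w') * e y' * e b" using x z by simp
    also have "\<dots> = (e a * e d + e c * e b) * (e y' * e w')" by (simp add: algebra_simps)
    finally have "cl (x' * w' + z' * y') (y' * w') = cl (a * d + c * b) (b * d)"
      using x z b d by (subst cl_eq_iff) (simp_all add: e_mult e_add)
    then show ?thesis using x z by (simp add: pr_mult pr_add)
  qed
  moreover have "(pr a, pr b) \<in> cl a b" "(pr c, pr d) \<in> cl c d" using b d by (simp_all add: mem_cl_iff)
  ultimately show ?thesis unfolding frac_field_def by (simp add: UN_const)
qed

lemma K_one: "\<one>\<^bsub>K\<^esub> = cl 1 1" and K_zero: "\<zero>\<^bsub>K\<^esub> = cl 0 1"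
  by (simp_all add: frac_field_def pr_one pr_zero)

text \<open>The embedding of the fraction field of \<open>Rr\<close> into the fraction field of the
  target of \<open>e\<close>. It is injective and respects the operations, so the ring axioms of
  \<open>K\<close> are inherited instead of being checked on classes.\<close>

definition val :: "('c \<times> 'c) set \<Rightarrow> 's fract" where
  "val Z = (THE y. \<exists>a b. (pr a, pr b) \<in> Z \<and> y = Fract (e a) (e b))"

lemma val_cl: "e b \<noteq> 0 \<Longrightarrow> val (cl a b) = Fract (e a) (e b)"
  unfolding val_def
proof (rule the_equality)
  assume b: "e b \<noteq> 0"
  show "\<exists>c d. (pr c, pr d) \<in> cl a b \<and> Fract (e a) (e b) = Fract (e c) (e d)"
    using b by (intro exI[of _ a] exI[of _ b]) (simp add: mem_cl_iff)
qed (auto simp: mem_cl_iff eq_fract)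

lemma val_inj: "inj_on val (carrier K)"
  by (rule inj_onI, elim carrier_KE) (simp add: val_cl eq_fract cl_eq_iff)

lemma K_closed:
  "x \<in> carrier K \<Longrightarrow> y \<in> carrier K \<Longrightarrow> x \<otimes>\<^bsub>K\<^esub> y \<in> carrier K"
  "x \<in> carrier K \<Longrightarrow> y \<in> carrier K \<Longrightarrow> x \<oplus>\<^bsub>K\<^esub> y \<in> carrier K"
  "\<one>\<^bsub>K\<^esub> \<in> carrier K" "\<zero>\<^bsub>K\<^esub> \<in> carrier K"
  by (auto elim!: carrier_KE simp: K_mult K_add K_one K_zero e_one e_mult intro!: cl_in_K)

lemma val_hom:
  "x \<in> carrier K \<Longrightarrow> y \<in> carrier K \<Longrightarrow> val (x \<otimes>\<^bsub>K\<^esub> y) = val x * val y"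
  "x \<in> carrier K \<Longrightarrow> y \<in> carrier K \<Longrightarrow> val (x \<oplus>\<^bsub>K\<^esub> y) = val x + val y"
  "val \<one>\<^bsub>K\<^esub> = 1" "val \<zero>\<^bsub>K\<^esub> = 0"
  by (auto elim!: carrier_KE simp: K_mult K_add K_one K_zero val_cl e_one e_mult e_add e_zero
      Zero_fract_def One_fract_def)

lemma cring_K: "cring K"
proof (rule cringI)
  note eqI = inj_onD[OF val_inj]
  show "abelian_group K"
  proof (rule abelian_groupI)
    fix x assume x: "x \<in> carrier K"
    then obtain a b where ab: "e b \<noteq> 0" "x = cl a b" by (rule carrier_KE)
    have "cl (- a) b \<oplus>\<^bsub>K\<^esub> x = \<zero>\<^bsub>K\<^esub>"
      by (rule eqI) (use ab in \<open>auto simp: val_hom cl_in_K val_cl e_uminus K_closed eq_fract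
        Zero_fract_def\<close>)
    then show "\<exists>y\<in>carrier K. y \<oplus>\<^bsub>K\<^esub> x = \<zero>\<^bsub>K\<^esub>" using ab by (auto intro: cl_in_K)
  qed (simp_all add: K_closed, (rule eqI; simp add: K_closed val_hom ac_simps)+)
  show "Group.comm_monoid K"
    by unfold_locales (simp_all add: K_closed, (rule eqI; simp add: K_closed val_hom ac_simps)+)
qed (rule inj_onD[OF val_inj]; simp add: K_closed val_hom algebra_simps)

sublocale K: cring K by (rule cring_K)

lemma val_pow: "x \<in> carrier K \<Longrightarrow> val (x [^]\<^bsub>K\<^esub> (n::nat)) = val x ^ n"
  by (induction n) (simp_all add: val_hom)

lemma val_finsum:
  "(\<And>i. i \<in> A \<Longrightarrow> f i \<in> carrier K) \<Longrightarrow> val (finsum K f A) = (\<Sum>i\<in>A. val (f i))"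
  by (induction A rule: infinite_finite_induct)
    (auto simp: val_hom K.finsum_infinite Pi_def)

lemma frac_embed_eq: "frac_embed Rr (pr p) = cl p 1"
  by (simp add: frac_embed_def pr_one)

lemma val_embed: "val (frac_embed Rr (pr p)) = Fract (e p) 1"
  by (simp add: frac_embed_eq val_cl e_one)

lemma integral_over_iff:
  assumes x: "x \<in> carrier K"
  shows "integral_over K (frac_embed Rr ` carrier Rr) x \<longleftrightarrow>
    (\<exists>(n::nat) c. 0 < n \<and> val x ^ n + (\<Sum>i<n. Fract (e (c i)) 1 * val x ^ i) = 0)" (is "?L \<longleftrightarrow> ?R")
proof -
  have val_rel: "val (x [^]\<^bsub>K\<^esub> n \<oplus>\<^bsub>K\<^esub> (\<Oplus>\<^bsub>K\<^esub>i\<in>{..<n}. frac_embed Rr (pr (c i)) \<otimes>\<^bsub>K\<^esub> (x [^]\<^bsub>K\<^esub> i)))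
      = val x ^ n + (\<Sum>i<n. Fract (e (c i)) 1 * val x ^ i)" for n :: nat and c
    using x cl_in_K[of 1] by (simp add: val_hom val_pow val_finsum frac_embed_eq e_one val_cl Pi_def)
  have cl1: "frac_embed Rr (pr p) \<in> carrier K" for p by (simp add: frac_embed_eq e_one cl_in_K)
  show ?thesis
  proof
    assume ?L
    then obtain n :: nat and c where n: "0 < n" and c: "\<forall>i<n. c i \<in> frac_embed Rr ` carrier Rr"
      and rel: "(x [^]\<^bsub>K\<^esub> n) \<oplus>\<^bsub>K\<^esub> (\<Oplus>\<^bsub>K\<^esub>i\<in>{..<n}. c i \<otimes>\<^bsub>K\<^esub> (x [^]\<^bsub>K\<^esub> i)) = \<zero>\<^bsub>K\<^esub>"
      unfolding integral_over_def by blast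
    have "\<forall>i. \<exists>p. i < n \<longrightarrow> c i = frac_embed Rr (pr p)" using c unfolding carr by blast
    then obtain p where p: "\<And>i. i < n \<Longrightarrow> c i = frac_embed Rr (pr (p i))" by metis
    have "(\<Oplus>\<^bsub>K\<^esub>i\<in>{..<n}. c i \<otimes>\<^bsub>K\<^esub> (x [^]\<^bsub>K\<^esub> i))
        = (\<Oplus>\<^bsub>K\<^esub>i\<in>{..<n}. frac_embed Rr (pr (p i)) \<otimes>\<^bsub>K\<^esub> (x [^]\<^bsub>K\<^esub> i))"
      by (rule K.finsum_cong') (auto simp: p x cl1)
    then have "val x ^ n + (\<Sum>i<n. Fract (e (p i)) 1 * val x ^ i) = 0"
      using rel val_rel[of n p] by (simp add: val_hom)
    then show ?R using n by blast
  next
    assume ?R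
    then obtain n c where n: "0 < n" and rel: "val x ^ n + (\<Sum>i<n. Fract (e (c i)) 1 * val x ^ i) = 0"
      by blast
    have "(x [^]\<^bsub>K\<^esub> n) \<oplus>\<^bsub>K\<^esub> (\<Oplus>\<^bsub>K\<^esub>i\<in>{..<n}. frac_embed Rr (pr (c i)) \<otimes>\<^bsub>K\<^esub> (x [^]\<^bsub>K\<^esub> i)) = \<zero>\<^bsub>K\<^esub>"
      by (rule inj_onD[OF val_inj]) (use rel val_rel[of n c] in \<open>auto simp: val_hom x cl1 Pi_def\<close>)
    then show ?L unfolding integral_over_def carr
      using n by (intro exI[of _ n] exI[of _ "\<lambda>i. frac_embed Rr (pr (c i))"]) simp
  qed
qed

text \<open>\<open>closed\<close> is integral closedness with denominators cleared, so that it
  speaks only about elements of the target of \<open>e\<close>. It sends integral fractions to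
  elements of \<open>A\<close>; \<open>int\<close> and \<open>frac\<close> show that every element
  of \<open>A\<close> is reached.\<close>

lemma normalization_iso:
  fixes A :: "'s set"
  assumes A: "is_subring A" and eA: "range e \<subseteq> A"
    and int: "\<And>a. a \<in> A \<Longrightarrow> integral_elem (range e) a"
    and frac: "\<And>a. a \<in> A \<Longrightarrow> \<exists>p q. e q \<noteq> 0 \<and> a * e q = e p"
    and closed: "\<And>p q n c. e q \<noteq> 0 \<Longrightarrow> 0 < n \<Longrightarrow>
      e p ^ n + (\<Sum>i<n. e (c i) * e p ^ i * e q ^ (n - i)) = 0 \<Longrightarrow> \<exists>a\<in>A. a * e q = e p"
  defines "N \<equiv> K\<lparr>carrier := integral_closure K (frac_embed Rr ` carrier Rr)\<rparr>"
  shows "\<exists>h \<in> ring_iso N (ring_on A). \<forall>p. h (frac_embed Rr (pr p)) = e p"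
proof -
  have Fpow: "Fract a 1 ^ n = Fract (a ^ n) 1" for a :: 's and n
    by (induction n) (simp_all add: One_fract_def)
  have Fsum: "(\<Sum>i\<in>I. Fract (f i) 1) = Fract (\<Sum>i\<in>I. f i) 1" for f :: "nat \<Rightarrow> 's" and I
    by (induction I rule: infinite_finite_induct) (simp_all add: Zero_fract_def)
  have F0: "Fract a 1 = 0 \<longleftrightarrow> a = 0" for a :: 's by (simp add: Zero_fract_def eq_fract)
  have Finj: "Fract a 1 = Fract b 1 \<longleftrightarrow> a = b" for a b :: 's by (simp add: eq_fract)
  define C where "C = integral_closure K (frac_embed Rr ` carrier Rr)"
  have to_A: "\<exists>a\<in>A. val x = Fract a 1" if x: "x \<in> C" for x
  proof -
    have xK: "x \<in> carrier K" and "integral_over K (frac_embed Rr ` carrier Rr) x"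
      using x unfolding C_def integral_closure_def by auto
    then obtain n c where n: "0 < n" and rel: "val x ^ n + (\<Sum>i<n. Fract (e (c i)) 1 * val x ^ i) = 0"
      unfolding integral_over_iff[OF xK] by blast
    obtain p q where pq: "e q \<noteq> 0" "x = cl p q" using xK by (rule carrier_KE)
    let ?q = "Fract (e q) 1"
    have v: "val x * ?q = Fract (e p) 1" using pq by (simp add: val_cl eq_fract)
    \<comment> \<open>The monic equation is multiplied by the \<open>n\<close>-th power of the
      denominator \<open>e q\<close>, which gives the form required by
      \<open>closed\<close>.\<close>
    have "0 = (val x ^ n + (\<Sum>i<n. Fract (e (c i)) 1 * val x ^ i)) * ?q ^ n" using rel by simp
    also have "\<dots> = (val x * ?q) ^ n + (\<Sum>i<n. Fract (e (c i)) 1 * (val x * ?q) ^ i * ?q ^ (n - i))"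
      unfolding distrib_right sum_distrib_right power_mult_distrib
    proof (intro arg_cong2[of _ _ _ _ "(+)"] sum.cong refl)
      fix i assume "i \<in> {..<n}"
      then have "?q ^ n = ?q ^ i * ?q ^ (n - i)" by (simp flip: power_add)
      then show "Fract (e (c i)) 1 * val x ^ i * ?q ^ n
          = Fract (e (c i)) 1 * (val x ^ i * ?q ^ i) * ?q ^ (n - i)" by (simp add: ac_simps)
    qed
    also have "\<dots> = Fract (e p ^ n + (\<Sum>i<n. e (c i) * e p ^ i * e q ^ (n - i))) 1"
      unfolding v Fpow mult_fract by (simp add: Fsum)
    finally have "e p ^ n + (\<Sum>i<n. e (c i) * e p ^ i * e q ^ (n - i)) = 0" using F0 by metis
    from closed[OF pq(1) n this] obtain a where "a \<in> A" "a * e q = e p" by blast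
    then show ?thesis using pq by (auto simp: val_cl eq_fract intro!: bexI[of _ a])
  qed
  have from_A: "\<exists>x\<in>C. val x = Fract a 1" if a: "a \<in> A" for a
  proof -
    obtain p q where pq: "e q \<noteq> 0" "a * e q = e p" using frac[OF a] by blast
    have v: "val (cl p q) = Fract a 1" using pq by (simp add: val_cl eq_fract)
    obtain n c where n: "0 < n" and c: "\<forall>i<n. c i \<in> range e"
      and rel: "a ^ n + (\<Sum>i<n. c i * a ^ i) = 0"
      using int[OF a] unfolding integral_elem_def by blast
    have "\<forall>i. \<exists>t. i < n \<longrightarrow> c i = e t" using c by blast
    then obtain t where t: "\<And>i. i < n \<Longrightarrow> c i = e (t i)" by metis
    have "val (cl p q) ^ n + (\<Sum>i<n. Fract (e (t i)) 1 * val (cl p q) ^ i)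
        = Fract (a ^ n + (\<Sum>i<n. e (t i) * a ^ i)) 1" unfolding v Fpow by (simp add: Fsum)
    also have "(\<Sum>i<n. e (t i) * a ^ i) = (\<Sum>i<n. c i * a ^ i)" by (simp add: t)
    finally have "val (cl p q) ^ n + (\<Sum>i<n. Fract (e (t i)) 1 * val (cl p q) ^ i) = 0"
      using rel F0 by simp
    then have "cl p q \<in> C" unfolding C_def integral_closure_def
      using integral_over_iff[OF cl_in_K[OF pq(1)]] n cl_in_K[OF pq(1)] by auto
    then show ?thesis using v by blast
  qed
  define h where "h x = (THE a. val x = Fract a 1)" for x
  have hI: "h x = a" if "val x = Fract a 1" for x a
    unfolding h_def using that by (auto simp: Finj)
  have CK: "C \<subseteq> carrier K" by (auto simp: C_def integral_closure_def)
  have N_simps: "carrier N = C" "x \<otimes>\<^bsub>N\<^esub> y = x \<otimes>\<^bsub>K\<^esub> y" "x \<oplus>\<^bsub>N\<^esub> y = x \<oplus>\<^bsub>K\<^esub> y" "\<one>\<^bsub>N\<^esub> = \<one>\<^bsub>K\<^esub>" for x y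
    by (simp_all add: N_def C_def)
  have "h \<in> ring_iso N (ring_on A)"
  proof (rule ring_iso_memI)
    fix x y assume x: "x \<in> carrier N" and y: "y \<in> carrier N"
    obtain a where a: "a \<in> A" "val x = Fract a 1" using x to_A[of x] N_simps(1) by blast
    obtain b where b: "b \<in> A" "val y = Fract b 1" using y to_A[of y] N_simps(1) by blast
    have K: "x \<in> carrier K" "y \<in> carrier K" using x y CK N_simps(1) by blast+
    show "h x \<in> carrier (ring_on A)" using a by (simp add: hI)
    have "h (x \<otimes>\<^bsub>N\<^esub> y) = a * b" by (rule hI) (simp add: N_simps val_hom K a b)
    then show "h (x \<otimes>\<^bsub>N\<^esub> y) = h x \<otimes>\<^bsub>ring_on A\<^esub> h y" using a b by (simp add: hI)
    have "h (x \<oplus>\<^bsub>N\<^esub> y) = a + b" by (rule hI) (simp add: N_simps val_hom K a b)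
    then show "h (x \<oplus>\<^bsub>N\<^esub> y) = h x \<oplus>\<^bsub>ring_on A\<^esub> h y" using a b by (simp add: hI)
  next
    show "h \<one>\<^bsub>N\<^esub> = \<one>\<^bsub>ring_on A\<^esub>"
      by (simp add: N_simps, rule hI) (simp add: val_hom One_fract_def)
    show "bij_betw h (carrier N) (carrier (ring_on A))"
    proof (rule bij_betwI')
      fix x y assume x: "x \<in> carrier N" and y: "y \<in> carrier N"
      obtain a where a: "a \<in> A" "val x = Fract a 1" using x to_A[of x] N_simps(1) by blast
      obtain b where b: "b \<in> A" "val y = Fract b 1" using y to_A[of y] N_simps(1) by blast
      have K: "x \<in> carrier K" "y \<in> carrier K" using x y CK N_simps(1) by blast+
      show "h x = h y \<longleftrightarrow> x = y" using hI[OF a(2)] hI[OF b(2)] a(2) b(2) inj_onD[OF val_inj _ K] by auto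
      show "h x \<in> carrier (ring_on A)" using a by (simp add: hI)
    next
      fix a assume "a \<in> carrier (ring_on A)"
      then obtain x where "x \<in> C" "val x = Fract a 1" using from_A[of a] by auto
      then show "\<exists>x\<in>carrier N. a = h x" using hI N_simps(1) by blast
    qed
  qed
  moreover have "h (frac_embed Rr (pr p)) = e p" for p by (rule hI) (rule val_embed)
  ultimately show ?thesis by blast
qed

end

section \<open>Ideals, quotients and their normalization\<close>

definition is_ideal :: "'a::comm_ring_1 set \<Rightarrow> bool" where
  "is_ideal I \<longleftrightarrow> 0 \<in> I \<and> (\<forall>x\<in>I. \<forall>y\<in>I. x + y \<in> I) \<and> (\<forall>a. \<forall>x\<in>I. a * x \<in> I)"

lemma is_ideal_closed:
  assumes "is_ideal I"
  shows is_ideal_zero: "0 \<in> I" and is_ideal_add: "x \<in> I \<Longrightarrow> y \<in> I \<Longrightarrow> x + y \<in> I"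
    and is_ideal_mult: "x \<in> I \<Longrightarrow> a * x \<in> I" and is_ideal_mult2: "x \<in> I \<Longrightarrow> x * a \<in> I"
    and is_ideal_uminus: "x \<in> I \<Longrightarrow> - x \<in> I"
    and is_ideal_diff: "x \<in> I \<Longrightarrow> y \<in> I \<Longrightarrow> x - y \<in> I"
proof -
  show "0 \<in> I" and a: "x \<in> I \<Longrightarrow> y \<in> I \<Longrightarrow> x + y \<in> I" and m: "x \<in> I \<Longrightarrow> a * x \<in> I" for x y a
    using assms unfolding is_ideal_def by auto
  show "x \<in> I \<Longrightarrow> x * a \<in> I" for x a using m[of x a] by (simp add: mult.commute)
  show u: "x \<in> I \<Longrightarrow> - x \<in> I" for x using m[of x "- 1"] by simp
  show "x \<in> I \<Longrightarrow> y \<in> I \<Longrightarrow> x - y \<in> I" using a[OF _ u] by force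
qed

lemma is_ideal_sum: "is_ideal I \<Longrightarrow> (\<And>i. i \<in> A \<Longrightarrow> f i \<in> I) \<Longrightarrow> sum f A \<in> I"
  by (induction A rule: infinite_finite_induct) (auto intro: is_ideal_closed)

lemma is_ideal_power: "is_ideal I \<Longrightarrow> x ^ m \<in> I \<Longrightarrow> m \<le> n \<Longrightarrow> x ^ n \<in> I"
  by (metis is_ideal_mult2 le_add_diff_inverse power_add)

lemma cring_UNIV: "cring (ring_on UNIV)"
  by (rule cring_ring_on) simp

lemma uminus_ring_on_UNIV [simp]: "\<ominus>\<^bsub>ring_on UNIV\<^esub> x = - x"
proof -
  interpret cring "ring_on UNIV" by (rule cring_UNIV)
  show ?thesis by (rule minus_equality) auto
qed

lemma minus_ring_on_UNIV [simp]: "x \<ominus>\<^bsub>ring_on UNIV\<^esub> y = x - y"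
  by (simp add: a_minus_def)

lemma ideal_iff: "ideal I (ring_on UNIV) \<longleftrightarrow> is_ideal I"
proof
  interpret R: cring "ring_on UNIV" by (rule cring_UNIV)
  show "is_ideal I" if "ideal I (ring_on UNIV)"
  proof -
    interpret ideal I "ring_on UNIV" by fact
    show ?thesis unfolding is_ideal_def
      using zero_closed a_closed I_l_closed by auto
  qed
  show "ideal I (ring_on UNIV)" if I: "is_ideal I"
  proof (rule idealI)
    show "subgroup I (add_monoid (ring_on UNIV))"
      by (rule R.add.subgroupI)
        (auto intro: is_ideal_closed[OF I])
  qed (auto intro: is_ideal_closed[OF I] R.ring_axioms)
qed

abbreviation gen_ideal :: "'a::comm_ring_1 set \<Rightarrow> 'a set" where
  "gen_ideal S \<equiv> Idl\<^bsub>ring_on UNIV\<^esub> S"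

lemma is_ideal_gen: "is_ideal (gen_ideal S)"
proof -
  interpret R: cring "ring_on UNIV" by (rule cring_UNIV)
  show ?thesis using R.genideal_ideal[of S] by (simp add: ideal_iff)
qed

lemma gen_ideal_self: "s \<in> S \<Longrightarrow> s \<in> gen_ideal S"
proof -
  interpret R: cring "ring_on UNIV" by (rule cring_UNIV)
  show "s \<in> S \<Longrightarrow> s \<in> gen_ideal S" using R.genideal_self[of S] by auto
qed

lemma gen_ideal_minimal: "is_ideal J \<Longrightarrow> S \<subseteq> J \<Longrightarrow> gen_ideal S \<subseteq> J"
proof -
  interpret R: cring "ring_on UNIV" by (rule cring_UNIV)
  show "is_ideal J \<Longrightarrow> S \<subseteq> J \<Longrightarrow> gen_ideal S \<subseteq> J"
    using R.genideal_minimal[of J S] by (simp add: ideal_iff)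
qed

lemma is_ideal_kernel:
  assumes "\<And>p q. e (p + q) = e p + e q" "\<And>p q. e (p * q) = e p * (e q :: 's::comm_ring_1)"
  shows "is_ideal {p. e p = 0}"
proof -
  have "e 0 = 0" using assms(1)[of 0 0] by (simp only: add_0 add_cancel_right_right)
  then show ?thesis by (auto simp: is_ideal_def assms)
qed

lemma coset_eq_iff:
  assumes "ideal I R" "x \<in> carrier R" "y \<in> carrier R"
  shows "I +>\<^bsub>R\<^esub> x = I +>\<^bsub>R\<^esub> y \<longleftrightarrow> x \<ominus>\<^bsub>R\<^esub> y \<in> I"
proof -
  interpret ideal I R by fact
  interpret abelian_subgroup I R by (rule abelian_subgroupI3) (rule is_additive_subgroup abelian_group_axioms)+
  show ?thesis
    using a_rcos_self[OF assms(2)] a_repr_independence[OF _ assms(3) a_subgroup, of x]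
      a_rcos_module_minus[OF ring_axioms assms(3,2)] by metis
qed

context
  fixes S :: "'t::comm_ring_1 set"
begin

interpretation R: cring "ring_on (UNIV :: 't set)" by (rule cring_UNIV)
interpretation I: ideal "gen_ideal S" "ring_on UNIV" by (simp add: ideal_iff is_ideal_gen)

lemma cring_rel_quotient: "cring (rel_quotient S)"
  unfolding rel_quotient_def by (rule I.quotient_is_cring[OF R.is_cring])

lemma rel_class_eq_iff: "rel_class S p = rel_class S q \<longleftrightarrow> p - q \<in> gen_ideal S"
  unfolding rel_class_def using coset_eq_iff[OF I.is_ideal, of p q] by simp

lemma rel_quotient_simps:
  "carrier (rel_quotient S) = range (rel_class S)"
  "rel_class S p \<otimes>\<^bsub>rel_quotient S\<^esub> rel_class S q = rel_class S (p * q)"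
  "rel_class S p \<oplus>\<^bsub>rel_quotient S\<^esub> rel_class S q = rel_class S (p + q)"
  "\<one>\<^bsub>rel_quotient S\<^esub> = rel_class S 1" "\<zero>\<^bsub>rel_quotient S\<^esub> = rel_class S 0"
proof -
  show "carrier (rel_quotient S) = range (rel_class S)"
    by (auto simp: rel_quotient_def rel_class_def FactRing_def A_RCOSETS_def' )
  note h = I.rcos_ring_hom
  show "rel_class S p \<otimes>\<^bsub>rel_quotient S\<^esub> rel_class S q = rel_class S (p * q)"
    "rel_class S p \<oplus>\<^bsub>rel_quotient S\<^esub> rel_class S q = rel_class S (p + q)"
    "\<one>\<^bsub>rel_quotient S\<^esub> = rel_class S 1"
    using ring_hom_mult[OF h, of p q] ring_hom_add[OF h, of p q] ring_hom_one[OF h]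
    by (simp_all add: rel_quotient_def rel_class_def)
  have "rel_class S 0 = gen_ideal S"
    unfolding rel_class_def using R.a_coset_add_zero[OF I.a_subset] by simp
  then show "\<zero>\<^bsub>rel_quotient S\<^esub> = rel_class S 0"
    by (simp add: rel_quotient_def FactRing_def)
qed

lemma rel_class_pow: "rel_class S p [^]\<^bsub>rel_quotient S\<^esub> (n::nat) = rel_class S (p ^ n)"
proof -
  interpret B: cring "rel_quotient S" by (rule cring_rel_quotient)
  show ?thesis by (induction n) (simp_all add: rel_quotient_simps mult.commute)
qed

lemma rel_class_minus: "rel_class S p \<ominus>\<^bsub>rel_quotient S\<^esub> rel_class S q = rel_class S (p - q)"
proof -
  interpret B: cring "rel_quotient S" by (rule cring_rel_quotient)
  have "\<ominus>\<^bsub>rel_quotient S\<^esub> rel_class S q = rel_class S (- q)"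
    by (rule B.minus_equality) (auto simp: rel_quotient_simps)
  then show ?thesis by (simp add: a_minus_def rel_quotient_simps)
qed

lemma rel_class_eq_zero_iff: "rel_class S p = \<zero>\<^bsub>rel_quotient S\<^esub> \<longleftrightarrow> p \<in> gen_ideal S"
  by (simp add: rel_quotient_simps rel_class_eq_iff)

text \<open>The criterion behind all three parts. The kernel of \<open>e\<close> only has to be nil
  modulo the relations: it then becomes the nilradical of the quotient, it is prime because the
  target is a domain, and the reduction is isomorphic to the range of \<open>e\<close>.\<close>

lemma quotient_normalization:
  fixes e :: "'t \<Rightarrow> 's::idom" and A :: "'s set"
  assumes e_add: "\<And>p q. e (p + q) = e p + e q" and e_mult: "\<And>p q. e (p * q) = e p * e q"
    and e_one: "e 1 = 1" and e_S: "\<And>s. s \<in> S \<Longrightarrow> e s = 0"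
    and nil: "\<And>p. e p = 0 \<Longrightarrow> \<exists>n. p ^ n \<in> gen_ideal S"
    and A: "is_subring A" and eA: "range e \<subseteq> A"
    and int: "\<And>a. a \<in> A \<Longrightarrow> integral_elem (range e) a"
    and frac: "\<And>a. a \<in> A \<Longrightarrow> \<exists>p q. e q \<noteq> 0 \<and> a * e q = e p"
    and closed: "\<And>p q n c. e q \<noteq> 0 \<Longrightarrow> 0 < n \<Longrightarrow>
      e p ^ n + (\<Sum>i<n. e (c i) * e p ^ i * e q ^ (n - i)) = 0 \<Longrightarrow> \<exists>a\<in>A. a * e q = e p"
  shows "\<exists>\<phi>. (\<forall>p. \<phi> (rel_class S p) = e p) \<and> is_normalization (rel_quotient S) (ring_on A) \<phi>"
proof -
  let ?B = "rel_quotient S"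
  interpret B: cring ?B by (rule cring_rel_quotient)
  have ker: "gen_ideal S \<subseteq> {p. e p = 0}"
    by (rule gen_ideal_minimal[OF is_ideal_kernel]) (auto simp: e_add e_mult e_S)
  have e0: "e 0 = 0" using ker is_ideal_zero[OF is_ideal_gen] by blast
  have e_diff: "e (p - q) = e p - e q" for p q
    using e_add[of "p - q" q] by simp
  have e_pow: "e (p ^ n) = e p ^ n" for p n
    by (induction n) (simp_all add: e_one e_mult)
  have nil_iff: "(\<exists>n. p ^ n \<in> gen_ideal S) \<longleftrightarrow> e p = 0" for p
    using nil[of p] ker e_pow[of p] by auto
  \<comment> \<open>In a domain a power of \<open>e p\<close> vanishes only if \<open>e p\<close>
    does, so nilpotent classes lie in the kernel; the converse is \<open>nil\<close>.\<close>
  have nilrad: "nilradical ?B = rel_class S ` {p. e p = 0}"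
    unfolding nilradical_def rel_quotient_simps(1)
    by (auto simp: rel_class_pow rel_class_eq_zero_iff simp flip: nil_iff intro!: imageI)
  have class_nil: "rel_class S p \<in> nilradical ?B \<longleftrightarrow> e p = 0" for p
    using ker by (auto simp: nilrad rel_class_eq_iff e_diff)
  have idl: "ideal (nilradical ?B) ?B"
  proof (rule idealI)
    show "subgroup (nilradical ?B) (add_monoid ?B)"
    proof (rule B.add.subgroupI)
      show "nilradical ?B \<subseteq> carrier (?B)" "nilradical ?B \<noteq> {}"
        using e0 by (auto simp: nilrad rel_quotient_simps)
      fix a assume "a \<in> nilradical ?B"
      then obtain p where p: "a = rel_class S p" "e p = 0" unfolding nilrad by auto
      have "\<ominus>\<^bsub>?B\<^esub> a = rel_class S (- p)"
        unfolding p by (rule B.minus_equality) (auto simp: rel_quotient_simps)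
      then show "\<ominus>\<^bsub>?B\<^esub> a \<in> nilradical ?B"
        using p e_diff[of 0 p] e0 by (simp add: class_nil)
    next
      fix a b assume "a \<in> nilradical ?B" "b \<in> nilradical ?B"
      then show "a \<oplus>\<^bsub>?B\<^esub> b \<in> nilradical ?B"
        by (auto simp: nilrad rel_quotient_simps e_add)
    qed
  qed (auto simp: nilrad rel_quotient_simps e_mult B.ring_axioms)
  have prime: "primeideal (nilradical ?B) ?B"
  proof (rule primeidealI[OF idl cring_rel_quotient])
    have "rel_class S 1 \<notin> nilradical ?B" by (simp add: class_nil e_one)
    then show "carrier ?B \<noteq> nilradical ?B" by (auto simp: rel_quotient_simps)
  qed (auto simp: rel_quotient_simps class_nil e_mult)
  let ?Rr = "reduction ?B"
  define pr where "pr p = nilradical ?B +>\<^bsub>?B\<^esub> rel_class S p" for p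
  have cl_carr: "rel_class S p \<in> carrier ?B" for p by (simp add: rel_quotient_simps)
  have pr_eq: "pr p = pr q \<longleftrightarrow> e p = e q" for p q
    unfolding pr_def coset_eq_iff[OF idl cl_carr cl_carr] rel_class_minus class_nil e_diff by simp
  have h: "((+>\<^bsub>?B\<^esub>) (nilradical ?B)) \<in> Ring.ring_hom ?B ?Rr"
    unfolding reduction_def by (rule ideal.rcos_ring_hom[OF idl])
  interpret frac_model ?Rr pr e
  proof
    show "carrier ?Rr = range pr"
      by (auto simp: reduction_def FactRing_def A_RCOSETS_def' pr_def rel_quotient_simps)
    show "pr p \<otimes>\<^bsub>?Rr\<^esub> pr q = pr (p * q)" for p q
      using ring_hom_mult[OF h cl_carr cl_carr, of p q] by (simp add: pr_def rel_quotient_simps)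
    show "pr p \<oplus>\<^bsub>?Rr\<^esub> pr q = pr (p + q)" for p q
      using ring_hom_add[OF h cl_carr cl_carr, of p q] by (simp add: pr_def rel_quotient_simps)
    show "\<one>\<^bsub>?Rr\<^esub> = pr 1"
      using ring_hom_one[OF h] by (simp add: pr_def rel_quotient_simps)
    have "pr 0 = nilradical ?B"
      unfolding pr_def rel_quotient_simps(5)[symmetric]
      by (rule B.a_coset_add_zero) (auto simp: nilrad rel_quotient_simps)
    then show "\<zero>\<^bsub>?Rr\<^esub> = pr 0" by (simp add: reduction_def FactRing_def)
  qed (simp_all add: e_add e_mult e_one pr_eq)
  obtain h where h: "h \<in> ring_iso (normalization ?B) (ring_on A)"
    and hp: "\<And>p. h (frac_embed ?Rr (pr p)) = e p"
    using normalization_iso[OF A eA] int frac closed unfolding normalization_def Let_def by blast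
  define \<phi> where "\<phi> X = e (SOME p. rel_class S p = X)" for X
  have \<phi>: "\<phi> (rel_class S p) = e p" for p
  proof -
    have "rel_class S (SOME q. rel_class S q = rel_class S p) = rel_class S p"
      by (rule someI) simp
    then have "e (SOME q. rel_class S q = rel_class S p) - e p = 0"
      using ker by (auto simp: rel_class_eq_iff e_diff)
    then show ?thesis by (simp add: \<phi>_def)
  qed
  have "\<phi> \<in> Ring.ring_hom ?B (ring_on A)"
    using eA by (intro ring_hom_memI) (auto simp: rel_quotient_simps \<phi> e_mult e_add e_one)
  moreover have "h (normalization_map ?B b) = \<phi> b" if "b \<in> carrier ?B" for b
    using that hp by (auto simp: rel_quotient_simps \<phi> normalization_map_def pr_def)
  ultimately have "is_normalization ?B (ring_on A) \<phi>"
    unfolding is_normalization_def using prime h by blast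
  with \<phi> show ?thesis by blast
qed

end

section \<open>Finite modules and integral extensions\<close>

text \<open>Gaussian elimination without division, so that it works over a domain: a vector with
  nonzero last coordinate clears this coordinate in the others by cross multiplication.\<close>

lemma linear_dependence:
  fixes v :: "'i \<Rightarrow> nat \<Rightarrow> 'r::idom"
  assumes "finite E" "D < card E"
  shows "\<exists>l. (\<exists>e\<in>E. l e \<noteq> 0) \<and> (\<forall>d<D. (\<Sum>e\<in>E. l e * v e d) = 0)"
  using assms
proof (induction D arbitrary: E v)
  case 0
  then obtain e where "e \<in> E" by fastforce
  then show ?case by (intro exI[of _ "\<lambda>_. 1"]) auto
next
  case (Suc D)
  show ?case
  proof (cases "\<forall>e\<in>E. v e D = 0")
    case True
    obtain l where "\<exists>e\<in>E. l e \<noteq> 0" "\<forall>d<D. (\<Sum>e\<in>E. l e * v e d) = 0"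
      using Suc.IH[of E v] Suc.prems by auto
    then show ?thesis using True by (intro exI[of _ l]) (auto simp: less_Suc_eq)
  next
    case False
    then obtain p where p: "p \<in> E" "v p D \<noteq> 0" by blast
    define E' where "E' = E - {p}"
    have E': "finite E'" "D < card E'" "E = insert p E'" "p \<notin> E'"
      using Suc.prems p by (auto simp: E'_def)
    obtain l where l: "\<exists>e\<in>E'. l e \<noteq> 0"
      and 0: "\<forall>d<D. (\<Sum>e\<in>E'. l e * (v p D * v e d - v e D * v p d)) = 0"
      using Suc.IH[OF E'(1,2), of "\<lambda>e d. v p D * v e d - v e D * v p d"] by blast
    \<comment> \<open>The factor \<open>v p D\<close> undoes the cross multiplication, and the
      coefficient at the pivot \<open>p\<close> is the one that cancels coordinate
      \<open>D\<close>.\<close>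
    define l' where "l' e = (if e = p then - (\<Sum>e\<in>E'. l e * v e D) else v p D * l e)" for e
    have *: "(\<Sum>e\<in>E. l' e * v e d)
        = (\<Sum>e\<in>E'. v p D * l e * v e d) - (\<Sum>e\<in>E'. l e * v e D) * v p d" for d
    proof -
      have "(\<Sum>e\<in>E'. l' e * v e d) = (\<Sum>e\<in>E'. v p D * l e * v e d)"
        using E'(4) by (intro sum.cong) (auto simp: l'_def)
      then show ?thesis unfolding E'(3) using E'(1,4) by (simp add: l'_def)
    qed
    have "(\<Sum>e\<in>E. l' e * v e d) = 0" if "d < Suc D" for d
    proof (cases "d = D")
      case True
      then show ?thesis unfolding * by (simp add: sum_distrib_left sum_distrib_right ac_simps)
    next
      case False
      then have "(\<Sum>e\<in>E'. l e * (v p D * v e d - v e D * v p d)) = 0" using 0 that by simp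
      also have "(\<Sum>e\<in>E'. l e * (v p D * v e d - v e D * v p d)) = (\<Sum>e\<in>E. l' e * v e d)"
        unfolding * by (simp add: sum_distrib_left sum_distrib_right sum_subtractf[symmetric] algebra_simps)
      finally show ?thesis .
    qed
    moreover have "\<exists>e\<in>E. l' e \<noteq> 0" using l p E'(3,4) by (auto simp: l'_def)
    ultimately show ?thesis by blast
  qed
qed

text \<open>For a subring \<open>S\<close> this is the \<open>S\<close>-module generated by
  \<open>M\<close>. Building sums one term at a time allows infinite \<open>M\<close> and supplies
  an induction principle.\<close>

inductive_set mspan :: "'a::comm_ring_1 set \<Rightarrow> 'a set \<Rightarrow> 'a set" for S M where
  mspan_zero: "0 \<in> mspan S M"
| mspan_step: "x \<in> mspan S M \<Longrightarrow> c \<in> S \<Longrightarrow> m \<in> M \<Longrightarrow> x + c * m \<in> mspan S M"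

lemma mspan_add:
  assumes "x \<in> mspan S M" "y \<in> mspan S M" shows "x + y \<in> mspan S M"
  using assms(2) by induction (auto simp: assms(1) add.assoc[symmetric] intro: mspan.intros)

lemma mspan_single: "c \<in> S \<Longrightarrow> m \<in> M \<Longrightarrow> c * m \<in> mspan S M"
  using mspan_step[OF mspan_zero] by fastforce

lemma mspan_sum: "(\<And>i. i \<in> A \<Longrightarrow> f i \<in> mspan S M) \<Longrightarrow> sum f A \<in> mspan S M"
  by (induction A rule: infinite_finite_induct) (auto intro: mspan_zero mspan_add)

lemma mspan_bind: "x \<in> mspan S M \<Longrightarrow> (\<And>c m. c \<in> S \<Longrightarrow> m \<in> M \<Longrightarrow> c * m * z \<in> mspan S' M') \<Longrightarrow> x * z \<in> mspan S' M'"
  by (induction x rule: mspan.induct) (auto simp: distrib_right intro: mspan_zero mspan_add)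

lemma mspan_scale:
  assumes "is_subring S" "x \<in> mspan S M" "c \<in> S" shows "c * x \<in> mspan S M"
proof -
  have "x * c \<in> mspan S M"
  proof (rule mspan_bind[OF assms(2)])
    fix a m assume "a \<in> S" "m \<in> M"
    then have "(a * c) * m \<in> mspan S M" by (intro mspan_single subring_mult assms)
    then show "a * m * c \<in> mspan S M" by (simp add: ac_simps)
  qed
  then show ?thesis by (simp add: mult.commute)
qed

lemma mspan_uminus: "is_subring S \<Longrightarrow> x \<in> mspan S M \<Longrightarrow> - x \<in> mspan S M"
  using mspan_scale[of S x M "- 1"] subring_uminus[of S 1] subring_one[of S] by simp

lemma mspan_mono: "x \<in> mspan S M \<Longrightarrow> S \<subseteq> S' \<Longrightarrow> M \<subseteq> M' \<Longrightarrow> x \<in> mspan S' M'"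
  by (induction x rule: mspan.induct) (auto intro: mspan.intros)

lemma mspan_finite:
  assumes S: "is_subring S" and "finite M" "x \<in> mspan S M"
  shows "\<exists>c. (\<forall>m\<in>M. c m \<in> S) \<and> x = (\<Sum>m\<in>M. c m * m)"
  using assms(3)
proof induction
  case mspan_zero
  show ?case using subring_zero[OF S] by (intro exI[of _ "\<lambda>_. 0"]) auto
next
  case (mspan_step x a m)
  then obtain c where c: "\<forall>m\<in>M. c m \<in> S" "x = (\<Sum>m\<in>M. c m * m)" by blast
  have "(\<Sum>k\<in>M. (c(m := c m + a)) k * k) = (\<Sum>k\<in>M. c k * k + (if k = m then a * m else 0))"
    by (intro sum.cong) (auto simp: algebra_simps)
  also have "\<dots> = x + a * m" using mspan_step.hyps assms(2) by (simp add: sum.distrib c)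
  finally show ?case using c mspan_step.hyps subring_add[OF S]
    by (intro exI[of _ "c(m := c m + a)"]) auto
qed

text \<open>For a subring \<open>S\<close>, these are the multipliers of the module spanned by
  \<open>M\<close> into itself; the determinant argument below makes them integral over
  \<open>S\<close>.\<close>

definition mult_stable :: "'a::comm_ring_1 set \<Rightarrow> 'a set \<Rightarrow> 'a set" where
  "mult_stable S M = {z. \<forall>m\<in>M. z * m \<in> mspan S M}"

lemma mult_stable_mspan:
  assumes S: "is_subring S" and "z \<in> mult_stable S M" "x \<in> mspan S M"
  shows "z * x \<in> mspan S M"
proof -
  have "x * z \<in> mspan S M"
  proof (rule mspan_bind[OF assms(3)])
    fix c m assume "c \<in> S" "m \<in> M"
    then have "c * (z * m) \<in> mspan S M"
      using mspan_scale[OF S, of "z * m" M c] assms(2) by (simp add: mult_stable_def)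
    then show "c * m * z \<in> mspan S M" by (simp add: ac_simps)
  qed
  then show ?thesis by (simp add: mult.commute)
qed

lemma is_subring_mult_stable:
  assumes S: "is_subring S" shows "is_subring (mult_stable S M)"
proof (rule is_subringI)
  show "1 \<in> mult_stable S M"
    using mspan_single[OF subring_one[OF S]] by (auto simp: mult_stable_def)
next
  fix x y assume x: "x \<in> mult_stable S M" and y: "y \<in> mult_stable S M"
  then show "x + y \<in> mult_stable S M" by (auto simp: mult_stable_def distrib_right intro: mspan_add)
  show "x * y \<in> mult_stable S M"
    using mult_stable_mspan[OF S x] y by (auto simp: mult_stable_def mult.assoc)
next
  fix x assume "x \<in> mult_stable S M"
  then show "- x \<in> mult_stable S M" by (auto simp: mult_stable_def intro: mspan_uminus[OF S])
qed

lemma mult_stable_base: "is_subring S \<Longrightarrow> S \<subseteq> mult_stable S M"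
  by (auto simp: mult_stable_def intro: mspan_single)

text \<open>The products \<open>m * y ^ i\<close> with \<open>i < n\<close> span a module stable
  under \<open>y\<close>, because the equation rewrites \<open>y ^ n\<close>. The old multipliers
  still act since they act on the factor \<open>m\<close>.\<close>

lemma integral_adjoin:
  assumes S: "is_subring S" and M: "finite M" and n: "0 < n"
    and c: "\<And>i. i < n \<Longrightarrow> c i \<in> mult_stable S M" and y: "y ^ n + (\<Sum>i<n. c i * y ^ i) = 0"
  defines "M' \<equiv> (\<lambda>(m, i). m * y ^ i) ` (M \<times> {..<n})"
  shows "finite M'" "M \<subseteq> M'" "insert y (mult_stable S M) \<subseteq> mult_stable S M'"
proof -
  show "finite M'" unfolding M'_def using M by simp
  show "M \<subseteq> M'" unfolding M'_def using n by (force intro: rev_image_eqI[of "(m, 0)" for m])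
  have M'I: "m * y ^ i \<in> M'" if "m \<in> M" "i < n" for m i using that by (auto simp: M'_def)
  have shift: "x * y ^ i \<in> mspan S M'" if "x \<in> mspan S M" "i < n" for x i
  proof (rule mspan_bind[OF that(1)])
    show "a * m * y ^ i \<in> mspan S M'" if "a \<in> S" "m \<in> M" for a m
      using mspan_single[OF that(1) M'I[OF that(2) \<open>i < n\<close>]] by (simp add: mult.assoc)
  qed
  have "y * m' \<in> mspan S M'" if "m' \<in> M'" for m'
  proof -
    obtain m i where m: "m \<in> M" "i < n" "m' = m * y ^ i" using \<open>m' \<in> M'\<close> by (auto simp: M'_def)
    show ?thesis
    proof (cases "Suc i < n")
      case True
      then show ?thesis using mspan_single[OF subring_one[OF S] M'I[OF m(1) True]]
        by (simp add: m ac_simps)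
    next
      case False
      then have n': "n = Suc i" using m by simp
      have "y * m' = m * y ^ n" by (simp add: m n' ac_simps)
      also have "\<dots> = (\<Sum>j<n. - (c j * m * y ^ j))"
      proof -
        have "y ^ n = - (\<Sum>i<n. c i * y ^ i)" using y by (simp add: eq_neg_iff_add_eq_0)
        then show ?thesis by (simp add: sum_distrib_left sum_negf ac_simps)
      qed
      also have "\<dots> \<in> mspan S M'"
        using c m by (intro mspan_sum mspan_uminus S shift) (auto simp: mult_stable_def)
      finally show ?thesis .
    qed
  qed
  moreover have "z * m' \<in> mspan S M'" if "z \<in> mult_stable S M" "m' \<in> M'" for z m'
    using that shift by (auto simp: M'_def mult_stable_def mult.assoc[symmetric])
  ultimately show "insert y (mult_stable S M) \<subseteq> mult_stable S M'"
    by (auto simp: mult_stable_def)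
qed

lemma integral_adjoin_finite:
  assumes S: "is_subring S" and T: "finite T" "\<And>t. t \<in> T \<Longrightarrow> integral_elem S t"
  shows "\<exists>M. finite M \<and> 1 \<in> M \<and> T \<subseteq> mult_stable S M"
  using T
proof induction
  case empty
  then show ?case by (intro exI[of _ "{1}"]) auto
next
  case (insert t T)
  then obtain M where M: "finite M" "1 \<in> M" "T \<subseteq> mult_stable S M" by auto
  obtain n c where n: "0 < n" "\<forall>i<n. c i \<in> S" "t ^ n + (\<Sum>i<n. c i * t ^ i) = 0"
    using insert.prems[of t] unfolding integral_elem_def by auto
  have "c i \<in> mult_stable S M" if "i < n" for i using n(2) mult_stable_base[OF S] that by blast
  from integral_adjoin[OF S M(1) n(1) this n(3)] M show ?case by blast
qed

text \<open>The determinant trick: multiplication by \<open>z\<close> on the generators is given by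
  a matrix over \<open>S\<close>, whose characteristic polynomial is monic over \<open>S\<close> and
  vanishes at \<open>z\<close>. The generator \<open>m0\<close> keeps the kernel vector from being
  zero.\<close>

lemma mult_stable_integral:
  fixes S :: "'a::idom set"
  assumes S: "is_subring S" and M: "finite M" "m0 \<in> M" "m0 \<noteq> 0" and z: "z \<in> mult_stable S M"
  shows "integral_elem S z"
proof -
  obtain ms where ms: "set ms = M" "distinct ms" using finite_distinct_list[OF M(1)] by blast
  define n where "n = length ms"
  have "\<exists>c. (\<forall>m\<in>M. c m \<in> S) \<and> z * (ms ! i) = (\<Sum>m\<in>M. c m * m)" if "i < n" for i
    using that z ms by (intro mspan_finite S M) (auto simp: mult_stable_def n_def)
  then obtain c where c: "\<And>i m. i < n \<Longrightarrow> m \<in> M \<Longrightarrow> c i m \<in> S"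
    and zc: "\<And>i. i < n \<Longrightarrow> z * (ms ! i) = (\<Sum>m\<in>M. c i m * m)" by metis
  define A where "A = mat n n (\<lambda>(i, j). c i (ms ! j))"
  have A: "A \<in> carrier_mat n n" by (simp add: A_def)
  \<comment> \<open>\<open>C\<close> is the characteristic matrix of \<open>A\<close> with the
    variable replaced by \<open>z\<close>; it annihilates the vector \<open>w\<close> of
    generators.\<close>
  define C where "C = mat n n (\<lambda>(i, j). (if i = j then z else 0) - c i (ms ! j))"
  have Cc: "C \<in> carrier_mat n n" by (simp add: C_def)
  have cp: "poly (char_poly A) z = det C" unfolding char_poly_def
    by (rule poly_det_cong[OF Cc char_poly_matrix_closed[OF A]])
      (auto simp: char_poly_matrix_def A_def C_def)
  define w where "w = vec n (\<lambda>i. ms ! i)"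
  have sum_ms: "(\<Sum>j\<in>{0..<n}. f (ms ! j)) = (\<Sum>m\<in>M. f m)" for f :: "'a \<Rightarrow> 'a"
    using sum.reindex_bij_betw[OF bij_betw_nth[OF ms(2) refl refl], of f]
    by (simp add: ms n_def atLeast0LessThan)
  have "C *\<^sub>v w = 0\<^sub>v n"
  proof (rule eq_vecI)
    fix i assume "i < dim_vec (0\<^sub>v n :: 'a vec)"
    then have i: "i < n" by simp
    have "(C *\<^sub>v w) $ i = (\<Sum>j\<in>{0..<n}. ((if i = j then z else 0) - c i (ms ! j)) * (ms ! j))"
      using i by (simp add: C_def w_def scalar_prod_def)
    also have "\<dots> = (\<Sum>j\<in>{0..<n}. if i = j then z * ms ! j else 0) - (\<Sum>j\<in>{0..<n}. c i (ms ! j) * ms ! j)"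
      unfolding sum_subtractf[symmetric] by (intro sum.cong) (auto simp: left_diff_distrib)
    also have "\<dots> = 0" using i zc[OF i] sum_ms[of "\<lambda>m. c i m * m"] by simp
    finally show "(C *\<^sub>v w) $ i = 0\<^sub>v n $ i" using i by simp
  qed (use Cc in auto)
  moreover have "w \<noteq> 0\<^sub>v n"
  proof -
    obtain i where "i < n" "ms ! i = m0" using M ms by (auto simp: n_def in_set_conv_nth)
    then show ?thesis using M(3) by (metis index_vec index_zero_vec(1) w_def)
  qed
  moreover have "w \<in> carrier_vec n" by (simp add: w_def)
  ultimately have "det C = 0" using det_0_iff_vec_prod_zero[OF Cc] by blast
  then have root: "poly (char_poly A) z = 0" using cp by simp
  let ?p = "char_poly A"
  have deg: "Polynomial.degree ?p = n" "Polynomial.coeff ?p n = 1"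
    using degree_monic_char_poly[OF A] by auto
  have P: "is_subring {p. \<forall>i. Polynomial.coeff p i \<in> S}"
    by (rule is_subringI) (auto simp: coeff_mult coeff_1 intro!: subring_sum subring_closed[OF S] S)
  have "?p \<in> {p. \<forall>i. Polynomial.coeff p i \<in> S}"
  proof -
    have e: "char_poly_matrix A $$ (i, j) \<in> {p. \<forall>i. Polynomial.coeff p i \<in> S}" if "i < n" "j < n" for i j
      using that c ms subring_closed[OF S]
      by (auto simp: char_poly_matrix_def A_def n_def coeff_pCons split: nat.split)
    show ?thesis unfolding char_poly_def det_def'[OF char_poly_matrix_closed[OF A]]
    proof (intro subring_sum[OF P] subring_mult[OF P] subring_prod[OF P])
      fix p i assume "p \<in> {p. p permutes {0..<n}}" "i \<in> {0..<n}"
      then show "char_poly_matrix A $$ (i, p i) \<in> {p. \<forall>i. Polynomial.coeff p i \<in> S}"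
        by (intro e) (auto simp: permutes_in_image)
    qed (auto simp: sign_def coeff_1 intro: subring_closed[OF S])
  qed
  moreover have "z ^ n + (\<Sum>i<n. Polynomial.coeff ?p i * z ^ i) = 0"
    using root unfolding poly_altdef deg(1) by (simp add: lessThan_Suc_atMost[symmetric] deg(2) add.commute)
  moreover have "0 < n" using M ms by (auto simp: n_def)
  ultimately show ?thesis unfolding integral_elem_def by blast
qed

lemma integral_elem_base: "is_subring S \<Longrightarrow> s \<in> S \<Longrightarrow> integral_elem S s"
  unfolding integral_elem_def
  by (intro exI[of _ 1] exI[of _ "\<lambda>_. - s"]) (auto intro: subring_uminus)

lemma integral_elem_mono: "integral_elem S x \<Longrightarrow> S \<subseteq> T \<Longrightarrow> integral_elem T x"
  unfolding integral_elem_def by blast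

lemma is_subring_integral:
  fixes S :: "'a::idom set"
  assumes S: "is_subring S" shows "is_subring {x. integral_elem S x}"
proof -
  have "integral_elem S (x - y) \<and> integral_elem S (x * y)" if xy: "integral_elem S x" "integral_elem S y" for x y
  proof -
    obtain M where M: "finite M" "1 \<in> M" "{x, y} \<subseteq> mult_stable S M"
      using integral_adjoin_finite[OF S, of "{x, y}"] xy by auto
    then show ?thesis
      using subring_diff[OF is_subring_mult_stable[OF S]] subring_mult[OF is_subring_mult_stable[OF S]]
      by (auto intro!: mult_stable_integral[OF S M(1,2)])
  qed
  then show ?thesis using integral_elem_base[OF S subring_one[OF S]] by (auto simp: is_subring_def)
qed

text \<open>The finitely many coefficients of the equation of \<open>x\<close> act on a common
  finite module over \<open>S\<close>, which is then enlarged by powers of \<open>x\<close>. For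
  this reason \<open>integral_adjoin\<close> takes its coefficients in
  \<open>mult_stable S M\<close>.\<close>

lemma integral_elem_trans:
  fixes S :: "'a::idom set"
  assumes S: "is_subring S" and "\<And>t. t \<in> T \<Longrightarrow> integral_elem S t" and "integral_elem T x"
  shows "integral_elem S x"
proof -
  obtain n c where n: "0 < n" "\<forall>i<n. c i \<in> T" "x ^ n + (\<Sum>i<n. c i * x ^ i) = 0"
    using assms(3) unfolding integral_elem_def by auto
  obtain M where M: "finite M" "1 \<in> M" "c ` {..<n} \<subseteq> mult_stable S M"
    using integral_adjoin_finite[OF S, of "c ` {..<n}"] assms(2) n(2) by auto
  have "c i \<in> mult_stable S M" if "i < n" for i using M(3) that by auto
  note adj = integral_adjoin[OF S M(1) n(1) this n(3)]
  show ?thesis by (rule mult_stable_integral[OF S adj(1), of 1]) (use adj M in auto)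
qed

section \<open>Homomorphisms and polynomial evaluation\<close>

definition rhom :: "('a::comm_ring_1 \<Rightarrow> 'b::comm_ring_1) \<Rightarrow> bool" where
  "rhom h \<longleftrightarrow> (\<forall>x y. h (x + y) = h x + h y) \<and> (\<forall>x y. h (x * y) = h x * h y) \<and> h 1 = 1"

lemma rhomI:
  "(\<And>x y. h (x + y) = h x + h y) \<Longrightarrow> (\<And>x y. h (x * y) = h x * h y) \<Longrightarrow> h 1 = 1 \<Longrightarrow> rhom h"
  by (simp add: rhom_def)

lemma rhom_simps:
  assumes "rhom h"
  shows rhom_add: "h (x + y) = h x + h y" and rhom_mult: "h (x * y) = h x * h y"
    and rhom_one: "h 1 = 1" and rhom_zero: "h 0 = 0" and rhom_uminus: "h (- x) = - h x"
    and rhom_diff: "h (x - y) = h x - h y" and rhom_power: "h (x ^ n) = h x ^ n"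
proof -
  show a: "h (x + y) = h x + h y" and m: "h (x * y) = h x * h y" and o: "h 1 = 1" for x y
    using assms by (simp_all add: rhom_def)
  show z: "h 0 = 0" using a[of 0 0] by (simp only: add_0 add_cancel_right_right)
  show u: "h (- x) = - h x" for x using a[of x "- x"] by (simp add: z eq_neg_iff_add_eq_0 add.commute)
  show "h (x - y) = h x - h y" using a[of x "- y"] by (simp add: u)
  show "h (x ^ n) = h x ^ n" by (induction n) (simp_all add: o m)
qed

lemma rhom_sum: "rhom h \<Longrightarrow> h (sum f A) = (\<Sum>i\<in>A. h (f i))"
  by (induction A rule: infinite_finite_induct) (simp_all add: rhom_simps)

lemma rhom_prod: "rhom h \<Longrightarrow> h (prod f A) = (\<Prod>i\<in>A. h (f i))"
  by (induction A rule: infinite_finite_induct) (simp_all add: rhom_simps)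

lemma rhom_comp: "rhom g \<Longrightarrow> rhom h \<Longrightarrow> rhom (\<lambda>x. g (h x))"
  by (simp add: rhom_def)

lemma rhom_range: "rhom h \<Longrightarrow> is_subring (range h)"
  unfolding is_subring_def
  by (auto simp flip: rhom_diff rhom_mult intro: rev_image_eqI[of 1] simp: rhom_one)

definition ev :: "('a::comm_ring_1 \<Rightarrow> 'b::comm_ring_1) \<Rightarrow> 'b \<Rightarrow> 'a poly \<Rightarrow> 'b" where
  "ev c x p = poly (map_poly c p) x"

lemma rhom_ev: assumes "rhom c" shows "rhom (ev c x)"
proof -
  interpret comm_ring_hom c
    by unfold_locales (use assms in \<open>simp_all add: rhom_simps\<close>)
  interpret m: map_poly_comm_ring_hom c ..
  show ?thesis by (rule rhomI) (simp_all add: ev_def m.hom_add m.hom_mult)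
qed

lemma ev_pCons: "rhom c \<Longrightarrow> ev c x (pCons a p) = c a + x * ev c x p"
  by (cases "pCons a p = 0") (simp_all add: ev_def map_poly_pCons rhom_zero)

lemma ev_const: "rhom c \<Longrightarrow> ev c x [:a:] = c a"
  by (simp add: ev_pCons rhom_zero[OF rhom_ev])

lemma ev_X: "rhom c \<Longrightarrow> ev c x [:0, 1:] = x"
  by (simp add: ev_pCons rhom_zero[OF rhom_ev] rhom_zero rhom_one)

lemma ev_monom: "rhom c \<Longrightarrow> ev c x (Polynomial.monom a n) = c a * x ^ n"
  by (induction n) (simp_all add: monom_0 monom_Suc ev_pCons ev_const rhom_zero ac_simps rhom_zero[OF rhom_ev])

lemma ev_altdef: "rhom c \<Longrightarrow> ev c x p = (\<Sum>i\<le>Polynomial.degree p. c (Polynomial.coeff p i) * x ^ i)"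
  by (subst (1) poly_as_sum_of_monoms[symmetric])
    (simp add: rhom_sum[OF rhom_ev] ev_monom)

lemma ev_unique: "rhom h \<Longrightarrow> h p = ev (\<lambda>a. h [:a:]) (h [:0, 1:]) p"
proof (induction p)
  case 0
  then show ?case by (simp add: ev_def rhom_zero)
next
  case (pCons a p)
  have r: "rhom (\<lambda>a. h [:a:])"
    by (rule rhom_comp[OF pCons.prems]) (simp add: rhom_def one_pCons)
  have "pCons a p = [:a:] + [:0, 1:] * p" by simp
  then have "h (pCons a p) = h [:a:] + h [:0, 1:] * h p"
    by (metis pCons.prems rhom_add rhom_mult)
  then show ?case using pCons.IH[OF pCons.prems] by (simp add: ev_pCons[OF r])
qed

lemma eval2_ev: "eval2 c x y = ev (ev c x) y"
proof
  have "(\<lambda>q. poly (map_poly c q) x) = ev c x" by (simp add: fun_eq_iff ev_def)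
  then show "eval2 c x y p = ev (ev c x) y p" for p by (simp add: eval2_def ev_def[of "ev c x"])
qed

lemma eval3_ev: "eval3 c x y z = ev (ev (ev c x) y) z"
  by (simp add: fun_eq_iff eval3_def ev_def[of "ev (ev c x) y"] eval2_ev)

lemma rhom_eval2: "rhom c \<Longrightarrow> rhom (eval2 c x y)"
  by (simp add: eval2_ev rhom_ev)

lemma rhom_eval3: "rhom c \<Longrightarrow> rhom (eval3 c x y z)"
  by (simp add: eval3_ev rhom_ev)

lemma eval2_simps:
  assumes "rhom c"
  shows "eval2 c x y (const2 a) = c a" "eval2 c x y X2 = x" "eval2 c x y Y2 = y"
  using rhom_ev[OF assms, of x] assms
  by (simp_all add: eval2_ev const2_def X2_def Y2_def ev_const ev_X)

lemma eval3_simps: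
  assumes "rhom c"
  shows "eval3 c x y z (const3 a) = c a" "eval3 c x y z X3 = x"
    "eval3 c x y z Y3 = y" "eval3 c x y z Z3 = z"
  using rhom_ev[OF assms, of x] rhom_ev[OF rhom_ev[OF assms, of x], of y] assms
  by (simp_all add: eval3_ev const3_def X3_def Y3_def Z3_def ev_const ev_X)

lemma rhom_const2: "rhom (const2 :: 'a::comm_ring_1 \<Rightarrow> _)"
  by (simp add: rhom_def const2_def one_pCons)

lemma rhom_const3: "rhom (const3 :: 'a::comm_ring_1 \<Rightarrow> _)"
  by (simp add: rhom_def const3_def one_pCons)

lemma eval2_unique:
  assumes "rhom h" shows "h p = eval2 (\<lambda>a. h (const2 a)) (h X2) (h Y2) p"
proof -
  have "rhom (\<lambda>a. h [:a:])" by (rule rhom_comp[OF assms]) (simp add: rhom_def one_pCons)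
  from ev_unique[OF this] have e: "(\<lambda>a. h [:a:]) = ev (\<lambda>a. h (const2 a)) (h X2)"
    unfolding const2_def X2_def by (rule ext)
  show ?thesis using ev_unique[OF assms, of p] unfolding e eval2_ev Y2_def .
qed

text \<open>The universal property of polynomials in three variables. Applied to the identity it
  yields the expansion into monomials.\<close>

lemma eval3_unique:
  assumes "rhom h" shows "h p = eval3 (\<lambda>a. h (const3 a)) (h X3) (h Y3) (h Z3) p"
proof -
  have r: "rhom (\<lambda>a. h [:a:])" by (rule rhom_comp[OF assms]) (simp add: rhom_def one_pCons)
  from eval2_unique[OF r] have e: "(\<lambda>a. h [:a:]) = ev (ev (\<lambda>a. h (const3 a)) (h X3)) (h Y3)"
    unfolding const3_def const2_def X3_def Y3_def X2_def Y2_def eval2_ev by (rule ext)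
  show ?thesis using ev_unique[OF assms, of p] unfolding e eval3_ev Z3_def .
qed

lemma eval2_altdef:
  assumes c: "rhom c"
  shows "eval2 c x y p = (\<Sum>j\<le>Polynomial.degree p. \<Sum>i\<le>Polynomial.degree (Polynomial.coeff p j).
    c (Polynomial.coeff (Polynomial.coeff p j) i) * x ^ i * y ^ j)"
  by (simp add: eval2_ev ev_altdef[OF rhom_ev[OF c]] ev_altdef[OF c] sum_distrib_right)

lemma eval3_altdef:
  assumes c: "rhom c"
  shows "eval3 c x y z p = (\<Sum>l\<le>Polynomial.degree p.
    \<Sum>j\<le>Polynomial.degree (Polynomial.coeff p l).
    \<Sum>i\<le>Polynomial.degree (Polynomial.coeff (Polynomial.coeff p l) j).
    c (Polynomial.coeff (Polynomial.coeff (Polynomial.coeff p l) j) i) * x ^ i * y ^ j * z ^ l)"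
  by (simp add: eval3_ev ev_altdef[OF rhom_ev[OF rhom_ev[OF c]]] ev_altdef[OF rhom_ev[OF c]]
      ev_altdef[OF c] sum_distrib_right)

lemma rhom_id: "rhom (\<lambda>x. x)" by (simp add: rhom_def)

lemma poly2_expand:
  fixes p :: "'a::comm_ring_1 poly poly"
  shows "p = (\<Sum>j\<le>Polynomial.degree p. \<Sum>i\<le>Polynomial.degree (Polynomial.coeff p j).
    const2 (Polynomial.coeff (Polynomial.coeff p j) i) * X2 ^ i * Y2 ^ j)"
  using eval2_unique[OF rhom_id, of p] eval2_altdef[OF rhom_const2, of X2 Y2 p] by simp

lemma poly3_expand:
  fixes p :: "'a::comm_ring_1 poly poly poly"
  shows "p = (\<Sum>l\<le>Polynomial.degree p.
    \<Sum>j\<le>Polynomial.degree (Polynomial.coeff p l).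
    \<Sum>i\<le>Polynomial.degree (Polynomial.coeff (Polynomial.coeff p l) j).
    const3 (Polynomial.coeff (Polynomial.coeff (Polynomial.coeff p l) j) i) * X3 ^ i * Y3 ^ j * Z3 ^ l)"
  using eval3_unique[OF rhom_id, of p] eval3_altdef[OF rhom_const3, of X3 Y3 Z3 p] by simp

lemma monom3_eq: "const3 a * X3 ^ i * Y3 ^ j * Z3 ^ l
    = Polynomial.monom (Polynomial.monom (Polynomial.monom a i) j) l"
proof -
  have 1: "[:0, 1:] ^ n = Polynomial.monom 1 n" for n :: nat
    by (induction n) (simp_all add: monom_Suc monom_0 one_pCons)
  have 2: "[:q:] ^ n = [:q ^ n:]" for q :: "'b::comm_ring_1" and n
    by (induction n) (simp_all add: one_pCons)
  have "(X3 :: 'a poly poly poly) ^ i = [:[:Polynomial.monom 1 i:]:]"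
    "(Y3 :: 'a poly poly poly) ^ j = [:Polynomial.monom 1 j:]"
    "(Z3 :: 'a poly poly poly) ^ l = Polynomial.monom 1 l"
    by (simp_all add: X3_def Y3_def Z3_def 1 2)
  then show ?thesis by (simp add: const3_def smult_monom)
qed

section \<open>Weighted gradings\<close>

definition hom_polys :: "nat \<Rightarrow> nat \<Rightarrow> int \<Rightarrow> 'a::comm_ring_1 poly poly poly set" where
  "hom_polys dp dm n = {p. \<forall>i j l.
     Polynomial.coeff (Polynomial.coeff (Polynomial.coeff p l) j) i \<noteq> 0 \<longrightarrow>
       - int i + int dp * int j - int dm * int l = n}"

lemma weighted_part_eq: "weighted_part S dp dm n = rel_class S ` hom_polys dp dm n"
  by (simp add: weighted_part_def hom_polys_def)

lemma hom_polys_zero: "0 \<in> hom_polys dp dm n"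
  by (simp add: hom_polys_def)

lemma hom_polys_add: "p \<in> hom_polys dp dm n \<Longrightarrow> q \<in> hom_polys dp dm n \<Longrightarrow> p + q \<in> hom_polys dp dm n"
  unfolding hom_polys_def by clarsimp (metis add.right_neutral)

lemma hom_polys_uminus: "p \<in> hom_polys dp dm n \<Longrightarrow> - p \<in> hom_polys dp dm n"
  by (simp add: hom_polys_def)

lemma hom_polys_sum: "(\<And>i. i \<in> A \<Longrightarrow> f i \<in> hom_polys dp dm n) \<Longrightarrow> sum f A \<in> hom_polys dp dm n"
  by (induction A rule: infinite_finite_induct) (auto intro: hom_polys_zero hom_polys_add)

lemma hom_polys_monom:
  "- int i + int dp * int j - int dm * int l = n \<Longrightarrow> const3 a * X3 ^ i * Y3 ^ j * Z3 ^ l \<in> hom_polys dp dm n"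
  unfolding monom3_eq hom_polys_def by (auto split: if_splits)

lemma hom_polys_induct [consumes 1, case_names zero add monom]:
  assumes p: "p \<in> hom_polys dp dm n" and 0: "P 0" and add: "\<And>p q. P p \<Longrightarrow> P q \<Longrightarrow> P (p + q)"
    and mon: "\<And>a i j l. - int i + int dp * int j - int dm * int l = n \<Longrightarrow>
      P (const3 a * X3 ^ i * Y3 ^ j * Z3 ^ l)"
  shows "P p"
proof -
  have sum: "P (sum f A)" if "\<And>i. i \<in> A \<Longrightarrow> P (f i)" for f and A :: "nat set"
    using that by (induction A rule: infinite_finite_induct) (auto intro: 0 add)
  have "P (const3 (Polynomial.coeff (Polynomial.coeff (Polynomial.coeff p l) j) i) * X3 ^ i * Y3 ^ j * Z3 ^ l)" for i j l
  proof (cases "Polynomial.coeff (Polynomial.coeff (Polynomial.coeff p l) j) i = 0")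
    case True
    then show ?thesis using 0 by (simp add: rhom_zero[OF rhom_const3])
  next
    case False
    then show ?thesis using p by (intro mon) (auto simp: hom_polys_def)
  qed
  then show ?thesis by (subst poly3_expand) (intro sum)
qed

lemma single_power: "Poly_Mapping.single (k::int) a ^ n = Poly_Mapping.single (int n * k) (a ^ n)"
  by (induction n) (simp_all add: mult_single algebra_simps)

lemma lookup_single_times:
  "Poly_Mapping.lookup (Poly_Mapping.single k c * f) (n::int) = c * Poly_Mapping.lookup f (n - k)"
proof -
  have "(k + q = n) = (q = n - k)" for q by auto
  then show ?thesis
    by (simp add: lookup_mult lookup_single when_mult eq_commute[of n])
qed

text \<open>Homogeneous arguments of the prescribed weights send every monomial of degree
  \<open>n\<close> to degree \<open>n\<close>, so only the evaluation of the coefficients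
  remains.\<close>

lemma eval3_single:
  assumes "p \<in> hom_polys dp dm n" and "rhom c"
  shows "eval3 (\<lambda>a. Poly_Mapping.single 0 (c a)) (Poly_Mapping.single (- 1) x)
    (Poly_Mapping.single (int dp) y) (Poly_Mapping.single (- int dm) z) p
    = Poly_Mapping.single n (eval3 c x y z p)"
proof -
  have r: "rhom (\<lambda>a. Poly_Mapping.single (0::int) (c a))"
    using assms(2) by (simp add: rhom_def single_add mult_single)
  note e = rhom_eval3[OF r] rhom_eval3[OF assms(2)]
  show ?thesis using assms(1)
  proof (induction rule: hom_polys_induct)
    case zero
    then show ?case by (simp add: rhom_zero[OF e(1)] rhom_zero[OF e(2)])
  next
    case (add p q)
    then show ?case by (simp add: rhom_add[OF e(1)] rhom_add[OF e(2)] single_add)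
  next
    case (monom a i j l)
    then show ?case
      by (simp add: rhom_mult[OF e(1)] rhom_mult[OF e(2)] rhom_power[OF e(1)] rhom_power[OF e(2)]
          eval3_simps[OF r] eval3_simps[OF assms(2)] single_power mult_single algebra_simps)
  qed
qed

context
  fixes dp dm :: nat
begin

text \<open>The coaction of the grading: the coefficient of \<open>grade_map p\<close> at
  \<open>n\<close> is the component of \<open>p\<close> of degree \<open>n\<close>. As it is a ring
  homomorphism, products of components need no comparison of coefficients.\<close>

definition grade_map :: "'a::comm_ring_1 poly poly poly \<Rightarrow> int \<Rightarrow>\<^sub>0 'a poly poly poly" where
  "grade_map = eval3 (\<lambda>a. Poly_Mapping.single 0 (const3 a)) (Poly_Mapping.single (- 1) X3)
    (Poly_Mapping.single (int dp) Y3) (Poly_Mapping.single (- int dm) Z3)"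

abbreviation "hpart n p \<equiv> Poly_Mapping.lookup (grade_map p) n"

lemma rhom_single_const: "rhom (\<lambda>a. Poly_Mapping.single (0::int) (const3 a))"
  by (rule rhomI) (simp_all add: rhom_simps[OF rhom_const3] single_add mult_single)

lemma rhom_grade_map: "rhom grade_map"
  unfolding grade_map_def by (rule rhom_eval3[OF rhom_single_const])

lemma grade_map_hom: "p \<in> hom_polys dp dm n \<Longrightarrow> grade_map p = Poly_Mapping.single n p"
  unfolding grade_map_def
  by (subst eval3_single[OF _ rhom_const3]) (simp_all flip: eval3_unique[OF rhom_id])

lemma grade_map_expand:
  "grade_map p = (\<Sum>l\<le>Polynomial.degree p.
    \<Sum>j\<le>Polynomial.degree (Polynomial.coeff p l).
    \<Sum>i\<le>Polynomial.degree (Polynomial.coeff (Polynomial.coeff p l) j).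
    Poly_Mapping.single (- int i + int dp * int j - int dm * int l)
     (const3 (Polynomial.coeff (Polynomial.coeff (Polynomial.coeff p l) j) i) * X3 ^ i * Y3 ^ j * Z3 ^ l))"
  unfolding grade_map_def eval3_altdef[OF rhom_single_const]
  by (simp add: single_power mult_single algebra_simps)

lemma hpart_in: "hpart n p \<in> hom_polys dp dm n"
  unfolding grade_map_expand lookup_sum lookup_single
  by (intro hom_polys_sum) (auto simp: when_def hom_polys_monom hom_polys_zero)

lemma hom_polys_mult:
  fixes p q :: "'a::comm_ring_1 poly poly poly"
  assumes "p \<in> hom_polys dp dm m" "q \<in> hom_polys dp dm n" shows "p * q \<in> hom_polys dp dm (m + n)"
proof -
  have "grade_map (p * q) = Poly_Mapping.single (m + n) (p * q)"
    by (simp add: rhom_mult[OF rhom_grade_map] grade_map_hom[OF assms(1)] grade_map_hom[OF assms(2)] mult_single)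
  then show ?thesis using hpart_in[of "p * q" "m + n"] by simp
qed

lemma hom_polys_power:
  fixes p :: "'a::comm_ring_1 poly poly poly"
  assumes "p \<in> hom_polys dp dm m" shows "p ^ k \<in> hom_polys dp dm (int k * m)"
proof (induction k)
  case 0
  show ?case using hom_polys_monom[of 0 dp 0 dm 0 0 1] by (simp add: const3_def one_pCons)
next
  case (Suc k)
  then show ?case using hom_polys_mult[OF assms Suc] by (simp add: algebra_simps)
qed

text \<open>Setting the degree variable to 1, which recovers a polynomial from its
  components.\<close>

definition coeff_sum :: "(int \<Rightarrow>\<^sub>0 'b::comm_monoid_add) \<Rightarrow> 'b" where
  "coeff_sum f = (\<Sum>k\<in>Poly_Mapping.keys f. Poly_Mapping.lookup f k)"

lemma coeff_sum_superset: "finite K \<Longrightarrow> Poly_Mapping.keys f \<subseteq> K \<Longrightarrow> coeff_sum f = (\<Sum>k\<in>K. Poly_Mapping.lookup f k)"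
  unfolding coeff_sum_def by (rule sum.mono_neutral_left) (auto simp: in_keys_iff)

lemma coeff_sum_add: "coeff_sum (f + g) = coeff_sum f + coeff_sum g"
proof -
  let ?K = "Poly_Mapping.keys f \<union> Poly_Mapping.keys g"
  have "coeff_sum (f + g) = (\<Sum>k\<in>?K. Poly_Mapping.lookup (f + g) k)"
    by (rule coeff_sum_superset) (auto simp: keys_add)
  then show ?thesis
    by (simp add: lookup_add sum.distrib coeff_sum_superset[of ?K f] coeff_sum_superset[of ?K g])
qed

lemma coeff_sum_single: "coeff_sum (Poly_Mapping.single k a) = a"
  by (simp add: coeff_sum_def)

lemma coeff_sum_sum: "coeff_sum (sum f A) = (\<Sum>i\<in>A. coeff_sum (f i))"
  by (induction A rule: infinite_finite_induct) (simp_all add: coeff_sum_add coeff_sum_def[of 0])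

lemma sum_hpart: "finite K \<Longrightarrow> Poly_Mapping.keys (grade_map p) \<subseteq> K \<Longrightarrow> (\<Sum>n\<in>K. hpart n p) = p"
  unfolding coeff_sum_superset[symmetric]
  by (subst grade_map_expand) (simp add: coeff_sum_sum coeff_sum_single flip: poly3_expand)

text \<open>The polynomials all of whose components lie in the ideal form an ideal containing the
  homogeneous generators. Closedness under multiplication need only be checked for monomials, which
  merely shift degrees.\<close>

lemma hpart_gen_ideal:
  fixes S :: "'a::comm_ring_1 poly poly poly set"
  assumes S: "\<And>s. s \<in> S \<Longrightarrow> \<exists>d. s \<in> hom_polys dp dm d" and p: "p \<in> gen_ideal S"
  shows "hpart n p \<in> gen_ideal S"
proof -
  note I = is_ideal_closed[OF is_ideal_gen[of S]]
  define J where "J = {p. \<forall>n. hpart n p \<in> gen_ideal S}"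
  have add: "p + q \<in> J" if "p \<in> J" "q \<in> J" for p q
    using that by (auto simp: J_def rhom_add[OF rhom_grade_map] lookup_add intro: I)
  have 0: "0 \<in> J" by (auto simp: J_def rhom_zero[OF rhom_grade_map] intro: I)
  have mon: "const3 a * X3 ^ i * Y3 ^ j * Z3 ^ l * p \<in> J" if "p \<in> J" for a i j l p
  proof -
    have "grade_map (const3 a * X3 ^ i * Y3 ^ j * Z3 ^ l * p)
        = Poly_Mapping.single (- int i + int dp * int j - int dm * int l) (const3 a * X3 ^ i * Y3 ^ j * Z3 ^ l) * grade_map p"
      unfolding rhom_mult[OF rhom_grade_map, of _ p] by (subst grade_map_hom) (rule hom_polys_monom, auto)
    then show ?thesis using that by (auto simp: J_def lookup_single_times intro: I)
  qed
  have sum: "sum f A \<in> J" if "\<And>i. i \<in> A \<Longrightarrow> f i \<in> J" for f and A :: "nat set"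
    using that by (induction A rule: infinite_finite_induct) (auto intro: 0 add)
  have mult: "a * p \<in> J" if "p \<in> J" for a p
    by (subst poly3_expand[of a]) (auto simp: sum_distrib_right intro!: sum mon that)
  have "is_ideal J" unfolding is_ideal_def using add 0 mult by blast
  moreover have "S \<subseteq> J"
  proof
    fix s assume s: "s \<in> S"
    then obtain d where "s \<in> hom_polys dp dm d" using S by blast
    then show "s \<in> J"
      using s I(1) by (auto simp: J_def grade_map_hom lookup_single when_def gen_ideal_self)
  qed
  ultimately show ?thesis using gen_ideal_minimal[of J S] p by (auto simp: J_def)
qed

lemma finsum_rel_quotient:
  fixes q :: "int \<Rightarrow> 'b::comm_ring_1"
  shows "finite F \<Longrightarrow> finsum (rel_quotient S) (\<lambda>n. rel_class S (q n)) F = rel_class S (\<Sum>n\<in>F. q n)"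
proof (induction F rule: finite_induct)
  interpret B: cring "rel_quotient S" by (rule cring_rel_quotient)
  case empty
  show ?case by (simp add: rel_quotient_simps)
next
  interpret B: cring "rel_quotient S" by (rule cring_rel_quotient)
  case (insert n F)
  then show ?case by (subst B.finsum_insert) (auto simp: rel_quotient_simps)
qed

text \<open>Components of a representative give existence. For uniqueness, two decompositions lift
  to polynomials that differ by an element of the ideal, and this ideal contains the components of
  its elements.\<close>

lemma is_grading_weighted_part:
  fixes S :: "'a::comm_ring_1 poly poly poly set"
  assumes S: "\<And>s. s \<in> S \<Longrightarrow> \<exists>d. s \<in> hom_polys dp dm d"
  shows "is_grading (rel_quotient S) (weighted_part S dp dm)"
  unfolding is_grading_def weighted_part_eq
proof (intro conjI allI ballI)
  let ?B = "rel_quotient S"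
  interpret B: cring ?B by (rule cring_rel_quotient)
  fix n m
  show "additive_subgroup (rel_class S ` hom_polys dp dm n) ?B"
  proof (rule additive_subgroupI, rule B.add.subgroupI)
    show "rel_class S ` hom_polys dp dm n \<subseteq> carrier ?B" "rel_class S ` hom_polys dp dm n \<noteq> {}"
      using hom_polys_zero by (auto simp: rel_quotient_simps)
    fix a b assume a: "a \<in> rel_class S ` hom_polys dp dm n"
    then obtain p where p: "a = rel_class S p" "p \<in> hom_polys dp dm n" by blast
    have "\<ominus>\<^bsub>?B\<^esub> a = rel_class S (- p)"
      unfolding p by (rule B.minus_equality) (auto simp: rel_quotient_simps)
    then show "\<ominus>\<^bsub>?B\<^esub> a \<in> rel_class S ` hom_polys dp dm n" using p hom_polys_uminus by blast
    assume "b \<in> rel_class S ` hom_polys dp dm n"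
    then show "a \<oplus>\<^bsub>?B\<^esub> b \<in> rel_class S ` hom_polys dp dm n"
      using p hom_polys_add by (auto simp: rel_quotient_simps intro!: imageI)
  qed
  fix x y assume "x \<in> rel_class S ` hom_polys dp dm m" "y \<in> rel_class S ` hom_polys dp dm n"
  then show "x \<otimes>\<^bsub>?B\<^esub> y \<in> rel_class S ` hom_polys dp dm (m + n)"
    using hom_polys_mult by (auto simp: rel_quotient_simps intro!: imageI)
next
  let ?B = "rel_quotient S"
  interpret B: cring ?B by (rule cring_rel_quotient)
  fix x assume "x \<in> carrier ?B"
  then obtain p where p: "x = rel_class S p" by (auto simp: rel_quotient_simps)
  let ?G = "\<lambda>n. rel_class S ` hom_polys dp dm n"
  have decomp: "finsum ?B (\<lambda>n. rel_class S (q n)) {n. rel_class S (q n) \<noteq> \<zero>\<^bsub>?B\<^esub>} = rel_class S (\<Sum>n\<in>K. q n)"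
    if "finite K" "{n. rel_class S (q n) \<noteq> \<zero>\<^bsub>?B\<^esub>} \<subseteq> K" for K and q :: "int \<Rightarrow> 'a poly poly poly"
  proof -
    have "finsum ?B (\<lambda>n. rel_class S (q n)) {n. rel_class S (q n) \<noteq> \<zero>\<^bsub>?B\<^esub>} = finsum ?B (\<lambda>n. rel_class S (q n)) K"
      by (rule B.add.finprod_mono_neutral_cong_left) (use that in \<open>auto simp: rel_quotient_simps\<close>)
    then show ?thesis using finsum_rel_quotient[OF that(1)] by simp
  qed
  show "\<exists>!f. (\<forall>n. f n \<in> ?G n) \<and> finite {n. f n \<noteq> \<zero>\<^bsub>?B\<^esub>} \<and>
        x = (\<Oplus>\<^bsub>?B\<^esub>n\<in>{n. f n \<noteq> \<zero>\<^bsub>?B\<^esub>}. f n)"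
  proof (rule ex1I[of _ "\<lambda>n. rel_class S (hpart n p)"], intro conjI allI)
    let ?K = "Poly_Mapping.keys (grade_map p)"
    show "rel_class S (hpart n p) \<in> ?G n" for n using hpart_in by blast
    have sub: "{n. rel_class S (hpart n p) \<noteq> \<zero>\<^bsub>?B\<^esub>} \<subseteq> ?K"
      by (auto simp: rel_quotient_simps in_keys_iff)
    then show "finite {n. rel_class S (hpart n p) \<noteq> \<zero>\<^bsub>?B\<^esub>}" by (rule finite_subset) simp
    show "x = finsum ?B (\<lambda>n. rel_class S (hpart n p)) {n. rel_class S (hpart n p) \<noteq> \<zero>\<^bsub>?B\<^esub>}"
      unfolding decomp[OF finite_keys sub] p by (subst sum_hpart) auto
  next
    fix f assume f: "(\<forall>n. f n \<in> ?G n) \<and> finite {n. f n \<noteq> \<zero>\<^bsub>?B\<^esub>} \<and>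
        x = (\<Oplus>\<^bsub>?B\<^esub>n\<in>{n. f n \<noteq> \<zero>\<^bsub>?B\<^esub>}. f n)"
    then have "\<forall>n. \<exists>q. f n = rel_class S q \<and> q \<in> hom_polys dp dm n" by blast
    then obtain q where q: "\<And>n. f n = rel_class S (q n)" "\<And>n. q n \<in> hom_polys dp dm n" by metis
    let ?F = "{n. f n \<noteq> \<zero>\<^bsub>?B\<^esub>}"
    have F: "finite ?F" using f by blast
    have "x = rel_class S (\<Sum>n\<in>?F. q n)"
      using f decomp[of ?F q] F unfolding q(1) by simp
    then have d: "p - (\<Sum>n\<in>?F. q n) \<in> gen_ideal S" using p rel_class_eq_iff by blast
    have "f k = rel_class S (hpart k p)" for k
    proof -
      have "hpart k (p - (\<Sum>n\<in>?F. q n)) = hpart k p - (\<Sum>n\<in>?F. q n when n = k)"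
        by (simp add: rhom_diff[OF rhom_grade_map] rhom_sum[OF rhom_grade_map] lookup_minus lookup_sum
            grade_map_hom[OF q(2)] lookup_single)
      also have "(\<Sum>n\<in>?F. q n when n = k) = (if k \<in> ?F then q k else 0)"
        using F by (simp add: when_def)
      finally have "hpart k p - (if k \<in> ?F then q k else 0) \<in> gen_ideal S"
        using hpart_gen_ideal[OF S d, of k] by simp
      then have "rel_class S (hpart k p) = rel_class S (if k \<in> ?F then q k else 0)"
        using rel_class_eq_iff by blast
      then show ?thesis using q(1)[of k] by (auto simp: rel_quotient_simps split: if_splits)
    qed
    then show "f = (\<lambda>n. rel_class S (hpart n p))" by blast
  qed
qed

end

section \<open>Algebras of sections\<close>

lemma poly_mapping_expand:
  "f = (\<Sum>k\<in>Poly_Mapping.keys f. Poly_Mapping.single k (Poly_Mapping.lookup f k))"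
  by (rule poly_mapping_eqI) (auto simp: lookup_sum lookup_single when_def in_keys_iff)

lemma lookup_times:
  fixes f g :: "int \<Rightarrow>\<^sub>0 'b::comm_ring_1"
  shows "Poly_Mapping.lookup (f * g) n = (\<Sum>k\<in>Poly_Mapping.keys f. Poly_Mapping.lookup f k * Poly_Mapping.lookup g (n - k))"
  by (subst poly_mapping_expand[of f]) (simp add: sum_distrib_right lookup_sum lookup_single_times)

text \<open>The coefficient \<open>x\<close> may be 0; this makes the notion stable under products
  over any commutative ring.\<close>

definition top_term :: "(int \<Rightarrow>\<^sub>0 'b::zero) \<Rightarrow> int \<Rightarrow> 'b \<Rightarrow> bool" where
  "top_term f n x \<longleftrightarrow> Poly_Mapping.lookup f n = x \<and> (\<forall>k>n. Poly_Mapping.lookup f k = 0)"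

lemma top_term_mult:
  fixes f g :: "int \<Rightarrow>\<^sub>0 'b::comm_ring_1"
  assumes "top_term f m x" "top_term g n y" shows "top_term (f * g) (m + n) (x * y)"
proof -
  have f: "Poly_Mapping.lookup f m = x" "\<And>k. k > m \<Longrightarrow> Poly_Mapping.lookup f k = 0"
    and g: "Poly_Mapping.lookup g n = y" "\<And>k. k > n \<Longrightarrow> Poly_Mapping.lookup g k = 0"
    using assms by (auto simp: top_term_def)
  have "Poly_Mapping.lookup f k * Poly_Mapping.lookup g (m + n - k) = (if k = m then x * y else 0)" for k
    using f(2)[of k] g(2)[of "m + n - k"] f(1) g(1) by (cases k m rule: linorder_cases) auto
  then have "Poly_Mapping.lookup (f * g) (m + n) = x * y"
    unfolding lookup_times using f(1) by (auto simp: in_keys_iff)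
  moreover have "Poly_Mapping.lookup (f * g) j = 0" if "j > m + n" for j
  proof -
    have "Poly_Mapping.lookup f k * Poly_Mapping.lookup g (j - k) = 0" for k
      using f(2)[of k] g(2)[of "j - k"] that by (cases "k > m") auto
    then show ?thesis by (simp add: lookup_times)
  qed
  ultimately show ?thesis by (simp add: top_term_def)
qed

lemma top_term_power:
  fixes f :: "int \<Rightarrow>\<^sub>0 'b::comm_ring_1"
  assumes "top_term f m x" shows "top_term (f ^ N) (int N * m) (x ^ N)"
proof (induction N)
  case 0
  show ?case by (simp add: top_term_def lookup_one when_def)
next
  case (Suc N)
  then show ?case using top_term_mult[OF assms Suc] by (simp add: algebra_simps)
qed

lemma top_term_Max:
  assumes "f \<noteq> 0"
  defines "n \<equiv> Max (Poly_Mapping.keys f)"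
  shows "top_term f n (Poly_Mapping.lookup f n)" "Poly_Mapping.lookup f n \<noteq> 0"
proof -
  have "Poly_Mapping.keys f \<noteq> {}" using assms by simp
  then show "Poly_Mapping.lookup f n \<noteq> 0"
    using Max_in[of "Poly_Mapping.keys f"] by (simp add: n_def in_keys_iff)
  show "top_term f n (Poly_Mapping.lookup f n)"
    unfolding top_term_def n_def
    using Max_ge[OF finite_keys, of _ f] by (metis in_keys_iff linorder_not_le)
qed

text \<open>The Euclidean function on Laurent polynomials over a field: monomials are units, so only
  the distance between the extreme exponents counts. The value at 0 is meaningless, hence the
  separate alternative for zero remainders.\<close>

definition width :: "(int \<Rightarrow>\<^sub>0 'b::zero) \<Rightarrow> nat" where
  "width f = nat (Max (Poly_Mapping.keys f) - Min (Poly_Mapping.keys f))"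

text \<open>A monomial multiple of \<open>d\<close> cancels the leading term of \<open>f\<close>;
  since \<open>d\<close> is no wider than \<open>f\<close>, this multiple does not reach below the
  lowest exponent of \<open>f\<close>.\<close>

lemma laurent_reduce:
  fixes f d :: "int \<Rightarrow>\<^sub>0 'k::field"
  assumes "f \<noteq> 0" "d \<noteq> 0" "width d \<le> width f"
  shows "\<exists>q. f - q * d = 0 \<or> width (f - q * d) < width f"
proof -
  let ?k = Poly_Mapping.keys
  have ne: "?k f \<noteq> {}" "?k d \<noteq> {}" using assms by auto
  have ord: "Min (?k f) \<le> Max (?k f)" "Min (?k d) \<le> Max (?k d)" using ne by auto
  define x where "x = Poly_Mapping.lookup f (Max (?k f))"
  define y where "y = Poly_Mapping.lookup d (Max (?k d))"
  define s where "s = Max (?k f) - Max (?k d)"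
  define q where "q = Poly_Mapping.single s (x / y)"
  have y: "y \<noteq> 0" using top_term_Max[OF assms(2)] by (simp add: y_def)
  have keys: "?k (f - q * d) \<subseteq> {Min (?k f)..<Max (?k f)}"
  proof
    fix j assume "j \<in> ?k (f - q * d)"
    then have j: "Poly_Mapping.lookup f j - x / y * Poly_Mapping.lookup d (j - s) \<noteq> 0"
      by (simp add: in_keys_iff lookup_minus q_def lookup_single_times)
    have "j \<le> Max (?k f)"
    proof (rule ccontr)
      assume "\<not> ?thesis"
      then have "j > Max (?k f)" "j - s > Max (?k d)" by (auto simp: s_def)
      then have "j \<notin> ?k f" "j - s \<notin> ?k d"
        using Max_ge[OF finite_keys, of j f] Max_ge[OF finite_keys, of "j - s" d] by linarith+
      then show False using j by (simp add: in_keys_iff)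
    qed
    moreover have "j \<noteq> Max (?k f)" using j y by (auto simp: s_def x_def[symmetric] y_def[symmetric])
    moreover have "Min (?k f) \<le> j"
    proof (rule ccontr)
      assume l: "\<not> ?thesis"
      have "j - s < Min (?k d)" using l assms(3) ord unfolding s_def width_def by linarith
      then have "j \<notin> ?k f" "j - s \<notin> ?k d"
        using l Min_le[OF finite_keys, of j f] Min_le[OF finite_keys, of "j - s" d] by linarith+
      then show False using j by (simp add: in_keys_iff)
    qed
    ultimately show "j \<in> {Min (?k f)..<Max (?k f)}" by simp
  qed
  have "width (f - q * d) < width f" if "f - q * d \<noteq> 0"
  proof -
    have n: "?k (f - q * d) \<noteq> {}" using that by simp
    have "Max (?k (f - q * d)) \<in> ?k (f - q * d)" "Min (?k (f - q * d)) \<in> ?k (f - q * d)"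
      using n by auto
    then have "Max (?k (f - q * d)) < Max (?k f)" "Min (?k f) \<le> Min (?k (f - q * d))"
      "Min (?k f) < Max (?k f)"
      using keys by force+
    then show ?thesis unfolding width_def by linarith
  qed
  then show ?thesis by blast
qed

text \<open>A nonzero element of least width in the ideal generated by \<open>g\<close> and
  \<open>h\<close> divides every element of that ideal.\<close>

lemma laurent_bezout:
  fixes g h :: "int \<Rightarrow>\<^sub>0 'k::field"
  assumes "h \<noteq> 0"
  shows "\<exists>a b d. d \<noteq> 0 \<and> d = a * g + b * h \<and> d dvd g \<and> d dvd h"
proof -
  define I where "I = {f. \<exists>a b. f = a * g + b * h}"
  have I: "x - q * y \<in> I" if xy: "x \<in> I" "y \<in> I" for x y q
  proof -
    obtain a b a' b' where "x = a * g + b * h" "y = a' * g + b' * h" using xy by (auto simp: I_def)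
    then have "x - q * y = (a - q * a') * g + (b - q * b') * h" by (simp add: algebra_simps)
    then show ?thesis unfolding I_def by blast
  qed
  have gI: "g \<in> I" unfolding I_def by (intro CollectI exI[of _ 1] exI[of _ 0]) simp
  have hI: "h \<in> I" unfolding I_def by (intro CollectI exI[of _ 0] exI[of _ 1]) simp
  obtain d where d: "d \<in> I" "d \<noteq> 0" "\<And>f. f \<in> I \<Longrightarrow> f \<noteq> 0 \<Longrightarrow> width d \<le> width f"
  proof -
    have "h \<in> I \<and> h \<noteq> 0" using hI assms by simp
    from ex_has_least_nat[where P = "\<lambda>f. f \<in> I \<and> f \<noteq> 0" and m = width, OF this]
    show ?thesis using that by auto
  qed
  have "d dvd f" if "f \<in> I" for f
    using that
  proof (induction "width f" arbitrary: f rule: less_induct)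
    case less
    show ?case
    proof (cases "f = 0")
      case False
      obtain q where q: "f - q * d = 0 \<or> width (f - q * d) < width f"
        using laurent_reduce[OF False d(2)] d(3)[OF less.prems False] by blast
      have "d dvd f - q * d" using q less.hyps[OF _ I[OF less.prems d(1)]] by auto
      from dvd_add[OF this, of "q * d"] show ?thesis by simp
    qed simp
  qed
  then show ?thesis using d(1,2) gI hI unfolding I_def by blast
qed

text \<open>The rational root argument. After division by the gcd, \<open>g'\<close> and
  \<open>h'\<close> are coprime and \<open>h'\<close> divides \<open>g' ^ n\<close>, so
  \<open>h'\<close> is a unit.\<close>

lemma laurent_integrally_closed:
  fixes g h :: "int \<Rightarrow>\<^sub>0 'k::field"
  assumes h: "h \<noteq> 0" and n: "0 < n" and rel: "g ^ n + (\<Sum>i<n. c i * g ^ i * h ^ (n - i)) = 0"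
  shows "h dvd g"
proof -
  obtain a b d where d: "d \<noteq> 0" "d = a * g + b * h" "d dvd g" "d dvd h" using laurent_bezout[OF h] by blast
  obtain g' h' where gh: "g = d * g'" "h = d * h'" using d by (elim dvdE)
  have "d * (a * g' + b * h') = d * 1" using d(2) gh by (simp add: algebra_simps)
  then have bez: "a * g' + b * h' = 1" using d(1) by simp
  have "d ^ n * (g' ^ n + (\<Sum>i<n. c i * g' ^ i * h' ^ (n - i)))
      = g ^ n + (\<Sum>i<n. c i * g ^ i * h ^ (n - i))"
    unfolding gh distrib_left sum_distrib_left power_mult_distrib
  proof (intro arg_cong2[of _ _ _ _ "(+)"] sum.cong refl)
    fix i assume "i \<in> {..<n}"
    then have "d ^ n = d ^ i * d ^ (n - i)" by (simp flip: power_add)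
    then show "d ^ n * (c i * g' ^ i * h' ^ (n - i)) = c i * (d ^ i * g' ^ i) * (d ^ (n - i) * h' ^ (n - i))"
      by (simp add: ac_simps)
  qed
  then have "g' ^ n + (\<Sum>i<n. c i * g' ^ i * h' ^ (n - i)) = 0" using rel d(1) by simp
  then have g'n: "g' ^ n = - (\<Sum>i<n. c i * g' ^ i * h' ^ (n - i))" by (simp add: eq_neg_iff_add_eq_0)
  have "h' dvd g' ^ n" unfolding g'n dvd_minus_iff
    by (intro dvd_sum) (auto intro: dvd_mult dvd_power)
  \<comment> \<open>Modulo \<open>h'\<close>, the power of the Bezout sum 1 equals
    \<open>(a * g') ^ m\<close>, which for \<open>m = n\<close> is itself divisible by
    \<open>h'\<close>.\<close>
  have "h' dvd (a * g' + b * h') ^ m - (a * g') ^ m" for m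
  proof -
    have "(a * g' + b * h') ^ m - (a * g') ^ m
        = b * h' * (\<Sum>i<m. (a * g') ^ (m - Suc i) * (a * g' + b * h') ^ i)"
      using power_diff_sumr2[of "a * g' + b * h'" m "a * g'"] by simp
    then show ?thesis by (simp add: dvd_mult2)
  qed
  from dvd_add[OF this[of n], of "(a * g') ^ n"] \<open>h' dvd g' ^ n\<close> have "h' dvd 1"
    by (simp add: bez power_mult_distrib)
  then have "h' dvd g'" by (rule dvd_trans) simp
  then show ?thesis unfolding gh by (rule mult_dvd_mono[OF dvd_refl])
qed

section \<open>The degree 0 embedding and fractions of a subring\<close>

lemma Fract1: "rhom (\<lambda>a. Fract a 1)"
  by (rule rhomI) (simp_all add: One_fract_def)

lemma Fract1_inj: "Fract a 1 = Fract b 1 \<longleftrightarrow> a = b"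
  by (simp add: eq_fract)

lemma Fract1_eq_0: "Fract a 1 = 0 \<longleftrightarrow> a = 0"
  by (simp add: Zero_fract_def eq_fract)

lemma rhom_base: "rhom base"
  by (rule rhomI) (simp_all add: base_def mult_single One_fract_def[symmetric] flip: single_add)

lemma base_eq_0: "base a = 0 \<longleftrightarrow> a = 0"
  by (metis base_def Fract1_eq_0 lookup_single_eq lookup_zero single_zero)

text \<open>The part of the fraction field of \<open>S\<close> that lies in the ambient domain; thus
  birationality is expressed without leaving the ring.\<close>

definition fracs :: "'a::idom set \<Rightarrow> 'a set" where
  "fracs S = {a. \<exists>q\<in>S. q \<noteq> 0 \<and> a * q \<in> S}"

lemma fracsI: "q \<in> S \<Longrightarrow> q \<noteq> 0 \<Longrightarrow> a * q \<in> S \<Longrightarrow> a \<in> fracs S"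
  by (auto simp: fracs_def)

lemma fracsE: "a \<in> fracs S \<Longrightarrow> (\<And>q. q \<in> S \<Longrightarrow> q \<noteq> 0 \<Longrightarrow> a * q \<in> S \<Longrightarrow> thesis) \<Longrightarrow> thesis"
  by (auto simp: fracs_def)

lemma fracs_base: "is_subring S \<Longrightarrow> s \<in> S \<Longrightarrow> s \<in> fracs S"
  by (rule fracsI[of 1]) (auto intro: subring_one)

lemma fracs_add:
  assumes S: "is_subring S" and "a \<in> fracs S" "b \<in> fracs S" shows "a + b \<in> fracs S"
proof -
  obtain q where q: "q \<in> S" "q \<noteq> 0" "a * q \<in> S" using assms(2) by (rule fracsE)
  obtain q' where q': "q' \<in> S" "q' \<noteq> 0" "b * q' \<in> S" using assms(3) by (rule fracsE)
  have "(a + b) * (q * q') = (a * q) * q' + (b * q') * q" by (simp add: algebra_simps)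
  also have "\<dots> \<in> S" using q q' by (simp add: subring_add[OF S] subring_mult[OF S])
  finally show ?thesis by (rule fracsI[rotated 2]) (use q q' subring_mult[OF S] in auto)
qed

lemma fracs_mult:
  assumes S: "is_subring S" and "a \<in> fracs S" "b \<in> fracs S" shows "a * b \<in> fracs S"
proof -
  obtain q where q: "q \<in> S" "q \<noteq> 0" "a * q \<in> S" using assms(2) by (rule fracsE)
  obtain q' where q': "q' \<in> S" "q' \<noteq> 0" "b * q' \<in> S" using assms(3) by (rule fracsE)
  have "(a * b) * (q * q') = (a * q) * (b * q')" by (simp add: algebra_simps)
  also have "\<dots> \<in> S" using q q' by (simp add: subring_mult[OF S])
  finally show ?thesis by (rule fracsI[rotated 2]) (use q q' subring_mult[OF S] in auto)
qed

lemma fracs_div: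
  assumes S: "is_subring S" and "p \<in> fracs S" "q \<in> fracs S" "q \<noteq> 0" "a * q = p" shows "a \<in> fracs S"
proof -
  obtain p2 where p: "p2 \<in> S" "p2 \<noteq> 0" "p * p2 \<in> S" using assms(2) by (rule fracsE)
  obtain q2 where q: "q2 \<in> S" "q2 \<noteq> 0" "q * q2 \<in> S" using assms(3) by (rule fracsE)
  have "a * (q * q2 * p2) = (p * p2) * q2" by (simp add: ac_simps flip: assms(5))
  also have "\<dots> \<in> S" using p q by (simp add: subring_mult[OF S])
  finally show ?thesis by (rule fracsI[rotated 2]) (use p q assms(4) subring_mult[OF S] in auto)
qed

lemma fracs_zero: "is_subring S \<Longrightarrow> 0 \<in> fracs S"
  by (simp add: fracs_base subring_zero)

lemma fracs_sum: "is_subring S \<Longrightarrow> (\<And>i. i \<in> I \<Longrightarrow> f i \<in> fracs S) \<Longrightarrow> sum f I \<in> fracs S"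
  by (induction I rule: infinite_finite_induct) (auto intro: fracs_zero fracs_add)

lemma integral_root:
  assumes S: "is_subring S" and k: "0 < k" and "t ^ k \<in> S" shows "integral_elem S t"
  unfolding integral_elem_def
proof (intro exI conjI)
  show "t ^ k + (\<Sum>i<k. (if i = 0 then - (t ^ k) else 0) * t ^ i) = 0"
    using k by (subst sum.remove[of _ 0]) auto
qed (simp_all add: k assms(3) subring_zero[OF S] subring_uminus[OF S])

text \<open>All that is used of the divisors: \<open>G n\<close> holds the coefficients of degree
  \<open>n\<close>, \<open>G_root\<close> is complete integral closedness for homogeneous elements,
  and \<open>G_div_v\<close>, \<open>G_div_w\<close> say that multiplication by \<open>v\<close> or
  \<open>w\<close> away from degree 0 is onto.\<close>

locale section_algebra =
  fixes G :: "int \<Rightarrow> 'a::idom fract set" and dp dm :: nat and u up v w :: "'a fract"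
  assumes G0: "G 0 = range (\<lambda>a. Fract a 1)"
    and G_zero: "0 \<in> G n"
    and G_add: "x \<in> G n \<Longrightarrow> y \<in> G n \<Longrightarrow> x + y \<in> G n"
    and G_mult: "x \<in> G m \<Longrightarrow> y \<in> G n \<Longrightarrow> x * y \<in> G (m + n)"
    and G_root: "a \<noteq> 0 \<Longrightarrow> (\<And>N. a * x ^ N \<in> G (e + int N * n)) \<Longrightarrow> x \<in> G n"
    and dp_pos: "0 < dp" and dm_pos: "0 < dm"
    and u: "u \<in> G (- 1)" "u \<noteq> 0" and up: "up \<in> G 1" "up \<noteq> 0"
    and v: "v \<in> G (int dp)" "v \<noteq> 0" and w: "w \<in> G (- int dm)" "w \<noteq> 0"
    and G_div_v: "0 \<le> n \<Longrightarrow> x \<in> G (n + int dp) \<Longrightarrow> x / v \<in> G n"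
    and G_div_w: "n \<le> 0 \<Longrightarrow> x \<in> G (n - int dm) \<Longrightarrow> x / w \<in> G n"
begin

definition A :: "(int \<Rightarrow>\<^sub>0 'a fract) set" where
  "A = {F. \<forall>n. Poly_Mapping.lookup F n \<in> G n}"

lemma Fract_G0: "Fract a 1 \<in> G 0" by (simp add: G0)

lemma G0E: "x \<in> G 0 \<Longrightarrow> (\<And>a. x = Fract a 1 \<Longrightarrow> thesis) \<Longrightarrow> thesis"
  by (auto simp: G0)

lemma G_uminus: "x \<in> G n \<Longrightarrow> - x \<in> G n"
  using G_mult[OF Fract_G0[of "- 1"], of x n] by (simp add: rhom_simps[OF Fract1])

lemma G_power: "x \<in> G n \<Longrightarrow> x ^ N \<in> G (int N * n)"
proof (induction N)
  case 0
  show ?case using Fract_G0[of 1] by (simp add: rhom_one[OF Fract1])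
next
  case (Suc N)
  then show ?case using G_mult[OF Suc.prems Suc.IH[OF Suc.prems]] by (simp add: distrib_right)
qed

lemma single_in_A: "Poly_Mapping.single n x \<in> A \<longleftrightarrow> x \<in> G n"
  using G_zero by (auto simp: A_def lookup_single when_def)

lemma base_in_A: "base a \<in> A"
  by (simp add: base_def single_in_A Fract_G0)

lemma G_sum: "(\<And>i. i \<in> I \<Longrightarrow> f i \<in> G n) \<Longrightarrow> sum f I \<in> G n"
  by (induction I rule: infinite_finite_induct) (auto intro: G_zero G_add)

lemma is_subring_A: "is_subring A"
proof (rule is_subringI)
  show "1 \<in> A" using base_in_A[of 1] by (simp add: rhom_one[OF rhom_base])
next
  fix x y assume x: "x \<in> A" and y: "y \<in> A"
  then show "x + y \<in> A" by (auto simp: A_def lookup_add intro: G_add)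
  have "Poly_Mapping.lookup x k * Poly_Mapping.lookup y (n - k) \<in> G n" for n k
    using x y G_mult[of "Poly_Mapping.lookup x k" k "Poly_Mapping.lookup y (n - k)" "n - k"]
    by (auto simp: A_def)
  then show "x * y \<in> A" by (auto simp: A_def lookup_times intro: G_sum)
next
  fix x assume "x \<in> A"
  then show "- x \<in> A" by (auto simp: A_def intro: G_uminus)
qed

text \<open>Complete integral closedness: the top homogeneous term of \<open>F\<close> is again almost integral, so it
  lies in \<open>A\<close> by \<open>G_root\<close> and can be split off.\<close>

lemma almost_integral:
  assumes "a \<in> A" "a \<noteq> 0" "\<And>N. a * F ^ N \<in> A"
  shows "F \<in> A"
  using assms(3)
proof (induction "card (Poly_Mapping.keys F)" arbitrary: F rule: less_induct)
  case less
  show ?case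
  proof (cases "F = 0")
    case True
    then show ?thesis using is_subring_A by (simp add: subring_zero)
  next
    case False
    define n where "n = Max (Poly_Mapping.keys F)"
    define x where "x = Poly_Mapping.lookup F n"
    define e where "e = Max (Poly_Mapping.keys a)"
    define \<alpha> where "\<alpha> = Poly_Mapping.lookup a e"
    have F: "top_term F n x" "x \<noteq> 0" using top_term_Max[OF False] by (simp_all add: n_def x_def)
    have a: "top_term a e \<alpha>" "\<alpha> \<noteq> 0" using top_term_Max[OF assms(2)] by (simp_all add: e_def \<alpha>_def)
    have "\<alpha> * x ^ N \<in> G (e + int N * n)" for N
    proof -
      have "Poly_Mapping.lookup (a * F ^ N) (e + int N * n) \<in> G (e + int N * n)"
        using less.prems[of N] by (simp add: A_def)
      then show ?thesis
        using top_term_mult[OF a(1) top_term_power[OF F(1), of N]] by (simp add: top_term_def)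
    qed
    then have xG: "x \<in> G n" by (rule G_root[OF a(2)])
    define F' where "F' = F - Poly_Mapping.single n x"
    have s: "Poly_Mapping.single n x \<in> A" using xG by (simp add: single_in_A)
    have "Poly_Mapping.keys F' \<subset> Poly_Mapping.keys F"
      using F by (auto simp: F'_def x_def in_keys_iff lookup_minus lookup_single when_def split: if_splits)
    then have "card (Poly_Mapping.keys F') < card (Poly_Mapping.keys F)" by (simp add: psubset_card_mono)
    moreover have "a * F' ^ N \<in> A" for N
    proof -
      \<comment> \<open>\<open>F'\<close> and \<open>F\<close> differ by an element of
        \<open>A\<close>, so the binomial formula expresses \<open>a * F' ^ N\<close> through the
        products \<open>a * F ^ k\<close>.\<close>
      have "a * F' ^ N = (\<Sum>k\<le>N. of_nat (N choose k) * (a * F ^ k) * (- Poly_Mapping.single n x) ^ (N - k))"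
        unfolding F'_def diff_conv_add_uminus binomial_ring by (simp add: sum_distrib_left ac_simps)
      also have "\<dots> \<in> A"
      proof (rule subring_sum[OF is_subring_A])
        fix k
        have "of_nat j \<in> A" for j
          by (induction j) (auto intro: subring_closed[OF is_subring_A])
        then show "of_nat (N choose k) * (a * F ^ k) * (- Poly_Mapping.single n x) ^ (N - k) \<in> A"
          using less.prems s
          by (simp add: subring_mult[OF is_subring_A] subring_power[OF is_subring_A] subring_uminus[OF is_subring_A])
      qed
      finally show ?thesis .
    qed
    ultimately have "F' \<in> A" by (rule less.hyps)
    then show ?thesis using s subring_add[OF is_subring_A, of F' "Poly_Mapping.single n x"] by (simp add: F'_def)
  qed
qed

text \<open>The quotient \<open>f\<close> exists among Laurent polynomials over the field. Its monic
  equation bounds the denominators of all its powers by \<open>h ^ n\<close>, so \<open>f\<close> is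
  almost integral over \<open>A\<close>.\<close>

lemma A_integrally_closed:
  assumes g: "g \<in> A" and h: "h \<in> A" "h \<noteq> 0" and n: "0 < n" and c: "\<And>i. i < n \<Longrightarrow> c i \<in> A"
    and rel: "g ^ n + (\<Sum>i<n. c i * g ^ i * h ^ (n - i)) = 0"
  shows "\<exists>f\<in>A. f * h = g"
proof -
  obtain f where f: "g = h * f" using laurent_integrally_closed[OF h(2) n rel] by (elim dvdE)
  have "h ^ n * (f ^ n + (\<Sum>i<n. c i * f ^ i)) = g ^ n + (\<Sum>i<n. c i * g ^ i * h ^ (n - i))"
    unfolding f distrib_left sum_distrib_left power_mult_distrib
  proof (intro arg_cong2[of _ _ _ _ "(+)"] sum.cong refl)
    fix i assume "i \<in> {..<n}"
    then have "h ^ n = h ^ i * h ^ (n - i)" by (simp flip: power_add)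
    then show "h ^ n * (c i * f ^ i) = c i * (h ^ i * f ^ i) * h ^ (n - i)" by (simp add: ac_simps)
  qed
  then have "f ^ n + (\<Sum>i<n. c i * f ^ i) = 0" using rel h(2) by simp
  then have fn: "f ^ n = - (\<Sum>i<n. c i * f ^ i)" by (simp add: eq_neg_iff_add_eq_0)
  note A = subring_closed[OF is_subring_A] subring_power[OF is_subring_A]
  have "h ^ n * f ^ N \<in> A" for N
  proof (induction N rule: less_induct)
    case (less N)
    show ?case
    proof (cases "N < n")
      case True
      then have "h ^ n * f ^ N = h ^ (n - N) * g ^ N"
        unfolding f by (simp add: power_mult_distrib mult.assoc[symmetric] flip: power_add)
      then show ?thesis using g h by (auto intro: A)
    next
      case False
      then have "h ^ n * f ^ N = h ^ n * f ^ (N - n) * f ^ n" by (simp add: mult.assoc flip: power_add)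
      also have "\<dots> = - (\<Sum>i<n. c i * (h ^ n * f ^ (N - n + i)))"
        unfolding fn by (simp add: sum_distrib_left power_add ac_simps)
      also have "\<dots> \<in> A"
      proof (intro A(3) subring_sum[OF is_subring_A])
        fix i assume "i \<in> {..<n}"
        then show "c i * (h ^ n * f ^ (N - n + i)) \<in> A"
          using False by (intro A(6)[OF c less.IH]) auto
      qed
      finally show ?thesis .
    qed
  qed
  then have "f \<in> A" by (rule almost_integral[of "h ^ n", rotated 2]) (simp_all add: h subring_power[OF is_subring_A])
  then show ?thesis using f by (auto simp: mult.commute)
qed

lemma G_div_v_power: "0 \<le> n \<Longrightarrow> x \<in> G (n + int N * int dp) \<Longrightarrow> x / v ^ N \<in> G n"
proof (induction N arbitrary: x)
  case (Suc N)
  have "x / v \<in> G (n + int N * int dp)"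
    using Suc.prems by (intro G_div_v) (simp_all add: algebra_simps)
  then show ?case using Suc.IH[of "x / v"] Suc.prems by simp
qed simp

lemma G_div_w_power: "n \<le> 0 \<Longrightarrow> x \<in> G (n - int N * int dm) \<Longrightarrow> x / w ^ N \<in> G n"
proof (induction N arbitrary: x)
  case (Suc N)
  have "x / w \<in> G (n - int N * int dm)"
    using Suc.prems order_trans[OF Suc.prems(1), of "int N * int dm"]
    by (intro G_div_w) (simp_all add: algebra_simps)
  then show ?case using Suc.IH[of "x / w"] Suc.prems by simp
qed simp

abbreviation "U \<equiv> Poly_Mapping.single (- 1) u"
abbreviation "V \<equiv> Poly_Mapping.single (int dp) v"
abbreviation "W \<equiv> Poly_Mapping.single (- int dm) w"

lemma UVW_in_A: "U \<in> A" "V \<in> A" "W \<in> A"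
  using u v w by (simp_all add: single_in_A)

lemma A_sum_singles: "F = (\<Sum>n\<in>Poly_Mapping.keys F. Poly_Mapping.single n (Poly_Mapping.lookup F n))"
  by (rule poly_mapping_expand)

text \<open>An element of degree \<open>n \<ge> 0\<close> has a \<open>dp\<close>-th power that is
  \<open>V ^ n\<close> times an element of degree 0, and similarly with \<open>W\<close> below.
  Integrality of the base over \<open>S\<close>, rather than its inclusion, is assumed so that (c)
  is covered too.\<close>

lemma A_integral:
  assumes S: "is_subring S" and b: "\<And>a. integral_elem S (base a)" and V: "V \<in> S" and W: "W \<in> S"
    and F: "F \<in> A"
  shows "integral_elem S F"
proof -
  let ?C = "{x. integral_elem S x}"
  have C: "is_subring ?C" by (rule is_subring_integral[OF S])
  have "Poly_Mapping.single n x \<in> ?C" if x: "x \<in> G n" for n x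
  proof (cases "0 \<le> n")
    case True
    have "x ^ dp / v ^ nat n \<in> G 0"
      using G_power[OF x, of dp] True by (intro G_div_v_power) (simp_all add: mult.commute)
    then obtain a where a: "x ^ dp / v ^ nat n = Fract a 1" by (rule G0E)
    have "Poly_Mapping.single n x ^ dp = base a * V ^ nat n"
      using True v a by (simp add: base_def single_power mult_single field_simps)
    also have "\<dots> \<in> ?C"
      using b V integral_elem_base[OF S] by (intro subring_mult[OF C] subring_power[OF C]) auto
    finally have "Poly_Mapping.single n x ^ dp \<in> ?C" .
    then have "integral_elem ?C (Poly_Mapping.single n x)" by (intro integral_root[OF C dp_pos])
    then show ?thesis using integral_elem_trans[OF S, of ?C "Poly_Mapping.single n x"] by simp
  next
    case False
    have "x ^ dm / w ^ nat (- n) \<in> G 0"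
      using G_power[OF x, of dm] False by (intro G_div_w_power) (simp_all add: mult.commute)
    then obtain a where a: "x ^ dm / w ^ nat (- n) = Fract a 1" by (rule G0E)
    have "Poly_Mapping.single n x ^ dm = base a * W ^ nat (- n)"
      using False w a by (simp add: base_def single_power mult_single field_simps)
    also have "\<dots> \<in> ?C"
      using b W integral_elem_base[OF S] by (intro subring_mult[OF C] subring_power[OF C]) auto
    finally have "Poly_Mapping.single n x ^ dm \<in> ?C" .
    then have "integral_elem ?C (Poly_Mapping.single n x)" by (intro integral_root[OF C dm_pos])
    then show ?thesis using integral_elem_trans[OF S, of ?C "Poly_Mapping.single n x"] by simp
  qed
  then have "(\<Sum>n\<in>Poly_Mapping.keys F. Poly_Mapping.single n (Poly_Mapping.lookup F n)) \<in> ?C"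
    using F by (intro subring_sum[OF C]) (auto simp: A_def)
  then show ?thesis by (simp flip: A_sum_singles)
qed

text \<open>Two elements of one degree, the second nonzero, differ by a factor from the fraction
  field of the base. So one nonzero element per degree decides about that degree.\<close>

lemma fracs_homogeneous:
  assumes S: "is_subring S" and b: "\<And>a. base a \<in> fracs S"
    and y: "y \<noteq> 0" "Poly_Mapping.single n y \<in> fracs S"
  shows "Poly_Mapping.single n x \<in> fracs S"
proof -
  obtain f g where fg: "x / y = Fract f g" "g \<noteq> 0" by (cases "x / y") auto
  have "x * Fract g 1 = (x / y) * y * Fract g 1" using y by simp
  also have "\<dots> = (Fract f g * Fract g 1) * y" by (simp add: fg ac_simps)
  also have "Fract f g * Fract g 1 = Fract f 1" using fg by (simp add: eq_fract)
  finally have "Poly_Mapping.single n x * base g = base f * Poly_Mapping.single n y"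
    by (simp add: base_def mult_single)
  moreover have "base f * Poly_Mapping.single n y \<in> fracs S" using b y(2) by (intro fracs_mult[OF S])
  moreover have "base g \<noteq> 0" using fg by (simp add: base_eq_0)
  ultimately show ?thesis
    using b fracs_div[OF S, of "base f * Poly_Mapping.single n y" "base g" "Poly_Mapping.single n x"] by blast
qed

lemma fracs_singles:
  assumes S: "is_subring S"
    and F: "\<And>n. Poly_Mapping.lookup F n \<noteq> 0 \<Longrightarrow> Poly_Mapping.single n (Poly_Mapping.lookup F n) \<in> fracs S"
  shows "F \<in> fracs S"
proof -
  have "(\<Sum>n\<in>Poly_Mapping.keys F. Poly_Mapping.single n (Poly_Mapping.lookup F n)) \<in> fracs S"
    by (rule fracs_sum[OF S]) (simp add: F in_keys_iff)
  then show ?thesis by (simp flip: A_sum_singles)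
qed

end

section \<open>The presentation in part (a)\<close>

lemma is_ideal_radical:
  fixes J :: "'t::comm_ring_1 set"
  assumes J: "is_ideal J" shows "is_ideal {p. \<exists>n. p ^ n \<in> J}"
  unfolding is_ideal_def
proof (intro conjI ballI allI)
  show "0 \<in> {p. \<exists>n. p ^ n \<in> J}" using is_ideal_zero[OF J] by (auto intro: exI[of _ 1])
  fix a x assume "x \<in> {p. \<exists>n. p ^ n \<in> J}"
  then show "a * x \<in> {p. \<exists>n. p ^ n \<in> J}"
    using is_ideal_mult[OF J] by (auto simp: power_mult_distrib)
next
  fix x y assume "x \<in> {p. \<exists>n. p ^ n \<in> J}" "y \<in> {p. \<exists>n. p ^ n \<in> J}"
  then obtain m n where m: "x ^ m \<in> J" and n: "y ^ n \<in> J" by auto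
  have "(x + y) ^ (m + n) = (\<Sum>i\<le>m + n. of_nat (m + n choose i) * x ^ i * y ^ (m + n - i))"
    by (rule binomial_ring)
  also have "\<dots> \<in> J"
  proof (rule is_ideal_sum[OF J])
    fix i assume "i \<in> {..m + n}"
    show "of_nat (m + n choose i) * x ^ i * y ^ (m + n - i) \<in> J"
    proof (cases "m \<le> i")
      case True
      then show ?thesis using is_ideal_power[OF J m True] by (simp add: is_ideal_mult[OF J] is_ideal_mult2[OF J])
    next
      case False
      then show ?thesis using is_ideal_power[OF J n, of "m + n - i"] by (simp add: is_ideal_mult[OF J])
    qed
  qed
  finally show "x + y \<in> {p. \<exists>n. p ^ n \<in> J}" by blast
qed

lemma single_eq_0: "Poly_Mapping.single k a = 0 \<longleftrightarrow> a = 0"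
  by (metis lookup_single_eq lookup_zero single_zero)

definition icong :: "'t::comm_ring_1 set \<Rightarrow> 't \<Rightarrow> 't \<Rightarrow> bool" where
  "icong I p q \<longleftrightarrow> p - q \<in> I"

context
  fixes I :: "'t::comm_ring_1 set" assumes I: "is_ideal I"
begin

lemma icong_refl: "icong I p p"
  by (simp add: icong_def is_ideal_zero[OF I])

lemma icong_sym: "icong I p q \<Longrightarrow> icong I q p"
  using is_ideal_uminus[OF I, of "p - q"] by (simp add: icong_def)

lemma icong_trans: "icong I p q \<Longrightarrow> icong I q r \<Longrightarrow> icong I p r"
  using is_ideal_add[OF I, of "p - q" "q - r"] by (simp add: icong_def)

lemma icong_mult: "icong I p q \<Longrightarrow> icong I p' q' \<Longrightarrow> icong I (p * p') (q * q')"
  using is_ideal_add[OF I is_ideal_mult2[OF I, of "p - q" p'] is_ideal_mult[OF I, of "p' - q'" q]]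
  by (simp add: icong_def algebra_simps)

lemma icong_add: "icong I p q \<Longrightarrow> icong I p' q' \<Longrightarrow> icong I (p + p') (q + q')"
  using is_ideal_add[OF I, of "p - q" "p' - q'"] by (simp add: icong_def algebra_simps)

lemma icong_power: "icong I p q \<Longrightarrow> icong I (p ^ n) (q ^ n)"
  by (induction n) (auto intro: icong_refl icong_mult)

lemma icong_scale: "icong I p q \<Longrightarrow> icong I (r * p) (r * q)"
  by (rule icong_mult[OF icong_refl])

end

lemma coprime_multiples:
  fixes k dp' dm' :: nat
  assumes "coprime dp' dm'" "0 < k" "0 < dp'" "0 < dm'" "k * dp' * a = k * dm' * b"
  shows "\<exists>t. a = dm' * t \<and> b = dp' * t"
proof -
  have e: "dp' * a = dm' * b" using assms(2,5) by (simp add: mult.assoc)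
  then have "dm' dvd dp' * a" by simp
  then have "dm' dvd a" using assms(1) by (simp add: coprime_commute coprime_dvd_mult_right_iff)
  then obtain t where "a = dm' * t" by (elim dvdE)
  with e assms(4) show ?thesis by (auto simp: ac_simps)
qed

text \<open>\<open>P\<close> and \<open>Qp\<close> enter as degree 0 products of \<open>u\<close>,
  \<open>v\<close> and \<open>w\<close>, which makes them elements of the base at once; their
  expressions as quotients are compared at the end.\<close>

locale dpd_relations = section_algebra +
  fixes k dp' dm' :: nat and P Qp Pm :: 'a
  assumes dp_eq: "dp = k * dp'" and dm_eq: "dm = k * dm'" and coprime': "coprime dp' dm'"
    and Pm: "u ^ dm = Fract Pm 1 * w" and Qp: "Fract Qp 1 = u ^ dp * v"
    and P: "Fract P 1 = v ^ dm' * w ^ dp'"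
begin

lemma pos: "0 < k" "0 < dp'" "0 < dm'"
  using dp_pos dm_pos dp_eq dm_eq by auto

lemma nz: "P \<noteq> 0" "Qp \<noteq> 0" "Pm \<noteq> 0"
proof -
  have "Fract P 1 \<noteq> 0" "Fract Qp 1 \<noteq> 0" unfolding P Qp using u v w by simp_all
  moreover have "Fract Pm 1 \<noteq> 0" using Pm u(2) by (metis mult_zero_left power_not_zero)
  ultimately show "P \<noteq> 0" "Qp \<noteq> 0" "Pm \<noteq> 0" by (simp_all add: Fract1_eq_0)
qed

text \<open>The compatibility of the three relations: it allows the third variable to be expressed
  through the first one once \<open>Qp\<close> is inverted.\<close>

lemma P_Qp: "P * Pm ^ dp' = Qp ^ dm'"
proof -
  have "Fract (P * Pm ^ dp') 1 = v ^ dm' * (Fract Pm 1 * w) ^ dp'"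
    by (simp only: rhom_mult[OF Fract1] rhom_power[OF Fract1] P power_mult_distrib ac_simps)
  also have "\<dots> = v ^ dm' * u ^ (dm * dp')" by (simp only: Pm[symmetric] power_mult)
  also have "dm * dp' = dp * dm'" by (simp add: dp_eq dm_eq)
  also have "v ^ dm' * u ^ (dp * dm') = Fract (Qp ^ dm') 1"
    by (simp add: rhom_power[OF Fract1] Qp power_mult_distrib power_mult[symmetric] ac_simps)
  finally show ?thesis by (simp add: Fract1_inj)
qed

definition e :: "'a poly poly poly \<Rightarrow> int \<Rightarrow>\<^sub>0 'a fract" where
  "e = eval3 base U V W"

lemma rhom_e: "rhom e"
  unfolding e_def by (rule rhom_eval3[OF rhom_base])

lemma e_simps: "e (const3 a) = base a" "e X3 = U" "e Y3 = V" "e Z3 = W"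
  unfolding e_def by (rule eval3_simps[OF rhom_base])+

lemma e_in_A: "e p \<in> A"
  unfolding e_def eval3_altdef[OF rhom_base]
  by (intro subring_sum[OF is_subring_A] subring_mult[OF is_subring_A] subring_power[OF is_subring_A]
      base_in_A UVW_in_A)

lemma e_hom: "p \<in> hom_polys dp dm n \<Longrightarrow> \<exists>y. e p = Poly_Mapping.single n y"
  unfolding e_def base_def using eval3_single[OF _ Fract1, of p dp dm n u v w] by blast

definition S :: "'a poly poly poly set" where
  "S = B_relations dp dm dp' dm' Pm P Qp"

abbreviation "I \<equiv> gen_ideal S"

lemmas ic = is_ideal_gen[of S]

lemma UVW_relations: "U ^ dm = W * base Pm" "V ^ dm' * W ^ dp' = base P" "V * U ^ dp = base Qp"
proof -
  show "U ^ dm = W * base Pm" by (simp add: base_def single_power mult_single Pm mult.commute)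
  show "V ^ dm' * W ^ dp' = base P"
    by (simp add: base_def single_power mult_single P) (simp add: dp_eq dm_eq)
  show "V * U ^ dp = base Qp" by (simp add: base_def single_power mult_single Qp mult.commute)
qed

lemma S_relations:
  "icong I (X3 ^ dm) (Z3 * const3 Pm)" "icong I (Y3 ^ dm' * Z3 ^ dp') (const3 P)"
  "icong I (Y3 * X3 ^ dp) (const3 Qp)"
  unfolding icong_def by (rule gen_ideal_self, simp add: S_def B_relations_def)+

lemma e_S: "s \<in> S \<Longrightarrow> e s = 0"
  unfolding S_def B_relations_def
  by (auto simp: rhom_simps[OF rhom_e] e_simps UVW_relations)

lemma e_I: "p \<in> I \<Longrightarrow> e p = 0"
proof -
  have "I \<subseteq> {p. e p = 0}"
    by (rule gen_ideal_minimal[OF is_ideal_kernel]) (auto simp: rhom_simps[OF rhom_e] e_S)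
  then show "p \<in> I \<Longrightarrow> e p = 0" by auto
qed

lemma S_homogeneous: "s \<in> S \<Longrightarrow> \<exists>d. s \<in> hom_polys dp dm d"
proof -
  have m: "const3 a * X3 ^ i * Y3 ^ j * Z3 ^ l \<in> hom_polys dp dm n"
    if "- int i + int dp * int j - int dm * int l = n" for a :: 'a and i j l n
    by (rule hom_polys_monom[OF that])
  have c1: "const3 (1::'a) = 1" by (rule rhom_one[OF rhom_const3])
  have diff: "p - q \<in> hom_polys dp dm d" if "p \<in> hom_polys dp dm d" "q \<in> hom_polys dp dm d"
    for p q :: "'a poly poly poly" and d
    using hom_polys_add[OF that(1) hom_polys_uminus[OF that(2)]] by simp
  have "X3 ^ dm - Z3 * const3 Pm \<in> hom_polys dp dm (- int dm)"
    using m[of dm 0 0 "- int dm" 1] m[of 0 0 1 "- int dm" Pm] by (intro diff) (simp_all add: c1 ac_simps)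
  moreover have "Y3 ^ dm' * Z3 ^ dp' - const3 P \<in> hom_polys dp dm 0"
    using m[of 0 dm' dp' 0 1] m[of 0 0 0 0 P] by (intro diff) (simp_all add: c1 dp_eq dm_eq)
  moreover have "Y3 * X3 ^ dp - const3 Qp \<in> hom_polys dp dm 0"
    using m[of dp 1 0 0 1] m[of 0 0 0 0 Qp] by (intro diff) (simp_all add: c1 ac_simps)
  ultimately show "s \<in> S \<Longrightarrow> ?thesis" unfolding S_def B_relations_def by blast
qed

abbreviation "c3 \<equiv> const3 :: 'a \<Rightarrow> _"
lemmas c3s = rhom_simps[OF rhom_const3]

text \<open>Where \<open>Q\<^sub>+\<close> is inverted, \<open>u\<^sub>-\<close> is invertible and the other variables are expressed through it.\<close>

lemma Qp_torsion:
  assumes p: "p \<in> hom_polys dp dm n" and e0: "e p = 0"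
  shows "\<exists>r. const3 Qp ^ r * p \<in> I"
proof -
  \<comment> \<open>Up to powers of \<open>Qp\<close> and \<open>X3\<close>, a homogeneous
    polynomial is a single monomial in \<open>X3\<close>. The equation
    \<open>int s - n = int t\<close> records its degree, so that the exponents of two summands can
    be matched.\<close>
  have "\<exists>r s t a. int s - n = int t \<and> icong I (c3 Qp ^ r * X3 ^ s * p) (c3 a * X3 ^ t)"
    using p
  proof (induction rule: hom_polys_induct)
    case zero
    show ?case
      by (intro exI[of _ 0] exI[of _ "nat n"] exI[of _ "nat (- n)"]) (auto simp: c3s icong_refl[OF ic])
  next
    case (add p q)
    obtain r s t a where 1: "int s - n = int t" "icong I (c3 Qp ^ r * X3 ^ s * p) (c3 a * X3 ^ t)"
      using add(1) by blast
    obtain r' s' t' a' where 2: "int s' - n = int t'" "icong I (c3 Qp ^ r' * X3 ^ s' * q) (c3 a' * X3 ^ t')"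
      using add(2) by blast
    have t: "int (s + s') - n = int (t + s')" "int (s + s') - n = int (t' + s)" using 1 2 by auto
    then have tt: "t' + s = t + s'" by linarith
    \<comment> \<open>Each congruence is multiplied by the factors of the other one; the degree
      equations force \<open>t + s' = t' + s\<close>.\<close>
    have "icong I (c3 Qp ^ r' * X3 ^ s' * (c3 Qp ^ r * X3 ^ s * p) + c3 Qp ^ r * X3 ^ s * (c3 Qp ^ r' * X3 ^ s' * q))
       (c3 Qp ^ r' * X3 ^ s' * (c3 a * X3 ^ t) + c3 Qp ^ r * X3 ^ s * (c3 a' * X3 ^ t'))"
      by (intro icong_add[OF ic] icong_scale[OF ic] 1 2)
    also have "c3 Qp ^ r' * X3 ^ s' * (c3 Qp ^ r * X3 ^ s * p) + c3 Qp ^ r * X3 ^ s * (c3 Qp ^ r' * X3 ^ s' * q)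
       = c3 Qp ^ (r + r') * X3 ^ (s + s') * (p + q)"
      by (simp add: power_add algebra_simps)
    also have "c3 Qp ^ r' * X3 ^ s' * (c3 a * X3 ^ t) + c3 Qp ^ r * X3 ^ s * (c3 a' * X3 ^ t')
       = c3 Qp ^ r' * c3 a * X3 ^ (t + s') + c3 Qp ^ r * c3 a' * X3 ^ (t' + s)"
      by (simp add: power_add algebra_simps)
    also have "\<dots> = c3 (Qp ^ r' * a + Qp ^ r * a') * X3 ^ (t + s')"
      unfolding tt c3s by (simp add: algebra_simps)
    finally show ?case using t(1) by blast
  next
    case (monom a i j l)
    have y: "icong I (Y3 ^ j * X3 ^ (dp * j)) (c3 Qp ^ j)"
      using icong_power[OF ic S_relations(3), of j] by (simp add: power_mult_distrib power_mult)
    \<comment> \<open>\<open>Qp ^ dm'\<close> supplies \<open>Pm ^ dp'\<close>; one factor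
      \<open>Pm\<close> is split off because \<open>Z3 * Pm\<close> is congruent to
      \<open>X3 ^ dm\<close>.\<close>
    have "c3 Qp ^ dm' * Z3 = c3 P * c3 Pm ^ (dp' - 1) * (Z3 * c3 Pm)"
    proof -
      have 1: "c3 Pm ^ dp' = c3 Pm ^ (dp' - 1) * c3 Pm" using pos(2) by (simp flip: power_Suc2)
      have "c3 Qp ^ dm' = c3 P * c3 Pm ^ dp'" using arg_cong[OF P_Qp, of c3] by (simp add: c3s)
      then show ?thesis unfolding 1 by (simp only: ac_simps)
    qed
    then have z: "icong I (c3 Qp ^ dm' * Z3) (c3 P * c3 Pm ^ (dp' - 1) * X3 ^ dm)"
      using icong_scale[OF ic icong_sym[OF ic S_relations(1)], of "c3 P * c3 Pm ^ (dp' - 1)"]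
      by (simp only:)
    define b where "b = P * Pm ^ (dp' - 1)"
    have z: "icong I (c3 Qp ^ (dm' * l) * Z3 ^ l) (c3 b ^ l * X3 ^ (dm * l))"
      using icong_power[OF ic z, of l] by (simp add: power_mult_distrib power_mult b_def c3s)
    have "icong I (c3 a * X3 ^ i * ((Y3 ^ j * X3 ^ (dp * j)) * (c3 Qp ^ (dm' * l) * Z3 ^ l)))
       (c3 a * X3 ^ i * (c3 Qp ^ j * (c3 b ^ l * X3 ^ (dm * l))))"
      by (intro icong_scale[OF ic] icong_mult[OF ic] y z)
    also have "c3 a * X3 ^ i * ((Y3 ^ j * X3 ^ (dp * j)) * (c3 Qp ^ (dm' * l) * Z3 ^ l))
       = c3 Qp ^ (dm' * l) * X3 ^ (dp * j) * (c3 a * X3 ^ i * Y3 ^ j * Z3 ^ l)"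
      by (simp add: ac_simps)
    also have "c3 a * X3 ^ i * (c3 Qp ^ j * (c3 b ^ l * X3 ^ (dm * l)))
       = c3 (a * Qp ^ j * b ^ l) * X3 ^ (i + dm * l)" by (simp add: c3s power_add ac_simps)
    finally show ?case using monom
      by (intro exI[of _ "dm' * l"] exI[of _ "dp * j"] exI[of _ "i + dm * l"] exI[of _ "a * Qp ^ j * b ^ l"]) auto
  qed
  then obtain r s t a where a: "icong I (c3 Qp ^ r * X3 ^ s * p) (c3 a * X3 ^ t)" by blast
  have "base a * U ^ t = 0"
    using e_I[OF a[unfolded icong_def]] by (simp add: rhom_simps[OF rhom_e] e_simps e0)
  then have "a = 0" using u by (simp add: base_eq_0 single_eq_0)
  then have "c3 Qp ^ r * X3 ^ s * p \<in> I" using a by (simp add: icong_def c3s)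
  \<comment> \<open>The cofactor completes \<open>X3 ^ s\<close> to
    \<open>(Y3 * X3 ^ dp) ^ s\<close>, which is congruent to \<open>Qp ^ s\<close>; so
    \<open>X3\<close> disappears from the multiplier.\<close>
  then have "Y3 ^ s * X3 ^ (dp * s - s) * (c3 Qp ^ r * X3 ^ s * p) \<in> I" by (rule is_ideal_mult[OF ic])
  moreover have "Y3 ^ s * X3 ^ (dp * s - s) * (c3 Qp ^ r * X3 ^ s * p) = c3 Qp ^ r * p * (Y3 * X3 ^ dp) ^ s"
  proof -
    have "(X3::'a poly poly poly) ^ (dp * s - s) * X3 ^ s = X3 ^ (dp * s)"
      using dp_pos by (simp flip: power_add)
    then show ?thesis by (simp add: power_mult_distrib power_mult[symmetric] ac_simps)
  qed
  ultimately have "icong I (c3 Qp ^ r * p * (Y3 * X3 ^ dp) ^ s) 0" by (simp add: icong_def)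
  then have "icong I (c3 Qp ^ r * p * c3 Qp ^ s) 0"
    by (rule icong_trans[OF ic icong_sym[OF ic], rotated]) (intro icong_scale[OF ic] icong_power[OF ic] S_relations)
  then have "c3 Qp ^ (r + s) * p \<in> I" by (simp add: icong_def power_add ac_simps)
  then show ?thesis by blast
qed

text \<open>The ideal generated by the relations and \<open>Qp\<close>, written so that membership
  exhibits the cofactor of \<open>Qp\<close>.\<close>

definition J :: "'a poly poly poly set" where
  "J = {p. \<exists>g. p - const3 Qp * g \<in> I}"

lemma is_ideal_J: "is_ideal J"
  unfolding is_ideal_def J_def
proof (intro conjI ballI allI)
  show "0 \<in> {p. \<exists>g. p - c3 Qp * g \<in> I}" using is_ideal_zero[OF ic] by (auto intro: exI[of _ 0])
  fix x y assume "x \<in> {p. \<exists>g. p - c3 Qp * g \<in> I}" "y \<in> {p. \<exists>g. p - c3 Qp * g \<in> I}"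
  then obtain g g' where "x - c3 Qp * g \<in> I" "y - c3 Qp * g' \<in> I" by auto
  from is_ideal_add[OF ic this] have "(x + y) - c3 Qp * (g + g') \<in> I" by (simp add: algebra_simps)
  then show "x + y \<in> {p. \<exists>g. p - c3 Qp * g \<in> I}" by blast
next
  fix a x assume "x \<in> {p. \<exists>g. p - c3 Qp * g \<in> I}"
  then obtain g where "x - c3 Qp * g \<in> I" by auto
  from is_ideal_mult[OF ic this, of a] have "a * x - c3 Qp * (a * g) \<in> I" by (simp add: algebra_simps)
  then show "a * x \<in> {p. \<exists>g. p - c3 Qp * g \<in> I}" by blast
qed

lemma I_J: "p \<in> I \<Longrightarrow> p \<in> J"
  unfolding J_def by (auto intro!: exI[of _ 0])

lemma Qp_J: "c3 Qp * g \<in> J"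
  unfolding J_def using is_ideal_zero[OF ic] by (auto intro!: exI[of _ g])

abbreviation "RJ \<equiv> {p. \<exists>n. p ^ n \<in> J}"
lemmas rc = is_ideal_radical[OF is_ideal_J]

lemma J_RJ: "p \<in> J \<Longrightarrow> p \<in> RJ"
  by (auto intro: exI[of _ 1])

lemma icong_RJ: "icong I p q \<Longrightarrow> icong RJ p q"
  unfolding icong_def using J_RJ I_J by blast

text \<open>\<open>(X3 * Y3) ^ dp\<close> is a multiple of \<open>Y3 * X3 ^ dp\<close>, which is
  congruent to \<open>Qp\<close>.\<close>

lemma XY_RJ: "X3 * Y3 \<in> RJ"
proof -
  have "icong J (Y3 * X3 ^ dp) 0"
    using S_relations(3) I_J Qp_J[of 1] icong_trans[OF is_ideal_J, of "Y3 * X3 ^ dp" "c3 Qp" 0]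
    by (simp add: icong_def)
  then have "Y3 ^ (dp - 1) * (Y3 * X3 ^ dp) \<in> J" by (simp add: icong_def is_ideal_mult[OF is_ideal_J])
  moreover have "Y3 ^ (dp - 1) * (Y3 * X3 ^ dp) = (X3 * Y3 :: 'a poly poly poly) ^ dp"
    using dp_pos by (cases dp) (simp_all add: power_mult_distrib ac_simps)
  ultimately show ?thesis by (intro CollectI exI[of _ dp]) simp
qed

text \<open>Modulo the radical of \<open>(Q\<^sub>+)\<close>, all monomials of a degree divisible by \<open>d\<^sub>+ d\<^sub>-\<close> are multiples
  of a single power of \<open>v\<^sub>+\<close> or \<open>v\<^sub>-\<close>.\<close>

definition wt :: "int \<Rightarrow> 'a poly poly poly" where
  "wt n = (if n \<ge> 0 then Y3 ^ (dm * nat n) else Z3 ^ (dp * nat (- n)))"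

lemma mod_RJ:
  assumes p: "p \<in> hom_polys dp dm (int (dp * dm) * n)"
  shows "\<exists>c. icong RJ p (c3 c * wt n)"
  using p
proof (induction rule: hom_polys_induct)
  case zero
  show ?case using icong_refl[OF rc, of 0] by (intro exI[of _ 0]) (simp add: c3s)
next
  case (add p q)
  then obtain c c' where "icong RJ p (c3 c * wt n)" "icong RJ q (c3 c' * wt n)" by blast
  from icong_add[OF rc this] show ?case by (intro exI[of _ "c + c'"]) (simp add: c3s distrib_right)
next
  case (monom a i j l)
  have yz: "icong RJ (Y3 ^ (dm' * t) * Z3 ^ (dp' * t)) (c3 (P ^ t))" for t
    using icong_RJ[OF icong_power[OF ic S_relations(2), of t]] by (simp add: power_mult_distrib power_mult c3s)
  \<comment> \<open>If \<open>X3\<close> and \<open>Y3\<close> both occur, the monomial lies in the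
    radical. If \<open>X3\<close> is absent, coprimality of \<open>dp'\<close> and
    \<open>dm'\<close> splits off a power of \<open>Y3 ^ dm' * Z3 ^ dp'\<close>, that is of
    \<open>P\<close>. If \<open>Y3\<close> is absent, the degree makes \<open>dm\<close> divide
    \<open>i\<close>, and \<open>X3 ^ dm\<close> becomes \<open>Z3 * Pm\<close>.\<close>
  consider "0 < i" "0 < j" | "i = 0" | "j = 0" "0 < i" by blast
  then show ?case
  proof cases
    case 1
    then have "c3 a * X3 ^ i * Y3 ^ j * Z3 ^ l = c3 a * X3 ^ (i - 1) * Y3 ^ (j - 1) * Z3 ^ l * (X3 * Y3)"
      by (cases i; cases j) (simp_all add: ac_simps)
    also have "\<dots> \<in> RJ" by (rule is_ideal_mult[OF rc XY_RJ])
    finally show ?thesis by (intro exI[of _ 0]) (simp add: icong_def c3s)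
  next
    case 2
    have deg: "int dp * int j - int dm * int l = int (dp * dm) * n" using monom 2 by simp
    have "\<exists>t. Y3 ^ j * Z3 ^ l = Y3 ^ (dm' * t) * Z3 ^ (dp' * t) * wt n"
    proof (cases "0 \<le> n")
      case True
      then obtain m where m: "n = int m" by (metis nonneg_int_cases)
      have e: "int dp * (int j - int (dm * m)) = int dm * int l" using deg by (simp add: m algebra_simps)
      then have "0 \<le> int dp * (int j - int (dm * m))" by simp
      then have "int (dm * m) \<le> int j" using dp_pos by (simp add: zero_le_mult_iff)
      then have le: "dm * m \<le> j" by (simp only: of_nat_le_iff)
      then have "int (dp * (j - dm * m)) = int (dm * l)" using e by (simp add: of_nat_diff)
      then have "k * dp' * (j - dm * m) = k * dm' * l" using dp_eq dm_eq by (simp only: of_nat_eq_iff)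
      then obtain t where "j - dm * m = dm' * t" "l = dp' * t" using coprime_multiples[OF coprime' pos] by blast
      then have "j = dm' * t + dm * m" "l = dp' * t" using le by auto
      then show ?thesis using True by (intro exI[of _ t]) (simp add: wt_def m power_add ac_simps)
    next
      case False
      then obtain m where m: "n = - int m" by (metis nonneg_int_cases minus_minus neg_0_le_iff_le linear)
      have e: "int dm * (int l - int (dp * m)) = int dp * int j" using deg by (simp add: m algebra_simps)
      then have "0 \<le> int dm * (int l - int (dp * m))" by simp
      then have "int (dp * m) \<le> int l" using dm_pos by (simp add: zero_le_mult_iff)
      then have le: "dp * m \<le> l" by (simp only: of_nat_le_iff)
      then have "int (dp * j) = int (dm * (l - dp * m))" using e by (simp add: of_nat_diff)
      then have "k * dp' * j = k * dm' * (l - dp * m)" using dp_eq dm_eq by (simp only: of_nat_eq_iff)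
      then obtain t where "j = dm' * t" "l - dp * m = dp' * t" using coprime_multiples[OF coprime' pos] by blast
      then have "j = dm' * t" "l = dp' * t + dp * m" using le by auto
      then show ?thesis using False by (intro exI[of _ t]) (simp add: wt_def m power_add ac_simps)
    qed
    then obtain t where t: "Y3 ^ j * Z3 ^ l = Y3 ^ (dm' * t) * Z3 ^ (dp' * t) * wt n" by blast
    have "icong RJ (c3 a * wt n * (Y3 ^ (dm' * t) * Z3 ^ (dp' * t))) (c3 a * wt n * c3 (P ^ t))"
      by (intro icong_scale[OF rc] yz)
    then show ?thesis using 2 t by (intro exI[of _ "a * P ^ t"]) (simp add: c3s ac_simps)
  next
    case 3
    have deg: "int i + int dm * int l = int dp * int dm * (- n)" using monom 3 by simp
    have "0 < int i + int dm * int l" using 3 by (simp add: add_pos_nonneg)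
    then have "0 < int dp * int dm * (- n)" using deg by simp
    then have "n < 0" by (simp add: zero_less_mult_iff mult_less_0_iff)
    then obtain m where m: "n = - int m" by (metis nonneg_int_cases minus_minus neg_0_le_iff_le less_imp_le)
    have "int i = int dm * (int (dp * m) - int l)" using deg by (simp add: m algebra_simps)
    then have "0 \<le> int dm * (int (dp * m) - int l)" by simp
    then have "int l \<le> int (dp * m)" using dm_pos by (simp add: zero_le_mult_iff)
    then have le: "l \<le> dp * m" by (simp only: of_nat_le_iff)
    define t where "t = dp * m - l"
    have "int i = int (dm * t)" using \<open>int i = _\<close> le by (simp add: t_def of_nat_diff)
    then have i: "i = dm * t" by (simp only: of_nat_eq_iff)
    have l: "t + l = dp * m" using le by (simp add: t_def)
    have "icong RJ (X3 ^ i) ((Z3 * c3 Pm) ^ t)"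
      using icong_RJ[OF icong_power[OF ic S_relations(1), of t]] by (simp add: i power_mult)
    from icong_scale[OF rc this, of "c3 a * Z3 ^ l"]
    have "icong RJ (c3 a * X3 ^ i * Y3 ^ j * Z3 ^ l) (c3 (a * Pm ^ t) * Z3 ^ (t + l))"
      using 3 by (simp add: c3s power_mult_distrib power_add ac_simps)
    then show ?thesis using \<open>n < 0\<close> unfolding l by (auto simp: wt_def m)
  qed
qed

text \<open>Repeated division by \<open>v\<close> or \<open>w\<close> down to degree 0 shows that
  the powers of \<open>y\<close> generate over the base in every multiple of the degree of
  \<open>wt n\<close>.\<close>

lemma e_wt:
  obtains y where "e (wt n) = Poly_Mapping.single (int (dp * dm) * n) y" "y \<noteq> 0"
    "\<And>x M. x \<in> G (int M * (int (dp * dm) * n)) \<Longrightarrow> \<exists>b. x = Fract b 1 * y ^ M"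
proof (cases "0 \<le> n")
  case True
  then obtain m where m: "n = int m" by (metis nonneg_int_cases)
  show thesis
  proof (rule that[of "v ^ (dm * m)"])
    show "e (wt n) = Poly_Mapping.single (int (dp * dm) * n) (v ^ (dm * m))"
      by (simp add: wt_def m rhom_power[OF rhom_e] e_simps single_power ac_simps)
    fix x M assume "x \<in> G (int M * (int (dp * dm) * n))"
    then have "x \<in> G (0 + int (dm * m * M) * int dp)" by (simp add: m ac_simps)
    then have "x / v ^ (dm * m * M) \<in> G 0" by (intro G_div_v_power) auto
    then obtain b where "x / v ^ (dm * m * M) = Fract b 1" by (rule G0E)
    then show "\<exists>b. x = Fract b 1 * (v ^ (dm * m)) ^ M"
      using v by (intro exI[of _ b]) (simp add: field_simps flip: power_mult)
  qed (use v in simp)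
next
  case False
  then obtain m where m: "n = - int m" by (metis nonneg_int_cases minus_minus neg_0_le_iff_le linear)
  show thesis
  proof (rule that[of "w ^ (dp * m)"])
    show "e (wt n) = Poly_Mapping.single (int (dp * dm) * n) (w ^ (dp * m))"
      using False by (simp add: wt_def m rhom_power[OF rhom_e] e_simps single_power ac_simps)
    fix x M assume "x \<in> G (int M * (int (dp * dm) * n))"
    then have "x \<in> G (0 - int (dp * m * M) * int dm)" by (simp add: m ac_simps)
    then have "x / w ^ (dp * m * M) \<in> G 0" by (intro G_div_w_power) auto
    then obtain b where "x / w ^ (dp * m * M) = Fract b 1" by (rule G0E)
    then show "\<exists>b. x = Fract b 1 * (w ^ (dp * m)) ^ M"
      using w by (intro exI[of _ b]) (simp add: field_simps flip: power_mult)
  qed (use w in simp)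
qed

text \<open>Modulo the radical of \<open>J\<close> the relation is \<open>c * wt n\<close>. Applying
  \<open>e\<close> to a power of the difference gives
  \<open>(- c) ^ M * y ^ M = Qp * b * y ^ M\<close>, so \<open>Qp\<close> divides a power of
  \<open>c\<close> in the base, and the term \<open>c * wt n\<close> lies in the radical as
  well.\<close>

lemma kernel_nilpotent_homogeneous:
  assumes p: "p \<in> hom_polys dp dm (int (dp * dm) * n)" and e0: "e p = 0"
  shows "\<exists>N. p ^ N \<in> I"
proof -
  obtain y where y: "e (wt n) = Poly_Mapping.single (int (dp * dm) * n) y" "y \<noteq> 0"
    and yG: "\<And>x M. x \<in> G (int M * (int (dp * dm) * n)) \<Longrightarrow> \<exists>b. x = Fract b 1 * y ^ M" using e_wt by blast
  obtain c where c: "icong RJ p (c3 c * wt n)" using mod_RJ[OF p] by blast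
  then obtain M g where M: "(p - c3 c * wt n) ^ M - c3 Qp * g \<in> I" unfolding icong_def J_def by blast
  have "e ((p - c3 c * wt n) ^ M - c3 Qp * g) = 0" by (rule e_I[OF M])
  then have "(- (base c * e (wt n))) ^ M = base Qp * e g"
    by (simp add: rhom_simps[OF rhom_e] e_simps e0)
  moreover have "(- (base c * e (wt n))) ^ M
    = Poly_Mapping.single (int M * (int (dp * dm) * n)) (Fract ((- c) ^ M) 1 * y ^ M)"
  proof -
    have "- (base c * e (wt n)) = base (- c) * e (wt n)" by (simp add: rhom_uminus[OF rhom_base])
    also have "\<dots> = Poly_Mapping.single (int (dp * dm) * n) (Fract (- c) 1 * y)"
      by (simp add: y base_def mult_single)
    finally show ?thesis by (simp add: single_power power_mult_distrib rhom_power[OF Fract1])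
  qed
  ultimately have "Fract ((- c) ^ M) 1 * y ^ M
      = Poly_Mapping.lookup (base Qp * e g) (int M * (int (dp * dm) * n))"
    by (metis lookup_single_eq)
  also have "\<dots> = Fract Qp 1 * Poly_Mapping.lookup (e g) (int M * (int (dp * dm) * n))"
    by (simp add: base_def lookup_single_times)
  also obtain b where "Poly_Mapping.lookup (e g) (int M * (int (dp * dm) * n)) = Fract b 1 * y ^ M"
    using yG e_in_A[of g] by (force simp: A_def)
  finally have "Fract ((- c) ^ M) 1 * y ^ M = Fract (Qp * b) 1 * y ^ M"
    by (simp only: rhom_mult[OF Fract1] mult.assoc)
  then have cM: "(- c) ^ M = Qp * b" using y(2) by (simp add: Fract1_inj)
  have "(c3 c * wt n) ^ M = (- 1) ^ M * c3 ((- c) ^ M) * wt n ^ M"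
    by (simp add: c3s power_mult_distrib[symmetric])
  also have "\<dots> = c3 Qp * ((- 1) ^ M * c3 b * wt n ^ M)" by (simp add: cM c3s ac_simps)
  also have "\<dots> \<in> J" by (rule Qp_J)
  finally have "c3 c * wt n \<in> RJ" by blast
  then have "p \<in> RJ" using c is_ideal_add[OF rc, of "p - c3 c * wt n" "c3 c * wt n"] by (simp add: icong_def)
  then obtain K g where K: "icong I (p ^ K) (c3 Qp * g)" unfolding icong_def J_def by blast
  obtain r where r: "c3 Qp ^ r * p \<in> I" using Qp_torsion[OF p e0] by blast
  \<comment> \<open>\<open>p ^ K\<close> is congruent to a multiple of \<open>Qp\<close> and
    \<open>Qp ^ r\<close> annihilates \<open>p\<close>; hence the exponent
    \<open>1 + K * r\<close>.\<close>
  have "icong I (p * (p ^ K) ^ r) (p * (c3 Qp * g) ^ r)"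
    by (intro icong_scale[OF ic] icong_power[OF ic] K)
  moreover have "p * (c3 Qp * g) ^ r \<in> I"
    using is_ideal_mult2[OF ic r, of "g ^ r"] by (simp add: power_mult_distrib ac_simps)
  ultimately have "p * (p ^ K) ^ r \<in> I"
    using is_ideal_add[OF ic, of "p * (p ^ K) ^ r - p * (c3 Qp * g) ^ r" "p * (c3 Qp * g) ^ r"]
    by (simp add: icong_def)
  then show ?thesis by (intro exI[of _ "Suc (K * r)"]) (simp add: power_mult)
qed

text \<open>As \<open>e\<close> respects degrees, the components of a kernel element are in the
  kernel. Their powers with exponent \<open>dp * dm\<close> have a degree divisible by
  \<open>dp * dm\<close>, and sums of nilpotents are nilpotent.\<close>

lemma kernel_nilpotent:
  assumes e0: "e p = 0" shows "\<exists>N. p ^ N \<in> I"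
proof -
  note ri = is_ideal_radical[OF ic]
  let ?K = "Poly_Mapping.keys (grade_map dp dm p)"
  have eh: "e (hpart dp dm n p) = 0" for n
  proof -
    have "\<forall>m. \<exists>y. e (hpart dp dm m p) = Poly_Mapping.single m y" using e_hom[OF hpart_in] by blast
    then obtain y where y: "\<And>m. e (hpart dp dm m p) = Poly_Mapping.single m (y m)" by metis
    have "0 = e (\<Sum>m\<in>insert n ?K. hpart dp dm m p)" using e0 by (subst sum_hpart) auto
    also have "\<dots> = (\<Sum>m\<in>insert n ?K. Poly_Mapping.single m (y m))" by (simp add: rhom_sum[OF rhom_e] y)
    finally have "0 = Poly_Mapping.lookup (\<Sum>m\<in>insert n ?K. Poly_Mapping.single m (y m)) n" by simp
    also have "\<dots> = y n" unfolding lookup_sum lookup_single when_def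
      by (subst sum.delta) auto
    finally show ?thesis by (simp add: y)
  qed
  have "hpart dp dm n p \<in> {p. \<exists>N. p ^ N \<in> I}" for n
  proof -
    have "hpart dp dm n p ^ (dp * dm) \<in> hom_polys dp dm (int (dp * dm) * n)"
      by (rule hom_polys_power[OF hpart_in])
    moreover have "e (hpart dp dm n p ^ (dp * dm)) = 0"
      using dp_pos dm_pos by (simp add: rhom_power[OF rhom_e] eh)
    ultimately obtain N where "(hpart dp dm n p ^ (dp * dm)) ^ N \<in> I"
      using kernel_nilpotent_homogeneous by blast
    then show ?thesis by (auto simp: power_mult[symmetric])
  qed
  then have "(\<Sum>n\<in>?K. hpart dp dm n p) \<in> {p. \<exists>N. p ^ N \<in> I}" by (intro is_ideal_sum[OF ri])
  then show ?thesis by (simp add: sum_hpart)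
qed

theorem normalization_B:
  "is_grading (rel_quotient S) (weighted_part S dp dm)"
  "\<exists>\<phi>. (\<forall>p. \<phi> (rel_class S p) = e p) \<and>
     (\<forall>n. \<phi> ` weighted_part S dp dm n \<subseteq> Poly_Mapping.single n ` G n) \<and>
     is_normalization (rel_quotient S) (ring_on A) \<phi>"
proof -
  show "is_grading (rel_quotient S) (weighted_part S dp dm)"
    by (rule is_grading_weighted_part[OF S_homogeneous])
  have T: "is_subring (range e)" by (rule rhom_range[OF rhom_e])
  have b: "base a \<in> range e" for a by (metis e_simps(1) rangeI)
  have uvw: "U \<in> range e" "V \<in> range e" "W \<in> range e" by (metis e_simps rangeI)+
  have fr: "\<exists>p q. e q \<noteq> 0 \<and> a * e q = e p" if a: "a \<in> A" for a
  proof -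
    have "Poly_Mapping.single n x \<in> fracs (range e)" for n x
    proof (cases "0 \<le> n")
      case True
      then obtain m where m: "n = int m" by (metis nonneg_int_cases)
      \<comment> \<open>The exponents are chosen so that \<open>V ^ m * U ^ (m * (dp - 1))\<close>
        has degree \<open>m * dp - m * (dp - 1) = m\<close>; below 0 powers of \<open>U\<close>
        suffice.\<close>
      have "n = int m * int dp - int (m * (dp - 1))"
        using dp_pos by (cases dp) (simp_all add: m algebra_simps)
      then have "V ^ m * U ^ (m * (dp - 1)) = Poly_Mapping.single n (v ^ m * u ^ (m * (dp - 1)))"
        by (simp add: single_power mult_single)
      moreover have "V ^ m * U ^ (m * (dp - 1)) \<in> fracs (range e)"
        using uvw by (intro fracs_base T subring_mult[OF T] subring_power[OF T])
      ultimately have "Poly_Mapping.single n (v ^ m * u ^ (m * (dp - 1))) \<in> fracs (range e)" by simp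
      then show ?thesis using fracs_homogeneous[OF T fracs_base[OF T b], of "v ^ m * u ^ (m * (dp - 1))"] u v
        by simp
    next
      case False
      then obtain m where m: "n = - int m" by (metis nonneg_int_cases minus_minus neg_0_le_iff_le linear)
      have "U ^ m \<in> fracs (range e)" using uvw by (intro fracs_base T subring_power[OF T])
      then have "Poly_Mapping.single n (u ^ m) \<in> fracs (range e)" by (simp add: m single_power)
      then show ?thesis using fracs_homogeneous[OF T fracs_base[OF T b], of "u ^ m"] u by simp
    qed
    then have "a \<in> fracs (range e)" by (rule fracs_singles[OF T])
    then obtain q where q: "q \<in> range e" "q \<noteq> 0" "a * q \<in> range e" by (rule fracsE)
    obtain q' where "q = e q'" using q(1) by blast
    moreover obtain p' where "a * q = e p'" using q(3) by blast
    ultimately show ?thesis using q(2) by metis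
  qed
  have "\<exists>\<phi>. (\<forall>p. \<phi> (rel_class S p) = e p) \<and> is_normalization (rel_quotient S) (ring_on A) \<phi>"
  proof (rule quotient_normalization)
    fix a assume "a \<in> A"
    then show "integral_elem (range e) a"
      using b uvw by (intro A_integral[OF T integral_elem_base[OF T]])
  next
    fix p q n c assume "e q \<noteq> 0" "0 < n" "e p ^ n + (\<Sum>i<n. e (c i) * e p ^ i * e q ^ (n - i)) = 0"
    then show "\<exists>a\<in>A. a * e q = e p"
      by (intro A_integrally_closed[of _ _ n "\<lambda>i. e (c i)"]) (auto simp: e_in_A)
  qed (auto simp: rhom_simps[OF rhom_e] e_S is_subring_A e_in_A intro: kernel_nilpotent fr)
  then obtain \<phi> where \<phi>: "\<forall>p. \<phi> (rel_class S p) = e p" "is_normalization (rel_quotient S) (ring_on A) \<phi>"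
    by blast
  have "\<phi> ` weighted_part S dp dm n \<subseteq> Poly_Mapping.single n ` G n" for n
  proof
    fix x assume "x \<in> \<phi> ` weighted_part S dp dm n"
    then obtain p where p: "p \<in> hom_polys dp dm n" "x = e p" using \<phi>(1) by (auto simp: weighted_part_eq)
    obtain y where "e p = Poly_Mapping.single n y" using e_hom[OF p(1)] by blast
    then show "x \<in> Poly_Mapping.single n ` G n" using e_in_A[of p] p(2) by (auto simp: single_in_A)
  qed
  then show "\<exists>\<phi>. (\<forall>p. \<phi> (rel_class S p) = e p) \<and>
     (\<forall>n. \<phi> ` weighted_part S dp dm n \<subseteq> Poly_Mapping.single n ` G n) \<and>
     is_normalization (rel_quotient S) (ring_on A) \<phi>" using \<phi> by blast
qed

end

section \<open>Cyclic coverings and hypersurfaces\<close>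

text \<open>A Bezout solution is shifted along the kernel direction \<open>(b, a)\<close> until both
  coefficients are natural numbers, since they will be exponents.\<close>

lemma coprime_int_combination:
  fixes a b :: nat
  assumes "coprime a b" "0 < a" "0 < b"
  shows "\<exists>i j. n = int a * int i - int b * int j"
proof -
  have "coprime (int a) (int b)" using assms(1) by simp
  then obtain x y where xy: "x * int a + y * int b = 1"
    using bezout_int[of "int a" "int b"] by auto
  \<comment> \<open>Any \<open>t\<close> dominating both \<open>- n * x\<close> and
    \<open>n * y\<close> works, as \<open>a\<close> and \<open>b\<close> are at least 1.\<close>
  define t where "t = \<bar>n * x\<bar> + \<bar>n * y\<bar>"
  have t: "0 \<le> t" "- (n * x) \<le> t" "n * y \<le> t" by (auto simp: t_def)
  have "t \<le> int b * t" "t \<le> int a * t" using t(1) assms(2,3) by (simp_all add: mult_le_cancel_right1)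
  then have nn: "0 \<le> n * x + int b * t" "0 \<le> int a * t - n * y" using t by linarith+
  have "int a * (n * x + int b * t) - int b * (int a * t - n * y) = n * (x * int a + y * int b)"
    by (simp add: algebra_simps)
  then have "n = int a * (n * x + int b * t) - int b * (int a * t - n * y)" using xy by simp
  then show ?thesis using nn by (metis nonneg_int_cases)
qed

lemma integral_elem_image:
  assumes h: "rhom h" and "integral_elem S a" shows "integral_elem (h ` S) (h a)"
proof -
  obtain n c where n: "0 < n" "\<forall>i<n. c i \<in> S" "a ^ n + (\<Sum>i<n. c i * a ^ i) = 0"
    using assms(2) unfolding integral_elem_def by auto
  have "h a ^ n + (\<Sum>i<n. h (c i) * h a ^ i) = h (a ^ n + (\<Sum>i<n. c i * a ^ i))"
    by (simp add: rhom_simps[OF h] rhom_sum[OF h])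
  then have "h a ^ n + (\<Sum>i<n. h (c i) * h a ^ i) = 0" using n(3) by (simp add: rhom_zero[OF h])
  then show ?thesis unfolding integral_elem_def using n(1,2)
    by (intro exI[of _ n] exI[of _ "\<lambda>i. h (c i)"]) auto
qed

lemma fracs_image:
  assumes h: "rhom h" "\<And>x. h x = 0 \<Longrightarrow> x = 0" and "a \<in> fracs S" shows "h a \<in> fracs (h ` S)"
proof -
  obtain q where "q \<in> S" "q \<noteq> 0" "a * q \<in> S" using assms(3) by (rule fracsE)
  then show ?thesis using h(2)
    by (intro fracsI[of "h q"]) (auto simp flip: rhom_mult[OF h(1)])
qed

lemma fracs_mono: "a \<in> fracs S \<Longrightarrow> S \<subseteq> T \<Longrightarrow> a \<in> fracs T"
  by (auto simp: fracs_def)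

definition noetherian :: "'a::comm_ring_1 itself \<Rightarrow> bool" where
  "noetherian _ \<longleftrightarrow> (\<forall>I::'a set. is_ideal I \<longrightarrow> (\<exists>X. finite X \<and> X \<subseteq> I \<and> I \<subseteq> mspan UNIV X))"

locale dpd_cover = dpd_relations +
  fixes z :: 'a
  assumes z_root: "z ^ k = 1" and z_primitive: "\<And>j. 0 < j \<Longrightarrow> j < k \<Longrightarrow> z ^ j \<noteq> 1"
begin

text \<open>The character \<open>n \<mapsto> z ^ n\<close> of the degrees. Reduction modulo
  \<open>k\<close> replaces negative exponents, because the base ring has no inverse
  operation.\<close>

definition chi :: "int \<Rightarrow> 'a" where
  "chi n = z ^ nat (n mod int k)"

lemma z_mod: "z ^ (m mod k) = z ^ m"
proof -
  have "z ^ m = z ^ (m mod k + k * (m div k))" by simp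
  also have "\<dots> = z ^ (m mod k)" by (simp only: power_add power_mult z_root power_one mult_1_right)
  finally show ?thesis by simp
qed

lemma chi_int: "chi (int m) = z ^ m"
  unfolding chi_def by (simp add: z_mod flip: zmod_int)

lemma chi_add: "chi (a + b) = chi a * chi b"
proof -
  obtain m n where mn: "a mod int k = int m" "b mod int k = int n"
    using pos(1) by (metis of_nat_0_less_iff nonneg_int_cases pos_mod_sign)
  have "chi (a + b) = chi (int m + int n)" unfolding chi_def by (simp add: mod_add_eq flip: mn)
  also have "\<dots> = z ^ (m + n)" using chi_int[of "m + n"] by simp
  finally show ?thesis by (simp add: chi_def mn power_add)
qed

lemma chi_eq_1: "chi n = 1 \<longleftrightarrow> int k dvd n"
proof -
  have "nat (n mod int k) < k" using pos(1) by (simp add: nat_less_iff)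
  then have "chi n = 1 \<longleftrightarrow> nat (n mod int k) = 0"
    unfolding chi_def using z_primitive[of "nat (n mod int k)"] by (cases "nat (n mod int k) = 0") auto
  also have "\<dots> \<longleftrightarrow> n mod int k = 0"
    using pos(1) pos_mod_sign[of "int k" n] by linarith
  finally show ?thesis by (simp add: dvd_eq_mod_eq_0)
qed

lemma chi_power: "chi n ^ j = chi (int j * n)"
proof (induction j)
  case 0
  show ?case using chi_eq_1[of 0] by simp
next
  case (Suc j)
  then show ?case using chi_add[of n "int j * n"] by (simp add: algebra_simps)
qed

lemma chi_nonzero: "chi n \<noteq> 0"
  using chi_power[of n k] chi_eq_1[of "int k * n"] pos(1) by (auto simp: power_0_left)

definition sigma :: "(int \<Rightarrow>\<^sub>0 'a fract) \<Rightarrow> (int \<Rightarrow>\<^sub>0 'a fract)" where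
  "sigma = Poly_Mapping.mapp (\<lambda>n x. Fract (chi n) 1 * x)"

lemma lookup_sigma: "Poly_Mapping.lookup (sigma F) n = Fract (chi n) 1 * Poly_Mapping.lookup F n"
  by (simp add: sigma_def lookup_mapp when_def in_keys_iff)

lemma keys_sigma: "Poly_Mapping.keys (sigma F) = Poly_Mapping.keys F"
  by (auto simp: in_keys_iff lookup_sigma Fract1_eq_0 chi_nonzero)

lemma sigma_add: "sigma (F + H) = sigma F + sigma H"
  by (rule poly_mapping_eqI) (simp add: lookup_sigma lookup_add distrib_left)

lemma sigma_mult: "sigma (F * H) = sigma F * sigma H"
proof (rule poly_mapping_eqI)
  fix n
  have "Fract (chi n) 1 * (x * y) = (Fract (chi j) 1 * x) * (Fract (chi (n - j)) 1 * y)" for j x y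
  proof -
    have "Fract (chi n) 1 = Fract (chi j) 1 * Fract (chi (n - j)) 1"
      using chi_add[of j "n - j"] by simp
    then show ?thesis by (simp only: ac_simps)
  qed
  then show "Poly_Mapping.lookup (sigma (F * H)) n = Poly_Mapping.lookup (sigma F * sigma H) n"
    by (simp only: lookup_sigma lookup_times keys_sigma sum_distrib_left)
qed

lemma sigma_one: "sigma 1 = 1"
  by (rule poly_mapping_eqI) (simp add: lookup_sigma lookup_one when_def chi_eq_1[of 0, simplified] One_fract_def)

lemma sigma_in_A: "F \<in> A \<Longrightarrow> sigma F \<in> A"
  using G_mult[OF Fract_G0] by (force simp: A_def lookup_sigma)

lemma lookup_sigma_power: "Poly_Mapping.lookup ((sigma ^^ j) F) n = Fract (chi (int j * n)) 1 * Poly_Mapping.lookup F n"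
proof (induction j)
  case 0
  show ?case by (simp add: chi_eq_1[of 0, simplified] rhom_one[OF Fract1])
next
  case (Suc j)
  have "chi (int (Suc j) * n) = chi n * chi (int j * n)" using chi_add[of n "int j * n"] by (simp add: algebra_simps)
  then show ?case by (simp add: lookup_sigma Suc mult.assoc[symmetric])
qed

lemma sigma_power_k: "(sigma ^^ k) F = F"
proof (rule poly_mapping_eqI)
  fix n
  have "chi (int k * n) = 1" by (simp add: chi_eq_1)
  then show "Poly_Mapping.lookup ((sigma ^^ k) F) n = Poly_Mapping.lookup F n"
    unfolding lookup_sigma_power by (simp add: rhom_one[OF Fract1])
qed

text \<open>\<open>U\<close> is a nonzero element of degree -1, a generator of the group of degrees,
  so it is fixed only by powers divisible by \<open>k\<close>.\<close>

lemma sigma_power_nontrivial: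
  assumes "0 < j" "j < k" shows "(sigma ^^ j) U \<noteq> U"
proof
  assume "(sigma ^^ j) U = U"
  then have "Fract (chi (int j * - 1)) 1 * u = 1 * u"
    using lookup_sigma_power[of j U "- 1"] by simp
  then have "Fract (chi (int j * - 1)) 1 = Fract 1 1" using u(2) by (simp only: mult_cancel_right rhom_one[OF Fract1]) simp
  then have "int k dvd int j * - 1" by (simp only: Fract1_inj chi_eq_1)
  then have "k dvd j" by simp
  then show False using assms by (simp add: nat_dvd_not_less)
qed

lemma sigma_power_in_A: "F \<in> A \<Longrightarrow> (sigma ^^ j) F \<in> A"
  by (induction j) (auto intro: sigma_in_A)

lemma sigma_iso: "sigma \<in> ring_iso (ring_on A) (ring_on A)"
proof (rule ring_iso_memI)
  obtain k' where k': "k = Suc k'" using pos(1) by (cases k) auto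
  have *: "sigma ((sigma ^^ k') F) = F" "(sigma ^^ k') (sigma F) = F" for F
    using sigma_power_k[of F] by (simp_all add: k' funpow_swap1)
  show "bij_betw sigma (carrier (ring_on A)) (carrier (ring_on A))"
    by (rule bij_betw_byWitness[where f' = "sigma ^^ k'"])
      (auto simp: * sigma_in_A sigma_power_in_A)
qed (auto simp: sigma_in_A sigma_add sigma_mult sigma_one)

definition Ak :: "(int \<Rightarrow>\<^sub>0 'a fract) set" where
  "Ak = {F \<in> A. sigma F = F}"

lemma fixed_iff: "sigma F = F \<longleftrightarrow> (\<forall>n. Poly_Mapping.lookup F n \<noteq> 0 \<longrightarrow> int k dvd n)"
proof -
  have "Fract (chi n) 1 * x = x \<longleftrightarrow> x = 0 \<or> int k dvd n" for n x
  proof -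
    have "Fract (chi n) 1 * x = x \<longleftrightarrow> x = 0 \<or> Fract (chi n) 1 = Fract 1 1"
      by (simp only: rhom_one[OF Fract1] mult_cancel_right1) auto
    then show ?thesis by (simp only: Fract1_inj chi_eq_1)
  qed
  then show ?thesis by (auto simp: poly_mapping_eq_iff fun_eq_iff lookup_sigma)
qed

lemma single_Ak: "x \<in> G n \<Longrightarrow> int k dvd n \<Longrightarrow> Poly_Mapping.single n x \<in> Ak"
  by (auto simp: Ak_def single_in_A fixed_iff lookup_single when_def split: if_splits)

lemma is_subring_Ak: "is_subring Ak"
proof (rule is_subringI)
  fix x assume x: "x \<in> Ak"
  have "sigma (- x) + sigma x = 0" using sigma_add[of "- x" x]
    by (simp add: poly_mapping_eq_iff fun_eq_iff lookup_sigma lookup_add)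
  then show "- x \<in> Ak" using x subring_uminus[OF is_subring_A]
    by (auto simp: Ak_def eq_neg_iff_add_eq_0)
qed (auto simp: Ak_def sigma_one sigma_add sigma_mult subring_one[OF is_subring_A]
    subring_add[OF is_subring_A] subring_mult[OF is_subring_A])

lemma Ak_members: "base a \<in> Ak" "V \<in> Ak" "W \<in> Ak"
  using v w by (auto simp: base_def Fract_G0 dp_eq dm_eq intro!: single_Ak)

text \<open>Multiplication by a power of \<open>u\<close> or \<open>up\<close> embeds
  \<open>G n\<close> as an ideal of the noetherian base, so each \<open>G n\<close> is finitely
  generated. Degrees outside \<open>- dm < n < dp\<close> reduce to these by division by
  \<open>v\<close> or \<open>w\<close>, which are invariant.\<close>

lemma Ak_finite_generators:
  assumes N: "noetherian TYPE('a)"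
  shows "\<exists>X. finite X \<and> X \<subseteq> A \<and> A \<subseteq> mspan Ak X"
proof -
  have fg: "\<exists>X. finite X \<and> X \<subseteq> G n \<and> G n \<subseteq> mspan (range (\<lambda>a. Fract a 1)) X" for n
  proof -
    obtain y where y: "y \<in> G (- n)" "y \<noteq> 0"
    proof (cases "0 \<le> n")
      case True
      then show thesis using that[of "u ^ nat n"] G_power[OF u(1), of "nat n"] u(2) by simp
    next
      case False
      then show thesis using that[of "up ^ nat (- n)"] G_power[OF up(1), of "nat (- n)"] up(2) by simp
    qed
    define I where "I = {a. Fract a 1 / y \<in> G n}"
    have "is_ideal I" unfolding is_ideal_def
    proof (intro conjI ballI allI)
      show "0 \<in> I" by (simp add: I_def rhom_zero[OF Fract1] G_zero)
      fix a b assume "a \<in> I" "b \<in> I"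
      then show "a + b \<in> I" using G_add[of "Fract a 1 / y" n "Fract b 1 / y"]
        by (simp add: I_def flip: add_divide_distrib)
    next
      fix a b assume "b \<in> I"
      then show "a * b \<in> I" using G_mult[OF Fract_G0[of a], of "Fract b 1 / y" n]
        by (simp add: I_def)
    qed
    then obtain X where X: "finite X" "X \<subseteq> I" "I \<subseteq> mspan UNIV X" using N unfolding noetherian_def by blast
    have span: "Fract a 1 / y \<in> mspan (range (\<lambda>a. Fract a 1)) ((\<lambda>a. Fract a 1 / y) ` X)" if "a \<in> mspan UNIV X" for a
      using that
    proof induction
      case mspan_zero
      show ?case by (simp add: rhom_zero[OF Fract1] mspan.mspan_zero)
    next
      case (mspan_step a c m)
      have "Fract (a + c * m) 1 / y = Fract a 1 / y + Fract c 1 * (Fract m 1 / y)"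
        by (simp only: rhom_add[OF Fract1] rhom_mult[OF Fract1] add_divide_distrib times_divide_eq_right)
      moreover have "Fract a 1 / y + Fract c 1 * (Fract m 1 / y)
          \<in> mspan (range (\<lambda>a. Fract a 1)) ((\<lambda>a. Fract a 1 / y) ` X)"
        by (rule mspan.mspan_step) (use mspan_step in auto)
      ultimately show ?case by (simp only:)
    qed
    have "x \<in> mspan (range (\<lambda>a. Fract a 1)) ((\<lambda>a. Fract a 1 / y) ` X)" if x: "x \<in> G n" for x
    proof -
      have "x * y \<in> G 0" using G_mult[OF x y(1)] by simp
      then obtain a where "x * y = Fract a 1" by (rule G0E)
      then have a: "x = Fract a 1 / y" using y(2) by (simp add: field_simps)
      then have "a \<in> I" using x by (simp add: I_def)
      then show ?thesis unfolding a using X(3) by (intro span) auto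
    qed
    then show ?thesis using X(1,2) by (intro exI[of _ "(\<lambda>a. Fract a 1 / y) ` X"]) (auto simp: I_def)
  qed
  then obtain X where X: "\<And>n. finite (X n)" "\<And>n. X n \<subseteq> G n" "\<And>n. G n \<subseteq> mspan (range (\<lambda>a. Fract a 1)) (X n)"
    by metis
  define Y where "Y = (\<Union>n\<in>{- int dm<..<int dp}. Poly_Mapping.single n ` X n)"
  have YA: "Y \<subseteq> A" using subsetD[OF X(2)] by (auto simp: Y_def single_in_A)
  have small: "Poly_Mapping.single n x \<in> mspan Ak Y" if "- int dm < n" "n < int dp" "x \<in> G n" for n x
  proof -
    have "x \<in> mspan (range (\<lambda>a. Fract a 1)) (X n)" using subsetD[OF X(3) that(3)] .
    then show ?thesis
    proof induction
      case mspan_zero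
      show ?case by (simp add: mspan.mspan_zero)
    next
      case (mspan_step a c m)
      then obtain b where b: "c = Fract b 1" by blast
      have "Poly_Mapping.single n (a + c * m) = Poly_Mapping.single n a + base b * Poly_Mapping.single n m"
        by (simp add: single_add base_def mult_single b)
      moreover have "Poly_Mapping.single n m \<in> Y" using mspan_step that by (auto simp: Y_def)
      ultimately show ?case
        using mspan.mspan_step[OF mspan_step.IH Ak_members(1)[of b]] by (simp only:)
    qed
  qed
  have "Poly_Mapping.single n x \<in> mspan Ak Y" if "x \<in> G n" for n x
    using that
  proof (induction "nat \<bar>n\<bar>" arbitrary: n x rule: less_induct)
    case less
    consider "int dp \<le> n" | "n \<le> - int dm" | "- int dm < n" "n < int dp" by linarith
    then show ?case
    proof cases
      case 1
      have "x / v \<in> G (n - int dp)" using 1 less.prems by (intro G_div_v) auto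
      then have "Poly_Mapping.single (n - int dp) (x / v) \<in> mspan Ak Y"
        using 1 dp_pos by (intro less.hyps) auto
      from mspan_scale[OF is_subring_Ak this Ak_members(2)] show ?thesis using v by (simp add: mult_single)
    next
      case 2
      have "x / w \<in> G (n + int dm)" using 2 less.prems by (intro G_div_w) auto
      then have "Poly_Mapping.single (n + int dm) (x / w) \<in> mspan Ak Y"
        using 2 dm_pos by (intro less.hyps) auto
      from mspan_scale[OF is_subring_Ak this Ak_members(3)] show ?thesis using w by (simp add: mult_single)
    next
      case 3
      then show ?thesis using small less.prems by blast
    qed
  qed
  then have "(\<Sum>n\<in>Poly_Mapping.keys F. Poly_Mapping.single n (Poly_Mapping.lookup F n)) \<in> mspan Ak Y" if "F \<in> A" for F
    using that by (intro mspan_sum) (auto simp: A_def)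
  then have "A \<subseteq> mspan Ak Y" by (auto simp flip: A_sum_singles)
  moreover have "finite Y" using X(1) by (auto simp: Y_def)
  ultimately show ?thesis using YA by blast
qed

lemma cyclic_covering:
  assumes N: "noetherian TYPE('a)" and h: "h \<in> ring_iso R (ring_on Ak)"
  shows "cyclic_branched_covering R (ring_on A) h k"
  unfolding cyclic_branched_covering_def
proof (intro conjI bexI)
  have hc: "h ` carrier R = Ak" "inj_on h (carrier R)"
    using h by (auto simp: ring_iso_def bij_betw_def)
  have AkA: "Ak \<subseteq> A" by (auto simp: Ak_def)
  show "h \<in> Ring.ring_hom R (ring_on A)"
    using h AkA unfolding ring_iso_def Ring.ring_hom_def by auto
  show "inj_on h (carrier R)" by (rule hc)
  obtain X where X: "finite X" "X \<subseteq> A" "A \<subseteq> mspan Ak X" using Ak_finite_generators[OF N] by blast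
  have "\<exists>c. c ` X \<subseteq> carrier R \<and> a = (\<Oplus>\<^bsub>ring_on A\<^esub>f\<in>X. h (c f) \<otimes>\<^bsub>ring_on A\<^esub> f)" if a: "a \<in> A" for a
  proof -
    obtain c where c: "\<forall>f\<in>X. c f \<in> Ak" "a = (\<Sum>f\<in>X. c f * f)"
      using mspan_finite[OF is_subring_Ak X(1), of a] X(3) a by blast
    have "\<forall>f\<in>X. \<exists>r. r \<in> carrier R \<and> h r = c f" using c(1) hc(1) by (metis imageE)
    then obtain r where r: "\<forall>f\<in>X. r f \<in> carrier R \<and> h (r f) = c f" by metis
    have "finsum (ring_on A) (\<lambda>f. h (r f) \<otimes>\<^bsub>ring_on A\<^esub> f) X = (\<Sum>f\<in>X. h (r f) \<otimes>\<^bsub>ring_on A\<^esub> f)"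
      using r c(1) X(2) AkA by (intro finsum_ring_on is_subring_A) (auto intro!: subring_mult[OF is_subring_A])
    also have "\<dots> = a" unfolding c(2) using r by (intro sum.cong) auto
    finally show ?thesis using r by (intro exI[of _ r]) auto
  qed
  then show "\<exists>F. finite F \<and> F \<subseteq> carrier (ring_on A) \<and> (\<forall>a\<in>carrier (ring_on A). \<exists>c. c ` F \<subseteq> carrier R \<and>
      a = (\<Oplus>\<^bsub>ring_on A\<^esub>f\<in>F. h (c f) \<otimes>\<^bsub>ring_on A\<^esub> f))"
    using X(1,2) by (intro exI[of _ X]) simp
  show "sigma \<in> ring_iso (ring_on A) (ring_on A)" by (rule sigma_iso)
  show "\<forall>a\<in>carrier (ring_on A). (sigma ^^ k) a = a" by (simp add: sigma_power_k)
  show "\<forall>j. 0 < j \<and> j < k \<longrightarrow> (\<exists>a\<in>carrier (ring_on A). (sigma ^^ j) a \<noteq> a)"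
    using sigma_power_nontrivial UVW_in_A(1) by auto
  show "h ` carrier R = {a \<in> carrier (ring_on A). sigma a = a}" by (simp add: hc Ak_def)
qed (rule pos)

text \<open>In \<open>R[v\<^sub>+, v\<^sub>-]\<close> with \<open>t = v\<^sub>+\<^sup>a v\<^sub>-\<^sup>b\<close>, the monomials of a given degree are the products of
  powers of \<open>t\<close> with the one of least \<open>v\<^sub>+\<close>-exponent.\<close>

definition e2 :: "('r::comm_ring_1 \<Rightarrow> 'a) \<Rightarrow> 'r poly poly \<Rightarrow> int \<Rightarrow>\<^sub>0 'a fract" where
  "e2 r = eval2 (\<lambda>x. base (r x)) V W"

definition t_subst :: "'r::comm_ring_1 poly \<Rightarrow> 'r poly poly" where
  "t_subst = ev const2 (X2 ^ dm' * Y2 ^ dp')"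

context
  fixes r :: "'r::comm_ring_1 \<Rightarrow> 'a"
  assumes r: "rhom r"
begin

lemma rhom_base_r: "rhom (\<lambda>x. base (r x))" by (rule rhom_comp[OF rhom_base r])
lemma rhom_e2: "rhom (e2 r)" unfolding e2_def by (rule rhom_eval2[OF rhom_base_r])
lemma rhom_t_subst: "rhom (t_subst :: 'r poly \<Rightarrow> _)" unfolding t_subst_def by (rule rhom_ev[OF rhom_const2])

lemma e2_simps: "e2 r (const2 a) = base (r a)" "e2 r X2 = V" "e2 r Y2 = W"
  unfolding e2_def by (rule eval2_simps[OF rhom_base_r])+

lemma e2_in_Ak: "e2 r p \<in> Ak"
  unfolding e2_def eval2_altdef[OF rhom_base_r]
  by (intro subring_sum[OF is_subring_Ak] subring_mult[OF is_subring_Ak] subring_power[OF is_subring_Ak] Ak_members)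

lemma e2_t_subst: "e2 r (t_subst F) = base (ev r P F)"
proof -
  have "e2 r (t_subst F) = ev (\<lambda>a. e2 r (t_subst [:a:])) (e2 r (t_subst [:0, 1:])) F"
    by (rule ev_unique[OF rhom_comp[OF rhom_e2 rhom_t_subst]])
  also have "(\<lambda>a. e2 r (t_subst [:a:])) = (\<lambda>a. base (ev r P [:a:]))"
    by (simp add: t_subst_def ev_const[OF rhom_const2] ev_const[OF r] e2_simps)
  also have "e2 r (t_subst [:0, 1:]) = base (ev r P [:0, 1:])"
    by (simp add: t_subst_def ev_X[OF rhom_const2] ev_X[OF r] rhom_simps[OF rhom_e2] e2_simps UVW_relations)
  also have "ev (\<lambda>a. base (ev r P [:a:])) (base (ev r P [:0, 1:])) F = base (ev r P F)"
    by (rule ev_unique[symmetric, OF rhom_comp[OF rhom_base rhom_ev[OF r]]])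
  finally show ?thesis .
qed

definition jmin :: "int \<Rightarrow> nat" where
  "jmin n = (LEAST j. \<exists>l. n = int dp * int j - int dm * int l)"

definition lmin :: "int \<Rightarrow> nat" where
  "lmin n = (SOME l. n = int dp * int (jmin n) - int dm * int l)"

lemma monomial_min:
  assumes "n = int dp * int j - int dm * int l"
  shows "n = int dp * int (jmin n) - int dm * int (lmin n)"
    and "\<exists>t. j = jmin n + dm' * t \<and> l = lmin n + dp' * t"
proof -
  have "\<exists>l. n = int dp * int (jmin n) - int dm * int l"
    unfolding jmin_def by (rule LeastI[of _ j]) (use assms in blast)
  then show 1: "n = int dp * int (jmin n) - int dm * int (lmin n)"
    unfolding lmin_def by (rule someI_ex)
  have le: "jmin n \<le> j" unfolding jmin_def by (rule Least_le) (use assms in blast)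
  have e: "int dp * (int j - int (jmin n)) = int dm * (int l - int (lmin n))"
    using 1 assms unfolding right_diff_distrib by linarith
  have "0 \<le> int dm * (int l - int (lmin n))" using le unfolding e[symmetric] by simp
  then have le2: "lmin n \<le> l" using dm_pos by (simp add: zero_le_mult_iff)
  have "int (dp * (j - jmin n)) = int (dm * (l - lmin n))" using e le le2 by (simp add: of_nat_diff)
  then have "k * dp' * (j - jmin n) = k * dm' * (l - lmin n)" using dp_eq dm_eq by (simp only: of_nat_eq_iff)
  then obtain t where "j - jmin n = dm' * t" "l - lmin n = dp' * t" using coprime_multiples[OF coprime' pos] by blast
  then show "\<exists>t. j = jmin n + dm' * t \<and> l = lmin n + dp' * t" using le le2 by (intro exI[of _ t]) auto
qed

lemma poly2_normal_form:
  fixes p :: "'r poly poly"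
  shows "\<exists>N F. finite N \<and> (\<forall>n\<in>N. n = int dp * int (jmin n) - int dm * int (lmin n)) \<and>
    p = (\<Sum>n\<in>N. t_subst (F n) * (X2 ^ jmin n * Y2 ^ lmin n))" (is "?NF p")
proof -
  note ts = rhom_simps[OF rhom_t_subst]
  have 0: "?NF 0" by (intro exI[of _ "{}"]) simp
  have add: "?NF (p + q)" if p: "?NF p" and q: "?NF q" for p q
  proof -
    obtain N F where N: "finite N" "\<forall>n\<in>N. n = int dp * int (jmin n) - int dm * int (lmin n)"
      "p = (\<Sum>n\<in>N. t_subst (F n) * (X2 ^ jmin n * Y2 ^ lmin n))" using p by blast
    obtain N' F' where N': "finite N'" "\<forall>n\<in>N'. n = int dp * int (jmin n) - int dm * int (lmin n)"
      "q = (\<Sum>n\<in>N'. t_subst (F' n) * (X2 ^ jmin n * Y2 ^ lmin n))" using q by blast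
    define H where "H n = (if n \<in> N then F n else 0)" for n
    define H' where "H' n = (if n \<in> N' then F' n else 0)" for n
    have "p = (\<Sum>n\<in>N \<union> N'. t_subst (H n) * (X2 ^ jmin n * Y2 ^ lmin n))"
      unfolding N(3) using N(1) N'(1) by (intro sum.mono_neutral_cong_left) (auto simp: H_def ts)
    moreover have "q = (\<Sum>n\<in>N \<union> N'. t_subst (H' n) * (X2 ^ jmin n * Y2 ^ lmin n))"
      unfolding N'(3) using N(1) N'(1) by (intro sum.mono_neutral_cong_left) (auto simp: H'_def ts)
    ultimately have "p + q = (\<Sum>n\<in>N \<union> N'. t_subst (H n + H' n) * (X2 ^ jmin n * Y2 ^ lmin n))"
      by (simp add: ts distrib_right sum.distrib)
    then show ?thesis using N(1,2) N'(1,2)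
      by (intro exI[of _ "N \<union> N'"] exI[of _ "\<lambda>n. H n + H' n"]) auto
  qed
  have sum: "?NF (sum f B)" if "\<And>i. i \<in> B \<Longrightarrow> ?NF (f i)" for f and B :: "nat set"
    using that by (induction B rule: infinite_finite_induct) (simp_all only: sum.infinite sum.empty sum.insert 0 add insertI1 insertI2 not_False_eq_True)
  have "?NF (const2 a * X2 ^ j * Y2 ^ l)" for a j l
  proof -
    define n where "n = int dp * int j - int dm * int l"
    obtain t where t: "j = jmin n + dm' * t" "l = lmin n + dp' * t" using monomial_min(2)[OF n_def] by blast
    have "t_subst (Polynomial.monom a t) = const2 a * (X2 ^ dm' * Y2 ^ dp') ^ t"
      by (simp add: t_subst_def ev_monom[OF rhom_const2])
    then have "const2 a * X2 ^ j * Y2 ^ l = t_subst (Polynomial.monom a t) * (X2 ^ jmin n * Y2 ^ lmin n)"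
      by (simp add: t power_add power_mult power_mult_distrib ac_simps)
    then show ?thesis using monomial_min(1)[OF n_def]
      by (intro exI[of _ "{n}"] exI[of _ "\<lambda>_. Polynomial.monom a t"]) simp
  qed
  then have "?NF (\<Sum>j\<le>Polynomial.degree p. \<Sum>i\<le>Polynomial.degree (Polynomial.coeff p j).
      const2 (Polynomial.coeff (Polynomial.coeff p j) i) * X2 ^ i * Y2 ^ j)" by (intro sum)
  then show ?thesis by (simp only: poly2_expand[of p, symmetric])
qed

text \<open>In the normal form distinct summands have distinct degrees, and each is mapped to
  \<open>ev r P (F n)\<close> times a nonzero monomial. Hence every \<open>F n\<close> is a relation
  of \<open>P\<close> over the coefficient ring.\<close>

lemma e2_kernel:
  assumes L: "is_ideal L" and sub: "\<And>F. ev r P F = 0 \<Longrightarrow> t_subst F \<in> L" and p: "e2 r p = 0"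
  shows "p \<in> L"
proof -
  obtain N F where N: "finite N" "\<forall>n\<in>N. n = int dp * int (jmin n) - int dm * int (lmin n)"
    and pF: "p = (\<Sum>n\<in>N. t_subst (F n) * (X2 ^ jmin n * Y2 ^ lmin n))"
    using poly2_normal_form[of p] by blast
  have "e2 r (t_subst (F n) * (X2 ^ jmin n * Y2 ^ lmin n))
      = Poly_Mapping.single n (Fract (ev r P (F n)) 1 * (v ^ jmin n * w ^ lmin n))" if "n \<in> N" for n
  proof -
    have n: "int (jmin n) * int dp + int (lmin n) * - int dm = n" using N(2) that by (auto simp: algebra_simps)
    have "e2 r (t_subst (F n) * (X2 ^ jmin n * Y2 ^ lmin n))
      = Poly_Mapping.single (int (jmin n) * int dp + int (lmin n) * - int dm) (Fract (ev r P (F n)) 1 * (v ^ jmin n * w ^ lmin n))"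
      by (simp add: rhom_simps[OF rhom_e2] e2_simps e2_t_subst base_def single_power mult_single)
    then show ?thesis unfolding n .
  qed
  then have s: "e2 r p = (\<Sum>n\<in>N. Poly_Mapping.single n (Fract (ev r P (F n)) 1 * (v ^ jmin n * w ^ lmin n)))"
    unfolding pF rhom_sum[OF rhom_e2] by (intro sum.cong) auto
  have "ev r P (F n) = 0" if n: "n \<in> N" for n
  proof -
    have "0 = Poly_Mapping.lookup (e2 r p) n" using p by simp
    also have "\<dots> = Fract (ev r P (F n)) 1 * (v ^ jmin n * w ^ lmin n)"
      unfolding s lookup_sum lookup_single when_def using N(1) n by (subst sum.delta) auto
    finally show ?thesis using v w by (simp add: Fract1_eq_0)
  qed
  then show ?thesis unfolding pF by (intro is_ideal_sum[OF L] is_ideal_mult2[OF L] sub)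
qed

text \<open>The coefficient ring \<open>'r\<close> is a parameter: it is the coordinate ring itself
  in (b) and the polynomial ring in \<open>s\<close> in (c). Coprimality of \<open>dp'\<close> and
  \<open>dm'\<close> yields a monomial in \<open>V\<close> and \<open>W\<close> in each degree
  divisible by \<open>k\<close>, which determines the fraction field.\<close>

lemma normalization_two_variables:
  fixes S0 :: "'r poly poly set"
  assumes e_S: "\<And>s. s \<in> S0 \<Longrightarrow> e2 r s = 0"
    and ker: "\<And>F. ev r P F = 0 \<Longrightarrow> t_subst F \<in> gen_ideal S0"
    and int: "\<And>a. integral_elem (range (e2 r)) (base a)"
    and fr: "\<And>a. base a \<in> fracs (range (e2 r))"
  shows "\<exists>\<phi>. (\<forall>p. \<phi> (rel_class S0 p) = e2 r p) \<and> is_normalization (rel_quotient S0) (ring_on Ak) \<phi>"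
proof (rule quotient_normalization)
  let ?T = "range (e2 r)"
  have T: "is_subring ?T" by (rule rhom_range[OF rhom_e2])
  have vw: "V \<in> ?T" "W \<in> ?T" by (metis e2_simps rangeI)+
  have AkA: "Ak \<subseteq> A" by (auto simp: Ak_def)
  show "is_subring Ak" by (rule is_subring_Ak)
  show "range (e2 r) \<subseteq> Ak" using e2_in_Ak by blast
  show "\<exists>n. p ^ n \<in> gen_ideal S0" if "e2 r p = 0" for p
    using e2_kernel[OF is_ideal_gen ker that] by (intro exI[of _ 1]) simp
  fix a assume a: "a \<in> Ak"
  show "integral_elem ?T a" using a AkA by (intro A_integral[OF T int vw]) auto
  have "a \<in> fracs ?T"
  proof (rule fracs_singles[OF T])
    fix n assume "Poly_Mapping.lookup a n \<noteq> 0"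
    then obtain n' where n': "n = int k * n'" using a by (auto simp: Ak_def fixed_iff)
    obtain i j where ij: "n' = int dp' * int i - int dm' * int j"
      using coprime_int_combination[OF coprime' pos(2,3)] by blast
    have "n = int i * int dp + int j * - int dm" by (simp add: n' ij dp_eq dm_eq algebra_simps)
    then have "V ^ i * W ^ j = Poly_Mapping.single n (v ^ i * w ^ j)" by (simp add: single_power mult_single)
    moreover have "V ^ i * W ^ j \<in> fracs ?T"
      using vw by (intro fracs_base T subring_mult[OF T] subring_power[OF T])
    ultimately have "Poly_Mapping.single n (v ^ i * w ^ j) \<in> fracs ?T" by simp
    then show "Poly_Mapping.single n (Poly_Mapping.lookup a n) \<in> fracs ?T"
      using fracs_homogeneous[OF T fr, of "v ^ i * w ^ j"] v w by simp
  qed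
  then obtain q where q: "q \<in> ?T" "q \<noteq> 0" "a * q \<in> ?T" by (rule fracsE)
  obtain q' where "q = e2 r q'" using q(1) by blast
  moreover obtain p' where "a * q = e2 r p'" using q(3) by blast
  ultimately show "\<exists>p q. e2 r q \<noteq> 0 \<and> a * e2 r q = e2 r p" using q(2) by metis
next
  have AkA: "Ak \<subseteq> A" by (auto simp: Ak_def)
  fix p q n c assume h: "e2 r q \<noteq> 0" "0 < n" "e2 r p ^ n + (\<Sum>i<n. e2 r (c i) * e2 r p ^ i * e2 r q ^ (n - i)) = 0"
  have eA: "e2 r p \<in> A" for p using e2_in_Ak AkA by blast
  obtain f where f: "f \<in> A" "f * e2 r q = e2 r p"
    using A_integrally_closed[of "e2 r p" "e2 r q" n "\<lambda>i. e2 r (c i)"] h eA by blast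
  have s: "sigma (e2 r p) = e2 r p" for p using e2_in_Ak by (auto simp: Ak_def)
  \<comment> \<open>The quotient found in \<open>A\<close> is invariant because numerator and
    denominator are.\<close>
  have "sigma f * e2 r q = f * e2 r q" using sigma_mult[of f "e2 r q"] f(2) s by metis
  then have "sigma f = f" using h(1) by (metis mult_right_cancel)
  then show "\<exists>a\<in>Ak. a * e2 r q = e2 r p" using f by (auto simp: Ak_def)
qed (simp_all add: rhom_simps[OF rhom_e2] e_S)

end

text \<open>By the factor theorem the kernel of \<open>t \<mapsto> P\<close> is generated by
  \<open>t - P\<close>, and substituting the product of the two variables for \<open>t\<close> turns
  this generator into the equation of the hypersurface.\<close>

theorem normalization_H:
  assumes N: "noetherian TYPE('a)"
  defines "S0 \<equiv> hypersurface_relation dp' dm' P"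
  shows "primeideal (nilradical (rel_quotient S0)) (rel_quotient S0)"
    and "\<exists>\<psi>. (\<forall>p. \<psi> (normalization_map (rel_quotient S0) (rel_class S0 p)) = eval2 base V W p) \<and>
      cyclic_branched_covering (normalization (rel_quotient S0)) (ring_on A) \<psi> k"
proof -
  have id: "rhom (\<lambda>x::'a. x)" by (rule rhom_id)
  have e2: "e2 (\<lambda>x. x) = eval2 base V W" by (simp add: e2_def)
  have T: "is_subring (range (e2 (\<lambda>x. x)))" by (rule rhom_range[OF rhom_e2[OF id]])
  have b: "base a \<in> range (e2 (\<lambda>x. x))" for a by (metis e2_simps(1)[OF id] rangeI)
  have "\<exists>\<phi>. (\<forall>p. \<phi> (rel_class S0 p) = e2 (\<lambda>x. x) p) \<and> is_normalization (rel_quotient S0) (ring_on Ak) \<phi>"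
  proof (rule normalization_two_variables[OF id])
    show "e2 (\<lambda>x. x) s = 0" if "s \<in> S0" for s
      using that by (auto simp: S0_def hypersurface_relation_def rhom_simps[OF rhom_e2[OF id]] e2_simps[OF id] UVW_relations)
    fix F assume "ev (\<lambda>x. x) P F = 0"
    then have "poly F P = 0" by (simp add: ev_def)
    then obtain H where F: "F = [:- P, 1:] * H" by (auto simp: poly_eq_0_iff_dvd)
    have "t_subst [:- P, 1:] = X2 ^ dm' * Y2 ^ dp' - const2 P"
      unfolding t_subst_def
      by (simp add: ev_pCons[OF rhom_const2] rhom_simps[OF rhom_const2] rhom_zero[OF rhom_ev[OF rhom_const2]])
    then have "t_subst [:- P, 1:] \<in> gen_ideal S0" by (intro gen_ideal_self) (simp add: S0_def hypersurface_relation_def)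
    then show "t_subst F \<in> gen_ideal S0"
      unfolding F rhom_mult[OF rhom_t_subst[OF id]] by (rule is_ideal_mult2[OF is_ideal_gen])
  qed (intro integral_elem_base[OF T] fracs_base[OF T] b)+
  then obtain \<phi> where \<phi>: "\<And>p. \<phi> (rel_class S0 p) = eval2 base V W p"
    and n: "is_normalization (rel_quotient S0) (ring_on Ak) \<phi>" unfolding e2 by blast
  show "primeideal (nilradical (rel_quotient S0)) (rel_quotient S0)"
    using n by (simp add: is_normalization_def)
  obtain h where h: "h \<in> ring_iso (normalization (rel_quotient S0)) (ring_on Ak)"
    "\<And>b. b \<in> carrier (rel_quotient S0) \<Longrightarrow> h (normalization_map (rel_quotient S0) b) = \<phi> b"
    using n unfolding is_normalization_def by blast
  have "h (normalization_map (rel_quotient S0) (rel_class S0 p)) = eval2 base V W p" for p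
    using h(2)[of "rel_class S0 p"] \<phi> by (simp add: rel_quotient_simps)
  then show "\<exists>\<psi>. (\<forall>p. \<psi> (normalization_map (rel_quotient S0) (rel_class S0 p)) = eval2 base V W p) \<and>
      cyclic_branched_covering (normalization (rel_quotient S0)) (ring_on A) \<psi> k"
    using cyclic_covering[OF N h(1)] by blast
qed

text \<open>For \<open>k = 1\<close> the group is trivial and the invariants are all of
  \<open>A\<close>. Three variables over \<open>\<complex>\<close> are read as two variables over
  the polynomials in \<open>s\<close>, and the equation is the substitution of \<open>t\<close> in
  \<open>q\<close>.\<close>

theorem normalization_space:
  fixes emb :: "complex \<Rightarrow> 'a"
  assumes k1: "k = 1" and emb: "rhom emb"
    and q: "\<And>F. eval2 emb s P F = 0 \<longleftrightarrow> q dvd F"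
    and int: "\<And>a. integral_elem (range (eval2 emb s P)) a"
    and fr: "\<And>a. a \<in> fracs (range (eval2 emb s P))"
  defines "S0 \<equiv> space_relation dp dm q"
  shows "\<exists>\<phi>. (\<forall>p. \<phi> (rel_class S0 p) = eval3 (\<lambda>c. base (emb c)) (base s) V W p) \<and>
    is_normalization (rel_quotient S0) (ring_on A) \<phi>"
proof -
  define r where "r = ev emb s"
  have r: "rhom r" unfolding r_def by (rule rhom_ev[OF emb])
  have br: "(\<lambda>x. base (r x)) = ev (\<lambda>c. base (emb c)) (base s)"
  proof
    fix x
    show "base (r x) = ev (\<lambda>c. base (emb c)) (base s) x"
      using ev_unique[OF rhom_comp[OF rhom_base r], of x] by (simp add: r_def ev_const[OF emb] ev_X[OF emb])
  qed
  have e2: "e2 r = eval3 (\<lambda>c. base (emb c)) (base s) V W"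
    by (simp add: e2_def eval2_ev eval3_ev br)
  have "int k dvd n" for n using k1 by simp
  then have AkA: "Ak = A" by (simp add: Ak_def fixed_iff)
  have d: "dp' = dp" "dm' = dm" using k1 dp_eq dm_eq by auto
  have er: "ev r P = eval2 emb s P" by (simp add: eval2_ev r_def)
  have c2: "ev const3 X3 = (const2 :: complex poly \<Rightarrow> _)"
  proof
    fix x :: "complex poly"
    show "ev const3 X3 x = const2 x"
      using ev_unique[OF rhom_const2, of x]
      by (simp only: const2_def const3_def[abs_def] X3_def)
  qed
  have "t_subst q = ev const2 (X2 ^ dm * Y2 ^ dp) q" unfolding t_subst_def unfolding d ..
  then have Sq: "S0 = {t_subst q}"
    by (simp add: S0_def space_relation_def eval2_ev c2 X2_def Y2_def Y3_def Z3_def)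
  have b: "base (eval2 emb s P F) = e2 r (t_subst F)" for F
    by (simp add: e2_t_subst[OF r] er)
  have sub: "base ` range (eval2 emb s P) \<subseteq> range (e2 r)" using b by auto
  have "\<exists>\<phi>. (\<forall>p. \<phi> (rel_class S0 p) = e2 r p) \<and> is_normalization (rel_quotient S0) (ring_on Ak) \<phi>"
  proof (rule normalization_two_variables[OF r])
    show "e2 r x = 0" if "x \<in> S0" for x
      using that q[of q] by (simp add: Sq e2_t_subst[OF r] er base_eq_0)
    fix F assume "ev r P F = 0"
    then have "q dvd F" using q by (simp add: er)
    then obtain H where F: "F = q * H" by (elim dvdE)
    show "t_subst F \<in> gen_ideal S0"
      unfolding F rhom_mult[OF rhom_t_subst[OF r]] by (intro is_ideal_mult2[OF is_ideal_gen] gen_ideal_self) (simp add: Sq)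
  next
    fix a
    show "integral_elem (range (e2 r)) (base a)"
      using integral_elem_mono[OF integral_elem_image[OF rhom_base int] sub] .
    show "base a \<in> fracs (range (e2 r))"
      using fracs_mono[OF fracs_image[OF rhom_base _ fr] sub] by (simp add: base_eq_0)
  qed
  then show ?thesis unfolding e2 AkA .
qed

end

section \<open>Noetherian rings and closed points\<close>

text \<open>A noetherian subring of the ambient ring, its ideals being subsets of that ring.
  Generators can thus be adjoined one by one within a single type.\<close>

definition noeth_in :: "'a::comm_ring_1 set \<Rightarrow> bool" where
  "noeth_in S \<longleftrightarrow> (\<forall>I. I \<subseteq> S \<and> 0 \<in> I \<and> (\<forall>x\<in>I. \<forall>y\<in>I. x + y \<in> I) \<and> (\<forall>s\<in>S. \<forall>x\<in>I. s * x \<in> I) \<longrightarrow>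
     (\<exists>X. finite X \<and> X \<subseteq> I \<and> I \<subseteq> mspan S X))"

lemma noeth_inD:
  assumes "noeth_in S" "I \<subseteq> S" "0 \<in> I" "\<And>x y. x \<in> I \<Longrightarrow> y \<in> I \<Longrightarrow> x + y \<in> I"
    "\<And>s x. s \<in> S \<Longrightarrow> x \<in> I \<Longrightarrow> s * x \<in> I"
  obtains X where "finite X" "X \<subseteq> I" "I \<subseteq> mspan S X"
proof -
  have "\<exists>X. finite X \<and> X \<subseteq> I \<and> I \<subseteq> mspan S X"
    using assms(1)[unfolded noeth_in_def, rule_format, of I] assms(2-5) by simp
  then show ?thesis using that by (elim exE conjE)
qed

lemma noeth_in_UNIV: "noeth_in (UNIV :: 'a::comm_ring_1 set) \<Longrightarrow> noetherian TYPE('a)"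
  unfolding noetherian_def noeth_in_def is_ideal_def by simp

lemma noeth_in_field:
  fixes h :: "complex \<Rightarrow> 'a::comm_ring_1"
  assumes h: "rhom h" shows "noeth_in (range h)"
  unfolding noeth_in_def
proof (intro allI impI)
  fix I assume I: "I \<subseteq> range h \<and> 0 \<in> I \<and> (\<forall>x\<in>I. \<forall>y\<in>I. x + y \<in> I) \<and> (\<forall>s\<in>range h. \<forall>x\<in>I. s * x \<in> I)"
  show "\<exists>X. finite X \<and> X \<subseteq> I \<and> I \<subseteq> mspan (range h) X"
  proof (cases "I = {0}")
    case True
    then show ?thesis by (intro exI[of _ "{}"]) (auto intro: mspan_zero)
  next
    case False
    then obtain c where c: "h c \<in> I" "h c \<noteq> 0" using I by blast
    then have "c \<noteq> 0" using rhom_zero[OF h] by auto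
    then have "h (inverse c) * h c = 1" using rhom_mult[OF h, of "inverse c" c] rhom_one[OF h] by simp
    then have 1: "1 \<in> I" using I c(1) by (metis rangeI)
    have "x \<in> mspan (range h) {1}" if "x \<in> I" for x
      using mspan_single[of x "range h" 1 "{1}"] that I by auto
    then show ?thesis using 1 by (intro exI[of _ "{1}"]) auto
  qed
qed

definition polys_over :: "'a::comm_ring_1 set \<Rightarrow> 'a poly set" where
  "polys_over S = {p. \<forall>i. Polynomial.coeff p i \<in> S}"

lemma is_subring_polys_over: "is_subring S \<Longrightarrow> is_subring (polys_over S)"
  unfolding polys_over_def
  by (rule is_subringI) (auto simp: coeff_mult coeff_1 intro!: subring_sum
      intro: subring_zero subring_one subring_add subring_mult subring_uminus)

definition adjoin :: "'a::comm_ring_1 set \<Rightarrow> 'a \<Rightarrow> 'a set" where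
  "adjoin S x = (\<lambda>p. poly p x) ` polys_over S"

lemma is_subring_adjoin: "is_subring S \<Longrightarrow> is_subring (adjoin S x)"
  unfolding adjoin_def is_subring_def using is_subring_polys_over[of S, unfolded is_subring_def]
  by (auto simp flip: poly_diff poly_mult intro: rev_image_eqI[of 1])

lemma adjoin_base: "is_subring S \<Longrightarrow> S \<subseteq> adjoin S x"
  unfolding adjoin_def polys_over_def
  by (auto simp: coeff_pCons subring_zero split: nat.split intro!: rev_image_eqI[of "[:s:]" for s])

lemma adjoin_elem: "is_subring S \<Longrightarrow> x \<in> adjoin S x"
  unfolding adjoin_def polys_over_def
  by (rule rev_image_eqI[of "[:0, 1:]"]) (auto simp: coeff_pCons subring_zero subring_one split: nat.split)

lemma mspan_finite_initial:
  assumes "finite X" "X \<subseteq> mspan S (range a)"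
  shows "\<exists>N::nat. X \<subseteq> mspan S (a ` {..<N})"
proof -
  have "\<exists>N. x \<in> mspan S (a ` {..<N})" if "x \<in> mspan S (range a)" for x
    using that
  proof induction
    case mspan_zero
    show ?case using mspan.mspan_zero by blast
  next
    case (mspan_step x c m)
    then obtain N i where N: "x \<in> mspan S (a ` {..<N})" "m = a i" by blast
    have "x \<in> mspan S (a ` {..<max N (Suc i)})" by (rule mspan_mono[OF N(1)]) auto
    then have "x + c * m \<in> mspan S (a ` {..<max N (Suc i)})"
      using mspan_step.hyps by (intro mspan.mspan_step) (auto simp: N(2))
    then show ?case by blast
  qed
  then have "\<forall>x. \<exists>N. x \<in> X \<longrightarrow> x \<in> mspan S (a ` {..<N})" using assms(2) by blast
  then obtain N where N: "\<And>x. x \<in> X \<Longrightarrow> x \<in> mspan S (a ` {..<N x})" by metis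
  have "x \<in> mspan S (a ` {..<Max (N ` X)})" if x: "x \<in> X" for x
  proof -
    have "N x \<le> Max (N ` X)" using assms(1) x by simp
    then show ?thesis by (intro mspan_mono[OF N[OF x]] image_mono) auto
  qed
  then show ?thesis by blast
qed

lemma mspan_mspan:
  assumes S: "is_subring S" and "X \<subseteq> mspan S M" "x \<in> mspan S X" shows "x \<in> mspan S M"
  using assms(3) by induction (use assms(2) in \<open>auto intro!: mspan_zero mspan_add mspan_scale[OF S]\<close>)

text \<open>Dependent choice in which each term sees all earlier ones; the auxiliary list
  \<open>g\<close> carries the history.\<close>

lemma choose_sequence:
  assumes "\<And>Y. finite Y \<Longrightarrow> \<exists>r. P Y r"
  shows "\<exists>f :: nat \<Rightarrow> 'b. \<forall>n. P (f ` {..<n}) (f n)"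
proof -
  define g where "g = (\<lambda>n. rec_nat [] (\<lambda>_ l. l @ [SOME r. P (set l) r]) n)"
  define f where "f n = (SOME r. P (set (g n)) r)" for n
  have g: "g 0 = []" "g (Suc n) = g n @ [f n]" for n by (simp_all add: g_def f_def)
  have s: "set (g n) = f ` {..<n}" for n
    by (induction n) (auto simp: g lessThan_Suc)
  have "P (set (g n)) (f n)" for n
    unfolding f_def by (rule someI_ex[OF assms]) simp
  then show ?thesis unfolding s by blast
qed

text \<open>Hilbert's basis theorem for \<open>S[x]\<close>, by choosing polynomials of minimal degree.\<close>

lemma noeth_in_adjoin:
  fixes S :: "'a::comm_ring_1 set"
  assumes S: "is_subring S" and N: "noeth_in S" shows "noeth_in (adjoin S x)"
  unfolding noeth_in_def
proof (intro allI impI)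
  let ?T = "adjoin S x"
  fix I assume "I \<subseteq> ?T \<and> 0 \<in> I \<and> (\<forall>x\<in>I. \<forall>y\<in>I. x + y \<in> I) \<and> (\<forall>s\<in>?T. \<forall>x\<in>I. s * x \<in> I)"
  then have IT: "I \<subseteq> ?T" and I0: "0 \<in> I" and Iadd: "\<And>x y. x \<in> I \<Longrightarrow> y \<in> I \<Longrightarrow> x + y \<in> I"
    and Imul: "\<And>s x. s \<in> ?T \<Longrightarrow> x \<in> I \<Longrightarrow> s * x \<in> I" by auto
  have T: "is_subring ?T" by (rule is_subring_adjoin[OF S])
  note PS = is_subring_polys_over[OF S]
  show "\<exists>X. finite X \<and> X \<subseteq> I \<and> I \<subseteq> mspan ?T X"
  proof (rule ccontr)
    assume neg: "\<not> ?thesis"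
    \<comment> \<open>Candidates have a value in \<open>I\<close> outside the span of the earlier
      values. The intersection discards members of \<open>Y\<close> with value outside
      \<open>I\<close>, so candidates exist for every finite \<open>Y\<close>.\<close>
    define C where "C Y = {p \<in> polys_over S. poly p x \<in> I \<and> poly p x \<notin> mspan ?T ((\<lambda>p. poly p x) ` (Y \<inter> {p. poly p x \<in> I}))}" for Y
    have choice: "\<exists>r. r \<in> C Y \<and> (\<forall>q\<in>C Y. Polynomial.degree r \<le> Polynomial.degree q)" if "finite Y" for Y
    proof -
      let ?Z = "(\<lambda>p. poly p x) ` (Y \<inter> {p. poly p x \<in> I})"
      have "\<not> I \<subseteq> mspan ?T ?Z" using neg that by (metis (no_types, lifting) finite_Int finite_imageI image_subsetI Int_iff mem_Collect_eq)
      then obtain y where "y \<in> I" "y \<notin> mspan ?T ?Z" by blast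
      moreover then obtain p where "p \<in> polys_over S" "y = poly p x" using IT unfolding adjoin_def by blast
      ultimately have "p \<in> C Y" by (auto simp: C_def)
      then show ?thesis using ex_has_least_nat[of "\<lambda>p. p \<in> C Y" p Polynomial.degree] by blast
    qed
    have "\<exists>f. \<forall>n::nat. f n \<in> C (f ` {..<n}) \<and> (\<forall>q\<in>C (f ` {..<n}). Polynomial.degree (f n) \<le> Polynomial.degree q)"
      by (rule choose_sequence[of "\<lambda>Y r. r \<in> C Y \<and> (\<forall>q\<in>C Y. Polynomial.degree r \<le> Polynomial.degree q)"])
        (rule choice)
    then obtain f where "\<forall>n::nat. f n \<in> C (f ` {..<n}) \<and> (\<forall>q\<in>C (f ` {..<n}). Polynomial.degree (f n) \<le> Polynomial.degree q)" ..
    then have f: "\<And>n. f n \<in> C (f ` {..<n})"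
      and fmin: "\<And>n q. q \<in> C (f ` {..<n}) \<Longrightarrow> Polynomial.degree (f n) \<le> Polynomial.degree q" by auto
    have fI: "poly (f n) x \<in> I" and fS: "f n \<in> polys_over S" for n using f by (auto simp: C_def)
    have img: "(\<lambda>p. poly p x) ` (f ` {..<n} \<inter> {p. poly p x \<in> I}) = (\<lambda>i. poly (f i) x) ` {..<n}" for n
      using fI by auto
    have Cn: "q \<in> C (f ` {..<n}) \<longleftrightarrow> q \<in> polys_over S \<and> poly q x \<in> I \<and> poly q x \<notin> mspan ?T ((\<lambda>i. poly (f i) x) ` {..<n})" for q n
      unfolding C_def img by auto
    have mono: "Polynomial.degree (f i) \<le> Polynomial.degree (f n)" if "i \<le> n" for i n
    proof (rule fmin)
      have "poly (f n) x \<notin> mspan ?T ((\<lambda>i. poly (f i) x) ` {..<n})" using f Cn by blast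
      then have "poly (f n) x \<notin> mspan ?T ((\<lambda>i. poly (f i) x) ` {..<i})"
        using mspan_mono[of "poly (f n) x" ?T "(\<lambda>i. poly (f i) x) ` {..<i}" ?T "(\<lambda>i. poly (f i) x) ` {..<n}"] that
        by force
      then show "f n \<in> C (f ` {..<i})" unfolding Cn using fS fI by blast
    qed
    define a where "a n = Polynomial.coeff (f n) (Polynomial.degree (f n))" for n
    have aS: "a n \<in> S" for n using fS by (simp add: a_def polys_over_def)
    have sub: "mspan S (range a) \<subseteq> S"
    proof
      fix y assume "y \<in> mspan S (range a)"
      then show "y \<in> S" by induction (use aS in \<open>auto intro: subring_zero[OF S] subring_add[OF S] subring_mult[OF S]\<close>)
    qed
    obtain X where X: "finite X" "X \<subseteq> mspan S (range a)" "mspan S (range a) \<subseteq> mspan S X"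
      using noeth_inD[OF N sub mspan_zero mspan_add mspan_scale[OF S]] by metis
    obtain N where "X \<subseteq> mspan S (a ` {..<N})" using mspan_finite_initial[OF X(1,2)] by blast
    then have aN: "a N \<in> mspan S (a ` {..<N})"
      using X(3) mspan_mspan[OF S] mspan_single[OF subring_one[OF S], of "a N" "range a"] by auto
    define d where "d = Polynomial.degree (f N)"
    \<comment> \<open>A combination of earlier leading coefficients is realised as the coefficient
      at \<open>d\<close>, the degree of \<open>f N\<close>, by raising the earlier polynomials to
      degree \<open>d\<close>; this needs their degrees to be at most \<open>d\<close>.\<close>
    have "\<exists>p\<in>polys_over S. Polynomial.degree p \<le> d \<and> Polynomial.coeff p d = y \<and>
        poly p x \<in> mspan ?T ((\<lambda>i. poly (f i) x) ` {..<N})" if "y \<in> mspan S (a ` {..<N})" for y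
      using that
    proof induction
      case mspan_zero
      show ?case by (rule bexI[of _ 0]) (auto intro: mspan.mspan_zero subring_zero[OF PS])
    next
      case (mspan_step y c m)
      obtain p where p: "p \<in> polys_over S" "Polynomial.degree p \<le> d" "Polynomial.coeff p d = y"
        "poly p x \<in> mspan ?T ((\<lambda>i. poly (f i) x) ` {..<N})" using mspan_step.IH by blast
      obtain i where i: "i < N" "m = a i" using mspan_step.hyps by blast
      define e where "e = d - Polynomial.degree (f i)"
      have de: "d = e + Polynomial.degree (f i)" using mono[of i N] i by (simp add: e_def d_def)
      have c': "Polynomial.monom c e \<in> polys_over S"
        using mspan_step.hyps by (auto simp: polys_over_def subring_zero[OF S])
      let ?q = "p + Polynomial.monom c e * f i"
      have "?q \<in> polys_over S" by (intro subring_add[OF PS] subring_mult[OF PS] p c' fS)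
      moreover have "Polynomial.degree ?q \<le> d"
      proof (rule degree_add_le[OF p(2)])
        have "Polynomial.degree (Polynomial.monom c e * f i) \<le> Polynomial.degree (Polynomial.monom c e) + Polynomial.degree (f i)"
          by (rule degree_mult_le)
        also have "\<dots> \<le> e + Polynomial.degree (f i)" by (simp add: degree_monom_le)
        finally show "Polynomial.degree (Polynomial.monom c e * f i) \<le> d" by (simp add: de)
      qed
      moreover have "Polynomial.coeff ?q d = y + c * m"
      proof -
        have "Polynomial.coeff (Polynomial.monom c e * f i) d = c * m"
          by (simp add: coeff_monom_mult de i(2) a_def)
        then show ?thesis by (simp add: p(3))
      qed
      moreover have "poly ?q x \<in> mspan ?T ((\<lambda>i. poly (f i) x) ` {..<N})"
      proof -
        have "poly (Polynomial.monom c e) x \<in> ?T" unfolding adjoin_def using c' by blast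
        then have "poly (Polynomial.monom c e) x * poly (f i) x \<in> mspan ?T ((\<lambda>i. poly (f i) x) ` {..<N})"
          by (rule mspan_single) (use i(1) in blast)
        from mspan_add[OF p(4) this] show ?thesis by (simp only: poly_add poly_mult)
      qed
      ultimately show ?case by blast
    qed
    from this[OF aN] obtain p where p: "p \<in> polys_over S" "Polynomial.degree p \<le> d" "Polynomial.coeff p d = a N"
        "poly p x \<in> mspan ?T ((\<lambda>i. poly (f i) x) ` {..<N})" by blast
    \<comment> \<open>The terms of degree \<open>d\<close> cancel, yet the value of \<open>q\<close>
      stays outside the span; so \<open>q\<close> is a candidate of smaller degree unless it is 0,
      and 0 lies in the span.\<close>
    define q where "q = f N - p"
    have qx: "poly q x = poly (f N) x - poly p x" by (simp add: q_def)
    have sp: "mspan ?T ((\<lambda>i. poly (f i) x) ` {..<N}) \<subseteq> I"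
    proof
      fix y assume "y \<in> mspan ?T ((\<lambda>i. poly (f i) x) ` {..<N})"
      then show "y \<in> I" by induction (use fI in \<open>auto intro: I0 Iadd Imul\<close>)
    qed
    have notin: "poly q x \<notin> mspan ?T ((\<lambda>i. poly (f i) x) ` {..<N})"
    proof
      assume "poly q x \<in> mspan ?T ((\<lambda>i. poly (f i) x) ` {..<N})"
      then have "poly q x + poly p x \<in> mspan ?T ((\<lambda>i. poly (f i) x) ` {..<N})" using p(4) by (rule mspan_add)
      then show False using f[of N] unfolding Cn by (simp add: qx)
    qed
    have "- poly p x \<in> I" using p(4) sp mspan_uminus[OF T] by blast
    then have "poly q x \<in> I" unfolding qx diff_conv_add_uminus using fI Iadd by blast
    moreover have "q \<in> polys_over S" unfolding q_def by (intro subring_diff[OF PS] fS p)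
    ultimately have "q \<in> C (f ` {..<N})" using notin Cn by blast
    then have "d \<le> Polynomial.degree q" unfolding d_def by (rule fmin)
    moreover have "Polynomial.degree q \<le> d" unfolding q_def using p(2) by (intro degree_diff_le) (auto simp: d_def)
    moreover have "Polynomial.coeff (f N) d = a N" by (simp add: a_def d_def)
    then have "Polynomial.coeff q d = 0" by (simp add: q_def p(3))
    ultimately have "q = 0" by (metis le_antisym leading_coeff_0_iff)
    then show False using notin mspan_zero[of ?T] by simp
  qed
qed

lemma noeth_in_generated:
  fixes h :: "complex \<Rightarrow> 'a::comm_ring_1"
  assumes h: "rhom h" and "finite F"
  shows "\<exists>S. is_subring S \<and> noeth_in S \<and> range h \<union> F \<subseteq> S"
  using assms(2)
proof induction
  case empty
  show ?case using rhom_range[OF h] noeth_in_field[OF h] by blast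
next
  case (insert x F)
  then obtain S where S: "is_subring S" "noeth_in S" "range h \<union> F \<subseteq> S" by blast
  show ?case
    using is_subring_adjoin[OF S(1)] noeth_in_adjoin[OF S(1,2)] adjoin_base[OF S(1)] adjoin_elem[OF S(1)] S(3)
    by (intro exI[of _ "adjoin S x"]) blast
qed

lemma generate_ring_subset:
  assumes S: "is_subring S" and "H \<subseteq> S" shows "generate_ring (ring_on UNIV) H \<subseteq> S"
proof
  fix x assume "x \<in> generate_ring (ring_on UNIV) H"
  then show "x \<in> S"
    by induction (use assms(2) in \<open>auto simp: subring_one[OF S] subring_uminus[OF S] subring_add[OF S] subring_mult[OF S]\<close>)
qed

lemma noetherian_finitely_generated:
  fixes h :: "complex \<Rightarrow> 'a::comm_ring_1"
  assumes "rhom h" "finite F" "generate_ring (ring_on UNIV) (range h \<union> F) = UNIV"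
  shows "noetherian TYPE('a)"
proof -
  obtain S where S: "is_subring S" "noeth_in S" "range h \<union> F \<subseteq> S" using noeth_in_generated[OF assms(1,2)] by blast
  have "S = UNIV" using generate_ring_subset[OF S(1,3)] assms(3) by auto
  then show ?thesis using S(2) noeth_in_UNIV by simp
qed

lemma noetherian_chain:
  fixes f :: "nat \<Rightarrow> 'a::comm_ring_1 set"
  assumes N: "noetherian TYPE('a)" and f: "\<And>n. is_ideal (f n)" "\<And>n. f n \<subseteq> f (Suc n)"
  shows "\<exists>n. f (Suc n) = f n"
proof -
  have mono: "i \<le> j \<Longrightarrow> f i \<subseteq> f j" for i j by (rule lift_Suc_mono_le[of f, OF f(2)])
  have "is_ideal (\<Union>n. f n)" unfolding is_ideal_def
  proof (intro conjI ballI allI)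
    show "0 \<in> (\<Union>n. f n)" using is_ideal_zero[OF f(1)] by blast
    fix x y assume "x \<in> (\<Union>n. f n)" "y \<in> (\<Union>n. f n)"
    then obtain i j where "x \<in> f i" "y \<in> f j" by blast
    then have "x \<in> f (max i j)" "y \<in> f (max i j)" using mono[of i "max i j"] mono[of j "max i j"] by auto
    then show "x + y \<in> (\<Union>n. f n)" using is_ideal_add[OF f(1)] by blast
  next
    fix a x assume "x \<in> (\<Union>n. f n)"
    then show "a * x \<in> (\<Union>n. f n)" using is_ideal_mult[OF f(1)] by blast
  qed
  then obtain X where X: "finite X" "X \<subseteq> (\<Union>n. f n)" "(\<Union>n. f n) \<subseteq> mspan UNIV X"
    using N unfolding noetherian_def by blast
  have "\<forall>x. \<exists>n. x \<in> X \<longrightarrow> x \<in> f n" using X(2) by blast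
  then obtain n where n: "\<And>x. x \<in> X \<Longrightarrow> x \<in> f (n x)" by metis
  define k where "k = Max (n ` X)"
  have Xk: "X \<subseteq> f k"
  proof
    fix x assume x: "x \<in> X"
    have "n x \<le> k" using X(1) x by (simp add: k_def)
    then show "x \<in> f k" using n[OF x] mono by blast
  qed
  have "mspan UNIV X \<subseteq> f k"
  proof
    fix y assume "y \<in> mspan UNIV X"
    then show "y \<in> f k"
      by induction (use Xk in \<open>auto intro: is_ideal_zero[OF f(1)] is_ideal_add[OF f(1)] is_ideal_mult[OF f(1)]\<close>)
  qed
  then have "f (Suc k) \<subseteq> f k" using X(3) by blast
  then show ?thesis using f(2) by blast
qed

lemma noetherian_maximal:
  fixes F :: "'a::comm_ring_1 set set"
  assumes N: "noetherian TYPE('a)" and F: "\<And>I. I \<in> F \<Longrightarrow> is_ideal I" "I0 \<in> F"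
  shows "\<exists>M\<in>F. I0 \<subseteq> M \<and> (\<forall>J\<in>F. M \<subseteq> J \<longrightarrow> J = M)"
proof (rule ccontr)
  assume neg: "\<not> ?thesis"
  have step: "\<exists>J\<in>F. x \<subset> J" if x: "x \<in> F" "I0 \<subseteq> x" for x
  proof (rule ccontr)
    assume no: "\<not> ?thesis"
    have "J = x" if "J \<in> F" "x \<subseteq> J" for J
    proof (rule ccontr)
      assume "J \<noteq> x"
      then have "x \<subset> J" using that(2) by (simp add: psubset_eq)
      then show False using no that(1) by (simp add: bexI)
    qed
    then have "\<forall>J\<in>F. x \<subseteq> J \<longrightarrow> J = x" by simp
    then have "\<exists>M\<in>F. I0 \<subseteq> M \<and> (\<forall>J\<in>F. M \<subseteq> J \<longrightarrow> J = M)" using x by (intro bexI[of _ x] conjI)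
    with neg show False by (rule notE)
  qed
  have "\<exists>f. \<forall>n. (f n \<in> F \<and> I0 \<subseteq> f n) \<and> f n \<subset> f (Suc n)"
  proof (rule dependent_nat_choice)
    show "\<exists>x. x \<in> F \<and> I0 \<subseteq> x" using F(2) by blast
    fix x assume x: "x \<in> F \<and> I0 \<subseteq> x"
    then have "\<exists>J\<in>F. x \<subset> J" by (intro step) simp_all
    then obtain J where J: "J \<in> F" "x \<subset> J" ..
    have "I0 \<subseteq> J" using x J(2) by (metis order_trans psubset_imp_subset)
    then show "\<exists>y. (y \<in> F \<and> I0 \<subseteq> y) \<and> x \<subset> y" using J by (intro exI[of _ J] conjI)
  qed
  then obtain f where "\<forall>n. (f n \<in> F \<and> I0 \<subseteq> f n) \<and> f n \<subset> f (Suc n)" ..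
  then have f: "f n \<in> F" "f n \<subset> f (Suc n)" for n by auto
  have "\<exists>n. f (Suc n) = f n" by (rule noetherian_chain[OF N]) (use F(1) f in auto)
  then obtain n where "f (Suc n) = f n" ..
  then show False using f(2)[of n] by blast
qed

section \<open>Prime and maximal ideals\<close>

definition is_prime :: "'a::comm_ring_1 set \<Rightarrow> bool" where
  "is_prime p \<longleftrightarrow> is_ideal p \<and> 1 \<notin> p \<and> (\<forall>a b. a * b \<in> p \<longrightarrow> a \<in> p \<or> b \<in> p)"

lemma is_ideal_one: "is_ideal I \<Longrightarrow> 1 \<in> I \<longleftrightarrow> I = UNIV"
  using is_ideal_mult[of I 1] by auto

lemma primeideal_iff: "primeideal p (ring_on UNIV) \<longleftrightarrow> is_prime p"
proof
  assume "primeideal p (ring_on UNIV)"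
  then interpret primeideal p "ring_on UNIV" .
  have i: "is_ideal p" using is_ideal by (simp add: ideal_iff)
  then show "is_prime p" unfolding is_prime_def
    using I_notcarr I_prime is_ideal_one[OF i] by auto
next
  assume p: "is_prime p"
  show "primeideal p (ring_on UNIV)"
    by (rule primeidealI) (use p is_ideal_one[of p] in \<open>auto simp: ideal_iff is_prime_def cring_UNIV\<close>)
qed

lemma maximalideal_iff:
  "maximalideal m (ring_on UNIV) \<longleftrightarrow> is_ideal m \<and> 1 \<notin> m \<and> (\<forall>J. is_ideal J \<longrightarrow> m \<subseteq> J \<longrightarrow> J = m \<or> J = UNIV)"
proof
  assume "maximalideal m (ring_on UNIV)"
  then interpret maximalideal m "ring_on UNIV" .
  have i: "is_ideal m" using is_ideal by (simp add: ideal_iff)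
  then show "is_ideal m \<and> 1 \<notin> m \<and> (\<forall>J. is_ideal J \<longrightarrow> m \<subseteq> J \<longrightarrow> J = m \<or> J = UNIV)"
    using I_notcarr I_maximal is_ideal_one[OF i] by (auto simp: ideal_iff)
next
  assume m: "is_ideal m \<and> 1 \<notin> m \<and> (\<forall>J. is_ideal J \<longrightarrow> m \<subseteq> J \<longrightarrow> J = m \<or> J = UNIV)"
  show "maximalideal m (ring_on UNIV)"
    by (rule maximalidealI) (use m in \<open>auto simp: ideal_iff\<close>)
qed

lemma closed_points_ideal: "m \<in> closed_points \<Longrightarrow> is_ideal m"
  by (simp add: closed_points_def maximalideal_iff)

lemma is_ideal_extend:
  assumes m: "is_ideal m" shows "is_ideal {x + a * y |x a. x \<in> m}"
  unfolding is_ideal_def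
proof (intro conjI ballI allI)
  show "0 \<in> {x + a * y |x a. x \<in> m}" 
    using is_ideal_zero[OF m] by (intro CollectI exI[of _ 0]) simp
next
  fix s t assume "s \<in> {x + a * y |x a. x \<in> m}" "t \<in> {x + a * y |x a. x \<in> m}"
  then obtain x a x' a' where h: "s = x + a * y" "t = x' + a' * y" "x \<in> m" "x' \<in> m" by blast
  then have "s + t = (x + x') + (a + a') * y" "x + x' \<in> m" by (auto simp: algebra_simps is_ideal_add[OF m])
  then show "s + t \<in> {x + a * y |x a. x \<in> m}" by blast
next
  fix c s assume "s \<in> {x + a * y |x a. x \<in> m}"
  then obtain x a where h: "s = x + a * y" "x \<in> m" by blast
  then have "c * s = c * x + (c * a) * y" "c * x \<in> m" by (auto simp: algebra_simps is_ideal_mult[OF m])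
  then show "c * s \<in> {x + a * y |x a. x \<in> m}" by blast
qed

lemma closed_points_invertible:
  assumes "m \<in> closed_points" "y \<notin> m" shows "\<exists>a. a * y - 1 \<in> m"
proof -
  have m: "is_ideal m" by (rule closed_points_ideal[OF assms(1)])
  let ?J = "{x + a * y |x a. x \<in> m}"
  have J: "is_ideal ?J" by (rule is_ideal_extend[OF m])
  have "x \<in> ?J" if "x \<in> m" for x using that by (intro CollectI exI[of _ x] exI[of _ 0]) simp
  then have "m \<subseteq> ?J" by blast
  moreover have "y \<in> ?J" using is_ideal_zero[OF m] by (intro CollectI exI[of _ 0] exI[of _ 1]) simp
  moreover have max: "J = m \<or> J = UNIV" if "is_ideal J" "m \<subseteq> J" for J
    using assms(1) that by (simp add: closed_points_def maximalideal_iff)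
  ultimately have "?J = UNIV" using max[OF J] assms(2) by blast
  then obtain x a where "1 = x + a * y" "x \<in> m" by blast
  then have "a * y - 1 = - x" by (simp add: algebra_simps)
  then show ?thesis using is_ideal_uminus[OF m \<open>x \<in> m\<close>] by metis
qed

lemma closed_points_prime: "m \<in> closed_points \<Longrightarrow> is_prime m"
proof -
  assume mc: "m \<in> closed_points"
  have m: "is_ideal m" by (rule closed_points_ideal[OF mc])
  have "b \<in> m" if ab: "a * b \<in> m" "a \<notin> m" for a b
  proof -
    obtain c where c: "c * a - 1 \<in> m" using closed_points_invertible[OF mc ab(2)] by blast
    have "c * (a * b) - (c * a - 1) * b \<in> m"
      by (rule is_ideal_diff[OF m is_ideal_mult[OF m ab(1)] is_ideal_mult2[OF m c]])
    then show ?thesis by (simp add: algebra_simps)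
  qed
  then show "is_prime m" using mc m unfolding is_prime_def by (auto simp: closed_points_def maximalideal_iff)
qed

lemma exists_closed_point:
  fixes I :: "'a::comm_ring_1 set"
  assumes N: "noetherian TYPE('a)" and I: "is_ideal I" "1 \<notin> I"
  shows "\<exists>m\<in>closed_points. I \<subseteq> m"
proof -
  have "\<exists>M\<in>{J. is_ideal J \<and> 1 \<notin> J}. I \<subseteq> M \<and> (\<forall>J\<in>{J. is_ideal J \<and> 1 \<notin> J}. M \<subseteq> J \<longrightarrow> J = M)"
    by (rule noetherian_maximal[OF N]) (use I in auto)
  then obtain M where M: "is_ideal M" "1 \<notin> M" "I \<subseteq> M"
    and max: "\<And>J. is_ideal J \<Longrightarrow> 1 \<notin> J \<Longrightarrow> M \<subseteq> J \<Longrightarrow> J = M" by auto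
  have "J = M \<or> J = UNIV" if "is_ideal J" "M \<subseteq> J" for J
    using that max[of J] is_ideal_one[of J] by auto
  then have "M \<in> closed_points" using M(1,2) by (simp add: closed_points_def maximalideal_iff)
  then show ?thesis using M(3) by blast
qed

section \<open>Affine algebras and affine curves\<close>

lemma mspan_finite_support: "x \<in> mspan S M \<Longrightarrow> \<exists>T. finite T \<and> T \<subseteq> M \<and> x \<in> mspan S T"
proof (induction rule: mspan.induct)
  case mspan_zero
  show ?case using mspan.mspan_zero by blast
next
  case (mspan_step x c m)
  then obtain T where T: "finite T" "T \<subseteq> M" "x \<in> mspan S T" by blast
  have "x + c * m \<in> mspan S (insert m T)"
    using mspan_mono[OF T(3), of S "insert m T"] mspan_step.hyps by (intro mspan.mspan_step) auto
  then show ?case using T mspan_step.hyps by (intro exI[of _ "insert m T"]) auto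
qed

lemma mspan_span_mult:
  assumes S: "is_subring S" and M: "\<And>m m'. m \<in> M \<Longrightarrow> m' \<in> M \<Longrightarrow> m * m' \<in> M"
    and x: "x \<in> mspan S M" and y: "y \<in> mspan S M"
  shows "x * y \<in> mspan S M"
proof (rule mspan_bind[OF x])
  fix c m assume c: "c \<in> S" "m \<in> M"
  have "y * m \<in> mspan S M"
    by (rule mspan_bind[OF y]) (auto simp: mult.assoc intro!: mspan_single M c)
  from mspan_scale[OF S this c(1)] show "c * m * y \<in> mspan S M" by (simp add: ac_simps)
qed

locale affine_algebra =
  fixes emb :: "complex \<Rightarrow> 'a::idom" and F :: "'a set"
  assumes emb: "rhom emb" and F: "finite F" "generate_ring (ring_on UNIV) (range emb \<union> F) = UNIV"
begin

lemma noetherian: "noetherian TYPE('a)"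
  by (rule noetherian_finitely_generated[OF emb F])

lemma UNIV_generated: "is_subring S \<Longrightarrow> range emb \<subseteq> S \<Longrightarrow> F \<subseteq> S \<Longrightarrow> x \<in> S"
  using generate_ring_subset[of S "range emb \<union> F"] F(2) by auto

lemma emb_eq_0: "emb c = 0 \<longleftrightarrow> c = 0"
proof
  assume h: "emb c = 0"
  show "c = 0"
  proof (rule ccontr)
    assume "c \<noteq> 0"
    then have "emb (inverse c) * emb c = 1"
      using rhom_mult[OF emb, of "inverse c" c] rhom_one[OF emb] by simp
    then show False using h by simp
  qed
qed (simp add: rhom_zero[OF emb])

lemma emb_inj: "emb c = emb d \<longleftrightarrow> c = d"
  using emb_eq_0[of "c - d"] by (simp add: rhom_diff[OF emb])

text \<open>Monomials in the generators are products of lists, so closedness under multiplication is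
  concatenation and countability that of the finite lists.\<close>

lemma countable_span: "\<exists>M. countable M \<and> (\<forall>x. x \<in> mspan (range emb) M)"
proof -
  have S: "is_subring (range emb)" by (rule rhom_range[OF emb])
  define M where "M = prod_list ` lists F"
  have M1: "1 \<in> M" unfolding M_def by (rule image_eqI[of _ _ "[]"]) auto
  have MM: "m * m' \<in> M" if mm: "m \<in> M" "m' \<in> M" for m m'
  proof -
    obtain xs ys where "xs \<in> lists F" "ys \<in> lists F" "m = prod_list xs" "m' = prod_list ys"
      using mm by (auto simp: M_def)
    then show ?thesis unfolding M_def by (intro image_eqI[of _ _ "xs @ ys"]) auto
  qed
  have MF: "F \<subseteq> M"
  proof
    fix x assume "x \<in> F"
    then show "x \<in> M" unfolding M_def by (intro image_eqI[of _ _ "[x]"]) auto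
  qed
  let ?S = "mspan (range emb) M"
  have c: "x \<in> ?S" if "x \<in> range emb" for x using mspan_single[OF that M1] by simp
  have "is_subring ?S"
  proof (rule is_subringI)
    show "1 \<in> ?S" by (rule c[OF subring_one[OF S]])
  qed (auto intro: mspan_add mspan_uminus[OF S] mspan_span_mult[OF S MM])
  moreover have "F \<subseteq> ?S"
  proof
    fix x assume "x \<in> F"
    then show "x \<in> ?S" using mspan_single[OF subring_one[OF S], of x M] MF by auto
  qed
  ultimately have "x \<in> ?S" for x using UNIV_generated[of ?S x] c by blast
  moreover have "countable M" unfolding M_def using F(1) by (intro countable_image countable_lists countable_finite)
  ultimately show ?thesis by blast
qed

text \<open>The algebra has countable dimension over \<open>\<complex>\<close>, while \<open>\<complex>\<close> is uncountable.\<close>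

lemma dependent_family:
  fixes a :: "complex \<Rightarrow> 'a"
  shows "\<exists>C l. finite C \<and> (\<exists>c\<in>C. l c \<noteq> 0) \<and> (\<Sum>c\<in>C. emb (l c) * a c) = 0"
proof -
  obtain M where M: "countable M" "\<And>x. x \<in> mspan (range emb) M" using countable_span by blast
  have "\<forall>c. \<exists>T. finite T \<and> T \<subseteq> M \<and> a c \<in> mspan (range emb) T" using mspan_finite_support[OF M(2)] by blast
  then obtain T where T: "\<And>c. finite (T c)" "\<And>c. T c \<subseteq> M" "\<And>c. a c \<in> mspan (range emb) (T c)" by metis
  \<comment> \<open>There are uncountably many indices but only countably many finite supports, so
    infinitely many indices share one support \<open>X\<close>; taking \<open>card X + 1\<close> of
    them forces a dependence.\<close>
  have "\<exists>X. infinite {c. T c = X}"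
  proof (rule ccontr)
    assume neg: "\<not> ?thesis"
    have "UNIV = (\<Union>X\<in>{X. X \<subseteq> M \<and> finite X}. {c. T c = X})" using T by auto
    moreover have "countable (\<Union>X\<in>{X. X \<subseteq> M \<and> finite X}. {c. T c = X})"
    proof (rule countable_UN)
      show "countable {X. X \<subseteq> M \<and> finite X}"
        using countable_Collect_finite_subset[OF M(1)] by (simp add: conj_commute)
    qed (use neg in \<open>auto intro: countable_finite\<close>)
    ultimately show False using uncountable_UNIV_complex by metis
  qed
  then obtain X where X: "infinite {c. T c = X}" by blast
  then obtain C where C: "finite C" "card C = Suc (card X)" "C \<subseteq> {c. T c = X}"
    using infinite_arbitrarily_large by blast
  have "C \<noteq> {}" using C(2) by auto
  then have Xf: "finite X" using C(3) T(1) by blast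
  obtain ms where ms: "set ms = X" "distinct ms" using finite_distinct_list[OF Xf] by blast
  have len: "length ms = card X" using ms distinct_card by fastforce
  have "\<exists>v. a c = (\<Sum>d<card X. emb (v d) * ms ! d)" if "c \<in> C" for c
  proof -
    have "a c \<in> mspan (range emb) X" using T(3)[of c] C(3) that by auto
    then obtain w where w: "\<forall>m\<in>X. w m \<in> range emb" "a c = (\<Sum>m\<in>X. w m * m)"
      using mspan_finite[OF rhom_range[OF emb] Xf] by blast
    have "\<forall>d. \<exists>x. d < card X \<longrightarrow> w (ms ! d) = emb x" using w(1) ms len by (metis nth_mem rangeE)
    then obtain v where v: "\<And>d. d < card X \<Longrightarrow> w (ms ! d) = emb (v d)" by metis
    have "(\<Sum>m\<in>X. w m * m) = (\<Sum>d<card X. w (ms ! d) * ms ! d)"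
      using sum.reindex_bij_betw[OF bij_betw_nth[OF ms(2) refl ms(1)[symmetric]], of "\<lambda>m. w m * m"] len by simp
    also have "\<dots> = (\<Sum>d<card X. emb (v d) * ms ! d)" by (intro sum.cong) (auto simp: v)
    finally show ?thesis using w(2) by auto
  qed
  then obtain v where v: "\<And>c. c \<in> C \<Longrightarrow> a c = (\<Sum>d<card X. emb (v c d) * ms ! d)" by metis
  obtain l where l: "\<exists>c\<in>C. l c \<noteq> 0" "\<forall>d<card X. (\<Sum>c\<in>C. l c * v c d) = 0"
    using linear_dependence[OF C(1), of "card X" v] C(2) by auto
  have "(\<Sum>c\<in>C. emb (l c) * a c) = (\<Sum>c\<in>C. \<Sum>d<card X. emb (l c * v c d) * ms ! d)"
    by (intro sum.cong) (auto simp: v sum_distrib_left rhom_mult[OF emb] mult.assoc)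
  also have "\<dots> = (\<Sum>d<card X. \<Sum>c\<in>C. emb (l c * v c d) * ms ! d)" by (rule sum.swap)
  also have "\<dots> = (\<Sum>d<card X. emb (\<Sum>c\<in>C. l c * v c d) * ms ! d)"
    by (simp add: rhom_sum[OF emb] sum_distrib_right)
  also have "\<dots> = 0" using l(2) by (simp add: rhom_zero[OF emb])
  finally show ?thesis using C(1) l(1) by blast
qed

text \<open>Over \<open>\<complex>\<close> the polynomial splits into linear factors, and a prime
  ideal containing the product contains one factor. For the zero ideal this says that nonconstant
  elements are transcendental.\<close>

lemma prime_linear_factor:
  assumes p: "is_prime p" and "g \<noteq> 0" "ev emb y g \<in> p"
  shows "\<exists>r. y - emb r \<in> p"
  using assms(2,3)
proof (induction "Polynomial.degree g" arbitrary: g rule: less_induct)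
  case less
  have pi: "is_ideal p" and p1: "1 \<notin> p" and pp: "\<And>a b. a * b \<in> p \<Longrightarrow> a \<in> p \<or> b \<in> p"
    using p by (auto simp: is_prime_def)
  show ?case
  proof (cases "Polynomial.degree g = 0")
    case True
    then obtain c where g: "g = [:c:]" by (rule degree_eq_zeroE)
    then have "emb (inverse c) * emb c \<in> p"
      using less.prems by (simp add: ev_const[OF emb] is_ideal_mult[OF pi])
    moreover have "emb (inverse c) * emb c = 1"
      using less.prems g rhom_mult[OF emb, of "inverse c" c] rhom_one[OF emb] by simp
    ultimately show ?thesis using p1 by simp
  next
    case False
    then have "\<not> constant (poly g)" by (simp add: constant_degree)
    then obtain r where "poly g r = 0" using fundamental_theorem_of_algebra by blast
    then obtain h where h: "g = [:- r, 1:] * h" by (auto simp: poly_eq_0_iff_dvd)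
    have h0: "h \<noteq> 0" using less.prems h by auto
    have "ev emb y [:- r, 1:] = y - emb r"
      by (simp add: ev_pCons[OF emb] rhom_simps[OF emb] rhom_zero[OF rhom_ev[OF emb]])
    then have "(y - emb r) * ev emb y h \<in> p" using less.prems(2) unfolding h rhom_mult[OF rhom_ev[OF emb]] by simp
    then consider "y - emb r \<in> p" | "ev emb y h \<in> p" using pp by blast
    then show ?thesis
    proof cases
      case 2
      have "Polynomial.degree g = Suc (Polynomial.degree h)" unfolding h using h0 by (subst degree_mult_eq) auto
      then show ?thesis using less.hyps[of h] h0 2 by simp
    qed blast
  qed
qed

text \<open>At the node \<open>e c0\<close> every summand except the one of \<open>c0\<close> has a
  vanishing factor, as in Lagrange interpolation.\<close>

lemma lagrange_sum_nonzero:
  fixes l :: "complex \<Rightarrow> complex" and h :: "complex \<Rightarrow> 'r::idom" and e :: "complex \<Rightarrow> 'r"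
  assumes C: "finite C" "c0 \<in> C" and e: "inj e" and h0: "h c0 \<noteq> 0"
  shows "(\<Sum>c\<in>C. [:h c:] * (\<Prod>c'\<in>C - {c}. [:- e c', 1:])) \<noteq> 0"
proof
  assume "(\<Sum>c\<in>C. [:h c:] * (\<Prod>c'\<in>C - {c}. [:- e c', 1:])) = 0"
  then have "0 = poly (\<Sum>c\<in>C. [:h c:] * (\<Prod>c'\<in>C - {c}. [:- e c', 1:])) (e c0)" by simp
  also have "\<dots> = (\<Sum>c\<in>C. h c * (\<Prod>c'\<in>C - {c}. e c0 - e c'))" by (simp add: poly_sum poly_prod)
  also have "\<dots> = h c0 * (\<Prod>c'\<in>C - {c0}. e c0 - e c') + (\<Sum>c\<in>C - {c0}. h c * (\<Prod>c'\<in>C - {c}. e c0 - e c'))"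
    by (rule sum.remove[OF C])
  also have "(\<Sum>c\<in>C - {c0}. h c * (\<Prod>c'\<in>C - {c}. e c0 - e c')) = 0"
  proof (intro sum.neutral ballI)
    fix c assume "c \<in> C - {c0}"
    then have "c0 \<in> C - {c}" using C(2) by auto
    then have "(\<Prod>c'\<in>C - {c}. e c0 - e c') = 0" using C(1) by (intro prod_zero) auto
    then show "h c * (\<Prod>c'\<in>C - {c}. e c0 - e c') = 0" by simp
  qed
  finally have "h c0 * (\<Prod>c'\<in>C - {c0}. e c0 - e c') = 0" by simp
  then show False using h0 C(1) e by (auto simp: inj_eq)
qed

text \<open>If \<open>a\<^sub>c (y - c) = b\<^sub>c\<close> for all \<open>c\<close>, a linear relation among the \<open>a\<^sub>c\<close> multiplied by the product of
  the \<open>y - c\<close> becomes a polynomial relation for \<open>y\<close> over the \<open>b\<^sub>c\<close>.\<close>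

lemma dependent_inverses:
  assumes ab: "\<And>c. a c * (y - emb c) = b c"
  shows "\<exists>C l. finite C \<and> (\<exists>c\<in>C. l c \<noteq> 0) \<and>
    (\<Sum>c\<in>C. emb (l c) * b c * (\<Prod>c'\<in>C - {c}. y - emb c')) = 0"
proof -
  obtain C l where C: "finite C" "\<exists>c\<in>C. l c \<noteq> 0" "(\<Sum>c\<in>C. emb (l c) * a c) = 0"
    using dependent_family by blast
  have "0 = (\<Sum>c\<in>C. emb (l c) * a c) * (\<Prod>c'\<in>C. y - emb c')" using C(3) by simp
  also have "\<dots> = (\<Sum>c\<in>C. emb (l c) * b c * (\<Prod>c'\<in>C - {c}. y - emb c'))"
    unfolding sum_distrib_right
  proof (intro sum.cong refl)
    fix c assume "c \<in> C"
    then have "(\<Prod>c'\<in>C. y - emb c') = (y - emb c) * (\<Prod>c'\<in>C - {c}. y - emb c')"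
      by (rule prod.remove[OF C(1)])
    then show "emb (l c) * a c * (\<Prod>c'\<in>C. y - emb c') = emb (l c) * b c * (\<Prod>c'\<in>C - {c}. y - emb c')"
      by (simp add: ac_simps flip: ab)
  qed
  finally show ?thesis using C(1,2) by (intro exI[of _ C] exI[of _ l]) auto
qed

text \<open>Otherwise each \<open>y - emb c\<close> has an inverse \<open>a c\<close> modulo
  \<open>m\<close>. In the relation from \<open>dependent_inverses\<close> the products
  \<open>a c * (y - emb c)\<close> may be replaced by 1 modulo \<open>m\<close>, which leaves a
  nonzero complex polynomial \<open>g\<close> with \<open>g(y)\<close> in \<open>m\<close>.\<close>

lemma nullstellensatz:
  assumes m: "m \<in> closed_points" shows "\<exists>c. y - emb c \<in> m"
proof (rule ccontr)
  assume neg: "\<not> ?thesis"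
  have mi: "is_ideal m" by (rule closed_points_ideal[OF m])
  have "\<forall>c. \<exists>a. a * (y - emb c) - 1 \<in> m" using closed_points_invertible[OF m] neg by blast
  then obtain a where a: "\<And>c. a c * (y - emb c) - 1 \<in> m" by metis
  obtain C l where C: "finite C" "\<exists>c\<in>C. l c \<noteq> 0"
    and s: "(\<Sum>c\<in>C. emb (l c) * (a c * (y - emb c)) * (\<Prod>c'\<in>C - {c}. y - emb c')) = 0"
    using dependent_inverses[of a y "\<lambda>c. a c * (y - emb c)"] by blast
  obtain c0 where c0: "c0 \<in> C" "l c0 \<noteq> 0" using C(2) by blast
  define g where "g = (\<Sum>c\<in>C. [:l c:] * (\<Prod>c'\<in>C - {c}. [:- c', 1:]))"
  have g0: "g \<noteq> 0" unfolding g_def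
    using lagrange_sum_nonzero[OF C(1) c0(1), of "\<lambda>c. c" l] c0(2) by simp
  have "ev emb y g = (\<Sum>c\<in>C. emb (l c) * (\<Prod>c'\<in>C - {c}. y - emb c'))"
    unfolding g_def by (simp only: rhom_sum[OF rhom_ev[OF emb]] rhom_mult[OF rhom_ev[OF emb]]
        rhom_prod[OF rhom_ev[OF emb]] ev_const[OF emb])
      (simp add: ev_pCons[OF emb] rhom_simps[OF emb] rhom_zero[OF rhom_ev[OF emb]])
  also have "\<dots> = (\<Sum>c\<in>C. emb (l c) * (\<Prod>c'\<in>C - {c}. y - emb c'))
      - (\<Sum>c\<in>C. emb (l c) * (a c * (y - emb c)) * (\<Prod>c'\<in>C - {c}. y - emb c'))" using s by simp
  also have "\<dots> = (\<Sum>c\<in>C. - (emb (l c) * (\<Prod>c'\<in>C - {c}. y - emb c') * (a c * (y - emb c) - 1)))"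
    by (simp add: sum_subtractf[symmetric] algebra_simps)
  also have "\<dots> \<in> m"
    using a by (intro is_ideal_sum[OF mi] is_ideal_uminus[OF mi] is_ideal_mult[OF mi])
  finally show False using prime_linear_factor[OF closed_points_prime[OF m] g0] neg by blast
qed

lemma is_prime_zero: "is_prime {0::'a}"
  by (auto simp: is_prime_def is_ideal_def)

lemma transcendental:
  assumes "P \<notin> range emb" "ev emb P g = 0" shows "g = 0"
  using prime_linear_factor[OF is_prime_zero, of g P] assms by auto

end

locale affine_curve = affine_algebra emb F for emb :: "complex \<Rightarrow> 'a::idom" and F +
  assumes dim: "krull_dim_one TYPE('a)"
begin

text \<open>The form in which dimension one is used. An ideal containing \<open>f\<close> and
  maximal among those avoiding the nonzero polynomials in \<open>P\<close> is prime, hence a closed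
  point; but there some \<open>P - emb c\<close> vanishes, which is such a polynomial.\<close>

lemma multiple_in_subfield:
  assumes P: "P \<notin> range emb" and f: "f \<noteq> 0"
  shows "\<exists>a h. h \<noteq> 0 \<and> a * f = ev emb P h"
proof (rule ccontr)
  assume neg: "\<not> ?thesis"
  define M where "M = ev emb P ` {h. h \<noteq> 0}"
  have M1: "1 \<in> M" unfolding M_def by (rule image_eqI[of _ _ 1]) (auto simp: rhom_one[OF rhom_ev[OF emb]])
  have Mm: "x * y \<in> M" if xy: "x \<in> M" "y \<in> M" for x y
  proof -
    obtain g h where "x = ev emb P g" "y = ev emb P h" "g \<noteq> 0" "h \<noteq> 0" using xy by (auto simp: M_def)
    then show ?thesis unfolding M_def by (intro image_eqI[of _ _ "g * h"]) (auto simp: rhom_mult[OF rhom_ev[OF emb]])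
  qed
  let ?F = "{J. is_ideal J \<and> J \<inter> M = {}}"
  have z: "is_ideal {0::'a}" by (auto simp: is_ideal_def)
  have no: "a * f \<noteq> ev emb P h" if "h \<noteq> 0" for a h using neg that by blast
  have fI: "{x + a * f |x a. x \<in> {0}} \<in> ?F"
    using is_ideal_extend[OF z, of f] no[symmetric] by (auto simp: M_def)
  have "\<exists>p\<in>?F. {x + a * f |x a. x \<in> {0}} \<subseteq> p \<and> (\<forall>J\<in>?F. p \<subseteq> J \<longrightarrow> J = p)"
    by (rule noetherian_maximal[OF noetherian _ fI]) auto
  then obtain p where p: "is_ideal p" "p \<inter> M = {}" "{x + a * f |x a. x \<in> {0}} \<subseteq> p"
    and pmax: "\<And>J. is_ideal J \<Longrightarrow> J \<inter> M = {} \<Longrightarrow> p \<subseteq> J \<Longrightarrow> J = p" by auto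
  have fp: "f \<in> p" using p(3) by (auto intro: subsetD exI[of _ 1])
  have ext: "\<exists>x a. x \<in> p \<and> x + a * y \<in> M" if y: "y \<notin> p" for y
  proof (rule ccontr)
    assume no: "\<not> ?thesis"
    let ?J = "{x + a * y |x a. x \<in> p}"
    have "x \<in> ?J" if "x \<in> p" for x using that by (intro CollectI exI[of _ x] exI[of _ 0]) simp
    then have "p \<subseteq> ?J" by blast
    moreover have "?J \<inter> M = {}" using no by blast
    ultimately have "?J = p" by (intro pmax is_ideal_extend[OF p(1)])
    moreover have "y \<in> ?J" using is_ideal_zero[OF p(1)] by (intro CollectI exI[of _ 0] exI[of _ 1]) simp
    ultimately show False using y by blast
  qed
  have "is_prime p" unfolding is_prime_def
  proof (intro conjI allI impI)
    show "is_ideal p" "1 \<notin> p" using p M1 by auto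
    fix b c assume bc: "b * c \<in> p"
    show "b \<in> p \<or> c \<in> p"
    proof (rule ccontr)
      assume no: "\<not> (b \<in> p \<or> c \<in> p)"
      obtain x s where 1: "x \<in> p" "x + s * b \<in> M" using ext[of b] no by blast
      obtain y t where 2: "y \<in> p" "y + t * c \<in> M" using ext[of c] no by blast
      have "(x + s * b) * (y + t * c) = x * (y + t * c) + ((s * b) * y + (s * t) * (b * c))"
        by (simp add: algebra_simps)
      also have "\<dots> \<in> p"
        by (rule is_ideal_add[OF p(1) is_ideal_mult2[OF p(1) 1(1)]
              is_ideal_add[OF p(1) is_ideal_mult[OF p(1) 2(1)] is_ideal_mult[OF p(1) bc]]])
      finally show False using Mm[OF 1(2) 2(2)] p(2) by blast
    qed
  qed
  then have pp: "is_prime p" .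
  obtain m where m: "m \<in> closed_points" "p \<subseteq> m" using exists_closed_point[OF noetherian p(1)] pp by (auto simp: is_prime_def)
  have "{0} \<subset> p" using fp f is_ideal_zero[OF p(1)] by auto
  \<comment> \<open>Dimension one forbids a chain of three distinct primes from \<open>{0}\<close>
    through \<open>p\<close> to \<open>m\<close>.\<close>
  then have "p = m"
    using dim is_prime_zero pp closed_points_prime[OF m(1)] m(2)
    unfolding krull_dim_one_def primeideal_iff by blast
  then obtain c where c: "P - emb c \<in> p" using nullstellensatz[OF m(1)] by blast
  have "ev emb P [:- c, 1:] = P - emb c"
    by (simp add: ev_pCons[OF emb] rhom_simps[OF emb] rhom_zero[OF rhom_ev[OF emb]])
  then have "P - emb c \<in> M" unfolding M_def by (intro image_eqI[of _ _ "[:- c, 1:]"]) auto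
  then show False using c p(2) by blast
qed

text \<open>For nonconstant \<open>y\<close> each \<open>y - emb c\<close> is nonzero and so divides
  a polynomial \<open>h c\<close> in \<open>P\<close>. A linear relation among the uncountably many
  cofactors \<open>a c\<close> becomes a polynomial relation of \<open>y\<close> over the
  polynomials in \<open>P\<close>.\<close>

lemma algebraic_dependence:
  assumes P: "P \<notin> range emb"
  shows "\<exists>G. G \<noteq> 0 \<and> eval2 emb P y G = 0"
proof (cases "y \<in> range emb")
  case True
  then obtain c where "y = emb c" by blast
  then have "eval2 emb P y [:- [:c:], 1:] = 0"
    by (simp add: eval2_ev ev_pCons[OF rhom_ev[OF emb]] ev_const[OF emb] rhom_simps[OF rhom_ev[OF emb]]
        rhom_simps[OF emb] rhom_zero[OF rhom_ev[OF rhom_ev[OF emb]]])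
  then show ?thesis by (intro exI[of _ "[:- [:c:], 1:]"]) auto
next
  case False
  have "\<exists>a h. h \<noteq> 0 \<and> a * (y - emb c) = ev emb P h" for c
    using False by (intro multiple_in_subfield[OF P]) auto
  then obtain a h where ah: "\<And>c. h c \<noteq> 0" "\<And>c. a c * (y - emb c) = ev emb P (h c)" by metis
  obtain C l where C: "finite C" "\<exists>c\<in>C. l c \<noteq> 0"
    and s: "(\<Sum>c\<in>C. emb (l c) * ev emb P (h c) * (\<Prod>c'\<in>C - {c}. y - emb c')) = 0"
    using dependent_inverses[of a y, OF ah(2)] by blast
  obtain c0 where c0: "c0 \<in> C" "l c0 \<noteq> 0" using C(2) by blast
  define G where "G = (\<Sum>c\<in>C. [:[:l c:] * h c:] * (\<Prod>c'\<in>C - {c}. [:- [:c':], 1:]))"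
  have "G \<noteq> 0" unfolding G_def
    using lagrange_sum_nonzero[OF C(1) c0(1), of "\<lambda>c. [:c:]" "\<lambda>c. [:l c:] * h c"] c0(2) ah(1)
    by (auto simp: inj_def)
  note r = rhom_ev[OF emb, of P]
  note r2 = rhom_ev[OF r, of y]
  have "eval2 emb P y G = (\<Sum>c\<in>C. emb (l c) * ev emb P (h c) * (\<Prod>c'\<in>C - {c}. y - emb c'))"
    unfolding G_def eval2_ev
    by (simp only: rhom_sum[OF r2] rhom_mult[OF r2] rhom_prod[OF r2] ev_const[OF r] rhom_mult[OF r] ev_const[OF emb])
      (simp add: ev_pCons[OF r] rhom_simps[OF r] ev_const[OF emb] rhom_zero[OF r2] rhom_uminus[OF emb])
  then show ?thesis using s \<open>G \<noteq> 0\<close> by auto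
qed

end

section \<open>Plane models of a curve\<close>

text \<open>A formal leading coefficient that may be 0, so that sums and products need no discussion
  of cancellation.\<close>

definition dcoeff :: "'a::comm_ring_1 poly \<Rightarrow> nat \<Rightarrow> 'a \<Rightarrow> bool" where
  "dcoeff p n a \<longleftrightarrow> Polynomial.degree p \<le> n \<and> Polynomial.coeff p n = a"

lemma dcoeff_mult:
  assumes "dcoeff p m a" "dcoeff q n b" shows "dcoeff (p * q) (m + n) (a * b)"
proof -
  have p: "Polynomial.degree p \<le> m" "Polynomial.coeff p m = a" and q: "Polynomial.degree q \<le> n" "Polynomial.coeff q n = b"
    using assms by (auto simp: dcoeff_def)
  have "Polynomial.coeff p i * Polynomial.coeff q (m + n - i) = (if i = m then a * b else 0)" if "i \<le> m + n" for i
    using p q that by (cases i m rule: linorder_cases) (auto simp: coeff_eq_0)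
  then have "Polynomial.coeff (p * q) (m + n) = (\<Sum>i\<le>m + n. if i = m then a * b else 0)"
    unfolding coeff_mult by (intro sum.cong) auto
  then show ?thesis using p q degree_mult_le[of p q] by (simp add: dcoeff_def)
qed

lemma dcoeff_power: "dcoeff p m a \<Longrightarrow> dcoeff (p ^ k) (k * m) (a ^ k)"
proof (induction k)
  case 0
  show ?case by (simp add: dcoeff_def)
next
  case (Suc k)
  then show ?case using dcoeff_mult[of p m a "p ^ k" "k * m" "a ^ k"] by simp
qed

lemma dcoeff_less: "dcoeff p m a \<Longrightarrow> m < n \<Longrightarrow> dcoeff p n 0"
  by (auto simp: dcoeff_def coeff_eq_0)

lemma dcoeff_sum: "(\<And>i. i \<in> B \<Longrightarrow> dcoeff (f i) n (a i)) \<Longrightarrow> dcoeff (sum f B) n (sum a B)"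
  by (induction B rule: infinite_finite_induct) (auto simp: dcoeff_def degree_add_le)

lemma map_poly_pCons': "f 0 = 0 \<Longrightarrow> map_poly f (pCons a p) = pCons (f a) (map_poly f p)"
  by (simp add: poly_eq_iff coeff_map_poly coeff_pCons split: nat.split)

lemma fracs_uminus: "is_subring S \<Longrightarrow> x \<in> fracs S \<Longrightarrow> - x \<in> fracs S"
  by (erule fracsE) (metis fracsI mult_minus_left subring_uminus)

context affine_algebra
begin

lemma ev_in_subring: "is_subring S \<Longrightarrow> rhom h \<Longrightarrow> (\<And>c. h c \<in> S) \<Longrightarrow> x \<in> S \<Longrightarrow> ev h x p \<in> S"
  by (simp add: ev_altdef subring_sum subring_mult subring_power)

lemma eval2_in_subring:
  assumes S: "is_subring S" and "\<And>c. emb c \<in> S" "x \<in> S" "y \<in> S" shows "eval2 emb x y p \<in> S"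
  unfolding eval2_ev by (intro ev_in_subring[OF S] rhom_ev emb assms)

text \<open>Substituting \<open>s = s' - c x\<close> into a relation \<open>G(s, x) = 0\<close> of total degree \<open>d\<close> gives a relation for
  \<open>x\<close> over \<open>\<complex>[s']\<close> whose coefficient of \<open>x\<^sup>d\<close> is a nonzero polynomial in \<open>c\<close>.\<close>

lemma generic_integral:
  assumes G: "G \<noteq> 0" "eval2 emb s x G = 0"
  shows "\<exists>B. finite B \<and> (\<forall>c. c \<notin> B \<longrightarrow> integral_elem (range (ev emb (s + emb c * x))) x)"
proof -
  define g where "g i j = Polynomial.coeff (Polynomial.coeff G j) i" for i j
  define Ix where "Ix = (SIGMA j:{..Polynomial.degree G}. {..Polynomial.degree (Polynomial.coeff G j)})"
  have Ixf: "finite Ix" by (simp add: Ix_def)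
  have nz: "{(j, i) \<in> Ix. g i j \<noteq> 0} \<noteq> {}"
  proof -
    let ?j = "Polynomial.degree G"
    let ?i = "Polynomial.degree (Polynomial.coeff G ?j)"
    have "g ?i ?j \<noteq> 0" using G(1) by (simp add: g_def)
    then have "(?j, ?i) \<in> {(j, i) \<in> Ix. g i j \<noteq> 0}" by (simp add: Ix_def)
    then show ?thesis by blast
  qed
  define d where "d = Max ((\<lambda>(j, i). i + j) ` {(j, i) \<in> Ix. g i j \<noteq> 0})"
  have fin: "finite ((\<lambda>(j, i). i + j) ` {(j, i) \<in> Ix. g i j \<noteq> 0})"
    by (rule finite_imageI, rule finite_subset[OF _ Ixf]) auto
  have le: "i + j \<le> d" if "(j, i) \<in> Ix" "g i j \<noteq> 0" for i j
    unfolding d_def using fin that by (intro Max_ge) force+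
  have "d \<in> (\<lambda>(j, i). i + j) ` {(j, i) \<in> Ix. g i j \<noteq> 0}" unfolding d_def using fin nz by (intro Max_in) auto
  then obtain i0 j0 where ij0: "(j0, i0) \<in> Ix" "g i0 j0 \<noteq> 0" "i0 + j0 = d" by auto
  \<comment> \<open>The coefficient of \<open>x ^ d\<close> after the substitution, as a polynomial
    in \<open>c\<close>: only the terms of top total degree contribute, each with
    \<open>(- c) ^ i\<close>. The powers of \<open>c\<close> are distinct, so nothing
    cancels.\<close>
  define bp where "bp = (\<Sum>(j, i)\<in>Ix. if i + j = d then Polynomial.monom (g i j * (- 1) ^ i) i else 0)"
  have "Polynomial.coeff bp i0 = (\<Sum>ji\<in>Ix. if ji = (j0, i0) then g i0 j0 * (- 1) ^ i0 else 0)"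
    unfolding bp_def coeff_sum using ij0(3) by (intro sum.cong) (auto split: prod.splits)
  also have "\<dots> = g i0 j0 * (- 1) ^ i0" using Ixf ij0(1) by simp
  finally have bp0: "bp \<noteq> 0" using ij0(2) by auto
  have int: "integral_elem (range (ev emb (s + emb c * x))) x" if c: "poly bp c \<noteq> 0" for c
  proof -
    define s' where "s' = s + emb c * x"
    note r = rhom_ev[OF emb, of s']
    note r2 = rhom_ev[OF r, of x]
    \<comment> \<open>\<open>L\<close> represents \<open>s = s' - c x\<close> as a polynomial in
      \<open>x\<close> over the polynomials in \<open>s'\<close>.\<close>
    define L :: "complex poly poly" where "L = [:[:0, 1:], [:- c:]:]"
    define H where "H = (\<Sum>(j, i)\<in>Ix. [:[:g i j:]:] * (L ^ i * Polynomial.monom 1 j))"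
    have L: "ev (ev emb s') x L = s"
      by (simp add: L_def ev_pCons[OF r] ev_const[OF r] ev_const[OF emb] ev_X[OF emb] rhom_zero[OF r2]
          rhom_zero[OF r] rhom_uminus[OF emb] mult.commute) (simp add: s'_def)
    have "ev (ev emb s') x H = (\<Sum>(j, i)\<in>Ix. emb (g i j) * (s ^ i * x ^ j))"
      unfolding H_def rhom_sum[OF r2]
      by (intro sum.cong) (auto simp: rhom_mult[OF r2] rhom_power[OF r2] L ev_const[OF r] ev_const[OF emb]
          ev_monom[OF r] rhom_one[OF r] simp del: mult_pCons_left)
    also have "\<dots> = eval2 emb s x G"
      unfolding eval2_altdef[OF emb] Ix_def g_def by (subst sum.Sigma) (auto simp: mult.assoc)
    finally have H0: "ev (ev emb s') x H = 0" using G(2) by simp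
    have dL: "dcoeff L 1 [:- c:]" by (simp add: L_def dcoeff_def)
    have dH: "dcoeff H d (\<Sum>(j, i)\<in>Ix. if i + j = d then [:g i j * (- c) ^ i:] else 0)"
      unfolding H_def split_def
    proof (rule dcoeff_sum)
      fix ji assume ji: "ji \<in> Ix"
      obtain j i where e: "ji = (j, i)" by (cases ji)
      have "dcoeff (L ^ i * Polynomial.monom 1 j) (i + j) [:(- c) ^ i:]"
        using dcoeff_mult[OF dcoeff_power[OF dL, of i], of "Polynomial.monom 1 j" j 1]
        by (simp add: dcoeff_def degree_monom_le poly_const_pow)
      from dcoeff_mult[OF _ this, of "[:[:g i j:]:]" 0 "[:g i j:]"]
      have dc: "dcoeff ([:[:g i j:]:] * (L ^ i * Polynomial.monom 1 j)) (i + j) [:g i j * (- c) ^ i:]"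
        by (simp add: dcoeff_def)
      show "dcoeff ([:[:g (snd ji) (fst ji):]:] * (L ^ snd ji * Polynomial.monom 1 (fst ji))) d
         (if snd ji + fst ji = d then [:g (snd ji) (fst ji) * (- c) ^ snd ji:] else 0)"
      proof (cases "g i j = 0")
        case True
        then show ?thesis by (simp add: e dcoeff_def)
      next
        case False
        then have "i + j \<le> d" using le ji e by auto
        then show ?thesis using dc dcoeff_less[OF dc, of d] by (auto simp: e)
      qed
    qed
    have "(\<Sum>(j, i)\<in>Ix. if i + j = d then [:g i j * (- c) ^ i:] else 0) = [:poly bp c:]"
    proof -
      have hc: "sum (\<lambda>k. [:f k:]) B = [:sum f B:]" for f :: "nat \<times> nat \<Rightarrow> complex" and B
        by (induction B rule: infinite_finite_induct) auto
      have "(\<Sum>(j, i)\<in>Ix. if i + j = d then [:g i j * (- c) ^ i:] else 0)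
          = (\<Sum>k\<in>Ix. [:(case k of (j, i) \<Rightarrow> if i + j = d then g i j * (- c) ^ i else 0):])"
        by (intro sum.cong) auto
      also have "\<dots> = [:\<Sum>(j, i)\<in>Ix. if i + j = d then g i j * (- c) ^ i else 0:]" by (rule hc)
      also have "(\<Sum>(j, i)\<in>Ix. if i + j = d then g i j * (- c) ^ i else 0) = poly bp c"
        unfolding bp_def poly_sum
        by (intro sum.cong) (auto simp: poly_monom split_def power_mult_distrib[symmetric] mult.assoc)
      finally show ?thesis .
    qed
    with dH have dH: "Polynomial.degree H \<le> d" "Polynomial.coeff H d = [:poly bp c:]" by (auto simp: dcoeff_def)
    then have deg: "Polynomial.degree H = d" using c by (metis le_antisym le_degree pCons_eq_0_iff)
    define b where "b = inverse (poly bp c)"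
    have bb: "emb b * emb (poly bp c) = 1"
      using rhom_mult[OF emb, of b "poly bp c"] rhom_one[OF emb] c by (simp add: b_def)
    have "d \<noteq> 0"
    proof
      assume "d = 0"
      then have "H = [:[:poly bp c:]:]" using dH deg by (metis degree_eq_zeroE coeff_pCons_0)
      then have "emb (poly bp c) = 0" using H0 by (simp add: ev_const[OF r] ev_const[OF emb])
      then show False using c emb_eq_0 by simp
    qed
    moreover have "x ^ d + (\<Sum>i<d. ev emb s' ([:b:] * Polynomial.coeff H i) * x ^ i) = 0"
    proof -
      have "0 = emb b * (\<Sum>i\<le>d. ev emb s' (Polynomial.coeff H i) * x ^ i)"
        using H0 unfolding ev_altdef[OF r] deg by simp
      also have "{..d} = insert d {..<d}" by auto
      also have "emb b * (\<Sum>i\<in>insert d {..<d}. ev emb s' (Polynomial.coeff H i) * x ^ i)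
          = x ^ d + (\<Sum>i<d. emb b * (ev emb s' (Polynomial.coeff H i) * x ^ i))"
        using bb by (simp add: dH ev_const[OF emb] distrib_left sum_distrib_left mult.assoc[symmetric])
      also have "(\<Sum>i<d. emb b * (ev emb s' (Polynomial.coeff H i) * x ^ i))
          = (\<Sum>i<d. ev emb s' ([:b:] * Polynomial.coeff H i) * x ^ i)"
        unfolding rhom_mult[OF r] ev_const[OF emb] by (simp add: mult.assoc)
      finally show ?thesis by simp
    qed
    ultimately show ?thesis unfolding integral_elem_def s'_def
      by (intro exI[of _ d] exI[of _ "\<lambda>i. ev emb (s + emb c * x) ([:b:] * Polynomial.coeff H i)"]) auto
  qed
  show ?thesis using int poly_roots_finite[OF bp0] by (intro exI[of _ "{c. poly bp c = 0}"]) auto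
qed

section \<open>Derivatives of a generic relation\<close>

lemma ev_pderiv_const:
  assumes r: "rhom r"
  shows "pderiv (map_poly r g) = map_poly r (pderiv g)"
proof (rule poly_eqI)
  have n: "r (of_nat n) = of_nat n" for n by (induction n) (simp_all add: rhom_simps[OF r])
  fix i
  show "Polynomial.coeff (pderiv (map_poly r g)) i = Polynomial.coeff (map_poly r (pderiv g)) i"
    using n[of "Suc i"] by (simp add: coeff_pderiv coeff_map_poly rhom_zero[OF r] rhom_mult[OF r] del: of_nat_Suc)
qed

lemma map_poly_rhom: "rhom r \<Longrightarrow> rhom (map_poly r)"
proof -
  assume r: "rhom r"
  interpret comm_ring_hom r by unfold_locales (use r in \<open>simp_all add: rhom_simps\<close>)
  interpret m: map_poly_comm_ring_hom r ..
  show ?thesis by (rule rhomI) (simp_all add: m.hom_add m.hom_mult)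
qed

end

text \<open>Inner coefficients of \<open>G\<close> are polynomials in the parameter, which
  \<open>map_poly pderiv\<close> differentiates; \<open>pderiv G\<close> is the derivative in the
  outer variable, for which \<open>t\<close> is substituted.\<close>

lemma chain_rule_relation:
  fixes r :: "'r::idom \<Rightarrow> 'a::idom"
  assumes r: "rhom r" and comm: "\<And>g. pderiv (map_poly r g) = map_poly r (pderiv g)"
    and m: "rhom (map_poly r)"
  shows "pderiv (ev (map_poly r) t G) = ev (map_poly r) t (map_poly pderiv G) + pderiv t * ev (map_poly r) t (pderiv G)"
proof (induction G)
  case 0
  show ?case by (simp add: rhom_zero[OF rhom_ev[OF m]])
next
  case (pCons g G)
  have 1: "ev (map_poly r) t (map_poly pderiv (pCons g G)) = map_poly r (pderiv g) + t * ev (map_poly r) t (map_poly pderiv G)"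
    by (simp add: map_poly_pCons'[of pderiv] ev_pCons[OF m])
  have 2: "ev (map_poly r) t (pderiv (pCons g G)) = ev (map_poly r) t G + t * ev (map_poly r) t (pderiv G)"
    by (simp add: pderiv_pCons rhom_add[OF rhom_ev[OF m]] ev_pCons[OF m] rhom_zero[OF m])
  show ?case unfolding 1 2 ev_pCons[OF m]
    by (simp add: pderiv_add pderiv_mult comm pCons.IH algebra_simps)
qed

context affine_algebra
begin

text \<open>\<open>[:s, x:]\<close> is \<open>s + U x\<close>. The finitely many products of powers
  of \<open>s\<close> and \<open>x\<close> below the degrees of \<open>f\<close> and
  \<open>g\<close> span a module over the polynomials in \<open>P\<close> and \<open>U\<close> that
  is stable under \<open>s + U x\<close> times both leading coefficients. More powers of this
  multiplier than generators are dependent.\<close>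

lemma generic_relation_exists:
  assumes P: "P \<notin> range emb"
    and f: "f \<noteq> 0" "eval2 emb P s f = 0" and g: "g \<noteq> 0" "eval2 emb P x g = 0"
  shows "\<exists>G. G \<noteq> 0 \<and> ev (map_poly (ev emb P)) [:s, x:] G = 0"
proof -
  define r where "r = ev emb P"
  have r: "rhom r" unfolding r_def by (rule rhom_ev[OF emb])
  have r0: "r h = 0 \<Longrightarrow> h = 0" for h unfolding r_def by (rule transcendental[OF P])
  have m: "rhom (map_poly r)" by (rule map_poly_rhom[OF r])
  let ?S = "range (map_poly r)"
  have S: "is_subring ?S" by (rule rhom_range[OF m])
  have c: "[:r h:] \<in> ?S" for h using rangeI[of "map_poly r" "[:h:]"] by (simp add: map_poly_pCons' rhom_zero[OF r])
  have U: "[:0, 1:] \<in> ?S" using rangeI[of "map_poly r" "[:0, 1:]"] by (simp add: map_poly_pCons' rhom_zero[OF r] rhom_one[OF r])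
  define M where "M = (\<lambda>(i, j). [:s ^ i * x ^ j:]) ` ({..<Polynomial.degree f} \<times> {..<Polynomial.degree g})"
  have Mf: "finite M" by (simp add: M_def)
  have deg: "0 < Polynomial.degree h" if "h \<noteq> 0" "eval2 emb P y h = 0" for h y
  proof (rule ccontr)
    assume "\<not> ?thesis"
    then obtain a where a: "h = [:a:]" using degree_eq_zeroE by blast
    then have "r a = 0" using that(2) by (simp add: eval2_ev ev_const[OF r[unfolded r_def]] r_def)
    then show False using r0 a that(1) by simp
  qed
  have top: "r (lead_coeff h) * y ^ Polynomial.degree h = (\<Sum>i<Polynomial.degree h. r (- Polynomial.coeff h i) * y ^ i)"
    if "eval2 emb P y h = 0" for h y
  proof -
    have "0 = (\<Sum>i\<le>Polynomial.degree h. r (Polynomial.coeff h i) * y ^ i)"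
      using that unfolding eval2_ev r_def[symmetric] ev_altdef[OF r] by simp
    also have "{..Polynomial.degree h} = insert (Polynomial.degree h) {..<Polynomial.degree h}" by auto
    finally have "r (lead_coeff h) * y ^ Polynomial.degree h + (\<Sum>i<Polynomial.degree h. r (Polynomial.coeff h i) * y ^ i) = 0"
      by simp
    then show ?thesis by (simp add: rhom_uminus[OF r] sum_negf eq_neg_iff_add_eq_0)
  qed
  define a where "a = lead_coeff f"
  define b where "b = lead_coeff g"
  have ab0: "a \<noteq> 0" "b \<noteq> 0" using f g by (auto simp: a_def b_def)
  have MI: "[:s ^ i * x ^ j:] \<in> M" if "i < Polynomial.degree f" "j < Polynomial.degree g" for i j
    using that by (auto simp: M_def)
  have as: "[:r a * s:] \<in> mult_stable ?S M" unfolding mult_stable_def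
  proof (intro CollectI ballI)
    fix y assume "y \<in> M"
    then obtain i j where ij: "i < Polynomial.degree f" "j < Polynomial.degree g" "y = [:s ^ i * x ^ j:]" by (auto simp: M_def)
    show "[:r a * s:] * y \<in> mspan ?S M"
    proof (cases "Suc i < Polynomial.degree f")
      case True
      then show ?thesis using mspan_single[OF c[of a] MI[OF True ij(2)]] by (simp add: ij ac_simps)
    next
      case False
      then have d: "Polynomial.degree f = Suc i" using ij by simp
      have "[:r a * s:] * y = [:r a * s ^ Polynomial.degree f * x ^ j:]" by (simp add: ij d ac_simps)
      also have "r a * s ^ Polynomial.degree f = (\<Sum>i<Polynomial.degree f. r (- Polynomial.coeff f i) * s ^ i)"
        unfolding a_def by (rule top[OF f(2)])
      also have "[:(\<Sum>i<Polynomial.degree f. r (- Polynomial.coeff f i) * s ^ i) * x ^ j:]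
          = (\<Sum>i<Polynomial.degree f. [:r (- Polynomial.coeff f i):] * [:s ^ i * x ^ j:])"
      proof -
        have hc: "sum (\<lambda>k. [:q k:]) B = [:sum q B:]" for q :: "nat \<Rightarrow> 'a" and B
          by (induction B rule: infinite_finite_induct) auto
        show ?thesis by (simp add: sum_distrib_right hc, simp add: ac_simps)
      qed
      also have "\<dots> \<in> mspan ?S M" using ij by (intro mspan_sum mspan_single c MI) auto
      finally show ?thesis .
    qed
  qed
  have bx: "[:r b * x:] \<in> mult_stable ?S M" unfolding mult_stable_def
  proof (intro CollectI ballI)
    fix y assume "y \<in> M"
    then obtain i j where ij: "i < Polynomial.degree f" "j < Polynomial.degree g" "y = [:s ^ i * x ^ j:]" by (auto simp: M_def)
    show "[:r b * x:] * y \<in> mspan ?S M"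
    proof (cases "Suc j < Polynomial.degree g")
      case True
      then show ?thesis using mspan_single[OF c[of b] MI[OF ij(1) True]] by (simp add: ij ac_simps)
    next
      case False
      then have d: "Polynomial.degree g = Suc j" using ij by simp
      have "[:r b * x:] * y = [:r b * x ^ Polynomial.degree g * s ^ i:]" by (simp add: ij d ac_simps)
      also have "r b * x ^ Polynomial.degree g = (\<Sum>j<Polynomial.degree g. r (- Polynomial.coeff g j) * x ^ j)"
        unfolding b_def by (rule top[OF g(2)])
      also have "[:(\<Sum>j<Polynomial.degree g. r (- Polynomial.coeff g j) * x ^ j) * s ^ i:]
          = (\<Sum>j<Polynomial.degree g. [:r (- Polynomial.coeff g j):] * [:s ^ i * x ^ j:])"
      proof -
        have hc: "sum (\<lambda>k. [:q k:]) B = [:sum q B:]" for q :: "nat \<Rightarrow> 'a" and B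
          by (induction B rule: infinite_finite_induct) auto
        show ?thesis by (simp add: sum_distrib_right hc, simp add: ac_simps)
      qed
      also have "\<dots> \<in> mspan ?S M" using ij by (intro mspan_sum mspan_single c MI) auto
      finally show ?thesis .
    qed
  qed
  note MS = is_subring_mult_stable[OF S, of M]
  have Sm: "z \<in> mult_stable ?S M" if "z \<in> ?S" for z using mult_stable_base[OF S] that by blast
  define t where "t = [:r (a * b):] * [:s, x:]"
  have "t = [:r b:] * [:r a * s:] + [:0, 1:] * ([:r a:] * [:r b * x:])"
    by (simp add: t_def rhom_mult[OF r] ac_simps)
  also have "\<dots> \<in> mult_stable ?S M"
    by (intro subring_add[OF MS] subring_mult[OF MS] as bx Sm[OF c] Sm[OF U])
  finally have t: "t \<in> mult_stable ?S M" .
  have "1 \<in> M" using MI[OF deg[OF f] deg[OF g]] by (simp add: one_pCons)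
  then have te: "t ^ e \<in> mspan ?S M" for e
    using subring_power[OF MS t, of e] by (force simp: mult_stable_def)
  obtain ms where ms: "set ms = M" "distinct ms" using finite_distinct_list[OF Mf] by blast
  have len: "length ms = card M" using ms distinct_card by fastforce
  have "\<exists>v. t ^ e = (\<Sum>d<card M. map_poly r (v d) * ms ! d)" for e
  proof -
    obtain w where w: "\<forall>m\<in>M. w m \<in> ?S" "t ^ e = (\<Sum>m\<in>M. w m * m)"
      using mspan_finite[OF S Mf te] by blast
    have "\<forall>d. \<exists>h. d < card M \<longrightarrow> w (ms ! d) = map_poly r h" using w(1) ms len by (metis nth_mem rangeE)
    then obtain v where v: "\<And>d. d < card M \<Longrightarrow> w (ms ! d) = map_poly r (v d)" by metis
    have "(\<Sum>m\<in>M. w m * m) = (\<Sum>d<card M. w (ms ! d) * ms ! d)"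
      using sum.reindex_bij_betw[OF bij_betw_nth[OF ms(2) refl ms(1)[symmetric]], of "\<lambda>m. w m * m"] len by simp
    also have "\<dots> = (\<Sum>d<card M. map_poly r (v d) * ms ! d)" by (intro sum.cong) (auto simp: v)
    finally show ?thesis using w(2) by auto
  qed
  then obtain v where v: "\<And>e. t ^ e = (\<Sum>d<card M. map_poly r (v e d) * ms ! d)" by metis
  obtain l where l: "\<exists>e\<in>{..card M}. l e \<noteq> 0" "\<forall>d<card M. (\<Sum>e\<in>{..card M}. l e * v e d) = 0"
    using linear_dependence[of "{..card M}" "card M" v] by auto
  have rel: "(\<Sum>e\<le>card M. map_poly r (l e) * t ^ e) = 0"
  proof -
    have "(\<Sum>e\<le>card M. map_poly r (l e) * t ^ e) = (\<Sum>e\<le>card M. \<Sum>d<card M. map_poly r (l e * v e d) * ms ! d)"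
      by (intro sum.cong) (auto simp: v sum_distrib_left rhom_mult[OF m] mult.assoc)
    also have "\<dots> = (\<Sum>d<card M. \<Sum>e\<le>card M. map_poly r (l e * v e d) * ms ! d)" by (rule sum.swap)
    also have "\<dots> = (\<Sum>d<card M. map_poly r (\<Sum>e\<le>card M. l e * v e d) * ms ! d)"
      by (simp add: rhom_sum[OF m] sum_distrib_right)
    also have "\<dots> = 0" using l(2) by (simp add: rhom_zero[OF m])
    finally show ?thesis .
  qed
  \<comment> \<open>The factor \<open>(a * b) ^ e\<close> contained in \<open>t ^ e\<close> is moved
    into the coefficient, so that the relation is one for \<open>s + U x\<close> itself.\<close>
  define G where "G = (\<Sum>e\<le>card M. Polynomial.monom (l e * [:a * b:] ^ e) e)"
  have cG: "Polynomial.coeff G e = (if e \<le> card M then l e * [:a * b:] ^ e else 0)" for e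
    unfolding G_def coeff_sum coeff_monom by (auto simp: sum.delta)
  have "G \<noteq> 0"
  proof -
    obtain e where "e \<le> card M" "l e \<noteq> 0" using l(1) by auto
    then have "Polynomial.coeff G e \<noteq> 0" using ab0 by (simp add: cG)
    then show ?thesis by auto
  qed
  moreover have "ev (map_poly r) [:s, x:] G = (\<Sum>e\<le>card M. map_poly r (l e) * t ^ e)"
    unfolding G_def rhom_sum[OF rhom_ev[OF m]] ev_monom[OF m] t_def power_mult_distrib
    by (simp add: rhom_mult[OF m] rhom_power[OF m] map_poly_pCons' rhom_zero[OF r] mult.assoc)
  ultimately show ?thesis using rel unfolding r_def by auto
qed

text \<open>Differentiating a relation \<open>G(U, s + U x) = 0\<close> of minimal degree with respect to \<open>U\<close> expresses \<open>x\<close>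
  rationally in \<open>U\<close> and \<open>s + U x\<close>; then \<open>U\<close> is specialized.\<close>

lemma generic_primitive:
  assumes P: "P \<notin> range emb"
    and f: "f \<noteq> 0" "eval2 emb P s f = 0" and g: "g \<noteq> 0" "eval2 emb P x g = 0"
  shows "\<exists>B. finite B \<and> (\<forall>c. c \<notin> B \<longrightarrow> x \<in> fracs (range (eval2 emb (s + emb c * x) P)))"
proof -
  define r where "r = ev emb P"
  have r: "rhom r" unfolding r_def by (rule rhom_ev[OF emb])
  have r0: "r h = 0 \<Longrightarrow> h = 0" for h unfolding r_def by (rule transcendental[OF P])
  have m: "rhom (map_poly r)" by (rule map_poly_rhom[OF r])
  have m0: "map_poly r h = 0 \<Longrightarrow> h = 0" for h
    using r0 by (simp add: poly_eq_iff coeff_map_poly rhom_zero[OF r])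
  define E where "E = ev (map_poly r) [:s, x:]"
  have E: "rhom E" unfolding E_def by (rule rhom_ev[OF m])
  have "\<exists>G. G \<noteq> 0 \<and> E G = 0" using generic_relation_exists[OF P f g] by (simp add: E_def r_def)
  then obtain G0 where G0: "G0 \<noteq> 0 \<and> E G0 = 0" ..
  obtain G where G: "G \<noteq> 0" "E G = 0" and min: "\<And>H. H \<noteq> 0 \<Longrightarrow> E H = 0 \<Longrightarrow> Polynomial.degree G \<le> Polynomial.degree H"
    using ex_has_least_nat[where P = "\<lambda>G. G \<noteq> 0 \<and> E G = 0" and m = Polynomial.degree, OF G0] by auto
  have "Polynomial.degree G \<noteq> 0"
  proof
    assume "Polynomial.degree G = 0"
    then obtain h where h: "G = [:h:]" by (rule degree_eq_zeroE)
    then have "map_poly r h = 0" using G(2) by (simp add: E_def ev_const[OF m])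
    then show False using m0 h G(1) by simp
  qed
  \<comment> \<open>In characteristic 0 the derivative of a nonconstant polynomial is nonzero; by
    minimality of the degree it is not a relation, so its value can serve as a denominator for
    \<open>x\<close>.\<close>
  then have "pderiv G \<noteq> 0" "Polynomial.degree (pderiv G) < Polynomial.degree G"
    by (simp_all add: pderiv_eq_0_iff degree_pderiv)
  then have D0: "E (pderiv G) \<noteq> 0" using min[of "pderiv G"] by auto
  have "pderiv (E G) = E (map_poly pderiv G) + pderiv [:s, x:] * E (pderiv G)"
    unfolding E_def by (rule chain_rule_relation[OF r ev_pderiv_const[OF r] m])
  then have rel: "E (map_poly pderiv G) + [:x:] * E (pderiv G) = 0" by (simp add: G(2) pderiv_pCons)
  have fin: "finite {c. poly (E (pderiv G)) (emb c) = 0}"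
  proof -
    have "finite (emb -` {y. poly (E (pderiv G)) y = 0})"
      by (rule finite_vimageI[OF poly_roots_finite[OF D0]]) (simp add: inj_def emb_inj)
    then show ?thesis by (simp add: vimage_def)
  qed
  have "x \<in> fracs (range (eval2 emb (s + emb c * x) P))" if c: "poly (E (pderiv G)) (emb c) \<noteq> 0" for c
  proof -
    let ?s = "s + emb c * x"
    let ?T = "range (eval2 emb ?s P)"
    have T: "is_subring ?T" by (rule rhom_range[OF rhom_eval2[OF emb]])
    have Tm: "emb d \<in> ?T" "?s \<in> ?T" "P \<in> ?T" for d by (metis eval2_simps[OF emb] rangeI)+
    have pT: "poly (E H) (emb c) \<in> ?T" for H
    proof -
      have p: "rhom (\<lambda>q. poly q (emb c))" by (rule rhomI) simp_all
      have "poly (E H) (emb c) = ev (\<lambda>q. poly (map_poly r q) (emb c)) ?s H"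
        using ev_unique[OF rhom_comp[OF p E], of H]
        by (simp add: E_def ev_const[OF m] ev_X[OF m])
      also have "(\<lambda>q. poly (map_poly r q) (emb c)) = ev r (emb c)" by (simp add: fun_eq_iff ev_def)
      also have "ev (ev r (emb c)) ?s H \<in> ?T"
        unfolding r_def by (intro ev_in_subring[OF T] rhom_ev emb Tm)
      finally show ?thesis .
    qed
    have "poly (E (map_poly pderiv G) + [:x:] * E (pderiv G)) (emb c) = 0" unfolding rel by simp
    then have "x * poly (E (pderiv G)) (emb c) = - poly (E (map_poly pderiv G)) (emb c)"
      by (simp add: eq_neg_iff_add_eq_0 add.commute)
    then have "x * poly (E (pderiv G)) (emb c) \<in> ?T" using subring_uminus[OF T pT] by simp
    then show ?thesis using c pT by (intro fracsI[of "poly (E (pderiv G)) (emb c)"])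
  qed
  then show ?thesis using fin by (intro exI[of _ "{c. poly (E (pderiv G)) (emb c) = 0}"]) auto
qed

end

context affine_curve
begin

text \<open>To absorb a further generator \<open>x\<close>, \<open>s\<close> is replaced by
  \<open>s + emb c * x\<close> with \<open>c\<close> outside two finite sets, one for integrality
  and one for birationality. The old \<open>s\<close> is recovered from the new one and
  \<open>x\<close>, so the earlier generators keep both properties.\<close>

lemma plane_generator_finite:
  assumes P: "P \<notin> range emb" and X: "finite X"
  shows "\<exists>s. \<forall>x\<in>X. integral_elem (range (eval2 emb s P)) x \<and> x \<in> fracs (range (eval2 emb s P))"
  using X
proof induction
  case empty
  show ?case by simp
next
  case (insert x X)
  then obtain s where s: "\<And>y. y \<in> X \<Longrightarrow> integral_elem (range (eval2 emb s P)) y"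
    "\<And>y. y \<in> X \<Longrightarrow> y \<in> fracs (range (eval2 emb s P))" by blast
  obtain f where f: "f \<noteq> 0" "eval2 emb P s f = 0" using algebraic_dependence[OF P] by blast
  obtain g where g: "g \<noteq> 0" "eval2 emb P x g = 0" using algebraic_dependence[OF P] by blast
  have "\<exists>G. G \<noteq> 0 \<and> eval2 emb s x G = 0"
  proof (cases "s \<in> range emb")
    case True
    then obtain c where "s = emb c" by blast
    then have "eval2 emb s x [:[:- c, 1:]:] = 0"
      by (simp add: eval2_ev ev_const[OF rhom_ev[OF emb]] ev_pCons[OF emb] rhom_simps[OF emb] rhom_zero[OF rhom_ev[OF emb]])
    then show ?thesis by (intro exI[of _ "[:[:- c, 1:]:]"]) simp
  next
    case False
    then show ?thesis by (rule algebraic_dependence)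
  qed
  then obtain G where G: "G \<noteq> 0" "eval2 emb s x G = 0" by blast
  obtain B1 where B1: "finite B1" "\<And>c. c \<notin> B1 \<Longrightarrow> integral_elem (range (ev emb (s + emb c * x))) x"
    using generic_integral[OF G] by blast
  obtain B2 where B2: "finite B2" "\<And>c. c \<notin> B2 \<Longrightarrow> x \<in> fracs (range (eval2 emb (s + emb c * x) P))"
    using generic_primitive[OF P f g] by blast
  have "infinite (UNIV :: complex set)" using uncountable_UNIV_complex countable_finite by blast
  then obtain c where c: "c \<notin> B1" "c \<notin> B2" using B1(1) B2(1) by (metis UnI1 UnI2 ex_new_if_finite finite_UnI)
  define s' where "s' = s + emb c * x"
  let ?T = "range (eval2 emb s P)" and ?T' = "range (eval2 emb s' P)"
  have T': "is_subring ?T'" by (rule rhom_range[OF rhom_eval2[OF emb]])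
  have Tm: "emb d \<in> ?T'" "s' \<in> ?T'" "P \<in> ?T'" for d by (metis eval2_simps[OF emb] rangeI)+
  have "range (ev emb s') \<subseteq> ?T'" using ev_in_subring[OF T' emb Tm(1,2)] by blast
  then have xi: "integral_elem ?T' x" using B1(2)[OF c(1)] integral_elem_mono unfolding s'_def by blast
  have xf: "x \<in> fracs ?T'" using B2(2)[OF c(2)] unfolding s'_def .
  let ?C = "{y. integral_elem ?T' y}"
  note C = is_subring_integral[OF T']
  have se: "s = s' - emb c * x" by (simp add: s'_def)
  have "s \<in> ?C" unfolding se using xi Tm by (intro subring_diff[OF C] subring_mult[OF C]) (auto intro: integral_elem_base[OF T'])
  then have TC: "?T \<subseteq> ?C" using eval2_in_subring[OF C, of s P] Tm integral_elem_base[OF T'] by auto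
  have Ff: "is_subring (fracs ?T')"
    by (rule is_subringI) (auto intro: fracs_base fracs_add fracs_mult T' subring_one fracs_uminus)
  have "s \<in> fracs ?T'" unfolding se using xf Tm
    by (intro subring_diff[OF Ff] subring_mult[OF Ff]) (auto intro: fracs_base[OF T'])
  then have TF: "?T \<subseteq> fracs ?T'" using eval2_in_subring[OF Ff, of s P] Tm fracs_base[OF T'] by auto
  have "integral_elem ?T' y \<and> y \<in> fracs ?T'" if y: "y \<in> X" for y
  proof
    show "integral_elem ?T' y" using integral_elem_trans[OF T' _ s(1)[OF y]] TC by blast
    obtain q where q: "q \<in> ?T" "q \<noteq> 0" "y * q \<in> ?T" using s(2)[OF y] by (rule fracsE)
    show "y \<in> fracs ?T'" by (rule fracs_div[OF T' subsetD[OF TF q(3)] subsetD[OF TF q(1)] q(2) refl])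
  qed
  then show ?case using xi xf by (intro exI[of _ s']) auto
qed

text \<open>The generator can be taken nonconstant: replace a constant \<open>s\<close> by \<open>s + P\<close>.\<close>

lemma plane_generator:
  assumes P: "P \<notin> range emb"
  shows "\<exists>s. s \<notin> range emb \<and> (\<forall>x. integral_elem (range (eval2 emb s P)) x) \<and> (\<forall>x. x \<in> fracs (range (eval2 emb s P)))"
proof -
  obtain s where s: "\<And>x. x \<in> F \<Longrightarrow> integral_elem (range (eval2 emb s P)) x"
    "\<And>x. x \<in> F \<Longrightarrow> x \<in> fracs (range (eval2 emb s P))" using plane_generator_finite[OF P F(1)] by blast
  let ?T = "range (eval2 emb s P)"
  have T: "is_subring ?T" by (rule rhom_range[OF rhom_eval2[OF emb]])
  have Tm: "emb d \<in> ?T" for d by (metis eval2_simps[OF emb] rangeI)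
  have "x \<in> {y. integral_elem ?T y}" for x
    using s(1) integral_elem_base[OF T Tm] by (intro UNIV_generated[OF is_subring_integral[OF T]]) auto
  then have si: "integral_elem ?T x" for x by simp
  have Ff: "is_subring (fracs ?T)"
    by (rule is_subringI) (auto intro: fracs_base fracs_add fracs_mult T subring_one fracs_uminus)
  have sf: "x \<in> fracs ?T" for x
    using s(2) fracs_base[OF T Tm] by (intro UNIV_generated[OF Ff]) auto
  show ?thesis
  proof (cases "s \<in> range emb")
    case False
    then show ?thesis using si sf by blast
  next
    case True
    then obtain c where c: "s = emb c" by blast
    let ?T' = "range (eval2 emb (s + P) P)"
    have T': "is_subring ?T'" by (rule rhom_range[OF rhom_eval2[OF emb]])
    have Tm': "emb d \<in> ?T'" "s + P \<in> ?T'" "P \<in> ?T'" for d by (metis eval2_simps[OF emb] rangeI)+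
    have "s \<in> ?T'" using c Tm' by simp
    then have sub: "?T \<subseteq> ?T'" using eval2_in_subring[OF T', of s P] Tm' by blast
    have "s + P \<notin> range emb"
    proof
      assume "s + P \<in> range emb"
      then obtain d where "s + P = emb d" by blast
      then have "P = emb (d - c)" using c by (simp add: rhom_diff[OF emb] algebra_simps)
      then show False using P by blast
    qed
    then show ?thesis using integral_elem_mono[OF si sub] fracs_mono[OF sf sub] by blast
  qed
qed

text \<open>Some prime factor \<open>q\<close> of a relation of least degree in \<open>t\<close> is
  a relation. Pseudo-division by \<open>q\<close> leaves no remainder in another relation
  \<open>H\<close>, so \<open>q\<close> divides \<open>[:a:] * H\<close>. As \<open>s\<close> is
  transcendental, \<open>q\<close> involves \<open>t\<close> and cannot divide the factor
  \<open>a\<close>, which is a polynomial in \<open>s\<close>.\<close>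

lemma plane_equation:
  assumes s: "s \<notin> range emb"
  shows "\<exists>q. irreducible q \<and> (\<forall>F. eval2 emb s P F = 0 \<longleftrightarrow> q dvd F)"
proof -
  define ee where "ee = eval2 emb s P"
  have ee: "rhom ee" unfolding ee_def by (rule rhom_eval2[OF emb])
  have "\<exists>G. G \<noteq> 0 \<and> ee G = 0" unfolding ee_def by (rule algebraic_dependence[OF s])
  then obtain G0 where G0: "G0 \<noteq> 0 \<and> ee G0 = 0" ..
  obtain G where G: "G \<noteq> 0" "ee G = 0" and min: "\<And>H. H \<noteq> 0 \<Longrightarrow> ee H = 0 \<Longrightarrow> Polynomial.degree G \<le> Polynomial.degree H"
    using ex_has_least_nat[where P = "\<lambda>G. G \<noteq> 0 \<and> ee G = 0" and m = Polynomial.degree, OF G0] by auto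
  have deg: "Polynomial.degree H \<noteq> 0" if "H \<noteq> 0" "ee H = 0" for H
  proof
    assume "Polynomial.degree H = 0"
    then obtain h where h: "H = [:h:]" by (rule degree_eq_zeroE)
    then have "ev emb s h = 0" using that(2) by (simp add: ee_def eval2_ev ev_const[OF rhom_ev[OF emb]])
    then show False using transcendental[OF s] h that(1) by simp
  qed
  have "\<exists>q. prime_elem q \<and> q dvd G \<and> ee q = 0"
    using G(1,2)
  proof (induction G rule: prime_divisors_induct)
    case zero
    then show ?case by simp
  next
    case (unit x)
    then obtain y where "1 = x * y" by (elim dvdE)
    then have "ee x * ee y = 1" using rhom_mult[OF ee, of x y] rhom_one[OF ee] by simp
    then show ?case using unit by simp
  next
    case (factor p x)
    show ?case
    proof (cases "ee p = 0")
      case True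
      then show ?thesis using factor by (intro exI[of _ p]) auto
    next
      case False
      then have "ee x = 0" "x \<noteq> 0" using factor by (auto simp: rhom_mult[OF ee])
      then obtain q where "prime_elem q" "q dvd x" "ee q = 0" using factor by blast
      then show ?thesis by (intro exI[of _ q]) auto
    qed
  qed
  then obtain q where q: "prime_elem q" "q dvd G" "ee q = 0" by blast
  have q0: "q \<noteq> 0" using q(2) G(1) by auto
  have qmin: "Polynomial.degree q \<le> Polynomial.degree H" if "H \<noteq> 0" "ee H = 0" for H
    using min[OF that] dvd_imp_degree_le[OF q(2) G(1)] by simp
  have "q dvd H" if H: "ee H = 0" for H
  proof -
    obtain a Q where a: "a \<noteq> 0" "smult a H = q * Q + pseudo_mod H q"
      and d: "pseudo_mod H q = 0 \<or> Polynomial.degree (pseudo_mod H q) < Polynomial.degree q"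
      using pseudo_mod[OF q0, of H] by blast
    have "smult a H = [:a:] * H" by simp
    then have "ee (smult a H) = 0" using H by (simp add: rhom_mult[OF ee] del: mult_pCons_left)
    then have "ee (pseudo_mod H q) = 0" using a(2) q(3) by (simp add: rhom_add[OF ee] rhom_mult[OF ee])
    then have "pseudo_mod H q = 0" using qmin[of "pseudo_mod H q"] d by fastforce
    then have "q dvd [:a:] * H" using a(2) by simp
    then consider "q dvd [:a:]" | "q dvd H" using q(1) prime_elem_dvd_mult_iff by blast
    then show ?thesis
    proof cases
      case 1
      then have "Polynomial.degree q \<le> 0" using a(1) dvd_imp_degree_le[of q "[:a:]"] by simp
      then show ?thesis using deg[OF q0 q(3)] by simp
    qed
  qed
  moreover have "ee H = 0" if "q dvd H" for H
    using that q(3) by (auto simp: rhom_mult[OF ee] elim!: dvdE)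
  moreover have "irreducible q" using q(1) by (rule prime_elem_imp_irreducible)
  ultimately show ?thesis unfolding ee_def by blast
qed

end

section \<open>Orders of vanishing\<close>

abbreviation ideal_power :: "'a::comm_ring_1 set \<Rightarrow> nat \<Rightarrow> 'a set" where
  "ideal_power m n \<equiv> m [^]\<^bsub>ideals_set (ring_on UNIV)\<^esub> n"

lemma ideals_set_simps [simp]:
  "x \<otimes>\<^bsub>ideals_set R\<^esub> y = ideal_prod R x y" "\<one>\<^bsub>ideals_set R\<^esub> = carrier R"
  by (simp_all add: ideals_set_def)

lemma mult_power_in_ideal_power: "t \<in> m \<Longrightarrow> a * t ^ n \<in> ideal_power m n"
proof (induction n arbitrary: a)
  case (Suc n)
  then show ?case using ideal_prod.prod[of "a * t ^ n" "ideal_power m n" t m "ring_on UNIV"] by (simp add: ac_simps)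
qed simp

text \<open>If \<open>s\<close> is a common denominator for writing elements of \<open>m\<close> as
  multiples of \<open>t\<close>, each of the \<open>n\<close> factors of a product costs one
  \<open>s\<close>.\<close>

lemma ideal_power_multiple:
  assumes s: "\<And>f. f \<in> m \<Longrightarrow> \<exists>a. s * f = a * t" and f: "f \<in> ideal_power m n"
  shows "\<exists>a. s ^ n * f = a * t ^ n"
  using f
proof (induction n arbitrary: f)
  case (Suc n)
  then have "f \<in> ideal_prod (ring_on UNIV) (ideal_power m n) m" by simp
  then show ?case
  proof induction
    case (prod i j)
    obtain a where a: "s ^ n * i = a * t ^ n" using Suc.IH[OF prod(1)] by blast
    obtain b where b: "s * j = b * t" using s[OF prod(2)] by blast
    have "s ^ Suc n * (i * j) = (s ^ n * i) * (s * j)" by (simp add: ac_simps)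
    also have "\<dots> = (a * b) * t ^ Suc n" unfolding a b by (simp add: ac_simps)
    finally show ?case by auto
  next
    case (sum f g)
    then obtain a b where "s ^ Suc n * f = a * t ^ Suc n" "s ^ Suc n * g = b * t ^ Suc n" by blast
    then have "s ^ Suc n * (f + g) = (a + b) * t ^ Suc n" by (simp only: distrib_left distrib_right)
    then show ?case by auto
  qed
qed simp

lemma is_prime_notin_mult: "is_prime m \<Longrightarrow> a \<notin> m \<Longrightarrow> b \<notin> m \<Longrightarrow> a * b \<notin> m"
  by (auto simp: is_prime_def)

lemma is_prime_notin_power: "is_prime m \<Longrightarrow> a \<notin> m \<Longrightarrow> a ^ n \<notin> m"
  by (induction n) (auto simp: is_prime_def)

text \<open>Nakayama's lemma for the local ring, with denominators outside \<open>m\<close> kept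
  explicit. Generators are eliminated one at a time instead of using a determinant.\<close>

lemma nakayama:
  fixes t :: "'a::comm_ring_1"
  assumes m: "is_prime m" and "finite Y"
    and "\<And>x. x \<in> Y \<Longrightarrow> \<exists>s a c. s \<notin> m \<and> (\<forall>y. c y \<in> m) \<and> s * x = a * t + (\<Sum>y\<in>Y. c y * y)"
  shows "\<exists>s. s \<notin> m \<and> (\<forall>x\<in>Y. \<exists>a. s * x = a * t)"
  using assms(2,3)
proof induction
  case empty
  then show ?case using m by (auto simp: is_prime_def)
next
  case (insert x Y)
  have mi: "is_ideal m" using m by (simp add: is_prime_def)
  obtain s a c where s: "s \<notin> m" "\<And>y. c y \<in> m" "s * x = a * t + (\<Sum>y\<in>insert x Y. c y * y)"
    using insert.prems[of x] by blast
  \<comment> \<open>The coefficient of \<open>x\<close> after collecting terms; it stays outside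
    \<open>m\<close>, that is, invertible locally, because \<open>c x\<close> lies in
    \<open>m\<close>.\<close>
  define s' where "s' = s - c x"
  have s': "s' \<notin> m" using s(1) is_ideal_add[OF mi _ s(2)[of x], of s'] by (auto simp: s'_def)
  have sx: "s' * x = a * t + (\<Sum>y\<in>Y. c y * y)" using s(3) insert.hyps by (simp add: s'_def algebra_simps)
  have "\<exists>s a c. s \<notin> m \<and> (\<forall>y. c y \<in> m) \<and> s * z = a * t + (\<Sum>y\<in>Y. c y * y)" if z: "z \<in> Y" for z
  proof -
    obtain r b d where r: "r \<notin> m" "\<And>y. d y \<in> m" "r * z = b * t + (\<Sum>y\<in>insert x Y. d y * y)"
      using insert.prems[of z] z by blast
    have "(s' * r) * z = s' * (b * t + (d x * x + (\<Sum>y\<in>Y. d y * y)))" using r(3) insert.hyps by (simp add: mult.assoc)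
    also have "\<dots> = s' * b * t + d x * (s' * x) + (\<Sum>y\<in>Y. s' * d y * y)"
      by (simp add: distrib_left sum_distrib_left ac_simps)
    also have "\<dots> = (s' * b + d x * a) * t + (\<Sum>y\<in>Y. (s' * d y + d x * c y) * y)"
      unfolding sx by (simp add: distrib_left distrib_right sum_distrib_left sum.distrib ac_simps)
    finally have "(s' * r) * z = (s' * b + d x * a) * t + (\<Sum>y\<in>Y. (s' * d y + d x * c y) * y)" .
    moreover have "s' * d y + d x * c y \<in> m" for y
      using r(2) s(2) by (intro is_ideal_add[OF mi] is_ideal_mult[OF mi])
    ultimately show ?thesis using is_prime_notin_mult[OF m s' r(1)]
      by (intro exI[of _ "s' * r"] exI[of _ "s' * b + d x * a"] exI[of _ "\<lambda>y. s' * d y + d x * c y"]) blast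
  qed
  then obtain q where q: "q \<notin> m" "\<And>z. z \<in> Y \<Longrightarrow> \<exists>a. q * z = a * t" using insert.IH by blast
  obtain b where b: "\<And>z. z \<in> Y \<Longrightarrow> q * z = b z * t" using q(2) by metis
  have "q * s' * x = q * (a * t) + (\<Sum>y\<in>Y. c y * (q * y))"
    by (simp add: mult.assoc sx distrib_left sum_distrib_left) (simp add: ac_simps)
  also have "(\<Sum>y\<in>Y. c y * (q * y)) = (\<Sum>y\<in>Y. c y * b y) * t" by (simp add: b sum_distrib_right mult.assoc)
  finally have "q * s' * x = (q * a + (\<Sum>y\<in>Y. c y * b y)) * t" by (simp add: distrib_right mult.assoc)
  moreover have "q * s' * z = (s' * b z) * t" if "z \<in> Y" for z
  proof -
    have "q * s' * z = s' * (q * z)" by (simp add: ac_simps)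
    then show ?thesis by (simp add: b[OF that] mult.assoc)
  qed
  ultimately show ?case using is_prime_notin_mult[OF m q(1) s']
    by (intro exI[of _ "q * s'"]) auto
qed

text \<open>\<open>t\<close> generates the maximal ideal of the local ring at \<open>m\<close>.\<close>

definition uniformizer :: "'a::idom set \<Rightarrow> 'a \<Rightarrow> bool" where
  "uniformizer m t \<longleftrightarrow> t \<in> m \<and> t \<noteq> 0 \<and> (\<exists>s. s \<notin> m \<and> (\<forall>f\<in>m. \<exists>a. s * f = a * t))"

lemma ideal_prod_span:
  assumes m: "is_ideal m" and X: "finite X" "\<And>f. f \<in> m \<Longrightarrow> \<exists>b. f = (\<Sum>x\<in>X. b x * x)"
    and f: "f \<in> ideal_prod (ring_on UNIV) m m"
  shows "\<exists>c. (\<forall>x. c x \<in> m) \<and> f = (\<Sum>x\<in>X. c x * x)"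
  using f
proof induction
  case (prod i j)
  obtain b where b: "j = (\<Sum>x\<in>X. b x * x)" using X(2)[OF prod(2)] by blast
  have "i * j = (\<Sum>x\<in>X. i * b x * x)" by (simp add: b sum_distrib_left mult.assoc)
  then show ?case using is_ideal_mult2[OF m prod(1)] by (intro exI[of _ "\<lambda>x. i * b x"]) simp
next
  case (sum f g)
  then obtain c d where "\<forall>x. c x \<in> m" "f = (\<Sum>x\<in>X. c x * x)" "\<forall>x. d x \<in> m" "g = (\<Sum>x\<in>X. d x * x)" by blast
  then show ?case
    by (intro exI[of _ "\<lambda>x. c x + d x"]) (simp add: is_ideal_add[OF m] distrib_right sum.distrib)
qed

text \<open>A basis \<open>t\<close> of the cotangent space generates \<open>m\<close> modulo its
  square. Finite generation of \<open>m\<close> and Nakayama's lemma lift this to the local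
  ring.\<close>

lemma exists_uniformizer:
  fixes m :: "'a::idom set"
  assumes N: "noetherian TYPE('a)" and m: "m \<in> closed_points" and c: "one_dim_cotangent m"
  shows "\<exists>t. uniformizer m t"
proof -
  have mi: "is_ideal m" and mp: "is_prime m" using closed_points_ideal closed_points_prime m by auto
  obtain X where X: "finite X" "X \<subseteq> m" "\<And>f. f \<in> m \<Longrightarrow> \<exists>b. f = (\<Sum>x\<in>X. b x * x)"
  proof -
    obtain X where X: "finite X" "X \<subseteq> m" "m \<subseteq> mspan UNIV X" using N mi unfolding noetherian_def by blast
    have "\<exists>b. f = (\<Sum>x\<in>X. b x * x)" if "f \<in> m" for f
      using mspan_finite[OF is_subring_UNIV X(1), of f] X(3) that by auto
    with X show ?thesis by (intro that) auto
  qed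
  let ?m2 = "ideal_prod (ring_on UNIV) m m"
  obtain t where t: "t \<in> m" "t \<notin> ?m2" "\<And>f. f \<in> m \<Longrightarrow> \<exists>a. f - a * t \<in> ?m2"
    using c unfolding one_dim_cotangent_def Let_def by blast
  have t0: "t \<noteq> 0" using t(2) ideal_prod.prod[of 0 m 0 m "ring_on UNIV"] is_ideal_zero[OF mi] by auto
  have "\<exists>s a c. s \<notin> m \<and> (\<forall>y. c y \<in> m) \<and> s * x = a * t + (\<Sum>y\<in>X. c y * y)" if x: "x \<in> X" for x
  proof -
    obtain a where "x - a * t \<in> ?m2" using t(3) x X(2) by blast
    then obtain c where c: "\<forall>y. c y \<in> m" "x - a * t = (\<Sum>y\<in>X. c y * y)" using ideal_prod_span[OF mi X(1,3)] by blast
    have "1 * x = a * t + (\<Sum>y\<in>X. c y * y)" by (simp flip: c(2))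
    then show ?thesis using c(1) mp unfolding is_prime_def by blast
  qed
  then obtain s where s: "s \<notin> m" "\<And>x. x \<in> X \<Longrightarrow> \<exists>a. s * x = a * t" using nakayama[OF mp X(1)] by blast
  obtain b where b: "\<And>x. x \<in> X \<Longrightarrow> s * x = b x * t" using s(2) by metis
  have "\<exists>a. s * f = a * t" if f: "f \<in> m" for f
  proof -
    obtain d where d: "f = (\<Sum>x\<in>X. d x * x)" using X(3)[OF f] by blast
    have "s * f = (\<Sum>x\<in>X. d x * (s * x))" by (simp add: d sum_distrib_left ac_simps)
    also have "\<dots> = (\<Sum>x\<in>X. d x * b x) * t" by (simp add: b sum_distrib_right mult.assoc)
    finally show ?thesis by blast
  qed
  then show ?thesis using t(1) t0 s(1) unfolding uniformizer_def by blast
qed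

text \<open>If \<open>f\<close> were locally divisible by all powers of \<open>t\<close>, consider
  the ascending ideals \<open>J n\<close> of those \<open>a\<close> for which
  \<open>t ^ n * a\<close> is locally a multiple of \<open>f\<close>. Where they stabilise,
  cancelling \<open>f\<close> makes an element outside \<open>m\<close> a multiple of
  \<open>t\<close>.\<close>

lemma order_exists:
  fixes m :: "'a::idom set"
  assumes N: "noetherian TYPE('a)" and mp: "is_prime m" and t: "uniformizer m t" and f: "f \<noteq> 0"
  shows "\<exists>n s a. s \<notin> m \<and> a \<notin> m \<and> s * f = a * t ^ n"
proof (rule ccontr)
  assume neg: "\<not> ?thesis"
  have mi: "is_ideal m" and m1: "1 \<notin> m" using mp by (auto simp: is_prime_def)
  obtain s0 where s0: "s0 \<notin> m" "\<And>f. f \<in> m \<Longrightarrow> \<exists>a. s0 * f = a * t" and tm: "t \<in> m" "t \<noteq> 0"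
    using t by (auto simp: uniformizer_def)
  have all: "\<exists>s a. s \<notin> m \<and> s * f = a * t ^ n" for n
  proof (induction n)
    case 0
    show ?case using m1 by (intro exI[of _ 1] exI[of _ f]) simp
  next
    case (Suc n)
    then obtain s a where sa: "s \<notin> m" "s * f = a * t ^ n" by blast
    then have "a \<in> m" using neg by blast
    then obtain b where b: "s0 * a = b * t" using s0(2) by blast
    have "(s0 * s) * f = (s0 * a) * t ^ n" by (simp add: sa mult.assoc)
    also have "\<dots> = b * t ^ Suc n" by (simp add: b mult.assoc)
    finally show ?case using is_prime_notin_mult[OF mp s0(1) sa(1)] by blast
  qed
  define J where "J n = {a. \<exists>s b. s \<notin> m \<and> s * t ^ n * a = b * f}" for n
  have J: "is_ideal (J n)" for n unfolding is_ideal_def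
  proof (intro conjI ballI allI)
    show "0 \<in> J n" unfolding J_def using m1 by (intro CollectI exI[of _ 1] exI[of _ 0]) simp
  next
    fix a a' assume "a \<in> J n" "a' \<in> J n"
    then obtain s b s' b' where 1: "s \<notin> m" "s * t ^ n * a = b * f" and 2: "s' \<notin> m" "s' * t ^ n * a' = b' * f"
      unfolding J_def by blast
    have "(s * s') * t ^ n * (a + a') = s' * (s * t ^ n * a) + s * (s' * t ^ n * a')" by (simp add: algebra_simps)
    also have "\<dots> = (s' * b + s * b') * f" unfolding 1 2 by (simp add: algebra_simps)
    finally show "a + a' \<in> J n" unfolding J_def using is_prime_notin_mult[OF mp 1(1) 2(1)] by blast
  next
    fix a' a assume "a \<in> J n"
    then obtain s b where 1: "s \<notin> m" "s * t ^ n * a = b * f" unfolding J_def by blast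
    have "s * t ^ n * (a' * a) = (a' * b) * f" using 1(2) by (simp add: ac_simps) 
    then show "a' * a \<in> J n" unfolding J_def using 1(1) by blast
  qed
  have "J n \<subseteq> J (Suc n)" for n
  proof
    fix a assume "a \<in> J n"
    then obtain s b where 1: "s \<notin> m" "s * t ^ n * a = b * f" unfolding J_def by blast
    have "s * t ^ Suc n * a = t * (s * t ^ n * a)" by (simp add: ac_simps)
    then have "s * t ^ Suc n * a = (t * b) * f" unfolding 1(2) by (simp add: mult.assoc)
    then show "a \<in> J (Suc n)" unfolding J_def using 1(1) by blast
  qed
  then obtain n where n: "J (Suc n) = J n" using noetherian_chain[OF N J] by blast
  obtain s a where sa: "s \<notin> m" "s * f = a * t ^ Suc n" using all by blast
  then have "1 * t ^ Suc n * a = s * f" by (simp add: mult.commute)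
  then have "a \<in> J (Suc n)" unfolding J_def using m1 by blast
  then obtain r b where r: "r \<notin> m" "r * t ^ n * a = b * f" unfolding n unfolding J_def by blast
  have "f * (r * s) = r * (s * f)" by (simp add: ac_simps)
  also have "\<dots> = t * (r * t ^ n * a)" unfolding sa(2) by (simp add: ac_simps)
  also have "\<dots> = f * (b * t)" unfolding r(2) by (simp add: ac_simps)
  finally have "r * s = b * t" using f by simp
  then have "r * s \<in> m" using is_ideal_mult[OF mi tm(1)] by simp
  then show False using is_prime_notin_mult[OF mp r(1) sa(1)] by blast
qed

lemma order_bound:
  fixes m :: "'a::idom set"
  assumes mp: "is_prime m" and t: "t \<in> m" "t \<noteq> 0"
    and 1: "s \<notin> m" "a \<notin> m" "s * f = a * t ^ n" and 2: "s' \<notin> m" "s' * f = a' * t ^ k"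
  shows "k \<le> n"
proof (rule ccontr)
  assume "\<not> ?thesis"
  then have k: "k = n + Suc (k - n - 1)" by simp
  have "t ^ n * (s' * a) = s' * (s * f)" unfolding 1(3) by (simp add: ac_simps)
  also have "\<dots> = s * (s' * f)" by (simp add: ac_simps)
  also have "\<dots> = t ^ n * (s * a' * t ^ (k - n - 1) * t)"
    unfolding 2(2) by (subst k) (simp add: power_add ac_simps)
  finally have "s' * a = s * a' * t ^ (k - n - 1) * t" using t(2) by simp
  also have "\<dots> \<in> m" using mp t(1) by (intro is_ideal_mult) (auto simp: is_prime_def)
  finally show False using is_prime_notin_mult[OF mp 2(1) 1(2)] by blast
qed

lemma ord_elem_eqI:
  fixes m :: "'a::idom set"
  assumes mp: "is_prime m" and t: "uniformizer m t" and 1: "s \<notin> m" "a \<notin> m" "s * f = a * t ^ n"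
  shows "ord_elem m f = n"
proof -
  obtain s0 where s0: "s0 \<notin> m" "\<And>f. f \<in> m \<Longrightarrow> \<exists>a. s0 * f = a * t" and tm: "t \<in> m" "t \<noteq> 0"
    using t by (auto simp: uniformizer_def)
  show ?thesis unfolding ord_elem_def
  proof (rule Greatest_equality)
    show "\<exists>s. s \<notin> m \<and> s * f \<in> ideal_power m n"
      using 1(1) mult_power_in_ideal_power[OF tm(1)] unfolding 1(3)[symmetric] by (metis 1(3))
    fix k assume "\<exists>s. s \<notin> m \<and> s * f \<in> ideal_power m k"
    then obtain r where r: "r \<notin> m" "r * f \<in> ideal_power m k" by blast
    obtain b where "s0 ^ k * (r * f) = b * t ^ k" using ideal_power_multiple[OF s0(2) r(2)] by blast
    then have "(s0 ^ k * r) * f = b * t ^ k" by (simp add: mult.assoc)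
    moreover have "s0 ^ k * r \<notin> m" by (rule is_prime_notin_mult[OF mp is_prime_notin_power[OF mp s0(1)] r(1)])
    ultimately show "k \<le> n" by (intro order_bound[OF mp tm 1])
  qed
qed

section \<open>Discrete valuations at the closed points of a smooth curve\<close>

locale smooth_curve = affine_curve emb F for emb :: "complex \<Rightarrow> 'a::idom" and F +
  assumes smooth: "\<And>m :: 'a set. m \<in> closed_points \<Longrightarrow> one_dim_cotangent m"
begin

lemma order_rep:
  assumes m: "(m :: 'a set) \<in> closed_points" "uniformizer m t" "f \<noteq> 0"
  shows "\<exists>s a. s \<notin> m \<and> a \<notin> m \<and> s * f = a * t ^ ord_elem m f"
  using order_exists[OF noetherian closed_points_prime m(2,3)] ord_elem_eqI[OF closed_points_prime m(2)] m(1) by metis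

lemma uniformizerE:
  assumes "(m :: 'a set) \<in> closed_points" obtains t where "uniformizer m t"
  using exists_uniformizer[OF noetherian assms smooth[OF assms]] by blast

lemma order_le_iff:
  assumes m: "(m :: 'a set) \<in> closed_points" "uniformizer m t" "f \<noteq> 0"
  shows "k \<le> ord_elem m f \<longleftrightarrow> (\<exists>s a. s \<notin> m \<and> s * f = a * t ^ k)"
proof
  have mp: "is_prime m" by (rule closed_points_prime[OF m(1)])
  obtain s a where sa: "s \<notin> m" "a \<notin> m" "s * f = a * t ^ ord_elem m f" using order_rep[OF m] by blast
  show "\<exists>s a. s \<notin> m \<and> s * f = a * t ^ k" if k: "k \<le> ord_elem m f"
  proof -
    have "t ^ ord_elem m f = t ^ (ord_elem m f - k) * t ^ k" using k by (simp flip: power_add)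
    then have "s * f = (a * t ^ (ord_elem m f - k)) * t ^ k" by (simp add: sa(3) mult.assoc)
    then show ?thesis using sa(1) by blast
  qed
  show "k \<le> ord_elem m f" if "\<exists>s a. s \<notin> m \<and> s * f = a * t ^ k"
    using that order_bound[OF mp _ _ sa] m(2) by (auto simp: uniformizer_def)
qed

lemma ord_elem_mult:
  assumes m: "(m :: 'a set) \<in> closed_points" and f: "f \<noteq> 0" "g \<noteq> 0"
  shows "ord_elem m (f * g) = ord_elem m f + ord_elem m g"
proof -
  have mp: "is_prime m" by (rule closed_points_prime[OF m])
  obtain t where t: "uniformizer m t" by (rule uniformizerE[OF m])
  obtain s a where 1: "s \<notin> m" "a \<notin> m" "s * f = a * t ^ ord_elem m f" using order_rep[OF m t f(1)] by blast
  obtain r b where 2: "r \<notin> m" "b \<notin> m" "r * g = b * t ^ ord_elem m g" using order_rep[OF m t f(2)] by blast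
  have "(s * r) * (f * g) = (s * f) * (r * g)" by (simp add: ac_simps)
  also have "\<dots> = (a * b) * t ^ (ord_elem m f + ord_elem m g)" unfolding 1 2 by (simp add: power_add ac_simps)
  finally show ?thesis by (rule ord_elem_eqI[OF mp t is_prime_notin_mult[OF mp 1(1) 2(1)] is_prime_notin_mult[OF mp 1(2) 2(2)]])
qed

lemma ord_elem_add:
  assumes m: "(m :: 'a set) \<in> closed_points" and f: "f \<noteq> 0" "g \<noteq> 0" "f + g \<noteq> 0"
  shows "min (ord_elem m f) (ord_elem m g) \<le> ord_elem m (f + g)" (is "?k \<le> _")
proof -
  have mp: "is_prime m" by (rule closed_points_prime[OF m])
  obtain t where t: "uniformizer m t" by (rule uniformizerE[OF m])
  obtain s a where 1: "s \<notin> m" "s * f = a * t ^ ?k" using order_le_iff[OF m t f(1)] by (meson min.cobounded1)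
  obtain r b where 2: "r \<notin> m" "r * g = b * t ^ ?k" using order_le_iff[OF m t f(2)] by (meson min.cobounded2)
  have "(s * r) * (f + g) = r * (s * f) + s * (r * g)" by (simp add: algebra_simps)
  also have "\<dots> = (r * a + s * b) * t ^ ?k" unfolding 1 2 by (simp add: algebra_simps)
  finally show ?thesis unfolding order_le_iff[OF m t f(3)] using is_prime_notin_mult[OF mp 1(1) 2(1)] by blast
qed

lemma ord_elem_notin:
  assumes m: "(m :: 'a set) \<in> closed_points" and f: "f \<notin> m" shows "ord_elem m f = 0"
proof -
  have mp: "is_prime m" by (rule closed_points_prime[OF m])
  obtain t where t: "uniformizer m t" by (rule uniformizerE[OF m])
  show ?thesis by (rule ord_elem_eqI[OF mp t _ f, of 1]) (use mp in \<open>auto simp: is_prime_def\<close>)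
qed

lemma ord_elem_in:
  assumes m: "(m :: 'a set) \<in> closed_points" and f: "f \<in> m" "f \<noteq> 0" shows "1 \<le> ord_elem m f"
proof -
  obtain t where t: "uniformizer m t" by (rule uniformizerE[OF m])
  then obtain s a where "s \<notin> m" "s * f = a * t" using f(1) by (auto simp: uniformizer_def)
  then have "\<exists>s a. s \<notin> m \<and> s * f = a * t ^ 1" by auto
  then show ?thesis by (simp only: order_le_iff[OF m t f(2)])
qed

lemma ord_elem_uniformizer:
  assumes m: "(m :: 'a set) \<in> closed_points" and t: "uniformizer m t" shows "ord_elem m t = 1"
  by (rule ord_elem_eqI[OF closed_points_prime[OF m] t, of 1 1])
    (use closed_points_prime[OF m] in \<open>auto simp: is_prime_def\<close>)

lemma ord_elem_power:
  assumes "(m :: 'a set) \<in> closed_points" "f \<noteq> 0" shows "ord_elem m (f ^ n) = n * ord_elem m f"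
proof (induction n)
  case 0
  show ?case using ord_elem_notin[OF assms(1), of 1] closed_points_prime[OF assms(1)] by (simp add: is_prime_def)
qed (use assms in \<open>simp add: ord_elem_mult\<close>)

lemma ord_at_Fract:
  assumes m: "(m :: 'a set) \<in> closed_points" and f: "f \<noteq> 0" "g \<noteq> 0"
  shows "ord_at m (Fract f g) = int (ord_elem m f) - int (ord_elem m g)"
  unfolding ord_at_def
proof (rule the_equality)
  fix z assume "\<exists>f' g'. f' \<noteq> 0 \<and> g' \<noteq> 0 \<and> Fract f g = Fract f' g' \<and> z = int (ord_elem m f') - int (ord_elem m g')"
  then obtain f' g' where *: "f' \<noteq> 0" "g' \<noteq> 0" "Fract f g = Fract f' g'" "z = int (ord_elem m f') - int (ord_elem m g')"
    by blast
  then have "f * g' = f' * g" using f by (simp add: eq_fract)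
  then have "ord_elem m f + ord_elem m g' = ord_elem m f' + ord_elem m g"
    using ord_elem_mult[OF m] f * by metis
  then show "z = int (ord_elem m f) - int (ord_elem m g)" using * by simp
qed (use f in blast)

lemma ord_at_mult:
  assumes m: "(m :: 'a set) \<in> closed_points" and x: "x \<noteq> 0" "y \<noteq> 0"
  shows "ord_at m (x * y) = ord_at m x + ord_at m y"
proof -
  obtain f g where x': "x = Fract f g" "f \<noteq> 0" "g \<noteq> 0" using x(1) by (cases x) (auto simp: Zero_fract_def eq_fract)
  obtain f' g' where y': "y = Fract f' g'" "f' \<noteq> 0" "g' \<noteq> 0" using x(2) by (cases y) (auto simp: Zero_fract_def eq_fract)
  show ?thesis using x' y' by (simp add: ord_at_Fract[OF m] ord_elem_mult[OF m])
qed

lemma ord_at_add: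
  assumes m: "(m :: 'a set) \<in> closed_points" and x: "x \<noteq> 0" "y \<noteq> 0" "x + y \<noteq> 0"
  shows "min (ord_at m x) (ord_at m y) \<le> ord_at m (x + y)"
proof -
  obtain f g where x': "x = Fract f g" "f \<noteq> 0" "g \<noteq> 0" using x(1) by (cases x) (auto simp: Zero_fract_def eq_fract)
  obtain f' g' where y': "y = Fract f' g'" "f' \<noteq> 0" "g' \<noteq> 0" using x(2) by (cases y) (auto simp: Zero_fract_def eq_fract)
  have nz: "f * g' + f' * g \<noteq> 0" using x(3) x' y' by (auto simp: Zero_fract_def eq_fract)
  then show ?thesis using x' y' ord_elem_add[OF m, of "f * g'" "f' * g"]
    by (simp add: ord_at_Fract[OF m] ord_elem_mult[OF m])
qed

lemma ord_at_one: "(m :: 'a set) \<in> closed_points \<Longrightarrow> ord_at m 1 = 0"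
  using ord_at_mult[of m 1 1] by simp

lemma ord_at_power: "(m :: 'a set) \<in> closed_points \<Longrightarrow> x \<noteq> 0 \<Longrightarrow> ord_at m (x ^ n) = int n * ord_at m x"
  by (induction n) (simp_all add: ord_at_one ord_at_mult algebra_simps)

lemma ord_at_divide:
  assumes m: "(m :: 'a set) \<in> closed_points" and "x \<noteq> 0" "y \<noteq> 0"
  shows "ord_at m (x / y) = ord_at m x - ord_at m y"
  using ord_at_mult[OF m, of "x / y" y] assms by simp

lemma ord_at_base: "(m :: 'a set) \<in> closed_points \<Longrightarrow> a \<noteq> 0 \<Longrightarrow> ord_at m (Fract a 1) = int (ord_elem m a)"
  using ord_elem_notin[of m 1] closed_points_prime[of m] by (simp add: ord_at_Fract is_prime_def)

text \<open>The ideal \<open>I\<close> of denominators of \<open>x\<close> is contained in no closed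
  point: at each point the two order representations provide a denominator outside it. Hence 1 is a
  denominator.\<close>

lemma regular_if_orders_nonneg:
  fixes x :: "'a fract"
  assumes x: "x \<noteq> 0" and "\<And>m. m \<in> closed_points \<Longrightarrow> 0 \<le> ord_at m x"
  shows "\<exists>a. x = Fract a 1"
proof -
  obtain f g where fg: "x = Fract f g" "f \<noteq> 0" "g \<noteq> 0" using x by (cases x) (auto simp: Zero_fract_def eq_fract)
  define I where "I = {a. \<exists>b. a * f = b * g}"
  have I: "is_ideal I" unfolding is_ideal_def
  proof (intro conjI ballI allI)
    show "0 \<in> I" unfolding I_def by (intro CollectI exI[of _ 0]) simp
    show "a + b \<in> I" if ab: "a \<in> I" "b \<in> I" for a b 
    proof -
      obtain p q where "a * f = p * g" "b * f = q * g" using ab by (auto simp: I_def)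
      then have "(a + b) * f = (p + q) * g" by (simp only: distrib_right)
      then show ?thesis unfolding I_def by blast
    qed
    show "c * a \<in> I" if ab: "a \<in> I" for c a 
    proof -
      obtain p where "a * f = p * g" using ab by (auto simp: I_def)
      then have "(c * a) * f = (c * p) * g" by (simp only: mult.assoc)
      then show ?thesis unfolding I_def by blast
    qed
  qed
  have "1 \<in> I"
  proof (rule ccontr)
    assume "1 \<notin> I"
    then obtain m where m: "m \<in> closed_points" "I \<subseteq> m" using exists_closed_point[OF noetherian I] by blast
    obtain t where t: "uniformizer m t" by (rule uniformizerE[OF m(1)])
    have le: "ord_elem m g \<le> ord_elem m f" using assms(2)[OF m(1)] fg by (simp add: ord_at_Fract[OF m(1)])
    obtain s a where 1: "s \<notin> m" "s * f = a * t ^ ord_elem m g"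
      using le unfolding order_le_iff[OF m(1) t fg(2)] by blast
    obtain r b where 2: "r \<notin> m" "b \<notin> m" "r * g = b * t ^ ord_elem m g" using order_rep[OF m(1) t fg(3)] by blast
    have "(s * b) * f = b * (s * f)" by (simp add: ac_simps)
    also have "\<dots> = a * (b * t ^ ord_elem m g)" unfolding 1(2) by (simp add: ac_simps)
    also have "\<dots> = (a * r) * g" unfolding 2(3)[symmetric] by (simp add: ac_simps)
    finally have "s * b \<in> I" unfolding I_def by blast
    then show False using m(2) is_prime_notin_mult[OF closed_points_prime[OF m(1)] 1(1) 2(2)] by blast
  qed
  then obtain b where "f = b * g" unfolding I_def by auto
  then show ?thesis using fg by (intro exI[of _ b]) (simp add: eq_fract)
qed

lemma closed_points_not_subset: "(m :: 'a set) \<in> closed_points \<Longrightarrow> m' \<in> closed_points \<Longrightarrow> m \<noteq> m' \<Longrightarrow> \<exists>h. h \<in> m \<and> h \<notin> m'"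
  unfolding closed_points_def maximalideal_iff by blast

text \<open>For each point of \<open>B\<close> a function vanishing there but not at
  \<open>m0\<close> is raised to the power \<open>N m\<close>, and these powers are
  multiplied.\<close>

lemma separating_element:
  fixes N :: "'a set \<Rightarrow> nat"
  assumes m0: "(m0 :: 'a set) \<in> closed_points" and "finite B" "B \<subseteq> closed_points" "m0 \<notin> B"
  shows "\<exists>g. g \<notin> m0 \<and> (\<forall>m\<in>B. N m \<le> ord_elem m g)"
  using assms(2-)
proof induction
  case empty
  then show ?case using closed_points_prime[OF m0] by (auto simp: is_prime_def)
next
  case (insert m B)
  have mp: "is_prime m0" by (rule closed_points_prime[OF m0])
  have nz: "g \<noteq> 0" if "g \<notin> m0" for g using that is_ideal_zero[OF closed_points_ideal[OF m0]] by auto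
  obtain g where g: "g \<notin> m0" "\<And>m. m \<in> B \<Longrightarrow> N m \<le> ord_elem m g" using insert by auto
  obtain h where h: "h \<in> m" "h \<notin> m0" using closed_points_not_subset[of m m0] m0 insert.prems by auto
  have "1 \<le> ord_elem m h" using ord_elem_in[OF _ h(1) nz[OF h(2)]] insert.prems by simp
  then have "N m \<le> N m * ord_elem m h" using mult_le_mono2[of 1 _ "N m"] by simp
  then have "N m \<le> ord_elem m (g * h ^ N m)"
    using insert.prems by (simp add: ord_elem_mult ord_elem_power nz g h trans_le_add2)
  moreover have "N x \<le> ord_elem x (g * h ^ N m)" if "x \<in> B" for x
    using insert.prems g(2)[OF that] that by (simp add: subset_iff ord_elem_mult ord_elem_power nz g h trans_le_add1)
  moreover have "g * h ^ N m \<notin> m0" using is_prime_notin_mult[OF mp g(1) is_prime_notin_power[OF mp h(2)]] .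
  ultimately show ?case by (intro exI[of _ "g * h ^ N m"]) auto
qed

text \<open>\<open>Fract s t\<close> has a simple pole at \<open>m0\<close> and no pole elsewhere,
  so powers of it or of \<open>t\<close> give the required order at \<open>m0\<close>. A function
  nonzero at \<open>m0\<close> then enforces the conditions at the finitely many other
  points.\<close>

lemma section_exact_order:
  assumes m0: "(m0 :: 'a set) \<in> closed_points" and E: "finite {m \<in> closed_points. E m \<noteq> 0}"
  shows "\<exists>x\<in>global_sections E. x \<noteq> 0 \<and> ord_at m0 x = - E m0"
proof -
  obtain t where t: "uniformizer m0 t" by (rule uniformizerE[OF m0])
  then obtain s where s: "s \<notin> m0" "\<And>f. f \<in> m0 \<Longrightarrow> \<exists>a. s * f = a * t" and t0: "t \<noteq> 0" "t \<in> m0" by (auto simp: uniformizer_def)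
  have nz: "g \<noteq> 0" if "g \<notin> m0" for g using that is_ideal_zero[OF closed_points_ideal[OF m0]] by auto
  have m01: "1 \<notin> m0" using closed_points_prime[OF m0] by (simp add: is_prime_def)
  define y where "y = (if 0 \<le> E m0 then Fract s t ^ nat (E m0) else Fract t 1 ^ nat (- E m0))"
  have st: "Fract s t \<noteq> 0" "Fract t 1 \<noteq> 0" using nz[OF s(1)] t0 by (simp_all add: Zero_fract_def eq_fract)
  have y0: "y \<noteq> 0" using st by (simp add: y_def)
  have y1: "ord_at m0 y = - E m0"
    using m0 st s(1) t0 nz[OF s(1)]
    by (simp add: y_def ord_at_power ord_at_Fract ord_elem_notin[OF m0 s(1)] ord_elem_uniformizer[OF m0 t]
        ord_elem_notin[OF m0, of 1] m01)
  have y2: "0 \<le> ord_at m y" if m: "m \<in> closed_points" "m \<noteq> m0" for m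
  proof -
    obtain f where f: "f \<in> m0" "f \<notin> m" using closed_points_not_subset[OF m0 m(1)] m(2) by auto
    obtain a where a: "s * f = a * t" using s(2)[OF f(1)] by blast
    have f0: "f \<noteq> 0" using f(2) is_ideal_zero[OF closed_points_ideal[OF m(1)]] by auto
    then have a0: "a \<noteq> 0" using a nz[OF s(1)] by auto
    \<comment> \<open>The same fraction with a denominator that does not vanish at \<open>m\<close>,
      which excludes a pole there.\<close>
    have "Fract s t = Fract a f" using a t0 f0 by (simp add: eq_fract)
    then have "0 \<le> ord_at m (Fract s t)" using a0 f0 m by (simp add: ord_at_Fract ord_elem_notin[OF m(1) f(2)])
    then show ?thesis using m st t0 by (simp add: y_def ord_at_power ord_at_base mult_nonpos_nonneg)
  qed
  define B where "B = {m \<in> closed_points. E m \<noteq> 0} - {m0}"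
  obtain g where g: "g \<notin> m0" "\<And>m. m \<in> B \<Longrightarrow> nat (- E m) \<le> ord_elem m g"
    using separating_element[OF m0, of B "\<lambda>m. nat (- E m)"] E by (auto simp: B_def)
  have g0: "Fract g 1 \<noteq> 0" using nz[OF g(1)] by (simp add: Fract1_eq_0)
  let ?x = "y * Fract g 1"
  have "ord_at m0 ?x = - E m0"
    using y0 y1 g0 nz[OF g(1)] by (simp add: ord_at_mult[OF m0] ord_at_base[OF m0] ord_elem_notin[OF m0 g(1)])
  moreover have "0 \<le> ord_at m ?x + E m" if m: "m \<in> closed_points" for m
  proof (cases "m = m0")
    case True
    then show ?thesis using calculation by simp
  next
    case False
    have "ord_at m ?x = ord_at m y + int (ord_elem m g)"
      using y0 g0 nz[OF g(1)] by (simp add: ord_at_mult[OF m] ord_at_base[OF m])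
    moreover have "0 \<le> int (ord_elem m g) + E m"
      using g(2)[of m] m False by (cases "E m = 0") (auto simp: B_def)
    ultimately show ?thesis using y2[OF m False] by simp
  qed
  ultimately show ?thesis using y0 g0 by (intro bexI[of _ ?x]) (auto simp: global_sections_def)
qed

end

section \<open>Sections of divisors\<close>

lemma common_denominator:
  fixes D :: "'b \<Rightarrow> rat"
  assumes "finite B" shows "\<exists>d>0. \<forall>m\<in>B. of_nat d * D m \<in> \<int>"
  using assms
proof induction
  case empty
  show ?case by auto
next
  case (insert m B)
  then obtain d where d: "0 < d" "\<And>m. m \<in> B \<Longrightarrow> of_nat d * D m \<in> \<int>" by blast
  obtain a b :: int where ab: "0 < b" "D m = of_int a / of_int b"
    using quotient_of_div[of "D m"] quotient_of_denom_pos[of "D m"] by (cases "quotient_of (D m)") auto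
  have "of_nat (d * nat b) * D m = of_int (int d * a)" using ab by simp
  then have "of_nat (d * nat b) * D m \<in> \<int>" by (metis Ints_of_int)
  moreover have "of_nat (d * nat b) * D x \<in> \<int>" if "x \<in> B" for x
  proof -
    have "of_nat (d * nat b) * D x = of_nat (nat b) * (of_nat d * D x)" by (simp add: ac_simps)
    then show ?thesis using d(2)[OF that] by (metis Ints_mult Ints_of_nat)
  qed
  moreover have "0 < d * nat b" using d ab by simp
  ultimately show ?case by (intro exI[of _ "d * nat b"]) auto
qed

lemma min_denom:
  assumes "is_qdivisor D" shows "0 < min_denom D" "of_nat (min_denom D) * D m \<in> \<int>"
proof -
  obtain d where d: "0 < d" "\<And>m. D m \<noteq> 0 \<Longrightarrow> of_nat d * D m \<in> \<int>"
    using common_denominator[of "{m. D m \<noteq> 0}" D] assms by (auto simp: is_qdivisor_def)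
  have "0 < d \<and> (\<forall>m. of_nat d * D m \<in> \<int>)" using d by (metis Ints_0 mult_zero_right)
  then have "0 < min_denom D \<and> (\<forall>m. of_nat (min_denom D) * D m \<in> \<int>)"
    unfolding min_denom_def by (rule LeastI)
  then show "0 < min_denom D" "of_nat (min_denom D) * D m \<in> \<int>" by auto
qed

lemma nonneg_add_floor_iff: "0 \<le> z + \<lfloor>r :: rat\<rfloor> \<longleftrightarrow> 0 \<le> of_int z + r"
  using le_floor_iff[of "- z" r] by (simp add: algebra_simps) linarith

lemma nonneg_if_multiples_bounded:
  fixes c r :: rat
  assumes "\<And>N::nat. 0 \<le> c + of_nat N * r" shows "0 \<le> r"
proof (rule ccontr)
  assume "\<not> ?thesis"
  then have r: "0 < - r" by simp
  obtain N :: nat where "c < of_nat N * - r" using ex_less_of_nat_mult[OF r] by blast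
  then show False using assms[of N] by simp
qed

locale divisor_pair = smooth_curve emb F for emb :: "complex \<Rightarrow> 'a::idom" and F +
  fixes Dp Dm :: "'a set \<Rightarrow> rat"
  assumes Dp: "is_qdivisor Dp" and Dm: "is_qdivisor Dm" and neg: "Dp m + Dm m \<le> 0"
begin

definition E :: "int \<Rightarrow> 'a set \<Rightarrow> int" where
  "E n m = \<lfloor>if n \<ge> 0 then of_int n * Dp m else of_int (- n) * Dm m\<rfloor>"

definition G :: "int \<Rightarrow> 'a fract set" where "G n = global_sections (E n)"

lemma graded_piece_eq: "graded_piece Dp Dm n = Poly_Mapping.single n ` G n"
  by (simp add: graded_piece_def G_def E_def[abs_def])

lemma single_image_iff: "Poly_Mapping.single n x \<in> Poly_Mapping.single n ` X \<longleftrightarrow> x \<in> X"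
  by (auto dest: arg_cong[of _ _ "\<lambda>f. Poly_Mapping.lookup f n"])

lemma DPD_algebra_eq: "DPD_algebra Dp Dm = ring_on {f. \<forall>n. Poly_Mapping.lookup f n \<in> G n}"
  by (simp add: DPD_algebra_def graded_piece_eq single_image_iff)

lemma E_finite: "finite {m \<in> closed_points. E n m \<noteq> 0}"
proof (rule finite_subset)
  show "finite ({m. Dp m \<noteq> 0} \<union> {m. Dm m \<noteq> 0})" using Dp Dm by (simp add: is_qdivisor_def)
qed (auto simp: E_def split: if_splits)

text \<open>Since \<open>D\<^sub>+ \<le> - D\<^sub>-\<close>, the degree \<open>n\<close> piece is cut out by both \<open>n D\<^sub>+\<close> and \<open>- n D\<^sub>-\<close>, whatever the
  sign of \<open>n\<close>.\<close>

lemma mem_G: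
  "x \<in> G n \<longleftrightarrow> x = 0 \<or> (\<forall>m\<in>closed_points. 0 \<le> of_int (ord_at m x) + of_int n * Dp m \<and>
     0 \<le> of_int (ord_at m x) - of_int n * Dm m)"
proof -
  have "0 \<le> ord_at m x + E n m \<longleftrightarrow> 0 \<le> of_int (ord_at m x) + of_int n * Dp m \<and>
     0 \<le> of_int (ord_at m x) - of_int n * Dm m" for m
  proof (cases "0 \<le> n")
    case True
    then have "of_int n * (Dp m + Dm m) \<le> 0" using neg[of m] by (simp add: mult_nonneg_nonpos)
    then show ?thesis using True by (auto simp: E_def nonneg_add_floor_iff distrib_left)
  next
    case False
    then have "0 \<le> of_int n * (Dp m + Dm m)" using neg[of m] by (simp add: mult_nonpos_nonpos)
    then show ?thesis using False by (auto simp: E_def nonneg_add_floor_iff distrib_left)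
  qed
  then show ?thesis by (simp add: G_def global_sections_def)
qed

lemma G_nonzero: "\<exists>x\<in>G n. x \<noteq> 0"
proof -
  have "is_ideal {0::'a}" "1 \<notin> {0::'a}" using is_prime_zero by (simp_all add: is_prime_def)
  then obtain m :: "'a set" where "m \<in> closed_points" using exists_closed_point[OF noetherian] by blast
  then show ?thesis using section_exact_order[OF _ E_finite] unfolding G_def by blast
qed

lemma generator_nonzero: "G n = range (\<lambda>a. v * Fract a 1) \<Longrightarrow> v \<noteq> 0"
  using G_nonzero[of n] by auto

lemma generator_mem: "G n = range (\<lambda>a. v * Fract a 1) \<Longrightarrow> v \<in> G n"
  using rangeI[of "\<lambda>a. v * Fract a 1" 1] by (simp add: rhom_one[OF Fract1])

text \<open>Being a section bounds the order of \<open>v\<close> from below. A section attaining the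
  bound at \<open>m\<close> exists and is a regular multiple of \<open>v\<close>, which bounds the
  order from above.\<close>

lemma generator_order:
  assumes v: "G n = range (\<lambda>a. v * Fract a 1)" and m: "m \<in> closed_points"
  shows "ord_at m v = - E n m"
proof -
  obtain x where x: "x \<in> G n" "x \<noteq> 0" "ord_at m x = - E n m"
    using section_exact_order[OF m E_finite] unfolding G_def by blast
  then obtain a where a: "x = v * Fract a 1" unfolding v by blast
  then have nz: "v \<noteq> 0" "Fract a 1 \<noteq> 0" "a \<noteq> 0" using x(2) by (auto simp: Fract1_eq_0)
  have "ord_at m x = ord_at m v + int (ord_elem m a)"
    unfolding a ord_at_mult[OF m nz(1,2)] ord_at_base[OF m nz(3)] ..
  moreover have "0 \<le> ord_at m v + E n m"
    using generator_mem[OF v] nz(1) m by (simp add: G_def global_sections_def)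
  ultimately show ?thesis using x(3) by simp
qed

lemma G_0: "G 0 = range (\<lambda>a. Fract a 1)"
proof
  have "\<exists>a. x = Fract a 1" if x: "x \<in> G 0" for x
    using regular_if_orders_nonneg[of x] x Fract1_eq_0[of 0] by (cases "x = 0") (auto simp: mem_G)
  then show "G 0 \<subseteq> range (\<lambda>a. Fract a 1)" by blast
  show "range (\<lambda>a. Fract a 1) \<subseteq> G 0"
  proof
    fix x :: "'a fract" assume "x \<in> range (\<lambda>a. Fract a 1)"
    then obtain a where "x = Fract a 1" by blast
    then show "x \<in> G 0" by (cases "a = 0") (auto simp: mem_G ord_at_base Fract1_eq_0)
  qed
qed

lemma G_zero: "0 \<in> G n" by (simp add: mem_G)

lemma G_add: assumes "x \<in> G n" "y \<in> G n" shows "x + y \<in> G n"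
proof -
  consider "x = 0 \<or> y = 0 \<or> x + y = 0" | "x \<noteq> 0" "y \<noteq> 0" "x + y \<noteq> 0" by blast
  then show ?thesis
  proof cases
    case 2
    have "0 \<le> ord_at m (x + y) + E n m" if m: "m \<in> closed_points" for m
      using ord_at_add[OF m 2] assms 2 m by (auto simp: G_def global_sections_def min_def split: if_splits)
    then show ?thesis by (simp add: G_def global_sections_def)
  qed (use assms G_zero in auto)
qed

lemma G_mult: assumes "x \<in> G n" "y \<in> G n'" shows "x * y \<in> G (n + n')"
proof (cases "x = 0 \<or> y = 0")
  case False
  have "0 \<le> of_int (ord_at m (x * y)) + of_int (n + n') * Dp m \<and>
     0 \<le> of_int (ord_at m (x * y)) - of_int (n + n') * Dm m" if m: "m \<in> closed_points" for m
  proof -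
    have "0 \<le> of_int (ord_at m x) + of_int n * Dp m" "0 \<le> of_int (ord_at m x) - of_int n * Dm m"
      "0 \<le> of_int (ord_at m y) + of_int n' * Dp m" "0 \<le> of_int (ord_at m y) - of_int n' * Dm m"
      using assms False m by (auto simp: mem_G)
    then show ?thesis using False by (simp add: ord_at_mult[OF m] distrib_right)
  qed
  then show ?thesis by (simp add: mem_G)
qed (auto simp: G_zero)

text \<open>Each order inequality for \<open>a * x ^ N\<close> is affine in \<open>N\<close>; if it
  holds for all \<open>N\<close>, its slope, which is the inequality for \<open>x\<close>, is
  nonnegative.\<close>

lemma G_root:
  assumes a: "a \<noteq> 0" and x: "\<And>N. a * x ^ N \<in> G (e + int N * n)"
  shows "x \<in> G n"
proof (cases "x = 0")
  case False
  have "0 \<le> of_int (ord_at m x) + of_int n * Dp m \<and> 0 \<le> of_int (ord_at m x) - of_int n * Dm m"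
    if m: "m \<in> closed_points" for m
  proof
    have o: "ord_at m (a * x ^ N) = ord_at m a + int N * ord_at m x" for N
      using a False by (simp add: ord_at_mult[OF m] ord_at_power[OF m])
    have "a * x ^ N \<noteq> 0" for N using a False by simp
    then have "0 \<le> of_int (ord_at m (a * x ^ N)) + of_int (e + int N * n) * Dp m \<and>
        0 \<le> of_int (ord_at m (a * x ^ N)) - of_int (e + int N * n) * Dm m" for N
      using x[of N] m unfolding mem_G by blast
    note * = this[unfolded o]
    show "0 \<le> of_int (ord_at m x) + of_int n * Dp m"
    proof (rule nonneg_if_multiples_bounded)
      fix N :: nat
      show "0 \<le> of_int (ord_at m a) + of_int e * Dp m + of_nat N * (of_int (ord_at m x) + of_int n * Dp m)"
        using *[of N] by (simp add: algebra_simps)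
    qed
    show "0 \<le> of_int (ord_at m x) - of_int n * Dm m"
    proof (rule nonneg_if_multiples_bounded)
      fix N :: nat
      show "0 \<le> of_int (ord_at m a) - of_int e * Dm m + of_nat N * (of_int (ord_at m x) - of_int n * Dm m)"
        using *[of N] by (simp add: algebra_simps)
    qed
  qed
  then show ?thesis by (simp add: mem_G)
qed (simp add: G_zero)

text \<open>The multiple of \<open>D_+\<close> by its minimal denominator is integral, so no
  rounding occurs and \<open>v\<close> has exactly the opposite orders. Dividing by \<open>v\<close>
  therefore loses nothing in the condition with \<open>D_+\<close>, which decides membership for
  \<open>n \<ge> 0\<close>.\<close>

lemma G_divide_generator_pos:
  assumes v: "G (int (min_denom Dp)) = range (\<lambda>a. v * Fract a 1)"
    and n: "0 \<le> n" and x: "x \<in> G (n + int (min_denom Dp))"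
  shows "x / v \<in> G n"
proof (cases "x = 0")
  case False
  have "0 \<le> ord_at m (x / v) + E n m" if m: "m \<in> closed_points" for m
  proof -
    have "of_int (E (int (min_denom Dp)) m) = of_nat (min_denom Dp) * Dp m"
      using min_denom(2)[OF Dp, of m] by (simp add: E_def)
    then have "of_int (ord_at m v) = - (of_nat (min_denom Dp) * Dp m)"
      unfolding generator_order[OF v m] by simp
    moreover have "0 \<le> of_int (ord_at m x) + of_int (n + int (min_denom Dp)) * Dp m"
      using x False m by (auto simp: mem_G)
    ultimately show ?thesis
      using n generator_nonzero[OF v] False
      by (simp add: E_def nonneg_add_floor_iff ord_at_divide[OF m] distrib_right)
  qed
  then show ?thesis by (simp add: G_def global_sections_def)
qed (simp add: G_zero)

lemma G_divide_generator_neg: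
  assumes w: "G (- int (min_denom Dm)) = range (\<lambda>a. w * Fract a 1)"
    and n: "n \<le> 0" and x: "x \<in> G (n - int (min_denom Dm))"
  shows "x / w \<in> G n"
proof (cases "x = 0")
  case False
  have "0 \<le> of_int (ord_at m (x / w)) + of_int n * Dp m \<and> 0 \<le> of_int (ord_at m (x / w)) - of_int n * Dm m"
    if m: "m \<in> closed_points" for m
  proof -
    have "of_int (E (- int (min_denom Dm)) m) = of_nat (min_denom Dm) * Dm m"
      using min_denom[OF Dm] by (simp add: E_def)
    then have "of_int (ord_at m w) = - (of_nat (min_denom Dm) * Dm m)"
      unfolding generator_order[OF w m] by simp
    moreover have "0 \<le> of_int (ord_at m x) - of_int (n - int (min_denom Dm)) * Dm m"
      using x False m by (auto simp: mem_G)
    ultimately have "0 \<le> of_int (ord_at m (x / w)) - of_int n * Dm m"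
      using generator_nonzero[OF w] False by (simp add: ord_at_divide[OF m] left_diff_distrib)
    moreover have "0 \<le> of_int n * (Dp m + Dm m)" using neg[of m] n by (simp add: mult_nonpos_nonpos)
    ultimately show ?thesis by (simp add: distrib_left)
  qed
  then show ?thesis by (simp add: mem_G)
qed (simp add: G_zero)

lemma section_algebra:
  assumes u: "G (- 1) = range (\<lambda>a. u * Fract a 1)" and u1: "G 1 = range (\<lambda>a. u1 * Fract a 1)"
    and v: "G (int (min_denom Dp)) = range (\<lambda>a. v * Fract a 1)"
    and w: "G (- int (min_denom Dm)) = range (\<lambda>a. w * Fract a 1)"
  shows "section_algebra G (min_denom Dp) (min_denom Dm) u u1 v w"
  by (rule section_algebra.intro[OF G_0 G_zero G_add G_mult G_root min_denom(1)[OF Dp] min_denom(1)[OF Dm]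
      generator_mem[OF u] generator_nonzero[OF u] generator_mem[OF u1] generator_nonzero[OF u1]
      generator_mem[OF v] generator_nonzero[OF v] generator_mem[OF w] generator_nonzero[OF w]
      G_divide_generator_pos[OF v] G_divide_generator_neg[OF w]])

lemma generator_lookup:
  assumes "graded_piece Dp Dm n = range (\<lambda>a. g * base a)"
  obtains v where "g = Poly_Mapping.single n v" "G n = range (\<lambda>a. v * Fract a 1)"
proof -
  have "g \<in> graded_piece Dp Dm n"
    unfolding assms using rangeI[of "\<lambda>a. g * base a" 1] by (simp add: rhom_one[OF rhom_base])
  then obtain v where v: "g = Poly_Mapping.single n v" by (auto simp: graded_piece_eq)
  have "x \<in> G n \<longleftrightarrow> (\<exists>a. x = v * Fract a 1)" for x
  proof -
    have "x \<in> G n \<longleftrightarrow> Poly_Mapping.single n x \<in> range (\<lambda>a. g * base a)"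
      by (simp flip: assms add: graded_piece_eq single_image_iff)
    also have "\<dots> \<longleftrightarrow> (\<exists>a. Poly_Mapping.single n x = Poly_Mapping.single n (v * Fract a 1))"
      by (auto simp: v base_def mult_single)
    finally show ?thesis by (metis lookup_single_eq)
  qed
  then show thesis using v by (intro that) auto
qed

end

theorem proposition4p8:
  fixes emb :: "complex \<Rightarrow> 'a::idom"
    and Dp Dm :: "'a set \<Rightarrow> rat"
    and u_p u_m v_p v_m :: "'a laurent"
    and Q P_p P_m :: 'a
    and dp dm k dp' dm' :: nat
  assumes curve: "smooth_affine_curve emb"
    and Dp: "is_qdivisor Dp" and Dm: "is_qdivisor Dm"
    and neg: "\<forall>m. Dp m + Dm m \<le> 0"
    and dp: "dp = min_denom Dp" and dm: "dm = min_denom Dm"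
    and A_1: "graded_piece Dp Dm 1 = range (\<lambda>a. u_p * base a)"
    and A_m1: "graded_piece Dp Dm (- 1) = range (\<lambda>a. u_m * base a)"
    and A_dp: "graded_piece Dp Dm (int dp) = range (\<lambda>a. v_p * base a)"
    and A_dm: "graded_piece Dp Dm (- int dm) = range (\<lambda>a. v_m * base a)"
    and Q: "u_p * u_m = base Q"
    and P_p: "u_p ^ dp = base P_p * v_p"
    and P_m: "u_m ^ dm = base P_m * v_m"
    and k: "k = gcd dp dm" and dp': "dp' = dp div k" and dm': "dm' = dm div k"
  shows "\<exists>P Qp :: 'a.
    Fract P 1 = Fract (Q ^ (k * dp' * dm')) 1 / (Fract P_p 1 ^ dm' * Fract P_m 1 ^ dp') \<and>
    Fract Qp 1 = Fract (Q ^ dp) 1 / Fract P_p 1 \<and>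
    \<comment> \<open>(a)\<close>
    (let S = B_relations dp dm dp' dm' P_m P Qp; B = rel_quotient S in
      is_grading B (weighted_part S dp dm) \<and>
      (\<exists>\<phi>. (\<forall>p. \<phi> (rel_class S p) = eval3 base u_m v_p v_m p) \<and>
        (\<forall>n. \<phi> ` weighted_part S dp dm n \<subseteq> graded_piece Dp Dm n) \<and>
        is_normalization B (DPD_algebra Dp Dm) \<phi>)) \<and>
    \<comment> \<open>(b)\<close>
    (let S = hypersurface_relation dp' dm' P; H = rel_quotient S in
      primeideal (nilradical H) H \<and>
      (\<exists>\<psi>. (\<forall>p. \<psi> (normalization_map H (rel_class S p)) = eval2 base v_p v_m p) \<and>
        cyclic_branched_covering (normalization H) (DPD_algebra Dp Dm) \<psi> k)) \<and>
    \<comment> \<open>(c)\<close>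
    (k = 1 \<and> v_p \<notin> Units (DPD_algebra Dp Dm) \<longrightarrow>
      (\<exists>q :: complex poly poly. irreducible q \<and>
        (let S = space_relation dp dm q; X = rel_quotient S in
          \<exists>s \<in> carrier (DPD_algebra Dp Dm). \<exists>\<phi>.
            (\<forall>p. \<phi> (rel_class S p) = eval3 (\<lambda>c. base (emb c)) s v_p v_m p) \<and>
            is_normalization X (DPD_algebra Dp Dm) \<phi>)))"

proof -
  obtain F where F: "finite F" "generate_ring (ring_on UNIV) (range emb \<union> F) = UNIV"
    and emb_hom: "emb \<in> Ring.ring_hom (ring_on UNIV) (ring_on UNIV)"
    and curve': "krull_dim_one TYPE('a)" "\<And>m :: 'a set. m \<in> closed_points \<Longrightarrow> one_dim_cotangent m"
    using curve unfolding smooth_affine_curve_def by blast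
  have emb: "rhom emb"
    using ring_hom_add[OF emb_hom] ring_hom_mult[OF emb_hom] ring_hom_one[OF emb_hom] by (intro rhomI) simp_all
  interpret divisor_pair emb F Dp Dm
    using emb F curve' Dp Dm neg by unfold_locales auto
  obtain u1 where u1: "u_p = Poly_Mapping.single 1 u1" "G 1 = range (\<lambda>a. u1 * Fract a 1)"
    using A_1 by (rule generator_lookup)
  obtain u where u: "u_m = Poly_Mapping.single (- 1) u" "G (- 1) = range (\<lambda>a. u * Fract a 1)"
    using A_m1 by (rule generator_lookup)
  obtain v where v: "v_p = Poly_Mapping.single (int dp) v" "G (int dp) = range (\<lambda>a. v * Fract a 1)"
    using A_dp by (rule generator_lookup)
  obtain w where w: "v_m = Poly_Mapping.single (- int dm) w" "G (- int dm) = range (\<lambda>a. w * Fract a 1)"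
    using A_dm by (rule generator_lookup)
  interpret S: section_algebra G dp dm u u1 v w
    using section_algebra[OF u(2) u1(2)] v(2) w(2) unfolding dp dm by blast
  have k0: "0 < k" using S.dp_pos by (simp add: k)
  have dpe: "dp = k * dp'" "dm = k * dm'" by (simp_all add: dp' dm' k)
  have cop: "coprime dp' dm'" unfolding dp' dm' k using S.dp_pos by (intro div_gcd_coprime) simp
  have u1u: "u1 * u = Fract Q 1"
    using Q by (simp add: u1(1) u(1) mult_single base_def) (metis lookup_single_eq)
  have Pp: "u1 ^ dp = Fract P_p 1 * v"
    using P_p by (simp add: u1(1) v(1) mult_single base_def single_power) (metis lookup_single_eq)
  have Pm: "u ^ dm = Fract P_m 1 * w"
    using P_m by (simp add: u(1) w(1) mult_single base_def single_power) (metis lookup_single_eq)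
  have e: "int dm' * int dp + int dp' * (- int dm) = 0" by (simp add: dpe)
  have "v ^ dm' * w ^ dp' \<in> G 0"
    using S.G_mult[OF S.G_power[OF S.v(1), of dm'] S.G_power[OF S.w(1), of dp']] unfolding e .
  then obtain P where P: "Fract P 1 = v ^ dm' * w ^ dp'" using G_0 by fastforce
  have "u ^ dp * v \<in> G 0" using S.G_mult[OF S.G_power[OF S.u(1), of dp] S.v(1)] by simp
  then obtain Qp where Qp: "Fract Qp 1 = u ^ dp * v" using G_0 by fastforce
  \<comment> \<open>A primitive complex \<open>k\<close>-th root of unity; injectivity of
    \<open>emb\<close> preserves its order.\<close>
  define z where "z = emb (cis (2 * pi / real k))"
  have root: "cis (2 * pi / real k) ^ j = cis (2 * pi * real j / real k)" for j
    by (simp add: DeMoivre mult.commute)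
  have zk: "z ^ k = 1"
    using k0 root[of k] by (simp add: z_def rhom_one[OF emb] flip: rhom_power[OF emb])
  have zj: "z ^ j \<noteq> 1" if j: "0 < j" "j < k" for j
  proof
    assume "z ^ j = 1"
    then have "emb (cis (2 * pi * real j / real k)) = emb 1"
      by (simp add: z_def rhom_one[OF emb] flip: rhom_power[OF emb] root)
    then have "cis (2 * pi * real j / real k) = cis (2 * pi * real 0 / real k)" by (simp add: emb_inj)
    then have "j = 0"
      using inj_onD[OF bij_betw_imp_inj_on[OF bij_betw_roots_unity[OF k0]], of j 0] j by simp
    then show False using j by simp
  qed
  interpret C: dpd_cover G dp dm u u1 v w k dp' dm' P Qp P_m z
    by unfold_locales (use dpe cop Pm Qp P zk zj in auto)
  have A: "DPD_algebra Dp Dm = ring_on S.A" by (simp add: DPD_algebra_eq S.A_def)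
  have nz: "Fract P_p 1 \<noteq> 0" "Fract P_m 1 \<noteq> 0"
    using Pp Pm S.u(2) S.up(2) by (metis mult_zero_left power_not_zero)+
  have Q_pow: "Fract (Q ^ n) 1 = u1 ^ n * u ^ n" for n
    by (simp only: rhom_power[OF Fract1] u1u[symmetric] power_mult_distrib)
  \<comment> \<open>The quotient is verified in multiplied form: \<open>P_p * v\<close> and
    \<open>P_m * w\<close> are powers of \<open>u1\<close> and \<open>u\<close>, and
    \<open>dp * dm' = dm * dp' = k * dp' * dm'\<close>.\<close>
  have "Fract P 1 * (Fract P_p 1 ^ dm' * Fract P_m 1 ^ dp') = (Fract P_p 1 * v) ^ dm' * (Fract P_m 1 * w) ^ dp'"
    by (simp only: P power_mult_distrib ac_simps)
  also have "\<dots> = u1 ^ (dp * dm') * u ^ (dm * dp')" by (simp only: Pp[symmetric] Pm[symmetric] power_mult)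
  also have "\<dots> = Fract (Q ^ (k * dp' * dm')) 1" by (simp only: Q_pow dpe ac_simps)
  finally have P_eq: "Fract P 1 = Fract (Q ^ (k * dp' * dm')) 1 / (Fract P_p 1 ^ dm' * Fract P_m 1 ^ dp')"
    using nz by (simp only: eq_divide_eq mult_eq_0_iff power_eq_0_iff simp_thms if_False) simp
  have "Fract Qp 1 * Fract P_p 1 = u ^ dp * (Fract P_p 1 * v)" by (simp only: Qp ac_simps)
  also have "\<dots> = Fract (Q ^ dp) 1" unfolding Pp[symmetric] Q_pow by (rule mult.commute)
  finally have Qp_eq: "Fract Qp 1 = Fract (Q ^ dp) 1 / Fract P_p 1"
    using nz by (simp only: eq_divide_eq) simp
  have a: "is_grading (rel_quotient C.S) (weighted_part C.S dp dm)"
    "\<exists>\<phi>. (\<forall>p. \<phi> (rel_class C.S p) = eval3 base u_m v_p v_m p) \<and>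
      (\<forall>n. \<phi> ` weighted_part C.S dp dm n \<subseteq> graded_piece Dp Dm n) \<and>
      is_normalization (rel_quotient C.S) (DPD_algebra Dp Dm) \<phi>"
    using C.normalization_B by (simp_all add: A graded_piece_eq C.e_def u(1) v(1) w(1))
  note b = C.normalization_H[OF noetherian, folded u(1) v(1) w(1) A]
  have c: "\<exists>q. irreducible q \<and> (\<exists>s \<in> S.A. \<exists>\<phi>.
      (\<forall>p. \<phi> (rel_class (space_relation dp dm q) p) = eval3 (\<lambda>c. base (emb c)) s v_p v_m p) \<and>
      is_normalization (rel_quotient (space_relation dp dm q)) (DPD_algebra Dp Dm) \<phi>)"
    if k1: "k = 1" and unit: "v_p \<notin> Units (DPD_algebra Dp Dm)"
  proof -
    \<comment> \<open>For \<open>k = 1\<close> the product \<open>v ^ dm * w ^ dp\<close> is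
      \<open>P\<close>; were it a constant, necessarily nonzero, \<open>v_p\<close> would be
      invertible with the inverse \<open>y\<close> below.\<close>
    have "P \<notin> range emb"
    proof
      assume "P \<in> range emb"
      then obtain r where r: "P = emb r" by blast
      then have "r \<noteq> 0" using C.nz(1) rhom_zero[OF emb] by auto
      then have "emb r * emb (inverse r) = 1" by (simp add: rhom_one[OF emb] flip: rhom_mult[OF emb])
      then have "1 = Fract P 1 * Fract (emb (inverse r)) 1"
        by (simp only: r flip: rhom_mult[OF Fract1]) (simp add: rhom_one[OF Fract1])
      also have "\<dots> = v * (v ^ (dm - 1) * w ^ dp * Fract (emb (inverse r)) 1)"
      proof -
        have "v ^ dm' = v * v ^ (dm - 1)" "dp' = dp" using power_minus_mult[OF S.dm_pos, of v] dpe k1 by (simp_all add: mult.commute)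
        then show ?thesis by (simp only: P mult.assoc)
      qed
      finally have one: "v * (v ^ (dm - 1) * w ^ dp * Fract (emb (inverse r)) 1) = 1" by simp
      define y where "y = v_p ^ (dm - 1) * v_m ^ dp * base (emb (inverse r))"
      have yA: "y \<in> S.A" unfolding y_def v(1) w(1)
        by (intro subring_mult[OF S.is_subring_A] subring_power[OF S.is_subring_A] S.base_in_A)
          (simp_all add: S.single_in_A S.v S.w)
      have "v_p * y = Poly_Mapping.single (int dp + (int (dm - 1) * int dp + int dp * (- int dm))) 1"
        by (simp add: y_def v(1) w(1) single_power mult_single base_def one[unfolded One_nat_def])
      also have "int dp + (int (dm - 1) * int dp + int dp * (- int dm)) = 0"
        using S.dm_pos by (cases dm) (simp_all add: algebra_simps)
      finally have "v_p * y = 1" by (simp add: single_one)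
      moreover have "v_p \<in> S.A" unfolding v(1) by (simp add: S.single_in_A S.v)
      ultimately have "v_p \<in> Units (DPD_algebra Dp Dm)"
        using yA unfolding A Units_def by (auto simp: mult.commute)
      then show False using unit by simp
    qed
    then obtain s where s: "s \<notin> range emb" "\<And>x. integral_elem (range (eval2 emb s P)) x"
      "\<And>x. x \<in> fracs (range (eval2 emb s P))" using plane_generator by blast
    obtain q where q: "irreducible q" "\<And>F. eval2 emb s P F = 0 \<longleftrightarrow> q dvd F" using plane_equation[OF s(1)] by blast
    show ?thesis
      using C.normalization_space[OF k1 emb q(2) s(2,3), folded v(1) w(1) A] q(1) S.base_in_A[of s] by blast
  qed
  show ?thesis
    unfolding Let_def
    using P_eq Qp_eq a b c by (intro exI[of _ P] exI[of _ Qp] conjI impI) (auto simp: A C.S_def)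
qed

end
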